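(* Let $\mathcal{R}(N):=\{n\le N:\ n=m+k \text{ and } 2^k+m \text{ is prime for some integers } k\ge1,\ m\ge1\}$. Then for all sufficiently large $N$, unconditionally, $$|\mathcal{R}(N)|\ge\left(\frac{1}{\log 2+8\Phi(N)}+o(1)\right)N .$$ In particular, there is an absolute constant $\delta\ge 0.0734$ such that $|\mathcal{R}(N)|\ge \delta N$ for all sufficiently large $N$.
   Context: $p$ denotes a prime. Let $K=K(N):=\lfloor \log_2 N - 2\log_2(\log N)\rfloor$, $d(k_2,h):=2^{k_2}(2^h-1)-h$, and $$\Phi(N):=\frac{1}{K^2}\sum_{\substack{1\le h\le K-1\\ h\equiv 0 \bmod 2}}\ \sum_{1\le k_2\le K-h}\mathfrak{S}\bigl(d(k_2,h)\bigr),$$ where for even $d$, $\mathfrak{S}(d):=2C_2\prod_{p\mid d,\ p>2}\left(1+\frac{1}{p-2}\right)$ and $C_2=\prod_{p\ge3}\left(1-\frac{1}{(p-1)^2}\right)$ is the twin prime constant. The $o(1)$ is as $N\to\infty$. *)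

theory Defs
  imports "HOL-Analysis.Analysis" "HOL-Computational_Algebra.Primes"
begin

definition KN :: "nat \<Rightarrow> int" where
  "KN N = \<lfloor>log 2 (real N) - 2 * log 2 (ln (real N))\<rfloor>"

definition shift :: "nat \<Rightarrow> nat \<Rightarrow> int" where
  "shift k\<^sub>2 h = 2 ^ k\<^sub>2 * (2 ^ h - 1) - int h"

definition twin_prime_const :: real where
  "twin_prime_const = (\<Prod>p. if prime p \<and> 3 \<le> p then 1 - 1 / (real p - 1)\<^sup>2 else 1)"

text \<open>The singular series is only meant for even \<open>d \<noteq> 0\<close>; elsewhere the value of the formula
  carries no meaning and is not used.\<close>

definition singular_series :: "int \<Rightarrow> real" where
  "singular_series d =
     2 * twin_prime_const * (\<Prod>p | prime p \<and> int p dvd d \<and> 2 < p. 1 + 1 / (real p - 2))"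

definition Phi :: "nat \<Rightarrow> real" where
  "Phi N = 1 / (real_of_int (KN N))\<^sup>2 *
     (\<Sum>h | 1 \<le> h \<and> int h \<le> KN N - 1 \<and> even h.
        \<Sum>k\<^sub>2 | 1 \<le> k\<^sub>2 \<and> int k\<^sub>2 \<le> KN N - int h. singular_series (shift k\<^sub>2 h))"

definition RN :: "nat \<Rightarrow> nat set" where
  "RN N = {n. n \<le> N \<and> (\<exists>k m. 1 \<le> k \<and> 1 \<le> m \<and> n = m + k \<and> prime (2 ^ k + m))}"

end

theory Submission
  imports Defs "HOL-Complex_Analysis.Complex_Analysis" "HOL-Number_Theory.Number_Theory" "HOL-Real_Asymp.Real_Asymp"
begin

text \<open>Count the representations \<open>r n\<close> of \<open>n\<close> with exponent \<open>k \<le> K\<close>, i.e. the \<open>k\<close> for which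
  \<open>n + s\<^sub>k\<close> is prime, where \<open>s\<^sub>k = 2 ^ k - k\<close>. By Cauchy-Schwarz the number of represented \<open>n\<close> is at least
  \<open>(\<Sum> r)\<^sup>2 / \<Sum> r\<^sup>2\<close>. The prime number theorem (only the lower bound is needed; it is obtained from the
  non-vanishing of zeta on the line \<open>Re s = 1\<close> by a Fejer kernel Tauberian argument) gives \<open>\<Sum> r\<close>.

  The off-diagonal part of \<open>\<Sum> r\<^sup>2\<close> counts the prime pairs \<open>p, p + s\<^sub>l - s\<^sub>k\<close>, and it is bounded by
  \<open>4 + o(1)\<close> times the expected size: the second prime is replaced by a sieve majorant, namely Brun's
  sieve for the small primes times Selberg's sieve of level \<open>N powr (1/4 - a)\<close> for the large ones.
  The differences \<open>s\<^sub>l - s\<^sub>k\<close> are equidistributed modulo every squarefree number, so the sum of the majorant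
  over all pairs of shifts has small variance when evaluated at a sieve-weighted integer. Hence it
  takes its mean value at almost all primes as well. Averaging over the shifts in this way replaces any information about primes in
  arithmetic progressions to large moduli.

  The same equidistribution gives \<open>liminf \<Phi> \<ge> 1/2\<close>, so that \<open>8 \<Phi>\<close> is asymptotically at least \<open>4\<close>.\<close>


section \<open>Periodic functions and their means\<close>

text \<open>The constant 4 is the reciprocal of the limiting exponent of the level \<open>R\<close>.
  The second moment of the majorant contains \<open>lam\<close> to the fourth power, so its
  remainder carries \<open>R ^ 4\<close> and has to stay below \<open>N\<close>, while the main term
  carries \<open>1 / ln R\<close>. The weight that replaces the first prime is exactly 1 at large
  primes. It sieves up to a fixed power of \<open>N\<close>, so its mass exceeds the number of
  primes only by a bounded factor; a variance below a small constant therefore survives the passage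
  from integers to primes. Three obstacles shape the proof. The periods of the sieve weights far
  exceed \<open>N\<close>, so errors are counted per progression, not per period. The main terms of
  the variance must cancel up to an arbitrarily small constant, so Brun's sieve has to be almost
  exact; hence its blocks. Equidistribution of \<open>2 ^ k - k\<close> modulo a prime
  \<open>p\<close> takes about \<open>p * p\<close> exponents, so for \<open>p * p > K\<close>
  divisibility is only bounded from above, by elimination or by size. Finally, the shifts form a
  Sidon set, so coincidences of differences occur only on the diagonal. The exponents and Brun's
  truncation are fixed first, then the range of exactly sieved primes, and \<open>N\<close>
  last.\<close>

definition per :: "nat => (int => real) => bool" where
  "per Q f \<longleftrightarrow> (\<forall>m. f (m mod int Q) = f m)"

definition mean :: "nat => (int => real) => real" where
  "mean Q f = (\<Sum>m\<in>{0..<int Q}. f m) / real Q"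

definition ind :: "nat => int => real" where
  "ind q m = (if int q dvd m then 1 else 0)"

lemma ind_bounds [simp]: "0 <= ind q m" "ind q m <= 1"
  by (auto simp: ind_def)

lemma ind_square [simp]: "ind q m * ind q m = ind q m"
  by (auto simp: ind_def)

lemma perD: assumes "per Q f" "[m = n] (mod int Q)" shows "f m = f n"
proof -
  have "f m = f (m mod int Q)" "f (n mod int Q) = f n" using assms(1) by (simp_all add: per_def)
  thus ?thesis using assms(2) by (simp add: Cong.cong_def)
qed

lemma per_dvd: assumes "per Q f" "Q dvd Q'" shows "per Q' f"
  unfolding per_def
proof
  fix m
  have "[m mod int Q' = m] (mod int Q)" using assms(2) by (simp add: Cong.cong_def mod_mod_cancel)
  thus "f (m mod int Q') = f m" by (rule perD[OF assms(1)])
qed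

lemma per_const [simp]: "per Q (\<lambda>m. c)"
  by (simp add: per_def)

lemma per_ind: "q dvd Q ==> per Q (\<lambda>m. ind q (m + a))"
proof -
  assume "q dvd Q"
  hence "int q dvd int Q" by simp
  hence "int q dvd m mod int Q + a \<longleftrightarrow> int q dvd m + a" for m
    using dvd_add_left_iff[of "int q" "int Q * (m div int Q)" "m mod int Q + a"]
    by (simp add: algebra_simps)
  thus ?thesis by (simp add: per_def ind_def)
qed

lemma per_add: "per Q f ==> per Q g ==> per Q (\<lambda>m. f m + g m)"
  by (simp add: per_def)

lemma per_mult: "per Q f ==> per Q g ==> per Q (\<lambda>m. f m * g m)"
  by (simp add: per_def)

lemma per_comp: "per Q f ==> per Q (\<lambda>m. h (f m))"
  by (simp add: per_def)

lemma per_shift: assumes "per Q f" shows "per Q (\<lambda>m. f (m + d))"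
  unfolding per_def
proof
  fix m
  have "[m mod int Q + d = m + d] (mod int Q)" by (simp add: Cong.cong_def mod_add_left_eq)
  thus "f (m mod int Q + d) = f (m + d)" by (rule perD[OF assms])
qed

lemma per_prod: "(\<And>i. i \<in> I ==> per Q (f i)) ==> per Q (\<lambda>m. \<Prod>i\<in>I. f i m)"
  by (induction I rule: infinite_finite_induct) (auto simp: per_def)

lemma mean_const [simp]: "Q > 0 ==> mean Q (\<lambda>m. c) = c"
  by (simp add: mean_def)

lemma mean_add: "mean Q (\<lambda>m. f m + g m) = mean Q f + mean Q g"
  by (simp add: mean_def sum.distrib add_divide_distrib)

lemma mean_diff: "mean Q (\<lambda>m. f m - g m) = mean Q f - mean Q g"
  by (simp add: mean_def sum_subtractf diff_divide_distrib)

lemma mean_cmult: "mean Q (\<lambda>m. c * f m) = c * mean Q f"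
  by (simp add: mean_def sum_distrib_left)

lemma mean_sum: "mean Q (\<lambda>m. \<Sum>i\<in>I. f i m) = (\<Sum>i\<in>I. mean Q (f i))"
  unfolding mean_def by (subst sum.swap) (simp add: sum_divide_distrib)

lemma mean_mono: "(\<And>m. f m <= g m) ==> mean Q f <= mean Q g"
  by (auto simp: mean_def intro!: divide_right_mono sum_mono)

lemma mean_nonneg: "(\<And>m. 0 <= f m) ==> 0 <= mean Q f"
  by (auto simp: mean_def intro!: divide_nonneg_nonneg sum_nonneg)

lemma mean_shift:
  assumes "per Q f" "Q > 0" shows "mean Q (\<lambda>m. f (m + d)) = mean Q f"
proof -
  have "(\<Sum>m\<in>{0..<int Q}. f (m + d)) = (\<Sum>m\<in>{0..<int Q}. f m)"
  proof (rule sum.reindex_bij_witness[where i = "\<lambda>m. (m - d) mod int Q" and j = "\<lambda>m. (m + d) mod int Q"])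
    fix m assume "m \<in> {0..<int Q}"
    thus "((m + d) mod int Q - d) mod int Q = m" "((m - d) mod int Q + d) mod int Q = m"
      by (simp_all add: mod_diff_left_eq mod_add_left_eq)
    show "f ((m + d) mod int Q) = f (m + d)" using assms(1) by (simp add: per_def)
  qed (use assms in auto)
  thus ?thesis by (simp add: mean_def)
qed

text \<open>Chinese remainder theorem: reduction modulo both periods is injective on one joint
  period by coprimality, and surjective by counting.\<close>

lemma sum_mult_coprime_periods:
  assumes f: "per Q f" and g: "per P g" and "coprime Q P" "Q > 0" "P > 0"
  shows "(\<Sum>m\<in>{0..<int (Q * P)}. f m * g m) = (\<Sum>m\<in>{0..<int Q}. f m) * (\<Sum>m\<in>{0..<int P}. g m)"
proof -
  let ?h = "\<lambda>m::int. (m mod int Q, m mod int P)"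
  let ?A = "{0..<int (Q * P)}" and ?B = "{0..<int Q} \<times> {0..<int P}"
  have inj: "inj_on ?h ?A"
  proof (rule inj_onI)
    fix x y assume xy: "x \<in> ?A" "y \<in> ?A" "?h x = ?h y"
    hence "[x = y] (mod int Q)" "[x = y] (mod int P)" by (auto simp: Cong.cong_def)
    hence "[x = y] (mod int Q * int P)"
      using coprime_cong_mult[of x y "int Q" "int P"] assms(3) by simp
    thus "x = y" using xy by (auto simp: Cong.cong_def)
  qed
  have "?h ` ?A \<subseteq> ?B" using assms by auto
  moreover have "card (?h ` ?A) = card ?B" using inj by (simp add: card_image card_cartesian_product nat_mult_distrib)
  ultimately have img: "?h ` ?A = ?B" by (intro card_subset_eq) auto
  have "(\<Sum>m\<in>?A. f m * g m) = (\<Sum>m\<in>?A. case ?h m of (a, b) => f a * g b)"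
    using f g by (intro sum.cong) (auto simp: per_def)
  also have "... = (\<Sum>x\<in>?h ` ?A. case x of (a, b) => f a * g b)"
    by (subst sum.reindex[OF inj]) (simp add: o_def)
  also have "... = (\<Sum>a\<in>{0..<int Q}. \<Sum>b\<in>{0..<int P}. f a * g b)"
    unfolding img by (simp add: sum.cartesian_product)
  finally show ?thesis by (simp add: sum_product)
qed

lemma mean_mult_coprime:
  assumes "per Q f" "per P g" "coprime Q P" "Q > 0" "P > 0"
  shows "mean (Q * P) (\<lambda>m. f m * g m) = mean Q f * mean P g"
  using sum_mult_coprime_periods[OF assms] by (simp add: mean_def)

lemma mean_prod_coprime:
  assumes "finite I" "\<And>i. i \<in> I ==> per (q i) (f i)" "\<And>i. i \<in> I ==> q i > 0"
    "\<And>i j. i \<in> I ==> j \<in> I ==> i ~= j ==> coprime (q i) (q j)"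
  shows "mean (\<Prod>i\<in>I. q i) (\<lambda>m. \<Prod>i\<in>I. f i m) = (\<Prod>i\<in>I. mean (q i) (f i))"
  using assms
proof (induction I rule: finite_induct)
  case empty
  thus ?case by (simp add: mean_def)
next
  case (insert a I)
  have "per (\<Prod>i\<in>I. q i) (\<lambda>m. \<Prod>i\<in>I. f i m)"
  proof (rule per_prod)
    fix i assume i: "i \<in> I"
    show "per (\<Prod>i\<in>I. q i) (f i)"
      by (rule per_dvd[of "q i"]) (use i insert in \<open>auto intro: dvd_prodI\<close>)
  qed
  moreover have "coprime (q a) (\<Prod>i\<in>I. q i)"
    using insert by (intro prod_coprime_right) auto
  moreover have "(\<Prod>i\<in>I. q i) > 0" using insert by (intro prod_pos) auto
  ultimately show ?case using insert
    by (simp add: mean_mult_coprime)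
qed

text \<open>The source of every Euler product below: the mean of a sieve weight splits into local
  densities, one for each prime.\<close>

lemma mean_prod_primes:
  assumes "finite P" "\<And>p. p \<in> P ==> prime p" "\<And>p. p \<in> P ==> per p (f p)"
  shows "mean (\<Prod>P) (\<lambda>m. \<Prod>p\<in>P. f p m) = (\<Prod>p\<in>P. mean p (f p))"
proof (rule mean_prod_coprime)
  fix p q assume "p \<in> P" "q \<in> P" "p ~= q"
  thus "coprime p q" using assms(2) by (intro primes_coprime) auto
qed (use assms prime_gt_0_nat in auto)

text \<open>Only a step onto a multiple of \<open>q\<close> raises the quotient, so counting
  multiples in an interval telescopes.\<close>

lemma div_succ_int:
  fixes y q :: int assumes "q > 0"
  shows "(y + 1) div q - y div q = (if q dvd y + 1 then 1 else 0)"
proof -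
  have e: "y = q * (y div q) + y mod q" by simp
  have b: "0 <= y mod q" "y mod q < q" using assms by auto
  show ?thesis
  proof (cases "y mod q = q - 1")
    case True
    have "y + 1 = q * (y div q) + (y mod q + 1)" by simp
    hence "y + 1 = q * (y div q + 1)" unfolding True by (simp add: distrib_left)
    moreover from this have "(y + 1) div q = y div q + 1"
      using assms by (metis nonzero_mult_div_cancel_left less_irrefl)
    ultimately show ?thesis by (simp add: dvd_def)
  next
    case False
    hence r: "0 <= y mod q + 1" "y mod q + 1 < q" using b by auto
    have "y + 1 = q * (y div q) + (y mod q + 1)" using e by simp
    hence "(y + 1) div q = y div q" "(y + 1) mod q = y mod q + 1"
      using int_div_pos_eq[of "y + 1" q "y div q" "y mod q + 1"] int_mod_pos_eq[of "y + 1" q "y div q" "y mod q + 1"] r by auto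
    thus ?thesis using b by (auto simp: dvd_eq_mod_eq_0)
  qed
qed

lemma sum_ind_interval:
  assumes "q > 0"
  shows "(\<Sum>m\<in>{0..<int x}. ind q (m + a)) = real_of_int ((int x + a - 1) div int q - (a - 1) div int q)"
proof (induction x)
  case (Suc x)
  have "{0..<int (Suc x)} = insert (int x) {0..<int x}" by auto
  hence "(\<Sum>m\<in>{0..<int (Suc x)}. ind q (m + a)) = ind q (int x + a) + (\<Sum>m\<in>{0..<int x}. ind q (m + a))"
    by simp
  also have "ind q (int x + a) = real_of_int ((int x + a - 1 + 1) div int q - (int x + a - 1) div int q)"
    using assms by (subst div_succ_int) (auto simp: ind_def)
  finally show ?case using Suc by (simp add: algebra_simps)
qed simp

lemma mean_ind:
  assumes "q dvd Q" "Q > 0" shows "mean Q (\<lambda>m. ind q (m + a)) = 1 / real q"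
proof -
  obtain r where r: "Q = q * r" using assms by blast
  hence q: "q > 0" using assms by simp
  have "(int Q + a - 1) div int q = int r + (a - 1) div int q"
    using q div_mult_self1[of "int q" "a - 1" "int r"] unfolding r by (simp add: algebra_simps)
  thus ?thesis using q assms unfolding mean_def sum_ind_interval[OF q] by (simp add: r)
qed

text \<open>The count is a difference of two floors whose arguments differ by \<open>x / q\<close>;
  the error is at most 1 whatever the shift \<open>a\<close>.\<close>

lemma sum_ind_estimate:
  assumes "q > 0" shows "\<bar>(\<Sum>m\<in>{0..<int x}. ind q (m + a)) - real x / real q\<bar> <= 1"
proof -
  have fl: "real_of_int (y div int q) = real_of_int \<lfloor>real_of_int y / real q\<rfloor>" for y
    using floor_divide_of_int_eq[of y "int q", where ?'a = real] by simp
  have d: "real_of_int (int x + a - 1) / real q = real x / real q + real_of_int (a - 1) / real q"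
    by (simp add: add_divide_distrib diff_divide_distrib)
  have "real_of_int \<lfloor>real x / real q + real_of_int (a - 1) / real q\<rfloor> - real_of_int \<lfloor>real_of_int (a - 1) / real q\<rfloor>
      - real x / real q <= 1" "real x / real q - (real_of_int \<lfloor>real x / real q + real_of_int (a - 1) / real q\<rfloor>
      - real_of_int \<lfloor>real_of_int (a - 1) / real q\<rfloor>) <= 1"
    by linarith+
  thus ?thesis unfolding sum_ind_interval[OF assms] of_int_diff[of "_ div _"] fl d by linarith
qed

section \<open>Combinations of progressions with an explicit cost\<close>

text \<open>Finite combinations of indicators of residue classes whose moduli divide
  \<open>Q\<close>; \<open>C\<close> bounds the sum of the absolute values of the coefficients. As
  each class contributes an error of at most its coefficient, sums over an interval are controlled
  by \<open>C\<close> alone, even when \<open>Q\<close> is far longer than the interval.\<close>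

inductive apc :: "nat => real => (int => real) => bool" for Q where
  apc_ind: "q dvd Q ==> \<bar>c\<bar> <= C ==> apc Q C (\<lambda>m. c * ind q (m + a))"
| apc_add: "apc Q C f ==> apc Q D g ==> apc Q (C + D) (\<lambda>m. f m + g m)"

lemma apc_per: "apc Q C f ==> per Q f"
  by (induction rule: apc.induct) (auto intro!: per_add per_mult per_ind)

lemma apc_estimate:
  assumes "apc Q C f" "Q > 0"
  shows "\<bar>(\<Sum>m\<in>{0..<int x}. f m) - real x * mean Q f\<bar> <= C"
  using assms(1)
proof (induction rule: apc.induct)
  case (apc_ind q c C a)
  have q: "q > 0" using apc_ind assms by (auto intro: Nat.gr0I)
  have "(\<Sum>m\<in>{0..<int x}. c * ind q (m + a)) - real x * mean Q (\<lambda>m. c * ind q (m + a))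
      = c * ((\<Sum>m\<in>{0..<int x}. ind q (m + a)) - real x / real q)"
    using apc_ind assms by (simp add: mean_cmult mean_ind sum_distrib_left algebra_simps)
  also have "\<bar>...\<bar> <= \<bar>c\<bar> * 1" unfolding abs_mult by (intro mult_left_mono sum_ind_estimate q) auto
  finally show ?case using apc_ind by simp
next
  case (apc_add C f D g)
  thus ?case by (simp add: sum.distrib mean_add algebra_simps)
qed

lemma apc_mono: "apc Q C f ==> C <= D ==> apc Q D f"
proof (induction arbitrary: D rule: apc.induct)
  case (apc_add C f C' g)
  have "apc Q (C + (D - C)) (\<lambda>m. f m + g m)"
    using apc_add by (intro apc.apc_add) auto
  thus ?case by simp
qed (auto intro: apc.apc_ind)

lemma apc_const: "\<bar>c\<bar> <= C ==> apc Q C (\<lambda>m. c)"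
  using apc_ind[of 1 Q c C 0] by (simp add: ind_def)

lemma apc_ind1: "q dvd Q ==> apc Q 1 (ind q)"
  using apc_ind[of q Q 1 1 0] by simp

lemma apc_shift: "apc Q C f ==> apc Q C (\<lambda>m. f (m + d))"
proof (induction rule: apc.induct)
  case (apc_ind q c C a)
  from apc.apc_ind[OF this, of "d + a"] show ?case by (simp add: add.assoc)
qed (auto intro: apc.apc_add)

lemma apc_cmult: "apc Q C f ==> apc Q (\<bar>c\<bar> * C) (\<lambda>m. c * f m)"
proof (induction rule: apc.induct)
  case (apc_ind q e C a)
  have "apc Q (\<bar>c\<bar> * C) (\<lambda>m. (c * e) * ind q (m + a))"
    using apc_ind by (intro apc.apc_ind) (auto simp: abs_mult mult_left_mono)
  thus ?case by (simp add: mult.assoc)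
qed (auto simp: distrib_left intro: apc.apc_add)

text \<open>Two residue classes either meet in one class modulo the least common multiple or are
  disjoint. The disjoint case is encoded by the coefficient 0 with the dummy modulus 1.\<close>

lemma ind_mult_ind:
  "\<exists>q c b. q dvd lcm q1 q2 & \<bar>c\<bar> <= 1 & (\<forall>m. ind q1 (m + a1) * ind q2 (m + a2) = c * ind q (m + b))"
proof (cases "\<exists>n. int q1 dvd n + a1 & int q2 dvd n + a2")
  case True
  then obtain n where n: "int q1 dvd n + a1" "int q2 dvd n + a2" by blast
  have "ind q1 (m + a1) * ind q2 (m + a2) = 1 * ind (lcm q1 q2) (m + (- n))" for m
  proof -
    have "int q1 dvd m + a1 \<longleftrightarrow> int q1 dvd m + (-n)" "int q2 dvd m + a2 \<longleftrightarrow> int q2 dvd m + (-n)"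
      using dvd_add_left_iff[OF n(1), of "m + (-n)"] dvd_add_left_iff[OF n(2), of "m + (-n)"] by simp_all
    moreover have "int (lcm q1 q2) dvd m + (-n) \<longleftrightarrow> int q1 dvd m + (-n) & int q2 dvd m + (-n)"
      using lcm_least_iff[of "int q1" "int q2" "m + (-n)"] by (simp add: lcm_int_int_eq)
    ultimately show ?thesis by (simp add: ind_def)
  qed
  thus ?thesis by (intro exI[of _ "lcm q1 q2"] exI[of _ 1] exI[of _ "-n"]) auto
next
  case False
  hence "ind q1 (m + a1) * ind q2 (m + a2) = 0 * ind 1 (m + 0)" for m by (auto simp: ind_def)
  thus ?thesis by (intro exI[of _ 1] exI[of _ 0] exI[of _ 0]) auto
qed

text \<open>Costs multiply even when the moduli share primes, since two classes meet in at most one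
  class. The remainder of a correlation of several sieve weights is thus the product of their
  costs.\<close>

lemma apc_mult: assumes "apc Q C f" "apc Q D g" shows "apc Q (C * D) (\<lambda>m. f m * g m)"
  using assms(1)
proof (induction rule: apc.induct)
  case (apc_ind q c C a)
  note 1 = this
  show ?case using assms(2)
  proof (induction rule: apc.induct)
    case (apc_ind q' c' C' a')
    obtain r e b where r: "r dvd lcm q q'" "\<bar>e\<bar> <= 1" "\<And>m. ind q (m + a) * ind q' (m + a') = e * ind r (m + b)"
      using ind_mult_ind[of q q' a a'] by blast
    have rQ: "r dvd Q" using r(1) 1 apc_ind by (meson dvd_trans lcm_least)
    have "\<bar>c * c' * e\<bar> <= C * C' * 1"
      unfolding abs_mult using 1 apc_ind r(2) by (intro mult_mono) auto
    hence "apc Q (C * C') (\<lambda>m. (c * c' * e) * ind r (m + b))"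
      using rQ by (intro apc.apc_ind) auto
    moreover have "(\<lambda>m. c * ind q (m + a) * (c' * ind q' (m + a'))) = (\<lambda>m. (c * c' * e) * ind r (m + b))"
      using r(3) by (auto simp: algebra_simps fun_eq_iff)
    ultimately show ?case by simp
  next
    case (apc_add C' f' D' g')
    from apc.apc_add[OF apc_add.IH] show ?case by (simp add: distrib_left)
  qed
next
  case (apc_add C f D g)
  from apc.apc_add[OF apc_add.IH] show ?case by (simp add: distrib_right)
qed

lemma apc_sum:
  assumes "finite I" "\<And>i. i \<in> I ==> apc Q (C i) (f i)"
  shows "apc Q (\<Sum>i\<in>I. C i) (\<lambda>m. \<Sum>i\<in>I. f i m)"
  using assms
proof (induction rule: finite_induct)
  case empty thus ?case by (simp add: apc_const)
qed (auto intro: apc_add)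

lemma apc_prod:
  assumes "finite I" "\<And>i. i \<in> I ==> apc Q (C i) (f i)"
  shows "apc Q (\<Prod>i\<in>I. C i) (\<lambda>m. \<Prod>i\<in>I. f i m)"
  using assms
proof (induction rule: finite_induct)
  case empty thus ?case by (simp add: apc_const)
qed (auto intro: apc_mult)

section \<open>Brun's sieve\<close>

definition om :: "nat set => int => nat" where
  "om P m = card {p \<in> P. int p dvd m}"

text \<open>Inclusion-exclusion for having no prime divisor in \<open>P\<close>, stopped at an even
  number of primes so that it overcounts (Bonferroni).\<close>

definition brun :: "nat => nat set => int => real" where
  "brun b P m = (\<Sum>i\<le>2*b. (-1) ^ i * real (om P m choose i))"

definition unsieved :: "nat set => int => real" where
  "unsieved P m = (\<Prod>p\<in>P. 1 - ind p m)"

lemma alternating_binomial_sum: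
  "(\<Sum>i\<le>k. (-1) ^ i * real (Suc n choose i)) = (-1) ^ k * real (n choose k)"
  by (induction k) (auto simp: algebra_simps)

lemma unsieved_eq: "finite P ==> unsieved P m = (if om P m = 0 then 1 else 0)"
  by (auto simp: unsieved_def om_def ind_def intro!: prod.neutral)

text \<open>The truncated alternating sum collapses to one binomial coefficient. This shows both the
  majorant property and that the values are natural numbers, which \<open>nu_le_cube\<close>
  exploits.\<close>

lemma brun_eq:
  assumes "finite P"
  shows "brun b P m = unsieved P m + (if om P m = 0 then 0 else real ((om P m - 1) choose (2*b)))"
proof (cases "om P m")
  case 0
  have "(\<Sum>i\<le>2*b. (-1) ^ i * real (0 choose i)) = (\<Sum>i\<in>{0}. (-1) ^ i * real (0 choose i))"
    by (rule sum.mono_neutral_right) (auto simp: binomial_eq_0)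
  thus ?thesis using 0 assms by (simp add: brun_def unsieved_eq)
next
  case (Suc n)
  thus ?thesis using assms alternating_binomial_sum[where k = "2*b" and n = n] by (simp add: brun_def unsieved_eq)
qed

lemma unsieved_bounds: "0 <= unsieved P m" "unsieved P m <= 1"
  unfolding unsieved_def by (auto intro!: prod_nonneg prod_le_1)

lemma unsieved_le_brun: "finite P ==> unsieved P m <= brun b P m"
  by (simp add: brun_eq)

lemma brun_nonneg: "finite P ==> 0 <= brun b P m"
  using unsieved_le_brun[of P m b] unsieved_bounds[of P m] by linarith

text \<open>Rankin's trick: the excess is nonzero only if more than \<open>2 * b\<close> primes of
  \<open>P\<close> divide \<open>m\<close>, and then \<open>2 ^ om P m / 2 ^ (2 * b)\<close> is at
  least 1 and can be inserted as a factor.\<close>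

lemma brun_le_unsieved:
  assumes "finite P" shows "brun b P m - unsieved P m <= 4 ^ om P m / 4 ^ b"
proof (cases "om P m <= 2 * b")
  case True
  thus ?thesis using assms by (auto simp: brun_eq binomial_eq_0)
next
  case False
  have "real ((om P m - 1) choose (2*b)) <= 2 ^ (om P m - 1)"
    using binomial_le_pow2[of "om P m - 1" "2*b"] by (metis of_nat_le_iff of_nat_numeral of_nat_power)
  also have "... <= 2 ^ om P m * (2 ^ om P m / 2 ^ (2*b))"
  proof -
    have "(2::real) ^ (2*b) <= 2 ^ om P m" using False by (intro power_increasing) auto
    hence "1 <= (2::real) ^ om P m / 2 ^ (2*b)" by simp
    moreover have "(2::real) ^ (om P m - 1) <= 2 ^ om P m" by (intro power_increasing) auto
    ultimately show ?thesis using mult_mono[of "(2::real) ^ (om P m - 1)" "2 ^ om P m" 1 "2 ^ om P m / 2 ^ (2*b)"] by simp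
  qed
  also have "... = 4 ^ om P m / 4 ^ b" by (simp add: power_mult flip: power_mult_distrib)
  finally show ?thesis using assms False by (simp add: brun_eq)
qed

lemma brun_le: assumes "finite P" shows "brun b P m <= 4 ^ om P m"
proof (cases "om P m = 0")
  case False
  have "real ((om P m - 1) choose (2*b)) <= 2 ^ (om P m - 1)"
    using binomial_le_pow2[of "om P m - 1" "2*b"] by (metis of_nat_le_iff of_nat_numeral of_nat_power)
  also have "... <= 2 ^ om P m" by (intro power_increasing) auto
  also have "... <= 4 ^ om P m" by (intro power_mono) auto
  finally show ?thesis using assms False by (simp add: brun_eq unsieved_eq)
qed (use assms in \<open>simp add: brun_eq unsieved_eq\<close>)

text \<open>The product form makes the mean of such a power an Euler product through
  \<open>mean_prod_primes\<close>.\<close>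

lemma power_om: "finite P ==> c ^ om P m = (\<Prod>p\<in>P. 1 + (c - 1) * ind p m)" for c :: real
proof -
  assume P: "finite P"
  have "(\<Prod>p\<in>P. 1 + (c - 1) * ind p m) = (\<Prod>p\<in>{p\<in>P. int p dvd m}. c)"
    using P by (intro prod.mono_neutral_cong_right) (auto simp: ind_def)
  thus ?thesis by (simp add: om_def)
qed

lemma prod_ind_primes:
  assumes "finite S" "\<And>p. p \<in> S ==> prime (p::nat)"
  shows "(\<Prod>p\<in>S. ind p m) = ind (\<Prod>S) m"
  using assms
proof (induction S rule: finite_induct)
  case (insert p S)
  have "coprime p (\<Prod>S)" using insert by (intro prod_coprime_right primes_coprime) auto
  hence "int p * int (\<Prod>S) dvd m \<longleftrightarrow> int p dvd m & int (\<Prod>S) dvd m"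
    by (metis coprime_int_iff divides_mult dvd_mult_left dvd_mult_right)
  thus ?case using insert by (simp add: ind_def)
qed (simp add: ind_def)

lemma prod_ind_subset:
  assumes "finite S" shows "(\<Prod>p\<in>S. ind p m) = (if \<forall>p\<in>S. int p dvd m then 1 else 0)"
  using assms by (induction S rule: finite_induct) (auto simp: ind_def)

lemma sum_binomial_le: "(\<Sum>i\<le>k. n choose i) <= (n + 1) ^ k"
proof (induction k)
  case (Suc k)
  have "n choose Suc k <= n ^ Suc k"
    by (cases "Suc k <= n") (auto intro: binomial_le_pow simp: binomial_eq_0 simp del: power_Suc)
  also have "... <= n * (n + 1) ^ k" by (simp add: power_mono)
  finally show ?case using Suc by simp
qed simp

text \<open>The cost counts the subsets of \<open>P\<close> with at most \<open>2 * b\<close>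
  elements, which is polynomial in \<open>card P\<close>. The exact sieve costs
  \<open>2 ^ card P\<close> in \<open>apc_unsieved\<close> and is affordable only for a fixed set of
  small primes.\<close>

lemma apc_brun:
  assumes "finite P" "\<And>p. p \<in> P ==> prime p" "\<Prod>P dvd Q"
  shows "apc Q (real ((card P + 1) ^ (2*b))) (brun b P)"
proof -
  have eq: "real (om P m choose i) = (\<Sum>S\<in>{S. S \<subseteq> P & card S = i}. ind (\<Prod>S) m)" for m i
  proof -
    have "(\<Sum>S\<in>{S. S \<subseteq> P & card S = i}. ind (\<Prod>S) m) = (\<Sum>S\<in>{S. S \<subseteq> P & card S = i}. (\<Prod>p\<in>S. ind p m))"
      using assms by (intro sum.cong refl prod_ind_primes[symmetric]) (auto intro: finite_subset)
    also have "... = (\<Sum>S\<in>{S. S \<subseteq> {p\<in>P. int p dvd m} & card S = i}. 1)"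
    proof (rule sum.mono_neutral_cong_right)
      show "finite {S. S \<subseteq> P & card S = i}" using assms(1) by simp
      show "\<forall>S\<in>{S. S \<subseteq> P & card S = i} - {S. S \<subseteq> {p\<in>P. int p dvd m} & card S = i}. (\<Prod>p\<in>S. ind p m) = 0"
      proof
        fix S assume S: "S \<in> {S. S \<subseteq> P & card S = i} - {S. S \<subseteq> {p\<in>P. int p dvd m} & card S = i}"
        hence "finite S" using assms(1) by (auto intro: finite_subset)
        moreover have "\<exists>p\<in>S. ind p m = 0" using S by (auto simp: ind_def)
        ultimately show "(\<Prod>p\<in>S. ind p m) = 0" by simp
      qed
    qed (auto simp: ind_def intro!: prod.neutral)
    also have "... = real (om P m choose i)" using assms(1) by (simp add: n_subsets om_def)
    finally show ?thesis ..
  qed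
  have "apc Q (\<Sum>S\<in>{S. S \<subseteq> P & card S = i}. 1) (\<lambda>m. \<Sum>S\<in>{S. S \<subseteq> P & card S = i}. ind (\<Prod>S) m)" for i
  proof (rule apc_sum)
    show "finite {S. S \<subseteq> P & card S = i}" using assms(1) by simp
    fix S assume "S \<in> {S. S \<subseteq> P & card S = i}"
    hence "\<Prod>S dvd \<Prod>P" using assms(1) by (intro prod_dvd_prod_subset) auto
    hence "\<Prod>S dvd Q" using assms(3) by (rule dvd_trans)
    thus "apc Q 1 (ind (\<Prod>S))" by (rule apc_ind1)
  qed
  hence a: "apc Q (real (card P choose i)) (\<lambda>m. real (om P m choose i))" for i
    using assms(1) by (simp add: eq n_subsets)
  have "apc Q (\<Sum>i\<le>2*b. real (card P choose i)) (brun b P)"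
    unfolding brun_def
  proof (rule apc_sum)
    fix i
    from apc_cmult[OF a[of i], of "(-1) ^ i"]
    show "apc Q (real (card P choose i)) (\<lambda>m. (-1) ^ i * real (om P m choose i))" by (simp add: power_abs)
  qed auto
  moreover have "(\<Sum>i\<le>2*b. real (card P choose i)) <= real ((card P + 1) ^ (2*b))"
    using sum_binomial_le[where n = "card P" and k = "2*b"] by (metis of_nat_le_iff of_nat_sum)
  ultimately show ?thesis by (rule apc_mono)
qed

lemma apc_unsieved:
  assumes "finite P" "\<And>p. p \<in> P ==> p dvd Q"
  shows "apc Q (2 ^ card P) (unsieved P)"
proof -
  have "apc Q (\<Prod>p\<in>P. 2) (unsieved P)" unfolding unsieved_def
  proof (rule apc_prod)
    fix p assume p: "p \<in> P"
    have "apc Q (1 + \<bar>-1\<bar> * 1) (\<lambda>m. 1 + (-1) * ind p m)"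
      using apc_ind1[of p Q] assms(2)[OF p] by (intro apc_add apc_const apc_cmult) auto
    thus "apc Q 2 (\<lambda>m. 1 - ind p m)" by simp
  qed (use assms in auto)
  thus ?thesis by simp
qed

section \<open>Local densities for three sieved points\<close>

text \<open>The proportion of residues modulo \<open>p\<close> for which none of three shifted
  values is divisible by \<open>p\<close>. Coinciding arguments are allowed, so one-point and
  two-point densities are special cases.\<close>

definition lp :: "nat => int => int => int => real" where
  "lp p h1 h2 h3 = mean p (\<lambda>m. (1 - ind p (m + h1)) * (1 - ind p (m + h2)) * (1 - ind p (m + h3)))"

lemma per_ind0: "p dvd Q ==> per Q (ind p)"
  using per_ind[of p Q 0] by simp

lemma mean_unsieved3:
  assumes "finite P" "\<And>p. p \<in> P ==> prime p"
  shows "mean (\<Prod>P) (\<lambda>m. unsieved P (m + h1) * unsieved P (m + h2) * unsieved P (m + h3)) = (\<Prod>p\<in>P. lp p h1 h2 h3)"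
proof -
  have "mean (\<Prod>P) (\<lambda>m. \<Prod>p\<in>P. (1 - ind p (m + h1)) * (1 - ind p (m + h2)) * (1 - ind p (m + h3))) = (\<Prod>p\<in>P. lp p h1 h2 h3)"
    unfolding lp_def using assms
    by (intro mean_prod_primes) (auto intro!: per_mult per_comp[where h = "\<lambda>x. 1 - x"] per_ind)
  thus ?thesis by (simp add: unsieved_def prod.distrib)
qed

lemma mean_power_om3:
  assumes "finite P" "\<And>p. p \<in> P ==> prime p"
  shows "mean (\<Prod>P) (\<lambda>m. 4 ^ om P (m + h1) * 4 ^ om P (m + h2) * 4 ^ om P (m + h3)) <= (\<Prod>p\<in>P. 1 + 189 / real p)"
proof -
  let ?f = "\<lambda>p m. (1 + 3 * ind p (m + h1)) * (1 + 3 * ind p (m + h2)) * (1 + 3 * ind p (m + h3))"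
  have "mean (\<Prod>P) (\<lambda>m. \<Prod>p\<in>P. ?f p m) = (\<Prod>p\<in>P. mean p (?f p))"
    using assms by (intro mean_prod_primes) (auto intro!: per_mult per_comp[where h = "\<lambda>x. 1 + 3 * x"] per_ind)
  also have "... <= (\<Prod>p\<in>P. 1 + 189 / real p)"
  proof (rule prod_mono)
    fix p assume p: "p \<in> P"
    hence p0: "p > 0" using assms(2) prime_gt_0_nat by blast
    \<comment> \<open>If some indicator is 1, the product is at most \<open>4 ^ 3\<close>, so 63 per
      indicator covers the excess over 1; three indicators give \<open>189 = 3 * 63\<close>.\<close>
    have "mean p (?f p) <= mean p (\<lambda>m. 1 + 63 * (ind p (m + h1) + ind p (m + h2) + ind p (m + h3)))"
      by (intro mean_mono) (auto simp: ind_def)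
    also have "... = 1 + 189 / real p"
      using p0 by (simp add: mean_add mean_cmult mean_ind)
    finally show "0 <= mean p (?f p) & mean p (?f p) <= 1 + 189 / real p"
      by (auto intro!: mean_nonneg mult_nonneg_nonneg)
  qed
  finally show ?thesis using assms(1) by (simp add: power_om prod.distrib)
qed

lemma prod_one_plus_le_exp:
  assumes "\<And>p. p \<in> P ==> 0 <= f p" shows "(\<Prod>p\<in>P. 1 + f p) <= exp (\<Sum>p\<in>P. f p :: real)"
proof (cases "finite P")
  case True
  have "(\<Prod>p\<in>P. 1 + f p) <= (\<Prod>p\<in>P. exp (f p))"
    using assms by (intro prod_mono) (auto intro: exp_ge_add_one_self add_nonneg_nonneg)
  thus ?thesis using True by (simp add: exp_sum)
qed simp

text \<open>Brun's weight is exchanged for the exact sieve at one point after another. The factors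
  at the other points are bounded by \<open>4 ^ om\<close>, and each exchange leaves an error with
  the factor \<open>1 / 4 ^ b\<close>.\<close>

lemma mean_brun3:
  assumes "finite P" "\<And>p. p \<in> P ==> prime p" "(\<Sum>p\<in>P. 1 / real p) <= B"
  shows "mean (\<Prod>P) (\<lambda>m. brun b P (m + h1) * brun b P (m + h2) * brun b P (m + h3))
     <= (\<Prod>p\<in>P. lp p h1 h2 h3) + 3 / 4 ^ b * exp (189 * B)"
proof -
  define E where "E = (\<lambda>m. 4 ^ om P (m + h1) * 4 ^ om P (m + h2) * 4 ^ om P (m + h3) :: real)"
  have pt: "brun b P (m + h1) * brun b P (m + h2) * brun b P (m + h3)
      <= unsieved P (m + h1) * unsieved P (m + h2) * unsieved P (m + h3) + 3 / 4 ^ b * E m" for m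
  proof -
    note [simp] = assms(1)
    define x y z x' y' z' where "x = brun b P (m + h1)" "y = brun b P (m + h2)" "z = brun b P (m + h3)"
      "x' = unsieved P (m + h1)" "y' = unsieved P (m + h2)" "z' = unsieved P (m + h3)"
    note d = this
    define X Y Z :: real where "X = 4 ^ om P (m + h1)" "Y = 4 ^ om P (m + h2)" "Z = 4 ^ om P (m + h3)"
    note D = this
    have nn: "0 <= x" "0 <= y" "0 <= z" "0 <= x'" "0 <= y'" "0 <= z'" "x' <= x" "y' <= y" "z' <= z"
      unfolding d by (auto intro: brun_nonneg unsieved_bounds unsieved_le_brun)
    have le: "x <= X" "y <= Y" "z <= Z" unfolding d D by (auto intro: brun_le)
    have df: "x - x' <= X / 4 ^ b" "y - y' <= Y / 4 ^ b" "z - z' <= Z / 4 ^ b"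
      unfolding d D by (auto intro: brun_le_unsieved)
    have P: "0 <= X" "0 <= Y" "0 <= Z" unfolding D by auto
    have "(x - x') * (y * z) <= X / 4 ^ b * (Y * Z)" using nn le df P by (intro mult_mono) auto
    moreover have "x' * ((y - y') * z) <= X * (Y / 4 ^ b * Z)" using nn le df P by (intro mult_mono) auto
    moreover have "x' * (y' * (z - z')) <= X * (Y * (Z / 4 ^ b))" using nn le df P by (intro mult_mono) auto
    moreover have "x * y * z - x' * y' * z' = (x - x') * (y * z) + x' * ((y - y') * z) + x' * (y' * (z - z'))"
      by (simp add: algebra_simps)
    ultimately have "x * y * z <= x' * y' * z' + 3 / 4 ^ b * (X * Y * Z)" by (simp add: field_simps)
    thus ?thesis by (simp add: d D E_def)
  qed
  have "mean (\<Prod>P) (\<lambda>m. brun b P (m + h1) * brun b P (m + h2) * brun b P (m + h3))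
     <= mean (\<Prod>P) (\<lambda>m. unsieved P (m + h1) * unsieved P (m + h2) * unsieved P (m + h3) + 3 / 4 ^ b * E m)"
    by (intro mean_mono pt)
  also have "... = (\<Prod>p\<in>P. lp p h1 h2 h3) + 3 / 4 ^ b * mean (\<Prod>P) E"
    unfolding mean_add mean_cmult using assms by (simp add: mean_unsieved3)
  finally have 1: "mean (\<Prod>P) (\<lambda>m. brun b P (m + h1) * brun b P (m + h2) * brun b P (m + h3))
     <= (\<Prod>p\<in>P. lp p h1 h2 h3) + 3 / 4 ^ b * mean (\<Prod>P) E" .
  have "mean (\<Prod>P) E <= (\<Prod>p\<in>P. 1 + 189 / real p)"
    unfolding E_def using assms by (intro mean_power_om3) auto
  also have "... <= exp (\<Sum>p\<in>P. 189 / real p)" by (rule prod_one_plus_le_exp) auto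
  also have "(\<Sum>p\<in>P. 189 / real p) = 189 * (\<Sum>p\<in>P. 1 / real p)" by (simp add: sum_distrib_left)
  also have "exp ... <= exp (189 * B)" using assms(3) by simp
  finally have "3 / 4 ^ b * mean (\<Prod>P) E <= 3 / 4 ^ b * exp (189 * B)" by (intro mult_left_mono) auto
  with 1 show ?thesis by linarith
qed

lemma lp_nonneg: "0 <= lp p h1 h2 h3"
  unfolding lp_def by (intro mean_nonneg mult_nonneg_nonneg) auto

lemma lp_le_1: "p > 0 ==> lp p h1 h2 h3 <= 1"
proof -
  assume "p > 0"
  moreover have "lp p h1 h2 h3 <= mean p (\<lambda>m. 1)"
    unfolding lp_def by (intro mean_mono) (auto simp: ind_def)
  ultimately show ?thesis by simp
qed

lemma lp_same: "p > 0 ==> lp p h h h = 1 - 1 / real p"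
proof -
  assume "p > 0"
  have "lp p h h h = mean p (\<lambda>m. 1 - ind p (m + h))"
    unfolding lp_def by (rule arg_cong[where f = "mean p"]) (auto simp: ind_def)
  thus ?thesis using \<open>p > 0\<close> by (simp add: mean_diff mean_ind)
qed

lemma dvd_disjoint: "\<not> int p dvd h1 - h2 ==> int p dvd m + h1 ==> int p dvd m + h2 ==> False"
  using dvd_diff[of "int p" "m + h1" "m + h2"] by simp

lemma lp_pair: assumes "p > 0" "\<not> int p dvd h1 - h2" shows "lp p h1 h2 h2 = 1 - 2 / real p"
proof -
  have "lp p h1 h2 h2 = mean p (\<lambda>m. 1 - ind p (m + h1) - ind p (m + h2))"
    unfolding lp_def
    by (intro arg_cong[where f = "mean p"]) (auto simp: ind_def fun_eq_iff dest: dvd_disjoint[OF assms(2)])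
  thus ?thesis using assms by (simp add: mean_diff mean_ind)
qed

lemma lp_distinct:
  assumes "p > 0" "\<not> int p dvd h1 - h2" "\<not> int p dvd h1 - h3" "\<not> int p dvd h2 - h3"
  shows "lp p h1 h2 h3 = 1 - 3 / real p"
proof -
  have "lp p h1 h2 h3 = mean p (\<lambda>m. 1 - ind p (m + h1) - ind p (m + h2) - ind p (m + h3))"
    unfolding lp_def
    by (intro arg_cong[where f = "mean p"])
      (auto simp: ind_def fun_eq_iff dest: dvd_disjoint[OF assms(2)] dvd_disjoint[OF assms(3)] dvd_disjoint[OF assms(4)])
  thus ?thesis using assms by (simp add: mean_diff mean_ind)
qed

lemma lp_pair_ge: assumes "p > 0" shows "1 - 2 / real p <= lp p h1 h2 h2"
proof -
  have "mean p (\<lambda>m. 1 - ind p (m + h1) - ind p (m + h2)) <= lp p h1 h2 h2"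
    unfolding lp_def by (intro mean_mono) (auto simp: ind_def)
  thus ?thesis using assms by (simp add: mean_diff mean_ind)
qed

text \<open>Origin of the constant 7: with \<open>x = 1 / p\<close> and \<open>p >= 5\<close>, the
  trivial density 1 is at most the generic \<open>(1 - 1 / p) ^ 3\<close> times the correction
  \<open>1 + 7 / p\<close>.\<close>

lemma inverse_cube_bound: "1 <= (1 - x) ^ 3 * (1 + 7 * x)" if "0 <= x" "x <= 1/5" for x :: real
proof -
  have "(1 - x) ^ 3 * (1 + 7 * x) - 1 = x * (4 - 18 * x + x\<^sup>2 * (20 - 7 * x))"
    by (simp add: power2_eq_square power3_eq_cube algebra_simps)
  moreover have "0 <= x\<^sup>2 * (20 - 7 * x)" using that by auto
  ultimately have "(1 - x) ^ 3 * (1 + 7 * x) - 1 >= 0" using that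
    by (simp only:) (intro mult_nonneg_nonneg, auto)
  thus ?thesis by simp
qed

text \<open>For distinct classes the density is \<open>1 - 3 / p\<close>, which Bernoulli's
  inequality bounds by the cube. A correction is paid only at primes that divide one of the
  differences.\<close>

lemma lp_triple_le:
  assumes "prime p" "p > 4"
  shows "lp p h1 h2 h3 <= (1 - 1 / real p) ^ 3 *
    (1 + (if int p dvd (h1 - h2) * (h1 - h3) * (h2 - h3) then 7 / real p else 0))"
proof (cases "int p dvd (h1 - h2) * (h1 - h3) * (h2 - h3)")
  case True
  have "1 <= (1 - 1 / real p) ^ 3 * (1 + 7 * (1 / real p))"
    using assms by (intro inverse_cube_bound) (auto simp: field_simps)
  thus ?thesis using True lp_le_1[of p h1 h2 h3] assms by simp
next
  case False
  have "prime (int p)" using assms by simp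
  hence "lp p h1 h2 h3 = 1 - 3 / real p" using False assms by (intro lp_distinct) (auto simp: prime_gt_0_nat)
  also have "... <= (1 - 1 / real p) ^ 3"
    using Bernoulli_inequality[of "- 1 / real p" 3] assms by (simp add: field_simps)
  finally show ?thesis using False by simp
qed

lemma lp_pair_le:
  assumes "prime p" "p > 4"
  shows "lp p h1 h2 h2 <= (1 - 1 / real p) ^ 2 * (1 + (if int p dvd h1 - h2 then 7 / real p else 0))"
proof (cases "int p dvd h1 - h2")
  case True
  have "1 <= (1 - 1 / real p) ^ 3 * (1 + 7 * (1 / real p))"
    using assms by (intro inverse_cube_bound) (auto simp: field_simps)
  also have "... <= (1 - 1 / real p) ^ 2 * (1 + 7 * (1 / real p))"
    using assms by (intro mult_right_mono power_decreasing) (auto simp: field_simps)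
  finally show ?thesis using True lp_le_1[of p h1 h2 h2] assms by simp
next
  case False
  hence "lp p h1 h2 h2 = 1 - 2 / real p" using assms by (intro lp_pair) (auto simp: prime_gt_0_nat)
  also have "... <= (1 - 1 / real p) ^ 2"
    using Bernoulli_inequality[of "- 1 / real p" 2] assms by (simp add: field_simps)
  finally show ?thesis using False by simp
qed

lemma prod_one_minus_ge_exp:
  assumes "finite P" "\<And>p. p \<in> P ==> prime p"
  shows "exp (- 2 * (\<Sum>p\<in>P. 1 / real p)) <= (\<Prod>p\<in>P. 1 - 1 / real p)"
proof -
  have "exp (- 2 * (\<Sum>p\<in>P. 1 / real p)) = (\<Prod>p\<in>P. exp (- 2 * (1 / real p)))"
    using assms(1) by (simp add: sum_distrib_left exp_sum flip: sum_negf)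
  also have "... <= (\<Prod>p\<in>P. 1 - 1 / real p)"
  proof (rule prod_mono)
    fix p assume "p \<in> P"
    hence p: "2 <= p" using assms(2) prime_ge_2_nat by blast
    have "exp (- 2 * (1 / real p)) = inverse (exp (2 / real p))" by (simp add: exp_minus)
    also have "... <= inverse (1 + 2 / real p)" using p by (intro le_imp_inverse_le exp_ge_add_one_self) (auto simp: add_pos_nonneg)
    also have "... <= 1 - 1 / real p" using p by (simp add: field_simps)
    finally show "0 <= exp (- 2 * (1 / real p)) & exp (- 2 * (1 / real p)) <= 1 - 1 / real p" by simp
  qed
  finally show ?thesis .
qed

text \<open>The additive error of \<open>mean_brun3\<close> becomes relative because the main factor
  is at least \<open>exp (-6 * B)\<close>; hence \<open>195 = 189 + 6\<close>. In the applications
  \<open>r\<close> is the number of distinct points among the three.\<close>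

lemma mean_brun3_le:
  assumes P: "finite P" "\<And>p. p \<in> P ==> prime p" "(\<Sum>p\<in>P. 1 / real p) <= B" and r: "r <= 3"
    and t: "\<And>p. p \<in> P ==> 0 <= t p" "\<And>p. p \<in> P ==> lp p h1 h2 h3 <= (1 - 1 / real p) ^ r * (1 + t p)"
  shows "mean (\<Prod>P) (\<lambda>m. brun b P (m + h1) * brun b P (m + h2) * brun b P (m + h3))
     <= (\<Prod>p\<in>P. 1 - 1 / real p) ^ r * (\<Prod>p\<in>P. 1 + t p) * (1 + 3 * exp (195 * B) / 4 ^ b)"
proof -
  define V where "V = (\<Prod>p\<in>P. 1 - 1 / real p)"
  have V: "exp (- 2 * B) <= V"
    unfolding V_def by (rule order.trans[OF _ prod_one_minus_ge_exp]) (use P in auto)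
  have B0: "0 <= B" using P(3) by (meson order.trans sum_nonneg divide_nonneg_nonneg of_nat_0_le_iff zero_le_one)
  have T: "1 <= (\<Prod>p\<in>P. 1 + t p)" using t by (intro prod_ge_1) auto
  have "exp (-6 * B) <= exp (-2 * B) ^ r"
    using mult_right_mono[of "real r" 3 B] r B0 by (simp add: exp_of_nat_mult[symmetric] mult.commute)
  also have "... <= V ^ r" using V by (intro power_mono) auto
  finally have Vr: "exp (-6 * B) <= V ^ r" .
  have "(\<Prod>p\<in>P. lp p h1 h2 h3) <= (\<Prod>p\<in>P. (1 - 1 / real p) ^ r * (1 + t p))"
    using t by (intro prod_mono) (auto simp: lp_nonneg)
  also have "... = V ^ r * (\<Prod>p\<in>P. 1 + t p)" by (simp add: prod.distrib V_def prod_power_distrib)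
  finally have 1: "(\<Prod>p\<in>P. lp p h1 h2 h3) <= V ^ r * (\<Prod>p\<in>P. 1 + t p)" .
  have "3 / 4 ^ b * exp (189 * B) = exp (-6 * B) * 1 * (3 * exp (195 * B) / 4 ^ b)"
    by (simp add: field_simps flip: exp_add)
  also have "... <= V ^ r * (\<Prod>p\<in>P. 1 + t p) * (3 * exp (195 * B) / 4 ^ b)"
    using Vr T order.trans[OF less_imp_le[OF exp_gt_zero] Vr] by (intro mult_right_mono mult_mono) auto
  finally have 2: "3 / 4 ^ b * exp (189 * B) <= V ^ r * (\<Prod>p\<in>P. 1 + t p) * (3 * exp (195 * B) / 4 ^ b)" .
  from mean_brun3[OF P, of b h1 h2 h3] 1 2 show ?thesis unfolding V_def by (simp add: distrib_left)
qed

section \<open>Selberg's sieve\<close>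

lemma sum_Pow_prod:
  fixes f :: "'a => 'b::comm_ring_1"
  assumes "finite A" shows "(\<Sum>X\<in>Pow A. \<Prod>x\<in>X. f x) = (\<Prod>x\<in>A. 1 + f x)"
  using prod_add[OF assms, of f "\<lambda>_. 1"] by (simp add: add.commute)

text \<open>Moebius inversion in the lattice of subsets: the signs cancel unless the interval
  consists of one set.\<close>

lemma sum_minus_one_card_between:
  assumes "finite N" "A \<subseteq> N"
  shows "(\<Sum>S | A \<subseteq> S & S \<subseteq> N. (-1) ^ card S) = (if A = N then (-1) ^ card A else (0::real))"
proof -
  have "(\<Sum>S | A \<subseteq> S & S \<subseteq> N. (-1) ^ card S) = (\<Sum>S\<in>Pow (N - A). (-1) ^ card (A \<union> S) :: real)"
    by (rule sum.reindex_bij_witness[where i = "\<lambda>S. A \<union> S" and j = "\<lambda>S. S - A"])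
      (use assms in \<open>auto simp: Un_absorb1\<close>)
  also have "... = (\<Sum>S\<in>Pow (N - A). (-1) ^ card A * (\<Prod>x\<in>S. -1))"
  proof (rule sum.cong)
    fix S assume "S \<in> Pow (N - A)"
    hence "finite A" "finite S" "A \<inter> S = {}" using assms by (auto intro: finite_subset)
    thus "(-1) ^ card (A \<union> S) = (-1) ^ card A * (\<Prod>x\<in>S. -1 :: real)"
      by (simp add: card_Un_disjoint power_add)
  qed simp
  also have "... = (-1) ^ card A * (\<Prod>x\<in>N - A. 1 + (-1))"
    using assms sum_Pow_prod[of "N - A" "\<lambda>_. -1 :: real"] by (simp flip: sum_distrib_left)
  also have "... = (if A = N then (-1) ^ card A else 0)"
    using assms by (auto simp: card_eq_0_iff power_0_left)
  finally show ?thesis .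
qed

text \<open>A squarefree number is represented by its set of primes, so gcd, lcm and coprimality
  become intersection, union and disjointness.\<close>

locale selberg_weights =
  fixes P :: "nat set" and R :: real
  assumes fin: "finite P" and primes: "\<And>p. p \<in> P ==> prime p" and R: "R >= 1"
begin

definition supp :: "nat set set" where
  "supp = {S. S \<subseteq> P & real (\<Prod>S) <= R}"

definition phi :: "nat set => real" where
  "phi S = (\<Prod>p\<in>S. real p - 1)"

definition G :: real where "G = (\<Sum>S\<in>supp. 1 / phi S)"

definition compl :: "nat set => nat set set" where
  "compl S = {T. T \<inter> S = {} & S \<union> T \<in> supp}"

text \<open>Selberg's optimal weights: the Moebius sign of \<open>d\<close>, times
  \<open>d / phi(d)\<close>, times the sum of \<open>1 / phi(t)\<close> over the
  \<open>t <= R / d\<close> coprime to \<open>d\<close>, divided by \<open>G\<close> so that the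
  empty set receives weight 1. Here \<open>compl S\<close> is the set of these cofactors
  \<open>t\<close>.\<close>

definition rho :: "nat set => real" where
  "rho S = (-1) ^ card S * (real (\<Prod>S) / phi S) * (\<Sum>T\<in>compl S. 1 / phi T) / G"

definition lam :: "int => real" where
  "lam m = (\<Sum>S\<in>supp. rho S * ind (\<Prod>S) m)"

lemma finite_supp [simp]: "finite supp"
  unfolding supp_def using fin by simp

lemma supp_subset: "S \<in> supp ==> S \<subseteq> P"
  by (simp add: supp_def)

lemma supp_finite: "S \<in> supp ==> finite S"
  using supp_subset fin finite_subset by blast

lemma sub_finite: "S \<subseteq> P ==> finite S"
  using fin finite_subset by blast

lemma prod_pos_P: "S \<subseteq> P ==> \<Prod>S > 0"
  by (intro prod_pos) (use primes prime_gt_0_nat in blast)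

lemma phi_pos: "S \<subseteq> P ==> phi S > 0"
  unfolding phi_def by (intro prod_pos) (use primes prime_gt_1_nat in fastforce)

lemma supp_down: assumes "S \<in> supp" "T \<subseteq> S" shows "T \<in> supp"
proof -
  have "\<Prod>T dvd \<Prod>S" using assms supp_finite by (intro prod_dvd_prod_subset) auto
  hence "\<Prod>T <= \<Prod>S" using prod_pos_P[OF supp_subset[OF assms(1)]] by (intro dvd_imp_le) auto
  hence "real (\<Prod>T) <= real (\<Prod>S)" by (rule of_nat_mono)
  thus ?thesis using assms unfolding supp_def by auto
qed

lemma empty_supp [simp]: "{} \<in> supp"
  using R by (simp add: supp_def)

lemma finite_compl [simp]: "finite (compl S)"
  by (rule finite_subset[of _ "Pow P"]) (use fin in \<open>auto simp: compl_def dest: supp_subset\<close>)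

lemma compl_subset: "T \<in> compl S ==> T \<subseteq> P"
  by (auto simp: compl_def dest: supp_subset)

lemma G_pos: "G > 0"
proof -
  have "0 < 1 / phi {}" by (simp add: phi_def)
  also have "... <= G" unfolding G_def
    by (rule member_le_sum) (use phi_pos supp_subset in \<open>auto intro: less_imp_le\<close>)
  finally show ?thesis .
qed

lemma phi_union: "S \<subseteq> P ==> T \<subseteq> P ==> S \<inter> T = {} ==> phi (S \<union> T) = phi S * phi T"
  unfolding phi_def by (intro prod.union_disjoint sub_finite)

lemma rho_empty [simp]: "rho {} = 1"
proof -
  have "compl {} = supp" by (auto simp: compl_def)
  thus ?thesis using G_pos by (simp add: rho_def phi_def G_def)
qed

lemma sum_inverse_phi: assumes "S \<subseteq> P" shows "(\<Sum>L\<in>Pow S. 1 / phi L) = real (\<Prod>S) / phi S"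
proof -
  have "(\<Sum>L\<in>Pow S. 1 / phi L) = (\<Sum>L\<in>Pow S. \<Prod>p\<in>L. 1 / (real p - 1))"
    by (simp add: phi_def prod_dividef)
  also have "... = (\<Prod>p\<in>S. 1 + 1 / (real p - 1))" using assms by (intro sum_Pow_prod sub_finite)
  also have "... = (\<Prod>p\<in>S. real p / (real p - 1))"
  proof (rule prod.cong)
    fix p assume "p \<in> S"
    hence "p > 1" using primes assms prime_gt_1_nat by blast
    thus "1 + 1 / (real p - 1) = real p / (real p - 1)" by (simp add: field_simps)
  qed simp
  finally show ?thesis by (simp add: phi_def prod_dividef)
qed

text \<open>Expand \<open>d / phi(d)\<close> as the sum of \<open>1 / phi(l)\<close> over the
  divisors \<open>l\<close>. A pair of a divisor and a cofactor is recovered from its union, and the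
  union lies in the support, so all terms together form a subsum of \<open>G\<close>.\<close>

lemma abs_rho_le_1: assumes "S \<in> supp" shows "\<bar>rho S\<bar> <= 1"
proof -
  have SP: "S \<subseteq> P" using assms supp_subset by auto
  have "real (\<Prod>S) / phi S * (\<Sum>T\<in>compl S. 1 / phi T) = (\<Sum>L\<in>Pow S. \<Sum>T\<in>compl S. 1 / phi L * (1 / phi T))"
    unfolding sum_inverse_phi[OF SP, symmetric] sum_product by simp
  also have "... = (\<Sum>x\<in>Pow S \<times> compl S. 1 / phi (fst x \<union> snd x))"
    unfolding sum.cartesian_product
  proof (rule sum.cong)
    fix x assume x: "x \<in> Pow S \<times> compl S"
    hence "snd x \<subseteq> P" "fst x \<subseteq> P" using SP compl_subset[of "snd x" S] by auto
    moreover have "fst x \<inter> snd x = {}" using x unfolding compl_def by fastforce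
    ultimately have "phi (fst x \<union> snd x) = phi (fst x) * phi (snd x)" by (intro phi_union)
    thus "(case x of (L, T) => 1 / phi L * (1 / phi T)) = 1 / phi (fst x \<union> snd x)"
      by (simp add: case_prod_beta)
  qed simp
  also have "... = (\<Sum>U\<in>(\<lambda>x. fst x \<union> snd x) ` (Pow S \<times> compl S). 1 / phi U)"
  proof (rule sum.reindex[symmetric, unfolded o_def])
    show "inj_on (\<lambda>x. fst x \<union> snd x) (Pow S \<times> compl S)"
    proof (rule inj_onI)
      fix x y assume *: "x \<in> Pow S \<times> compl S" "y \<in> Pow S \<times> compl S" "fst x \<union> snd x = fst y \<union> snd y"
      have sub: "fst x \<subseteq> S" "fst y \<subseteq> S" "snd x \<inter> S = {}" "snd y \<inter> S = {}"
        using *(1,2) by (auto simp: compl_def)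
      have "fst x = (fst x \<union> snd x) \<inter> S" "fst y = (fst y \<union> snd y) \<inter> S" using sub by blast+
      moreover have "snd x = (fst x \<union> snd x) - S" "snd y = (fst y \<union> snd y) - S" using sub by blast+
      ultimately show "x = y" using *(3) by (metis prod_eqI)
    qed
  qed
  also have "... <= G" unfolding G_def
  proof (rule sum_mono2)
    show "(\<lambda>x. fst x \<union> snd x) ` (Pow S \<times> compl S) \<subseteq> supp"
    proof
      fix U assume "U \<in> (\<lambda>x. fst x \<union> snd x) ` (Pow S \<times> compl S)"
      then obtain L T where "U = L \<union> T" "L \<subseteq> S" "S \<union> T \<in> supp" by (auto simp: compl_def)
      thus "U \<in> supp" using supp_down[of "S \<union> T" U] by auto
    qed
  qed (use phi_pos supp_subset in \<open>auto intro: less_imp_le\<close>)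
  finally have "real (\<Prod>S) / phi S * (\<Sum>T\<in>compl S. 1 / phi T) <= G" .
  moreover have "0 <= real (\<Prod>S) / phi S * (\<Sum>T\<in>compl S. 1 / phi T)"
  proof (intro mult_nonneg_nonneg sum_nonneg divide_nonneg_nonneg)
    show "0 <= phi S" using phi_pos[OF SP] by simp
    show "0 <= phi T" if "T \<in> compl S" for T using phi_pos[OF compl_subset[OF that]] by simp
  qed (auto intro: prod_nonneg)
  ultimately have y: "0 <= y" "y <= G" if "y = real (\<Prod>S) / phi S * (\<Sum>T\<in>compl S. 1 / phi T)" for y
    using that by simp_all
  have "rho S = (-1) ^ card S * (real (\<Prod>S) / phi S * (\<Sum>T\<in>compl S. 1 / phi T)) / G"
    by (simp add: rho_def)
  hence "\<bar>rho S\<bar> = \<bar>real (\<Prod>S) / phi S * (\<Sum>T\<in>compl S. 1 / phi T)\<bar> / G"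
    using G_pos by (simp only: abs_mult abs_divide power_abs) simp
  also have "... <= 1" using y[OF refl] G_pos by (simp only: abs_of_nonneg) (simp only: divide_le_eq_1_pos)
  finally show ?thesis .
qed

text \<open>In these variables the quadratic form of the sieve is diagonal, and the weights are
  chosen so that the variables are proportional to the Moebius sign over \<open>phi\<close>, the
  minimiser under \<open>rho {} = 1\<close>.\<close>

lemma sum_rho_multiples:
  assumes "A \<in> supp"
  shows "(\<Sum>S | S \<in> supp & A \<subseteq> S. rho S / real (\<Prod>S)) = (-1) ^ card A / (phi A * G)"
proof -
  have "(\<Sum>S | S \<in> supp & A \<subseteq> S. rho S / real (\<Prod>S))
      = (\<Sum>S | S \<in> supp & A \<subseteq> S. \<Sum>T\<in>compl S. (-1) ^ card S / phi (S \<union> T) / G)"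
  proof (rule sum.cong)
    fix S assume S: "S \<in> {S. S \<in> supp & A \<subseteq> S}"
    hence SP: "S \<subseteq> P" using supp_subset by auto
    have "rho S / real (\<Prod>S) = (\<Sum>T\<in>compl S. (-1) ^ card S / (phi S * phi T) / G)"
      using prod_pos_P[OF SP] by (simp add: rho_def sum_distrib_left sum_divide_distrib mult.assoc del: of_nat_prod)
    also have "... = (\<Sum>T\<in>compl S. (-1) ^ card S / phi (S \<union> T) / G)"
      using SP compl_subset by (intro sum.cong refl) (subst phi_union, auto simp: compl_def)
    finally show "rho S / real (\<Prod>S) = (\<Sum>T\<in>compl S. (-1) ^ card S / phi (S \<union> T) / G)" .
  qed simp
  also have "... = (\<Sum>x\<in>Sigma {S. S \<in> supp & A \<subseteq> S} compl. (-1) ^ card (fst x) / phi (fst x \<union> snd x) / G)"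
    by (subst sum.Sigma) (auto simp: case_prod_beta)
  \<comment> \<open>Regroup by \<open>N\<close>, the union of \<open>S\<close> and \<open>T\<close>;
    for fixed \<open>N\<close> only the signs of the sets between \<open>A\<close> and
    \<open>N\<close> remain, and they cancel unless \<open>N = A\<close>.\<close>
  also have "... = (\<Sum>x\<in>Sigma {N. N \<in> supp & A \<subseteq> N} (\<lambda>N. {S. A \<subseteq> S & S \<subseteq> N}). (-1) ^ card (snd x) / phi (fst x) / G)"
    by (rule sum.reindex_bij_witness[where i = "\<lambda>(N, S). (S, N - S)" and j = "\<lambda>(S, T). (S \<union> T, S)"])
      (auto simp: compl_def Un_absorb1 intro: supp_down)
  also have "... = (\<Sum>N | N \<in> supp & A \<subseteq> N. \<Sum>S | A \<subseteq> S & S \<subseteq> N. (-1) ^ card S / phi N / G)"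
  proof (subst sum.Sigma)
    show "\<forall>N\<in>{N. N \<in> supp & A \<subseteq> N}. finite {S. A \<subseteq> S & S \<subseteq> N}"
      using supp_finite by (auto intro!: finite_subset[of _ "Pow _"])
  qed (auto simp: case_prod_beta)
  also have "... = (\<Sum>N | N \<in> supp & A \<subseteq> N. (if A = N then (-1) ^ card A else 0) / phi N / G)"
    by (intro sum.cong refl) (subst sum_minus_one_card_between[symmetric], auto simp: supp_finite sum_divide_distrib)
  also have "... = (\<Sum>N\<in>{A}. (-1) ^ card A / phi N / G)"
    by (rule sum.mono_neutral_cong_right) (use assms in auto)
  finally show ?thesis by simp
qed

text \<open>The reciprocal of an lcm is the gcd over the product, and the gcd is the sum of
  \<open>phi\<close> over its divisors. This turns the form into a weighted sum of squares of the
  quantities in \<open>sum_rho_multiples\<close>.\<close>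

lemma quadratic_form:
  "(\<Sum>S\<in>supp. \<Sum>T\<in>supp. rho S * rho T / real (\<Prod>(S \<union> T))) = 1 / G"
proof -
  have "rho S * rho T / real (\<Prod>(S \<union> T))
      = (\<Sum>A\<in>supp. phi A * ((if A \<subseteq> S then rho S / real (\<Prod>S) else 0) * (if A \<subseteq> T then rho T / real (\<Prod>T) else 0)))"
    if "S \<in> supp" "T \<in> supp" for S T
  proof -
    have f: "finite S" "finite T" using that supp_finite by auto
    have pos: "real (\<Prod>S) > 0" "real (\<Prod>T) > 0" "real (\<Prod>(S \<union> T)) > 0" "real (\<Prod>(S \<inter> T)) > 0"
      using that supp_subset by (auto intro!: prod_pos_P simp del: of_nat_prod)
    have "real (\<Prod>(S \<union> T)) * real (\<Prod>(S \<inter> T)) = real (\<Prod>S) * real (\<Prod>T)"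
      using prod.union_inter[OF f, of "\<lambda>x. real x"] by simp
    hence "1 / real (\<Prod>(S \<union> T)) = real (\<Prod>(S \<inter> T)) / (real (\<Prod>S) * real (\<Prod>T))"
      using pos by (simp add: field_simps del: of_nat_prod)
    also have "real (\<Prod>(S \<inter> T)) = (\<Prod>p\<in>S \<inter> T. 1 + (real p - 1))" by simp
    also have "... = (\<Sum>A\<in>Pow (S \<inter> T). phi A)"
      unfolding phi_def using f by (intro sum_Pow_prod[symmetric]) auto
    also have "... = (\<Sum>A\<in>supp. if A \<subseteq> S & A \<subseteq> T then phi A else 0)"
      using that supp_down by (intro sum.mono_neutral_cong_left) auto
    finally have "rho S * rho T / real (\<Prod>(S \<union> T)) = rho S * rho T *
       ((\<Sum>A\<in>supp. if A \<subseteq> S & A \<subseteq> T then phi A else 0) / (real (\<Prod>S) * real (\<Prod>T)))"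
      by (metis times_divide_eq_right mult.right_neutral)
    also have "... = (\<Sum>A\<in>supp. phi A * ((if A \<subseteq> S then rho S / real (\<Prod>S) else 0) * (if A \<subseteq> T then rho T / real (\<Prod>T) else 0)))"
      by (auto simp: sum_divide_distrib sum_distrib_left intro!: sum.cong)
    finally show ?thesis .
  qed
  hence "(\<Sum>S\<in>supp. \<Sum>T\<in>supp. rho S * rho T / real (\<Prod>(S \<union> T))) = (\<Sum>S\<in>supp. \<Sum>T\<in>supp. \<Sum>A\<in>supp.
      phi A * ((if A \<subseteq> S then rho S / real (\<Prod>S) else 0) * (if A \<subseteq> T then rho T / real (\<Prod>T) else 0)))"
    by (intro sum.cong) auto
  also have "... = (\<Sum>A\<in>supp. phi A * ((\<Sum>S\<in>supp. if A \<subseteq> S then rho S / real (\<Prod>S) else 0) *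
      (\<Sum>T\<in>supp. if A \<subseteq> T then rho T / real (\<Prod>T) else 0)))"
  proof -
    have "(\<Sum>S\<in>supp. \<Sum>T\<in>supp. \<Sum>A\<in>supp. g A * (h A S * h A T)) = (\<Sum>A\<in>supp. g A * ((\<Sum>S\<in>supp. h A S) * (\<Sum>T\<in>supp. h A T)))"
      for g :: "nat set => real" and h
    proof -
      have "(\<Sum>S\<in>supp. \<Sum>T\<in>supp. \<Sum>A\<in>supp. g A * (h A S * h A T)) = (\<Sum>S\<in>supp. \<Sum>A\<in>supp. \<Sum>T\<in>supp. g A * (h A S * h A T))"
        by (intro sum.cong refl sum.swap)
      also have "... = (\<Sum>A\<in>supp. \<Sum>S\<in>supp. \<Sum>T\<in>supp. g A * (h A S * h A T))" by (rule sum.swap)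
      finally show ?thesis unfolding sum_product by (simp only: sum_distrib_left)
    qed
    from this[of phi "\<lambda>A S. if A \<subseteq> S then rho S / real (\<Prod>S) else 0"] show ?thesis .
  qed
  also have "... = (\<Sum>A\<in>supp. phi A * ((-1) ^ card A / (phi A * G) * ((-1) ^ card A / (phi A * G))))"
  proof (rule sum.cong)
    fix A assume A: "A \<in> supp"
    have "(\<Sum>S\<in>supp. if A \<subseteq> S then rho S / real (\<Prod>S) else 0) = (-1) ^ card A / (phi A * G)"
      unfolding sum_rho_multiples[OF A, symmetric] by (rule sum.mono_neutral_cong_right) auto
    thus "phi A * ((\<Sum>S\<in>supp. if A \<subseteq> S then rho S / real (\<Prod>S) else 0) *
      (\<Sum>T\<in>supp. if A \<subseteq> T then rho T / real (\<Prod>T) else 0)) = phi A * ((-1) ^ card A / (phi A * G) * ((-1) ^ card A / (phi A * G)))"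
      by simp
  qed simp
  also have "... = (\<Sum>A\<in>supp. 1 / phi A * (1 / G\<^sup>2))"
  proof (rule sum.cong)
    fix A assume "A \<in> supp"
    hence "phi A > 0" using phi_pos supp_subset by auto
    thus "phi A * ((-1) ^ card A / (phi A * G) * ((-1) ^ card A / (phi A * G))) = 1 / phi A * (1 / G\<^sup>2)"
      using G_pos by (simp add: field_simps power2_eq_square flip: power_add power_mult_distrib)
  qed simp
  also have "... = G * (1 / G\<^sup>2)" unfolding G_def by (rule sum_distrib_right[symmetric])
  also have "... = 1 / G" using G_pos by (simp add: power2_eq_square)
  finally show ?thesis .
qed

lemma ind_Prod: "S \<subseteq> P ==> ind (\<Prod>S) m = (if \<forall>p\<in>S. int p dvd m then 1 else 0)"
  using prod_ind_primes[of S m] prod_ind_subset[of S m] sub_finite primes by (metis subsetD)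

lemma ind_Prod_mult: "S \<subseteq> P ==> T \<subseteq> P ==> ind (\<Prod>S) m * ind (\<Prod>T) m = ind (\<Prod>(S \<union> T)) m"
  by (subst (1 2 3) ind_Prod) auto

lemma Prod_dvd: "S \<subseteq> P ==> \<Prod>S dvd \<Prod>P"
  using fin by (rule prod_dvd_prod_subset)

lemma mean_ind_Prod: "S \<subseteq> P ==> mean (\<Prod>P) (\<lambda>m. ind (\<Prod>S) m) = 1 / real (\<Prod>S)"
  using mean_ind[OF Prod_dvd[of S] prod_pos_P[of P], of 0] by simp

lemma lam_sq: "(lam m)\<^sup>2 = (\<Sum>S\<in>supp. \<Sum>T\<in>supp. rho S * rho T * ind (\<Prod>(S \<union> T)) m)"
proof -
  have "(lam m)\<^sup>2 = (\<Sum>S\<in>supp. \<Sum>T\<in>supp. (rho S * ind (\<Prod>S) m) * (rho T * ind (\<Prod>T) m))"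
    unfolding lam_def power2_eq_square sum_product ..
  also have "... = (\<Sum>S\<in>supp. \<Sum>T\<in>supp. rho S * rho T * ind (\<Prod>(S \<union> T)) m)"
  proof (intro sum.cong refl)
    fix S T assume "S \<in> supp" "T \<in> supp"
    hence "ind (\<Prod>S) m * ind (\<Prod>T) m = ind (\<Prod>(S \<union> T)) m" by (intro ind_Prod_mult supp_subset)
    thus "(rho S * ind (\<Prod>S) m) * (rho T * ind (\<Prod>T) m) = rho S * rho T * ind (\<Prod>(S \<union> T)) m"
      by (metis mult.assoc mult.left_commute)
  qed
  finally show ?thesis .
qed

lemma mean_lam_sq: "mean (\<Prod>P) (\<lambda>m. (lam m)\<^sup>2) = 1 / G"
  unfolding lam_sq mean_sum mean_cmult quadratic_form[symmetric]
  using supp_subset by (intro sum.cong refl) (subst mean_ind_Prod, auto)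

lemma abs_lam_le: "\<bar>lam m\<bar> <= 2 ^ om P m"
proof -
  have "\<bar>lam m\<bar> <= (\<Sum>S\<in>supp. \<bar>rho S * ind (\<Prod>S) m\<bar>)" unfolding lam_def by (rule sum_abs)
  also have "... <= (\<Sum>S\<in>supp. ind (\<Prod>S) m)"
    by (intro sum_mono) (auto simp: abs_mult intro!: mult_left_le_one_le abs_rho_le_1)
  also have "... = (\<Sum>S\<in>supp. if S \<subseteq> {p\<in>P. int p dvd m} then 1 else 0)"
    using supp_subset by (intro sum.cong refl) (subst ind_Prod, auto)
  also have "... <= (\<Sum>S\<in>Pow {p\<in>P. int p dvd m}. 1)"
    using fin by (subst sum.inter_filter[symmetric]) (auto intro!: card_mono)
  also have "... = 2 ^ om P m" using fin by (simp add: card_Pow om_def)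
  finally show ?thesis .
qed

lemma mean_lam_pow4_le: "mean (\<Prod>P) (\<lambda>m. lam m ^ 4) <= exp (15 * (\<Sum>p\<in>P. 1 / real p))"
proof -
  have "lam m ^ 4 <= 16 ^ om P m" for m
  proof -
    have "lam m ^ 4 = \<bar>lam m\<bar> ^ 4" by simp
    also have "... <= (2 ^ om P m) ^ 4" by (intro power_mono abs_lam_le) auto
    also have "... = 16 ^ om P m" by (simp add: power_mult[symmetric] mult.commute[of _ 4] power_mult)
    finally show ?thesis .
  qed
  hence "mean (\<Prod>P) (\<lambda>m. lam m ^ 4) <= mean (\<Prod>P) (\<lambda>m. \<Prod>p\<in>P. 1 + 15 * ind p m)"
    using power_om[OF fin, of 16] by (intro mean_mono) simp
  also have "... = (\<Prod>p\<in>P. mean p (\<lambda>m. 1 + 15 * ind p m))"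
    using fin primes by (intro mean_prod_primes) (auto intro!: per_comp[where h = "\<lambda>x. 1 + 15 * x"] per_ind0)
  also have "... = (\<Prod>p\<in>P. 1 + 15 / real p)"
  proof (rule prod.cong)
    fix p assume "p \<in> P"
    hence "p > 0" using primes prime_gt_0_nat by blast
    thus "mean p (\<lambda>m. 1 + 15 * ind p m) = 1 + 15 / real p"
      using mean_ind[of p p 0] by (simp add: mean_add mean_cmult)
  qed simp
  also have "... <= exp (\<Sum>p\<in>P. 15 / real p)" by (rule prod_one_plus_le_exp) auto
  finally show ?thesis by (simp add: sum_distrib_left)
qed

text \<open>By unique factorisation a set of primes is determined by its product, a positive integer
  at most \<open>R\<close>. Together with \<open>abs_rho_le_1\<close> this makes \<open>R\<close>
  the cost of \<open>lam\<close>.\<close>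

lemma card_supp_le: "real (card supp) <= R"
proof -
  have "inj_on (\<lambda>S. \<Prod>S) supp"
  proof (rule inj_onI)
    fix S T assume *: "S \<in> supp" "T \<in> supp" "\<Prod>S = \<Prod>T"
    have "prime_factors (\<Prod>U) = U" if U: "U \<in> supp" for U
    proof -
      have pr: "prime p" if "p \<in> U" for p using that U supp_subset primes by blast
      hence "0 \<notin> U" using not_prime_0 by blast
      hence "prime_factors (\<Prod>U) = (\<Union>p\<in>U. prime_factors p)"
        using prime_factors_prod[of U "\<lambda>p. p"] supp_finite[OF U] by simp
      also have "... = (\<Union>p\<in>U. {p})" by (intro SUP_cong refl) (simp add: prime_factorization_prime pr)
      finally show ?thesis by simp
    qed
    thus "S = T" using * by metis
  qed
  hence "card supp = card ((\<lambda>S. \<Prod>S) ` supp)" by (simp add: card_image)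
  also have "... <= card {1..nat \<lfloor>R\<rfloor>}"
  proof (rule card_mono)
    show "(\<lambda>S. \<Prod>S) ` supp \<subseteq> {1..nat \<lfloor>R\<rfloor>}"
    proof
      fix n assume "n \<in> (\<lambda>S. \<Prod>S) ` supp"
      then obtain S where S: "S \<in> supp" "n = \<Prod>S" by auto
      have "real n <= R" using S by (simp add: supp_def)
      moreover have "n >= 1" using prod_pos_P[OF supp_subset[OF S(1)]] S(2) by simp
      ultimately show "n \<in> {1..nat \<lfloor>R\<rfloor>}" by (auto simp: le_nat_floor)
    qed
  qed simp
  also have "... = nat \<lfloor>R\<rfloor>" by simp
  finally have "real (card supp) <= real (nat \<lfloor>R\<rfloor>)" by (rule of_nat_mono)
  also have "... <= R" using R by (simp add: of_nat_floor)
  finally show ?thesis .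
qed

lemma apc_lam: assumes "\<Prod>P dvd Q" shows "apc Q R lam"
proof -
  have "apc Q (\<Sum>S\<in>supp. 1) lam" unfolding lam_def
  proof (rule apc_sum)
    fix S assume S: "S \<in> supp"
    have "\<Prod>S dvd Q" using Prod_dvd[OF supp_subset[OF S]] assms by (rule dvd_trans)
    from apc_cmult[OF apc_ind1[OF this], of "rho S"]
    show "apc Q 1 (\<lambda>m. rho S * ind (\<Prod>S) m)" by (rule apc_mono) (simp add: abs_rho_le_1 S)
  qed simp
  thus ?thesis by (rule apc_mono) (use card_supp_le in simp)
qed

text \<open>Prescribing divisibility at \<open>p\<close> costs a factor \<open>1 / p\<close>; the
  other primes contribute at most the exponential of a sum of reciprocals.\<close>

lemma mean_marked_prime:
  assumes p: "p \<in> P" and k: "\<And>q. q \<in> P ==> per q (k q)" "\<And>q m. q \<in> P ==> 0 <= k q m"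
    "\<And>q. q \<in> P ==> mean q (k q) <= 1 + c / real q" and c: "0 <= c"
  shows "mean (\<Prod>P) (\<lambda>m. ind p (m + d) * (\<Prod>q\<in>P - {p}. k q m)) <= 1 / real p * exp (c * (\<Sum>q\<in>P. 1 / real q))"
proof -
  let ?f = "\<lambda>q m. if q = p then ind p (m + d) else k q m"
  have eq: "ind p (m + d) * (\<Prod>q\<in>P - {p}. k q m) = (\<Prod>q\<in>P. ?f q m)" for m
    using p fin by (subst prod.remove[of P p]) (auto intro!: prod.cong)
  have "mean (\<Prod>P) (\<lambda>m. \<Prod>q\<in>P. ?f q m) = (\<Prod>q\<in>P. mean q (?f q))"
  proof (rule mean_prod_primes[OF fin primes])
    fix q assume "q \<in> P"
    thus "per q (?f q)" using k(1)[of q] per_ind[of p p d] by (cases "q = p") auto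
  qed
  also have "... = mean p (\<lambda>m. ind p (m + d)) * (\<Prod>q\<in>P - {p}. mean q (k q))"
    using p fin by (subst prod.remove[of P p]) (auto intro!: prod.cong)
  also have "mean p (\<lambda>m. ind p (m + d)) = 1 / real p"
    using primes[OF p] prime_gt_0_nat by (intro mean_ind) auto
  also have "(\<Prod>q\<in>P - {p}. mean q (k q)) <= (\<Prod>q\<in>P - {p}. 1 + c / real q)"
    using k by (intro prod_mono) (auto intro: mean_nonneg)
  also have "... <= exp (\<Sum>q\<in>P - {p}. c / real q)" using c by (intro prod_one_plus_le_exp) auto
  also have "... <= exp (\<Sum>q\<in>P. c / real q)" using c fin by (auto intro!: sum_mono2)
  also have "(\<Sum>q\<in>P. c / real q) = c * (\<Sum>q\<in>P. 1 / real q)" by (simp add: sum_distrib_left)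
  finally show ?thesis unfolding eq by (simp add: mult_left_mono divide_right_mono)
qed

text \<open>The number of pairs of sieve divisors of \<open>m\<close> of which at least one contains
  \<open>p\<close>. It bounds the terms of \<open>lam\<close> squared that involve
  \<open>p\<close>.\<close>

definition marked :: "nat => int => real" where
  "marked p m = (\<Sum>x\<in>{x \<in> supp \<times> supp. p \<in> fst x \<union> snd x}. ind (\<Prod>(fst x \<union> snd x)) m)"

lemma marked_le:
  assumes "p \<in> P" shows "marked p m <= 4 * ind p m * (\<Prod>q\<in>P - {p}. 1 + 3 * ind q m)"
proof (cases "int p dvd m")
  case False
  have "marked p m = 0" unfolding marked_def
  proof (rule sum.neutral, rule ballI)
    fix x assume "x \<in> {x \<in> supp \<times> supp. p \<in> fst x \<union> snd x}"
    hence "fst x \<union> snd x \<subseteq> P" "p \<in> fst x \<union> snd x" using supp_subset[of "fst x"] supp_subset[of "snd x"] by auto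
    thus "ind (\<Prod>(fst x \<union> snd x)) m = 0" using False by (subst ind_Prod) auto
  qed
  thus ?thesis using False by (simp add: ind_def)
next
  case True
  let ?D = "{p\<in>P. int p dvd m}"
  have "marked p m <= (\<Sum>x\<in>supp \<times> supp. ind (\<Prod>(fst x \<union> snd x)) m)"
    unfolding marked_def by (rule sum_mono2) auto
  also have "... = (\<Sum>x\<in>supp \<times> supp. if x \<in> Pow ?D \<times> Pow ?D then 1 else 0)"
  proof (rule sum.cong)
    fix x assume "x \<in> supp \<times> supp"
    hence "fst x \<subseteq> P" "snd x \<subseteq> P" using supp_subset[of "fst x"] supp_subset[of "snd x"] by auto
    thus "ind (\<Prod>(fst x \<union> snd x)) m = (if x \<in> Pow ?D \<times> Pow ?D then 1 else 0)"
      by (subst ind_Prod) (auto simp: mem_Times_iff)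
  qed simp
  also have "... = real (card (supp \<times> supp \<inter> Pow ?D \<times> Pow ?D))"
    by (simp add: sum.If_cases)
  also have "... <= real (card (Pow ?D \<times> Pow ?D))" using fin by (intro of_nat_mono card_mono) auto
  also have "... = 4 ^ om P m" using fin by (simp add: card_cartesian_product card_Pow om_def flip: power_mult_distrib)
  also have "... = 4 * (\<Prod>q\<in>P - {p}. 1 + 3 * ind q m)"
    using power_om[OF fin, of 4 m] prod.remove[OF fin assms, of "\<lambda>q. 1 + 3 * ind q m"] True by (simp add: ind_def)
  finally show ?thesis using True by (simp add: ind_def)
qed

text \<open>Near independence at two points. Terms without a common prime factor exactly, so the
  deviation from the product of the two means comes from common primes. At a common prime outside
  \<open>d - d'\<close> the joint mean vanishes and only the product of order
  \<open>1 / p ^ 2\<close> is left; at a prime dividing \<open>d - d'\<close> the loss is of order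
  \<open>1 / p\<close>. Both are small when all primes of \<open>P\<close> are large.\<close>

lemma mean_lam_two_point:
  defines "s \<equiv> (\<Sum>p\<in>P. 1 / real p)"
  shows "mean (\<Prod>P) (\<lambda>m. (lam (m + d))\<^sup>2 * (lam (m + d'))\<^sup>2)
     <= (1 / G)\<^sup>2 + (\<Sum>p | p \<in> P & int p dvd d - d'. 16 / real p) * exp (15 * s) + (\<Sum>p\<in>P. 16 / (real p)\<^sup>2) * exp (6 * s)"
proof -
  define X where "X = supp \<times> supp"
  define u where "u = (\<lambda>x. rho (fst x) * rho (snd x))"
  define A where "A = (\<lambda>x::nat set \<times> nat set. fst x \<union> snd x)"
  have finX [simp]: "finite X" by (simp add: X_def)
  have AP: "A x \<subseteq> P" if "x \<in> X" for x using that supp_subset[of "fst x"] supp_subset[of "snd x"] by (auto simp: X_def A_def)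
  have Apos: "real (\<Prod>(A x)) > 0" if "x \<in> X" for x using prod_pos_P[OF AP[OF that]] by (simp del: of_nat_prod)
  have u1: "\<bar>u x\<bar> <= 1" if "x \<in> X" for x
    using that abs_rho_le_1 unfolding u_def abs_mult X_def by (intro mult_le_one) auto
  have lsq: "(lam m)\<^sup>2 = (\<Sum>x\<in>X. u x * ind (\<Prod>(A x)) m)" for m
    unfolding lam_sq X_def u_def A_def by (simp add: sum.cartesian_product case_prod_beta)
  define M where "M = (\<lambda>x y. mean (\<Prod>P) (\<lambda>m. ind (\<Prod>(A x)) (m + d) * ind (\<Prod>(A y)) (m + d')))"
  have M0: "0 <= M x y" for x y unfolding M_def by (intro mean_nonneg) auto
  have lhs: "mean (\<Prod>P) (\<lambda>m. (lam (m + d))\<^sup>2 * (lam (m + d'))\<^sup>2) = (\<Sum>x\<in>X. \<Sum>y\<in>X. u x * u y * M x y)"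
  proof -
    have "(lam (m + d))\<^sup>2 * (lam (m + d'))\<^sup>2 = (\<Sum>x\<in>X. \<Sum>y\<in>X. (u x * u y) * (ind (\<Prod>(A x)) (m + d) * ind (\<Prod>(A y)) (m + d')))" for m
      unfolding lsq sum_product by (simp add: mult.assoc mult.left_commute)
    thus ?thesis by (simp only: mean_sum mean_cmult M_def)
  qed
  have G2: "(1 / G)\<^sup>2 = (\<Sum>x\<in>X. \<Sum>y\<in>X. u x * u y * (1 / real (\<Prod>(A x)) * (1 / real (\<Prod>(A y)))))"
  proof -
    have "1 / G = (\<Sum>x\<in>X. u x * (1 / real (\<Prod>(A x))))"
      unfolding quadratic_form[symmetric] X_def u_def A_def by (simp add: sum.cartesian_product case_prod_beta del: of_nat_prod)
    thus ?thesis unfolding power2_eq_square by (simp add: sum_product mult.assoc mult.left_commute del: of_nat_prod)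
  qed
  have disj: "M x y = 1 / real (\<Prod>(A x)) * (1 / real (\<Prod>(A y)))" if x: "x \<in> X" and y: "y \<in> X" and xy: "A x \<inter> A y = {}" for x y
  proof -
    let ?f = "\<lambda>p m. (if p \<in> A x then ind p (m + d) else 1) * (if p \<in> A y then ind p (m + d') else 1)"
    have pr: "(\<Prod>p\<in>P. if p \<in> S then g p else 1) = (\<Prod>p\<in>S. g p)" if "S \<subseteq> P" for S and g :: "nat => real"
      using that fin by (intro prod.mono_neutral_cong_right) auto
    have "ind (\<Prod>(A x)) (m + d) * ind (\<Prod>(A y)) (m + d') = (\<Prod>p\<in>P. ?f p m)" for m
      using AP[OF x] AP[OF y] primes sub_finite
      by (simp add: prod.distrib pr prod_ind_primes subset_eq)
    hence "M x y = mean (\<Prod>P) (\<lambda>m. \<Prod>p\<in>P. ?f p m)" unfolding M_def by presburger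
    also have "... = (\<Prod>p\<in>P. mean p (?f p))"
    proof (rule mean_prod_primes[OF fin primes])
      fix p
      show "per p (?f p)"
        using per_ind[of p p d] per_ind[of p p d'] by (cases "p \<in> A x"; cases "p \<in> A y") (auto intro: per_mult)
    qed
    also have "... = (\<Prod>p\<in>P. (if p \<in> A x then 1 / real p else 1) * (if p \<in> A y then 1 / real p else 1))"
    proof (rule prod.cong)
      fix p assume "p \<in> P"
      hence "p > 0" using primes prime_gt_0_nat by blast
      thus "mean p (?f p) = (if p \<in> A x then 1 / real p else 1) * (if p \<in> A y then 1 / real p else 1)"
        using xy by (auto simp: mean_ind)
    qed simp
    also have "... = (\<Prod>p\<in>A x. 1 / real p) * (\<Prod>p\<in>A y. 1 / real p)"
      using AP[OF x] AP[OF y] by (simp add: prod.distrib pr)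
    finally show ?thesis by (simp add: prod_dividef)
  qed
  have "(\<Sum>x\<in>X. \<Sum>y\<in>X. u x * u y * M x y) - (1 / G)\<^sup>2
      = (\<Sum>x\<in>X. \<Sum>y\<in>X. u x * u y * (M x y - 1 / real (\<Prod>(A x)) * (1 / real (\<Prod>(A y)))))"
    unfolding G2 by (simp add: sum_subtractf right_diff_distrib del: of_nat_prod)
  \<comment> \<open>Terms with disjoint prime sets are zero by \<open>disj\<close>. Every other term
    is charged to its common primes, with coefficients at most 1 and the difference replaced by a
    sum.\<close>
  also have "... <= (\<Sum>x\<in>X. \<Sum>y\<in>X. \<Sum>p\<in>P. (if p \<in> A x & p \<in> A y then M x y + 1 / real (\<Prod>(A x)) * (1 / real (\<Prod>(A y))) else 0))"
  proof (intro sum_mono)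
    fix x y assume x: "x \<in> X" and y: "y \<in> X"
    let ?m = "1 / real (\<Prod>(A x)) * (1 / real (\<Prod>(A y)))"
    have m0: "0 <= ?m" using Apos[OF x] Apos[OF y] by simp
    show "u x * u y * (M x y - ?m) <= (\<Sum>p\<in>P. if p \<in> A x & p \<in> A y then M x y + ?m else 0)"
    proof (cases "A x \<inter> A y = {}")
      case True
      thus ?thesis using disj[OF x y] M0 m0 by (auto intro!: sum_nonneg simp del: of_nat_prod)
    next
      case False
      then obtain p where p: "p \<in> A x" "p \<in> A y" "p \<in> P" using AP[OF x] by auto
      have "u x * u y * (M x y - ?m) <= \<bar>u x\<bar> * \<bar>u y\<bar> * \<bar>M x y - ?m\<bar>" by (metis abs_ge_self abs_mult)
      also have "... <= 1 * 1 * (M x y + ?m)"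
      proof (rule mult_mono)
        show "\<bar>M x y - ?m\<bar> <= M x y + ?m" using M0[of x y] m0 by linarith
      qed (use u1[OF x] u1[OF y] in \<open>auto intro: mult_le_one\<close>)
      also have "... = (if p \<in> A x & p \<in> A y then M x y + ?m else 0)" using p by simp
      also have "... <= (\<Sum>p\<in>P. if p \<in> A x & p \<in> A y then M x y + ?m else 0)"
        using p fin M0[of x y] m0 by (intro member_le_sum) auto
      finally show ?thesis .
    qed
  qed
  also have "... = (\<Sum>p\<in>P. (\<Sum>x\<in>X. \<Sum>y\<in>X. if p \<in> A x & p \<in> A y then M x y else 0)
      + (\<Sum>x\<in>X. if p \<in> A x then 1 / real (\<Prod>(A x)) else 0)\<^sup>2)" (is "?L = (\<Sum>p\<in>P. ?F p + ?S p)")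
  proof -
    have "?L = (\<Sum>x\<in>X. \<Sum>p\<in>P. \<Sum>y\<in>X. (if p \<in> A x & p \<in> A y then M x y + 1 / real (\<Prod>(A x)) * (1 / real (\<Prod>(A y))) else 0))"
      by (intro sum.cong refl sum.swap)
    also have "... = (\<Sum>p\<in>P. \<Sum>x\<in>X. \<Sum>y\<in>X. (if p \<in> A x & p \<in> A y then M x y + 1 / real (\<Prod>(A x)) * (1 / real (\<Prod>(A y))) else 0))"
      by (rule sum.swap)
    also have "... = (\<Sum>p\<in>P. ?F p + ?S p)"
    proof (intro sum.cong refl)
      fix p
      have "?S p = (\<Sum>x\<in>X. \<Sum>y\<in>X. if p \<in> A x & p \<in> A y then 1 / real (\<Prod>(A x)) * (1 / real (\<Prod>(A y))) else 0)"
        unfolding power2_eq_square sum_product by (intro sum.cong refl) auto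
      thus "(\<Sum>x\<in>X. \<Sum>y\<in>X. (if p \<in> A x & p \<in> A y then M x y + 1 / real (\<Prod>(A x)) * (1 / real (\<Prod>(A y))) else 0)) = ?F p + ?S p"
        by (simp add: sum.distrib[symmetric] del: of_nat_prod) (intro sum.cong refl, simp del: of_nat_prod)
    qed
    finally show ?thesis .
  qed
  also have "... <= (\<Sum>p\<in>P. (if int p dvd d - d' then 16 / real p * exp (15 * s) else 0) + 16 / (real p)\<^sup>2 * exp (6 * s))"
  proof (intro sum_mono add_mono)
    fix p assume p: "p \<in> P"
    have p0: "p > 0" using primes[OF p] prime_gt_0_nat by blast
    have mk: "marked p m = (\<Sum>x\<in>X. if p \<in> A x then ind (\<Prod>(A x)) m else 0)" for m
      unfolding marked_def X_def A_def by (rule sum.mono_neutral_cong_left) auto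
    have mk0: "0 <= marked p m" for m unfolding marked_def by (intro sum_nonneg) auto
    have "?F p = mean (\<Prod>P) (\<lambda>m. marked p (m + d) * marked p (m + d'))"
    proof -
      have "marked p (m + d) * marked p (m + d') = (\<Sum>x\<in>X. \<Sum>y\<in>X. if p \<in> A x & p \<in> A y then ind (\<Prod>(A x)) (m + d) * ind (\<Prod>(A y)) (m + d') else 0)" for m
        unfolding mk sum_product by (intro sum.cong refl) auto
      hence "mean (\<Prod>P) (\<lambda>m. marked p (m + d) * marked p (m + d')) = (\<Sum>x\<in>X. \<Sum>y\<in>X. mean (\<Prod>P) (\<lambda>m. if p \<in> A x & p \<in> A y then ind (\<Prod>(A x)) (m + d) * ind (\<Prod>(A y)) (m + d') else 0))"
        by (simp only: mean_sum)
      also have "... = ?F p" by (intro sum.cong refl) (auto simp: M_def mean_def)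
      finally show ?thesis ..
    qed
    also have "... <= (if int p dvd d - d' then 16 / real p * exp (15 * s) else 0)"
    proof (cases "int p dvd d - d'")
      case False
      \<comment> \<open>\<open>p\<close> cannot divide both arguments, so one of the two factors is
        0.\<close>
      have "marked p (m + d) * marked p (m + d') <= 0" for m
      proof -
        have "marked p (m + d) = 0 \<or> marked p (m + d') = 0"
          using dvd_disjoint[OF False, of m] marked_le[OF p, of "m + d"] marked_le[OF p, of "m + d'"] mk0[of "m + d"] mk0[of "m + d'"]
          by (auto simp: ind_def split: if_splits)
        thus ?thesis by auto
      qed
      hence "mean (\<Prod>P) (\<lambda>m. marked p (m + d) * marked p (m + d')) <= mean (\<Prod>P) (\<lambda>m. 0)" by (intro mean_mono) auto
      thus ?thesis using False by (simp add: mean_def)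
    next
      case True
      let ?k = "\<lambda>q m. (1 + 3 * ind q (m + d)) * (1 + 3 * ind q (m + d'))"
      have "mean (\<Prod>P) (\<lambda>m. marked p (m + d) * marked p (m + d')) <= mean (\<Prod>P) (\<lambda>m. 16 * (ind p (m + d) * (\<Prod>q\<in>P - {p}. ?k q m)))"
      proof (rule mean_mono)
        fix m
        let ?a = "\<Prod>q\<in>P - {p}. 1 + 3 * ind q (m + d)" and ?b = "\<Prod>q\<in>P - {p}. 1 + 3 * ind q (m + d')"
        have ab: "0 <= ?a" "0 <= ?b" by (auto intro!: prod_nonneg)
        have "marked p (m + d) * marked p (m + d') <= (4 * ind p (m + d) * ?a) * (4 * ind p (m + d') * ?b)"
          using mk0 ab by (intro mult_mono marked_le p) auto
        also have "... <= (4 * ind p (m + d) * ?a) * (4 * 1 * ?b)" using ab by (intro mult_left_mono mult_right_mono) auto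
        finally show "marked p (m + d) * marked p (m + d') <= 16 * (ind p (m + d) * (\<Prod>q\<in>P - {p}. ?k q m))"
          by (simp add: prod.distrib mult_ac)
      qed
      also have "... = 16 * mean (\<Prod>P) (\<lambda>m. ind p (m + d) * (\<Prod>q\<in>P - {p}. ?k q m))" by (rule mean_cmult)
      also have "mean (\<Prod>P) (\<lambda>m. ind p (m + d) * (\<Prod>q\<in>P - {p}. ?k q m)) <= 1 / real p * exp (15 * (\<Sum>q\<in>P. 1 / real q))"
      proof (rule mean_marked_prime[OF p])
        fix q assume q: "q \<in> P"
        hence q0: "q > 0" using primes prime_gt_0_nat by blast
        show "per q (?k q)" by (auto intro!: per_mult per_comp[where h = "\<lambda>x. 1 + 3 * x"] per_ind)
        \<comment> \<open>\<open>15 / 2\<close> per indicator suffices: with both equal to 1 the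
          excess is \<open>4 * 4 - 1 = 15\<close>, with one of them it is 3.\<close>
        have "mean q (?k q) <= mean q (\<lambda>m. 1 + 15 / 2 * (ind q (m + d) + ind q (m + d')))"
          by (intro mean_mono) (auto simp: ind_def)
        also have "... = 1 + 15 / real q" unfolding mean_add mean_cmult using q0 by (simp add: mean_ind)
        finally show "mean q (?k q) <= 1 + 15 / real q" .
      qed auto
      finally show ?thesis using True by (simp add: s_def)
    qed
    finally show "?F p <= (if int p dvd d - d' then 16 / real p * exp (15 * s) else 0)" .
    have "(\<Sum>x\<in>X. if p \<in> A x then 1 / real (\<Prod>(A x)) else 0) = mean (\<Prod>P) (marked p)"
      unfolding mk mean_sum using AP mean_ind_Prod by (intro sum.cong refl) (auto simp: mean_def)
    also have "... <= mean (\<Prod>P) (\<lambda>m. 4 * (ind p (m + 0) * (\<Prod>q\<in>P - {p}. 1 + 3 * ind q m)))"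
      using marked_le[OF p] by (intro mean_mono) (simp add: mult.assoc)
    also have "... = 4 * mean (\<Prod>P) (\<lambda>m. ind p (m + 0) * (\<Prod>q\<in>P - {p}. 1 + 3 * ind q m))" by (rule mean_cmult)
    also have "mean (\<Prod>P) (\<lambda>m. ind p (m + 0) * (\<Prod>q\<in>P - {p}. 1 + 3 * ind q m)) <= 1 / real p * exp (3 * (\<Sum>q\<in>P. 1 / real q))"
    proof (rule mean_marked_prime[OF p])
      fix q assume q: "q \<in> P"
      hence q0: "q > 0" using primes prime_gt_0_nat by blast
      show "per q (\<lambda>m. 1 + 3 * ind q m)" by (auto intro!: per_comp[where h = "\<lambda>x. 1 + 3 * x"] per_ind0)
      show "mean q (\<lambda>m. 1 + 3 * ind q m) <= 1 + 3 / real q"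
        using q0 mean_ind[of q q 0] by (simp add: mean_add mean_cmult)
    qed auto
    finally have "(\<Sum>x\<in>X. if p \<in> A x then 1 / real (\<Prod>(A x)) else 0) <= 4 / real p * exp (3 * s)" by (simp add: s_def)
    hence "?S p <= (4 / real p * exp (3 * s))\<^sup>2"
      by (intro power_mono sum_nonneg) (auto intro: prod_nonneg)
    also have "... = 16 / (real p)\<^sup>2 * exp (6 * s)" by (simp add: power_mult_distrib power_divide exp_double[symmetric] mult.assoc)
    finally show "?S p <= 16 / (real p)\<^sup>2 * exp (6 * s)" .
  qed
  also have "... = (\<Sum>p | p \<in> P & int p dvd d - d'. 16 / real p) * exp (15 * s) + (\<Sum>p\<in>P. 16 / (real p)\<^sup>2) * exp (6 * s)"
    using fin by (auto simp: sum.distrib sum_distrib_right sum.inter_filter intro!: sum.cong)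
  finally show ?thesis using lhs by simp
qed

end

section \<open>Chebyshev's bound and sums over primes\<close>

definition psi :: "nat => real" where
  "psi n = (\<Sum>d=1..n. mangoldt d)"

lemma card_multiples: assumes "d > 0" shows "card {k\<in>{1..n}. d dvd k} = n div (d::nat)"
proof -
  have "{k\<in>{1..n}. d dvd k} = (\<lambda>j. d * j) ` {1..n div d}"
  proof
    show "{k\<in>{1..n}. d dvd k} \<subseteq> (\<lambda>j. d * j) ` {1..n div d}"
    proof
      fix k assume k: "k \<in> {k\<in>{1..n}. d dvd k}"
      then obtain j where j: "k = d * j" by auto
      with k assms have "j \<in> {1..n div d}" by (auto simp: less_eq_div_iff_mult_less_eq mult.commute Suc_le_eq)
      thus "k \<in> (\<lambda>j. d * j) ` {1..n div d}" using j by blast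
    qed
  qed (use assms in \<open>auto simp: less_eq_div_iff_mult_less_eq mult.commute Suc_le_eq\<close>)
  moreover have "inj_on (\<lambda>j. d * j) {1..n div d}" using assms by (auto simp: inj_on_def)
  ultimately show ?thesis by (simp add: card_image)
qed

text \<open>Legendre's formula: each \<open>ln k\<close> is the sum of the von Mangoldt function
  over the divisors of \<open>k\<close>, and the multiples of each divisor are then counted.\<close>

lemma ln_fact_mangoldt: "ln (fact n) = (\<Sum>d=1..n. mangoldt d * real (n div d))"
proof -
  have "ln (fact n) = (\<Sum>k=1..n. ln (real k))"
    unfolding fact_prod of_nat_prod by (rule ln_prod) auto
  also have "... = (\<Sum>k=1..n. \<Sum>d | d dvd k. mangoldt d)"
    by (intro sum.cong refl) (subst mangoldt_sum, auto)
  also have "... = (\<Sum>k=1..n. \<Sum>d=1..n. if d dvd k then mangoldt d else 0)"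
  proof (rule sum.cong[OF refl])
    fix k assume k: "k \<in> {1..n}"
    hence eq: "{d. d dvd k} = {d \<in> {1..n}. d dvd k}" by (auto dest: dvd_imp_le intro: Suc_leI dvd_pos_nat)
    show "(\<Sum>d | d dvd k. mangoldt d) = (\<Sum>d=1..n. if d dvd k then mangoldt d else (0::real))"
      unfolding eq by (rule sum.inter_filter) simp
  qed
  also have "... = (\<Sum>d=1..n. \<Sum>k=1..n. if d dvd k then mangoldt d else 0)" by (rule sum.swap)
  also have "... = (\<Sum>d=1..n. mangoldt d * real (n div d))"
  proof (intro sum.cong refl)
    fix d assume "d \<in> {1..n}"
    hence "card {k\<in>{1..n}. d dvd k} = n div d" by (intro card_multiples) auto
    thus "(\<Sum>k=1..n. if d dvd k then mangoldt d else 0) = mangoldt d * real (n div d)"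
      by (simp flip: sum.inter_filter)
  qed
  finally show ?thesis .
qed

lemma psi_mono: "m <= n ==> psi m <= psi n"
  unfolding psi_def by (intro sum_mono2) (auto simp: mangoldt_nonneg)

lemma psi_nonneg: "0 <= psi n"
  unfolding psi_def by (intro sum_nonneg mangoldt_nonneg)

text \<open>Chebyshev's argument with the central binomial coefficient: in its logarithm the
  coefficient of each von Mangoldt value is nonnegative, and it is at least 1 on the range from
  \<open>n\<close> to \<open>2 * n\<close>.\<close>

lemma psi_double: "psi (2 * n) <= psi n + 2 * real n * ln 2"
proof -
  have c: "real ((2 * n) div d) - 2 * real (n div d) >= (if n < d then 1 else 0)" if "d \<in> {1..2*n}" for d
  proof -
    have "2 * (n div d) <= (2 * n) div d"
      using that by (subst less_eq_div_iff_mult_less_eq) (auto simp: mult.assoc)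
    hence "2 * real (n div d) <= real ((2 * n) div d)" by (metis of_nat_le_iff of_nat_mult of_nat_numeral)
    moreover have "(2 * n) div d >= 1" using that by (auto simp: Suc_le_eq div_greater_zero_iff)
    ultimately show ?thesis by auto
  qed
  have "psi (2 * n) - psi n = (\<Sum>d=1..2*n. mangoldt d * (if n < d then 1 else 0))"
  proof -
    have "{1..2*n} = {1..n} \<union> {n<..2*n}" by auto
    hence "psi (2 * n) = psi n + (\<Sum>d\<in>{n<..2*n}. mangoldt d)"
      unfolding psi_def by (subst sum.union_disjoint[symmetric]) auto
    moreover have "(\<Sum>d=1..2*n. mangoldt d * (if n < d then 1 else 0)) = (\<Sum>d\<in>{n<..2*n}. mangoldt d :: real)"
      by (rule sum.mono_neutral_cong_right) auto
    ultimately show ?thesis by simp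
  qed
  also have "... <= (\<Sum>d=1..2*n. mangoldt d * (real ((2 * n) div d) - 2 * real (n div d)))"
    by (intro sum_mono mult_left_mono c mangoldt_nonneg)
  also have "... = ln (fact (2 * n)) - 2 * (\<Sum>d=1..2*n. mangoldt d * real (n div d))"
    by (simp add: ln_fact_mangoldt right_diff_distrib sum_subtractf sum_distrib_left mult.left_commute)
  also have "(\<Sum>d=1..2*n. mangoldt d * real (n div d)) = ln (fact n)"
    unfolding ln_fact_mangoldt by (rule sum.mono_neutral_right) auto
  also have "ln (fact (2 * n)) - 2 * ln (fact n) = ln (real (2 * n choose n))"
    by (simp add: binomial_fact ln_div ln_mult)
  also have "... <= ln (2 ^ (2 * n))"
  proof (subst ln_le_cancel_iff)
    show "real (2 * n choose n) <= 2 ^ (2 * n)"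
      using binomial_le_pow2[of "2 * n" n] by (metis of_nat_le_iff of_nat_numeral of_nat_power)
  qed auto
  also have "... = 2 * real n * ln 2" by (simp add: ln_realpow)
  finally show ?thesis by simp
qed

lemma psi_le: "psi n <= 4 * real n"
proof (induction n rule: less_induct)
  case (less n)
  have l2: "ln 2 <= (1::real)" using ln_le_minus_one[of 2] by simp
  show ?case
  proof (cases "n <= 1")
    case True
    hence "n = 0 \<or> n = 1" by auto
    thus ?thesis by (auto simp: psi_def)
  next
    case False
    \<comment> \<open>Induction by halving with \<open>m\<close> rounded up. The closing inequality
      \<open>3 * (n + 1) <= 4 * n\<close> needs \<open>n >= 3\<close>, so \<open>n = 2\<close> is
      computed directly.\<close>
    define m where "m = (n + 1) div 2"
    have m: "m < n" "n <= 2 * m" "2 * m <= n + 1" using False by (auto simp: m_def)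
    have "psi n <= psi (2 * m)" using m by (intro psi_mono)
    also have "... <= psi m + 2 * real m * ln 2" by (rule psi_double)
    also have "... <= 4 * real m + 2 * real m * 1" using less[of m] m l2 by (intro add_mono mult_left_mono) auto
    also have "... = 3 * real (2 * m)" by simp
    also have "... <= 3 * real (n + 1)" using m by (intro mult_left_mono of_nat_mono) auto
    also have "... <= 4 * real n" if "n >= 3" using that by simp
    finally show ?thesis
    proof (cases "n = 2")
      case True
      have "psi 2 = mangoldt 1 + mangoldt 2" by (simp add: psi_def numeral_2_eq_2)
      also have "... <= 4 * 2" using l2 by simp
      finally show ?thesis using True by simp
    qed (use False in auto)
  qed
qed

text \<open>Replacing the integer parts in \<open>ln n!\<close> by quotients costs at most
  \<open>psi n\<close>, which is linear in \<open>n\<close>, and \<open>n!\<close> is at most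
  \<open>n ^ n\<close>.\<close>

lemma sum_mangoldt_over: assumes "n > 0" shows "(\<Sum>d=1..n. mangoldt d / real d) <= ln (real n) + 4"
proof -
  have "real n * (\<Sum>d=1..n. mangoldt d / real d) = (\<Sum>d=1..n. mangoldt d * (real n / real d))"
    by (simp add: sum_distrib_left mult.commute)
  also have "... <= (\<Sum>d=1..n. mangoldt d * (real (n div d) + 1))"
  proof (intro sum_mono mult_left_mono mangoldt_nonneg)
    fix d
    show "real n / real d <= real (n div d) + 1" using of_nat_less_iff[of "n" "d * (n div d + 1)", where ?'a = real]
      by (cases "d = 0") (auto simp: field_simps dividend_less_times_div less_imp_le)
  qed
  also have "... = ln (fact n) + psi n" by (simp add: ln_fact_mangoldt psi_def distrib_left sum.distrib)
  also have "... <= real n * ln (real n) + 4 * real n"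
  proof -
    have "ln (fact n) <= ln (real n ^ n)"
      using assms fact_le_power[of n, where ?'a = real] by (subst ln_le_cancel_iff) auto
    thus ?thesis using psi_le[of n] assms by (simp add: ln_realpow)
  qed
  also have "... = real n * (ln (real n) + 4)" by (simp add: algebra_simps)
  finally show ?thesis using assms by simp
qed

lemma sum_ln_over_primes:
  assumes "n > 0" "finite A" "\<And>p. p \<in> A ==> prime p & p <= n" shows "(\<Sum>p\<in>A. ln (real p) / real p) <= ln (real n) + 4"
proof -
  have "(\<Sum>p\<in>A. ln (real p) / real p) = (\<Sum>p\<in>A. mangoldt p / real p)"
    using assms by (intro sum.cong) auto
  also have "... <= (\<Sum>d=1..n. mangoldt d / real d)"
    using assms prime_ge_1_nat by (intro sum_mono2) (auto intro!: divide_nonneg_nonneg mangoldt_nonneg)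
  also have "... <= ln (real n) + 4" by (rule sum_mangoldt_over) fact
  finally show ?thesis .
qed

text \<open>Every term is enlarged by \<open>ln p / ln y >= 1\<close>. The bound remains constant as
  long as \<open>n\<close> is at most a fixed power of \<open>y\<close>.\<close>

lemma sum_inverse_primes_above:
  assumes "y > 1" "n > 0" "finite A" "\<And>p. p \<in> A ==> prime p & y <= real p & p <= n"
  shows "(\<Sum>p\<in>A. 1 / real p) <= (ln (real n) + 4) / ln y"
proof -
  have "(\<Sum>p\<in>A. 1 / real p) <= (\<Sum>p\<in>A. ln (real p) / real p / ln y)"
  proof (rule sum_mono)
    fix p assume "p \<in> A"
    hence p: "y <= real p" using assms by auto
    hence "ln y <= ln (real p)" "0 < ln y" using assms(1) by auto
    thus "1 / real p <= ln (real p) / real p / ln y" using p assms(1) by (simp add: field_simps)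
  qed
  also have "... = (\<Sum>p\<in>A. ln (real p) / real p) / ln y" by (simp add: sum_divide_distrib)
  also have "... <= (ln (real n) + 4) / ln y"
    using assms by (intro divide_right_mono sum_ln_over_primes) auto
  finally show ?thesis .
qed

lemma sum_inverse_primes_block:
  assumes "y >= 2" "finite A" "\<And>p. p \<in> A ==> prime p & y < p & p <= y\<^sup>2"
  shows "(\<Sum>p\<in>A. 1 / real p) <= 8"
proof -
  have "(\<Sum>p\<in>A. 1 / real p) <= (ln (real (y\<^sup>2)) + 4) / ln (real y)"
    using assms by (intro sum_inverse_primes_above) (auto dest: assms(3))
  also have "... = 2 + 4 / ln (real y)" using assms(1) by (simp add: ln_realpow field_simps)
  also have "... <= 2 + 4 / ln 2" using assms(1) by (intro add_left_mono divide_left_mono) auto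
  also have "... <= 8" using ln2_ge_two_thirds by (simp add: field_simps)
  finally show ?thesis .
qed

text \<open>A small power of \<open>n\<close> takes the place of the power of \<open>ln n\<close>
  that Mertens' theorem would give; the bounded range below a threshold goes into
  \<open>C\<close>.\<close>

lemma exp_sum_inverse_primes:
  assumes "c >= 0"
  obtains C where "C >= 1"
    "\<And>n A. n > 0 ==> finite A ==> (\<And>p. p \<in> A ==> prime p & p <= n) ==> exp (c * (\<Sum>p\<in>A. 1 / real p)) <= C * real n powr (1/4)"
proof -
  \<comment> \<open>With this threshold the coefficient \<open>c / ln T\<close> of
    \<open>ln n\<close> equals \<open>c / (4 * c + 1)\<close> and is below
    \<open>1 / 4\<close>.\<close>
  define T where "T = exp (4 * c + 1)"
  have T: "T > 1" "ln T = 4 * c + 1" using assms by (auto simp: T_def)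
  define C where "C = exp (c * T + 1)"
  have C1: "C >= 1" unfolding C_def using assms T by auto
  have "exp (c * (\<Sum>p\<in>A. 1 / real p)) <= C * real n powr (1/4)"
    if n: "n > 0" and A: "finite A" "\<And>p. p \<in> A ==> prime p & p <= n" for n A
  proof -
    have "(\<Sum>p\<in>A. 1 / real p) = (\<Sum>p | p \<in> A & real p < T. 1 / real p) + (\<Sum>p | p \<in> A & T <= real p. 1 / real p)"
      using A(1) by (subst sum.union_disjoint[symmetric]) (auto intro!: sum.cong)
    also have "(\<Sum>p | p \<in> A & real p < T. 1 / real p) <= T"
    proof -
      have sub: "{p. p \<in> A & real p < T} \<subseteq> {1..nat \<lfloor>T\<rfloor>}"
        using A prime_ge_1_nat by (auto simp: le_nat_floor)
      have "(\<Sum>p | p \<in> A & real p < T. 1 / real p) <= (\<Sum>p | p \<in> A & real p < T. 1)"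
        using A prime_ge_1_nat by (intro sum_mono) (auto simp: divide_le_eq_1 Suc_le_eq prime_gt_0_nat)
      also have "... <= real (card {1..nat \<lfloor>T\<rfloor>})" using card_mono[OF _ sub] by simp
      also have "... <= T" using T by (simp add: of_nat_floor)
      finally show ?thesis .
    qed
    also have "(\<Sum>p | p \<in> A & T <= real p. 1 / real p) <= (ln (real n) + 4) / ln T"
      using T n A by (intro sum_inverse_primes_above) auto
    finally have "(\<Sum>p\<in>A. 1 / real p) <= T + (ln (real n) + 4) / ln T" by simp
    hence "c * (\<Sum>p\<in>A. 1 / real p) <= c * (T + (ln (real n) + 4) / ln T)"
      using assms by (rule mult_left_mono)
    also have "... = c * T + (c / (4 * c + 1)) * (ln (real n) + 4)" by (simp add: T algebra_simps)
    also have "... <= c * T + (1/4) * (ln (real n) + 4)"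
      using assms n by (intro add_left_mono mult_right_mono) (auto simp: field_simps)
    also have "... = (c * T + 1) + (1/4) * ln (real n)" by simp
    finally have "exp (c * (\<Sum>p\<in>A. 1 / real p)) <= exp ((c * T + 1) + (1/4) * ln (real n))"
      by (simp only: exp_le_cancel_iff)
    also have "... = C * real n powr (1/4)" using n by (simp add: C_def powr_def exp_add)
    finally show ?thesis .
  qed
  with C1 show thesis using that by blast
qed

section \<open>Bounds for the Selberg sum\<close>

lemma sum_geometric_le:
  assumes "finite K" "0 <= x" "x < (1::real)" "\<And>k. k \<in> K ==> j <= k"
  shows "(\<Sum>k\<in>K. x ^ k) <= x ^ j / (1 - x)"
proof -
  have "(\<Sum>k\<in>K. x ^ k) <= (\<Sum>k\<in>{j..Max (insert j K)}. x ^ k)"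
    using assms by (intro sum_mono2) auto
  also have "... = x ^ j * (\<Sum>k\<le>Max (insert j K) - j. x ^ k)"
    using assms(1) by (intro sum_power_shift) auto
  also have "... <= x ^ j * (1 / (1 - x))"
  proof (intro mult_left_mono)
    have "(\<Sum>k<Suc (Max (insert j K) - j). x ^ k) <= (\<Sum>k. x ^ k)"
      using assms by (intro sum_le_suminf summable_geometric) auto
    thus "(\<Sum>k\<le>Max (insert j K) - j. x ^ k) <= 1 / (1 - x)" using assms by (simp add: suminf_geometric lessThan_Suc_atMost)
  qed (use assms in auto)
  finally show ?thesis by simp
qed

text \<open>A finite Euler product: every prime of \<open>A\<close> contributes a geometric series,
  which starts at exponent 1 instead of 0 for the primes of \<open>S\<close> that must divide
  \<open>n\<close>.\<close>

lemma sum_inverse_smooth_le: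
  assumes "finite A" "\<And>p. p \<in> A ==> prime p" "finite X" "S \<subseteq> A"
    "\<And>n. n \<in> X ==> n > 0 & prime_factors n \<subseteq> A & S \<subseteq> prime_factors n"
  shows "(\<Sum>n\<in>X. 1 / real n) <= (\<Prod>p\<in>A. if p \<in> S then 1 / (real p - 1) else 1 / (1 - 1 / real p))"
  using assms
proof (induction A arbitrary: X S rule: finite_induct)
  case empty
  have "X \<subseteq> {1}"
  proof
    fix n assume "n \<in> X"
    hence "n > 0" "prime_factors n = {}" using empty.prems(4) by auto
    thus "n \<in> {1}" by (simp add: prime_factorization_empty_iff)
  qed
  hence "X = {} \<or> X = {1}" by auto
  thus ?case by auto
next
  case (insert p A)
  have p: "prime p" "p > 1" "p \<notin> A" using insert prime_gt_1_nat by auto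
  define D where "D = (\<Prod>p\<in>A. if p \<in> S - {p} then 1 / (real p - 1) else 1 / (1 - 1 / real p))"
  define Ks where "Ks = multiplicity p ` X"
  \<comment> \<open>The least admissible exponent of \<open>p\<close>; for \<open>j = 1\<close> the
    series sums to \<open>1 / (p - 1)\<close>.\<close>
  define j :: nat where "j = (if p \<in> S then 1 else 0)"
  have finK: "finite Ks" using insert by (simp add: Ks_def)
  \<comment> \<open>Dividing out the exact power of \<open>p\<close> is injective on a fibre of the
    multiplicity and leaves integers composed of primes of \<open>A\<close>, to which the induction
    hypothesis applies.\<close>
  have fib: "(\<Sum>n | n \<in> X & multiplicity p n = k. 1 / real n) <= (1 / real p) ^ k * D'"
    if D': "D' = (\<Prod>q\<in>A. if q \<in> S - {p} then 1 / (real q - 1) else 1 / (1 - 1 / real q))" for k D'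
  proof -
    let ?Xk = "{n \<in> X. multiplicity p n = k}" and ?g = "\<lambda>n. n div p ^ k"
    have dec: "n = p ^ k * ?g n & \<not> p dvd ?g n & ?g n > 0" if "n \<in> ?Xk" for n
    proof -
      have n0: "n > 0" using that insert.prems(4)[of n] by auto
      have "p ^ k dvd n" using that by (auto intro: multiplicity_dvd)
      hence e: "n = p ^ k * ?g n" by simp
      moreover have "\<not> p dvd ?g n"
      proof
        assume "p dvd ?g n"
        hence "p ^ k * p dvd p ^ k * ?g n" by (intro mult_dvd_mono) auto
        hence "p ^ Suc k dvd n" unfolding e[symmetric] by (simp add: mult.commute)
        hence "Suc k <= multiplicity p n" using n0 p by (intro multiplicity_geI) auto
        thus False using that by simp
      qed
      moreover have "?g n ~= 0"
      proof
        assume "?g n = 0"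
        hence "n = p ^ k * 0" using e by (simp only:)
        thus False using n0 by simp
      qed
      ultimately show ?thesis by blast
    qed
    have inj: "inj_on ?g ?Xk"
    proof (rule inj_onI)
      fix x y assume xy: "x \<in> ?Xk" "y \<in> ?Xk" "?g x = ?g y"
      have "x = p ^ k * ?g x" using dec[OF xy(1)] by blast
      also have "... = p ^ k * ?g y" by (simp only: xy(3))
      also have "... = y" using dec[OF xy(2)] by metis
      finally show "x = y" .
    qed
    have "(\<Sum>n\<in>?Xk. 1 / real n) = (\<Sum>n\<in>?Xk. (1 / real p) ^ k * (1 / real (?g n)))"
    proof (intro sum.cong refl)
      fix n assume "n \<in> ?Xk"
      hence "n = p ^ k * ?g n" using dec by blast
      hence "real n = real (p ^ k * ?g n)" by (simp only:)
      hence "real n = real p ^ k * real (?g n)" by (simp only: of_nat_mult of_nat_power)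
      thus "1 / real n = (1 / real p) ^ k * (1 / real (?g n))" by (simp add: power_divide)
    qed
    also have "... = (1 / real p) ^ k * (\<Sum>n\<in>?g ` ?Xk. 1 / real n)"
      by (simp add: sum_distrib_left sum.reindex[OF inj])
    also have "(\<Sum>n\<in>?g ` ?Xk. 1 / real n) <= D'" unfolding D'
    proof (rule insert.IH)
      fix n assume "n \<in> ?g ` ?Xk"
      then obtain n' where n': "n' \<in> ?Xk" "n = ?g n'" by auto
      have e: "n' = p ^ k * n" "\<not> p dvd n" "n > 0" using dec[OF n'(1)] n'(2) by auto
      have pf: "prime_factors n' - {p} \<subseteq> prime_factors n" "prime_factors n \<subseteq> prime_factors n' - {p}"
      proof -
        show "prime_factors n' - {p} \<subseteq> prime_factors n"
        proof
          fix q assume q: "q \<in> prime_factors n' - {p}"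
          hence "prime q" "q dvd p ^ k * n" "q ~= p" using e(1) by auto
          moreover from this have "\<not> q dvd p ^ k" using p(1) primes_dvd_imp_eq[of q p] prime_dvd_power[of q p k] by blast
          ultimately have "q dvd n" using prime_dvd_mult_iff[of q "p ^ k" n] by blast
          thus "q \<in> prime_factors n" using \<open>prime q\<close> e(3) by (simp add: prime_factors_dvd)
        qed
        show "prime_factors n \<subseteq> prime_factors n' - {p}"
          using e p by (auto simp: prime_factors_dvd)
      qed
      have "prime_factors n' \<subseteq> insert p A" "S \<subseteq> prime_factors n'" using n'(1) insert.prems(4) by auto
      thus "n > 0 & prime_factors n \<subseteq> A & S - {p} \<subseteq> prime_factors n" using pf e(3) by blast
    qed (use insert in auto)
    finally show ?thesis by (simp add: mult_left_mono)
  qed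
  define D' where "D' = (\<Prod>q\<in>A. if q \<in> S - {p} then 1 / (real q - 1) else 1 / (1 - 1 / real q))"
  have D'eq: "D' = (\<Prod>q\<in>A. if q \<in> S then 1 / (real q - 1) else 1 / (1 - 1 / real q))"
    unfolding D'_def using p(3) by (intro prod.cong) auto
  have D0: "0 <= D'" unfolding D'_def
    using insert.prems(1) prime_gt_1_nat by (intro prod_nonneg) (auto simp: field_simps prime_gt_0_nat Suc_le_eq)
  have "(\<Sum>n\<in>X. 1 / real n) = (\<Sum>k\<in>Ks. \<Sum>n | n \<in> X & multiplicity p n = k. 1 / real n)"
    unfolding Ks_def using insert.prems(2) by (rule sum.image_gen)
  also have "... <= (\<Sum>k\<in>Ks. (1 / real p) ^ k * D')" using fib[OF D'_def] by (intro sum_mono) simp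
  also have "... = (\<Sum>k\<in>Ks. (1 / real p) ^ k) * D'" by (simp add: sum_distrib_right)
  also have "... <= (1 / real p) ^ j / (1 - 1 / real p) * D'"
  proof (intro mult_right_mono sum_geometric_le finK D0)
    fix k assume "k \<in> Ks"
    then obtain n where n: "n \<in> X" "k = multiplicity p n" by (auto simp: Ks_def)
    show "j <= k"
    proof (cases "p \<in> S")
      case True
      hence "p \<in> prime_factors n" using n insert.prems(4) by blast
      hence "multiplicity p n > 0" by (simp add: prime_factors_multiplicity)
      thus ?thesis using n True by (simp add: j_def)
    qed (simp add: j_def)
  qed (use p in auto)
  also have "(1 / real p) ^ j / (1 - 1 / real p) = (if p \<in> S then 1 / (real p - 1) else 1 / (1 - 1 / real p))"
    using p by (auto simp: j_def field_simps)
  finally show ?case using insert.hyps by (simp add: D'eq)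
qed

context selberg_weights begin

text \<open>The harmonic sum up to \<open>R\<close> is sorted by the primes of \<open>P\<close> that
  divide \<open>n\<close>. The group of \<open>S\<close> is at most \<open>1 / phi S\<close> times
  the Euler product over \<open>T\<close>, because \<open>T\<close> and \<open>P\<close> together
  cover all primes up to \<open>R\<close>. The density of the primes in \<open>T\<close> is thereby
  built into the lower bound.\<close>

lemma G_ge:
  assumes T: "finite T" "\<And>p. p \<in> T ==> prime p" "T \<inter> P = {}"
    and cover: "\<And>p. prime p ==> real p <= R ==> p \<in> T \<union> P"
  shows "(\<Prod>p\<in>T. 1 - 1 / real p) * ln R <= G"
proof -
  define X where "X = {1..nat \<lfloor>R\<rfloor>}"
  define V where "V = (\<Prod>p\<in>T. 1 - 1 / real p)"
  have V0: "V > 0" unfolding V_def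
  proof (rule prod_pos)
    fix p assume "p \<in> T"
    hence "p > 1" using T(2) prime_gt_1_nat by blast
    thus "0 < 1 - 1 / real p" by simp
  qed
  have sp: "prime_factors n \<inter> P \<in> supp" if "n \<in> X" for n
  proof -
    have "real n <= R" "n > 0" using that R unfolding X_def by (auto simp: le_nat_iff le_floor_iff)
    have "\<Prod>(prime_factors n \<inter> P) dvd \<Prod>(prime_factors n)" by (intro prod_dvd_prod_subset) auto
    also have "... dvd n"
    proof -
      have "(\<Prod>p\<in>prime_factors n. p) dvd (\<Prod>p\<in>prime_factors n. p ^ multiplicity p n)"
        by (intro prod_dvd_prod) (auto simp: prime_factors_multiplicity intro!: dvd_power)
      thus ?thesis using \<open>n > 0\<close> prime_factorization_nat[of n] by simp
    qed
    finally have "\<Prod>(prime_factors n \<inter> P) <= n" using \<open>n > 0\<close> by (intro dvd_imp_le)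
    hence "real (\<Prod>(prime_factors n \<inter> P)) <= real n" by (rule of_nat_mono)
    thus ?thesis using \<open>real n <= R\<close> by (simp add: supp_def del: of_nat_prod)
  qed
  have "ln R <= ln (real (nat \<lfloor>R\<rfloor> + 1))" using R by (subst ln_le_cancel_iff) linarith+
  also have "... <= harm (nat \<lfloor>R\<rfloor>)" using ln_le_harm[of "nat \<lfloor>R\<rfloor>"] by (simp add: add.commute)
  also have "... = (\<Sum>n\<in>X. 1 / real n)" by (simp add: harm_def X_def inverse_eq_divide)
  also have "... = (\<Sum>S\<in>(\<lambda>n. prime_factors n \<inter> P) ` X. \<Sum>n | n \<in> X & prime_factors n \<inter> P = S. 1 / real n)"
    by (rule sum.image_gen) (simp add: X_def)
  also have "... <= (\<Sum>S\<in>supp. \<Sum>n | n \<in> X & prime_factors n \<inter> P = S. 1 / real n)"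
    using sp by (intro sum_mono2) (auto intro!: sum_nonneg)
  also have "... <= (\<Sum>S\<in>supp. (1 / V) * (1 / phi S))"
  proof (rule sum_mono)
    fix S assume S: "S \<in> supp"
    have dj: "T \<inter> S = {}" "finite S" using supp_subset[OF S] T(3) supp_finite[OF S] by auto
    have "(\<Sum>n | n \<in> X & prime_factors n \<inter> P = S. 1 / real n)
        <= (\<Prod>p\<in>T \<union> S. if p \<in> S then 1 / (real p - 1) else 1 / (1 - 1 / real p))"
    proof (rule sum_inverse_smooth_le)
      fix n assume n: "n \<in> {n \<in> X. prime_factors n \<inter> P = S}"
      hence n0: "n > 0" "real n <= R" using R by (auto simp: X_def le_nat_iff le_floor_iff)
      have "prime_factors n \<subseteq> T \<union> P"
      proof
        fix p assume p: "p \<in> prime_factors n"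
        hence "prime p" "p <= n" using n0 by (auto intro: dvd_imp_le)
        thus "p \<in> T \<union> P" using cover[of p] n0 by linarith
      qed
      thus "n > 0 & prime_factors n \<subseteq> T \<union> S & S \<subseteq> prime_factors n" using n n0 by auto
    next
      show "prime p" if "p \<in> T \<union> S" for p using that T(2) primes supp_subset[OF S] by blast
    qed (use T dj X_def in auto)
    also have "... = (\<Prod>p\<in>T. 1 / (1 - 1 / real p)) * (\<Prod>p\<in>S. 1 / (real p - 1))"
      using dj T(1) by (subst prod.union_disjoint) (auto intro!: arg_cong2[where f = "(*)"] prod.cong)
    also have "... = (1 / V) * (1 / phi S)" by (simp add: V_def phi_def prod_dividef)
    finally show "(\<Sum>n | n \<in> X & prime_factors n \<inter> P = S. 1 / real n) <= (1 / V) * (1 / phi S)" .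
  qed
  also have "... = G / V" by (simp add: G_def sum_divide_distrib mult.commute)
  finally show ?thesis using V0 unfolding V_def[symmetric] by (simp add: field_simps)
qed

lemma G_le: "G <= exp (2 * (\<Sum>p\<in>P. 1 / real p))"
proof -
  have "G <= (\<Sum>S\<in>Pow P. 1 / phi S)" unfolding G_def
    using fin supp_subset phi_pos by (intro sum_mono2) (auto intro: less_imp_le)
  also have "... = (\<Sum>S\<in>Pow P. \<Prod>p\<in>S. 1 / (real p - 1))" by (simp add: phi_def prod_dividef)
  also have "... = (\<Prod>p\<in>P. 1 + 1 / (real p - 1))" by (rule sum_Pow_prod[OF fin])
  also have "... <= exp (\<Sum>p\<in>P. 1 / (real p - 1))"
  proof (rule prod_one_plus_le_exp)
    fix p assume "p \<in> P"
    hence "p > 1" using primes prime_gt_1_nat by blast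
    thus "0 <= 1 / (real p - 1)" by simp
  qed
  also have "... <= exp (2 * (\<Sum>p\<in>P. 1 / real p))"
    unfolding exp_le_cancel_iff sum_distrib_left
  proof (rule sum_mono)
    fix p assume "p \<in> P"
    hence "p >= 2" using primes prime_ge_2_nat by blast
    thus "1 / (real p - 1) <= 2 * (1 / real p)" by (simp add: field_simps)
  qed
  finally show ?thesis .
qed

end

section \<open>The shifts\<close>

definition sh :: "nat => int" where "sh k = 2 ^ k - int k"

lemma sh_Suc: "sh (Suc k) = sh k + (2 ^ k - 1)"
  by (simp add: sh_def)

lemma sh_mono: "k <= l ==> sh k <= sh l"
proof (induction l rule: dec_induct)
  case (step n)
  have "(1::int) <= 2 ^ n" by simp
  thus ?case using step unfolding sh_Suc by linarith
qed simp

lemma sh_strict_mono: assumes "1 <= k" "k < l" shows "sh k < sh l"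
proof -
  have "(2::int) ^ k >= 2 ^ 1" using assms by (intro power_increasing) auto
  hence "sh k < sh (Suc k)" by (simp add: sh_Suc)
  also have "... <= sh l" using assms by (intro sh_mono) auto
  finally show ?thesis .
qed

lemma sh_pos: "1 <= sh k"
  using sh_mono[of 0 k] by (simp add: sh_def)

lemma sh_le_power: "sh k <= 2 ^ k"
  by (simp add: sh_def)

lemma sh_inj: "1 <= k ==> 1 <= l ==> sh k = sh l ==> k = l"
  using sh_strict_mono[of k l] sh_strict_mono[of l k] by (cases k l rule: linorder_cases) auto

text \<open>The shifts roughly double: \<open>2 * sh (a - 1)\<close> exceeds \<open>sh a\<close> by
  \<open>2 - a\<close>, which is at most 0 here, so the sum with the larger top index is the larger
  one.\<close>

lemma sh_sum_max:
  assumes "a > c" "c >= e" "1 <= b" "1 <= e" shows "sh c + sh e < sh a + sh b"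
proof -
  have "sh c <= sh (a - 1)" "sh e <= sh (a - 1)" using assms by (auto intro!: sh_mono)
  moreover obtain a' where a: "a = Suc a'" using assms by (cases a) auto
  have "2 * sh (a - 1) < sh a + sh b" using sh_pos[of b] assms a by (simp add: sh_def)
  ultimately show ?thesis by simp
qed

text \<open>Bring the two equal differences into the form of equal sums and compare the larger
  indices, then the smaller ones. Later this makes the differences attached to distinct index pairs
  distinct.\<close>

lemma sh_sidon:
  assumes "1 <= k1" "1 <= k2" "1 <= k3" "1 <= k4" "k1 ~= k2" "sh k2 - sh k1 = sh k4 - sh k3"
  shows "k1 = k3 & k2 = k4"
proof -
  have s: "sh k2 + sh k3 = sh k4 + sh k1" using assms by simp
  define a b c e where "a = max k2 k3" "b = min k2 k3" "c = max k4 k1" "e = min k4 k1"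
  note d = this
  have sums: "sh a + sh b = sh c + sh e" using s unfolding d by (simp add: max_def min_def)
  have ord: "b <= a" "e <= c" "1 <= b" "1 <= e" using assms unfolding d by auto
  have ac: "a = c"
  proof (rule ccontr)
    assume "a ~= c"
    then consider "a > c" | "c > a" by linarith
    thus False using sh_sum_max[of c a e b] sh_sum_max[of a c b e] ord sums by cases auto
  qed
  hence "b = e" using sums ord by (intro sh_inj) auto
  with ac have "{k2, k3} = {k4, k1}" unfolding d by (auto simp: max_def min_def split: if_splits)
  thus ?thesis using assms(5) by (auto simp: doubleton_eq_iff)
qed

text \<open>\<open>T\<close> is a common period of the shifts modulo \<open>W\<close> in which every
  class occurs \<open>T / W\<close> times. Periodicity starts at exponent 1, since
  \<open>2 ^ 0\<close> is the only odd power of 2; this is why sums run over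
  \<open>sh (Suc k)\<close>.\<close>

definition equidist :: "nat => nat => bool" where
  "equidist W T \<longleftrightarrow> T > 0 & W > 0 & (\<forall>k\<ge>1. int W dvd sh (k + T) - sh k) \<and>
     (\<forall>a. (\<Sum>k<T. ind W (sh (Suc k) - a)) * real W = real T)"

lemma equidist_1: "equidist 1 1"
  by (simp add: equidist_def ind_def)

lemma equidist_period: assumes "equidist W T" "k >= 1" shows "int W dvd sh (k + j * T) - sh k"
proof (induction j)
  case (Suc j)
  have "int W dvd sh (k + j * T + T) - sh (k + j * T)" using assms by (auto simp: equidist_def)
  from dvd_add[OF this Suc] show ?case by (simp add: algebra_simps)
qed simp

lemma ind_cong: "int q dvd x - y ==> ind q x = ind q y"
  unfolding ind_def using dvd_add_right_iff[of "int q" "x - y" y] by simp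

lemma equidist_sum_multiple:
  assumes "equidist W T" shows "(\<Sum>k<j*T. ind W (sh (Suc k) - a)) * real W = real (j * T)"
proof -
  have "(\<Sum>k<j*T. ind W (sh (Suc k) - a)) = (\<Sum>i<j. \<Sum>k\<in>{i*T..<i*T+T}. ind W (sh (Suc k) - a))"
    by (rule sum.nat_group[symmetric])
  also have "... = (\<Sum>i<j. \<Sum>k<T. ind W (sh (Suc k) - a))"
  proof (rule sum.cong[OF refl])
    fix i
    have "(\<Sum>k\<in>{i*T..<i*T+T}. ind W (sh (Suc k) - a)) = (\<Sum>k<T. ind W (sh (Suc (k + i * T)) - a))"
      using sum.shift_bounds_nat_ivl[of "\<lambda>k. ind W (sh (Suc k) - a)" 0 "i*T" T] by (simp add: lessThan_atLeast0 add.commute)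
    also have "... = (\<Sum>k<T. ind W (sh (Suc k) - a))"
    proof (rule sum.cong[OF refl])
      fix k
      show "ind W (sh (Suc (k + i * T)) - a) = ind W (sh (Suc k) - a)"
        using equidist_period[OF assms, of "Suc k" i] by (intro ind_cong) simp
    qed
    finally show "(\<Sum>k\<in>{i*T..<i*T+T}. ind W (sh (Suc k) - a)) = (\<Sum>k<T. ind W (sh (Suc k) - a))" .
  qed
  also have "... * real W = real j * ((\<Sum>k<T. ind W (sh (Suc k) - a)) * real W)" by simp
  also have "... = real (j * T)" using assms by (simp add: equidist_def)
  finally show ?thesis .
qed

lemma sum_ind_linear:
  assumes "prime p" "\<not> p dvd t" shows "(\<Sum>i<p. ind p (c - int t * int i)) = 1"
proof -
  have p0: "p > 0" using assms prime_gt_0_nat by auto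
  have "coprime (int t) (int p)"
    using assms by (simp add: coprime_commute prime_imp_coprime)
  then obtain x where x: "[int t * x = 1] (mod int p)" using cong_solve_coprime_int by blast
  have tx: "int p dvd int t * x - 1" using x by (simp add: cong_iff_dvd_diff)
  have eq: "ind p (c - int t * int i) = ind p (int i + (- (x * c)))" for i
  proof -
    have "int p dvd c - int t * int i \<longleftrightarrow> int p dvd int i + (- (x * c))"
    proof
      assume "int p dvd c - int t * int i"
      hence "int p dvd (int t * x - 1) * int i + x * (c - int t * int i)" using tx by auto
      hence "int p dvd x * c - int i" by (simp add: algebra_simps)
      thus "int p dvd int i + (- (x * c))" by (metis dvd_minus_iff minus_diff_eq uminus_add_conv_diff add.commute)
    next
      assume "int p dvd int i + (- (x * c))"
      hence "int p dvd - (int t * (int i + (- (x * c)))) - (int t * x - 1) * c"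
        using tx by (intro dvd_diff) auto
      thus "int p dvd c - int t * int i" by (simp add: algebra_simps)
    qed
    thus ?thesis by (simp add: ind_def)
  qed
  have "(\<Sum>i<p. ind p (c - int t * int i)) = (\<Sum>m\<in>{0..<int p}. ind p (m + (- (x * c))))"
    unfolding eq by (rule sum.reindex_bij_witness[where i = nat and j = int]) auto
  also have "... = real p * mean p (\<lambda>m. ind p (m + (- (x * c))))" using p0 by (simp add: mean_def)
  also have "... = 1" using p0 by (simp add: mean_ind del: add_uminus_conv_diff)
  finally show ?thesis .
qed

lemma pow2_period: assumes "prime p" "k >= 1" shows "int p dvd 2 ^ (k + j * (p - 1)) - 2 ^ k"
proof (cases "p = 2")
  case True
  thus ?thesis using assms(2) by (auto intro!: dvd_diff dvd_power)
next
  case False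
  have "\<not> p dvd 2" using False assms primes_dvd_imp_eq[of p 2] two_is_prime_nat by blast
  hence "[2 ^ (p - 1) = 1] (mod p)" using fermat_theorem[OF assms(1), of 2] by simp
  hence "[(2 ^ (p - 1)) ^ j = 1 ^ j] (mod p)" by (rule cong_pow)
  hence "[2 ^ k * (2 ^ (p - 1)) ^ j = 2 ^ k * 1] (mod p)" by (intro cong_mult) auto
  hence "[2 ^ (k + j * (p - 1)) = 2 ^ k] (mod p)" by (simp add: power_add power_mult[symmetric] mult.commute)
  hence "[int (2 ^ (k + j * (p - 1))) = int (2 ^ k)] (mod int p)" by (simp only: cong_int_iff)
  thus ?thesis by (simp add: cong_iff_dvd_diff)
qed

text \<open>A step of \<open>T * (p - 1)\<close> fixes the shifts modulo \<open>W\<close> and, by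
  Fermat, fixes \<open>2 ^ k\<close> modulo \<open>p\<close>, so it moves the shift linearly modulo
  \<open>p\<close>. The slope is prime to \<open>p\<close>; hence \<open>p\<close> consecutive
  blocks meet every class modulo \<open>p\<close> once, jointly with each class modulo
  \<open>W\<close>.\<close>

lemma equidist_step:
  assumes E: "equidist W T" and p: "prime p" "\<not> p dvd T" "coprime W p"
  shows "equidist (W * p) (T * (p - 1) * p)"
proof -
  define T1 where "T1 = T * (p - 1)"
  have p1: "p > 1" using p(1) prime_gt_1_nat by auto
  have T0: "T > 0" "W > 0" using E by (auto simp: equidist_def)
  have nd: "\<not> p dvd T1"
  proof
    assume "p dvd T1"
    hence "p dvd p - 1" using p unfolding T1_def by (simp add: prime_dvd_mult_iff)
    thus False using p1 by (auto dest: dvd_imp_le)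
  qed
  have W1: "int W dvd sh (k + i * T1) - sh k" if "k >= 1" for i k
    using equidist_period[OF E that, of "i * (p - 1)"] by (simp add: T1_def mult_ac)
  have p2: "int p dvd sh (k + i * T1) - (sh k - int T1 * int i)" if "k >= 1" for i k
  proof -
    have "int p dvd 2 ^ (k + (i * T) * (p - 1)) - 2 ^ k" by (rule pow2_period) fact+
    hence "int p dvd 2 ^ (k + i * T1) - 2 ^ k" unfolding T1_def by (simp only: mult.assoc)
    moreover have "sh (k + i * T1) - (sh k - int T1 * int i) = 2 ^ (k + i * T1) - 2 ^ k" by (simp add: sh_def mult.commute)
    ultimately show ?thesis by simp
  qed
  have ind_prod: "ind (W * p) m = ind W m * ind p m" for m
  proof -
    have "coprime (int W) (int p)" using p(3) by simp
    hence "int W * int p dvd m \<longleftrightarrow> int W dvd m & int p dvd m"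
      by (metis divides_mult dvd_mult_left dvd_mult_right)
    thus ?thesis by (simp add: ind_def)
  qed
  show ?thesis unfolding equidist_def T1_def[symmetric]
  proof (intro conjI allI impI)
    show "0 < T1 * p" "0 < W * p" using T0 p1 by (auto simp: T1_def)
  next
    fix k :: nat assume k: "k >= 1"
    have "int W dvd sh (k + T1 * p) - sh k" using W1[OF k, of p] by (simp add: mult.commute)
    moreover have "int p dvd sh (k + T1 * p) - sh k"
    proof -
      have "int p dvd (sh (k + p * T1) - (sh k - int T1 * int p)) - int T1 * int p"
        by (rule dvd_diff[OF p2[OF k]]) simp
      thus ?thesis by (simp add: mult.commute)
    qed
    ultimately show "int (W * p) dvd sh (k + T1 * p) - sh k"
      using p(3) by (simp add: divides_mult)
  next
    fix a
    have "(\<Sum>k<T1 * p. ind (W * p) (sh (Suc k) - a)) = (\<Sum>i<p. \<Sum>k\<in>{i*T1..<i*T1+T1}. ind (W * p) (sh (Suc k) - a))"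
      using sum.nat_group[of "\<lambda>k. ind (W * p) (sh (Suc k) - a)" T1 p] by (simp add: mult.commute)
    also have "... = (\<Sum>i<p. \<Sum>k<T1. ind W (sh (Suc k) - a) * ind p ((sh (Suc k) - a) - int T1 * int i))"
    proof (rule sum.cong[OF refl])
      fix i
      have "(\<Sum>k\<in>{i*T1..<i*T1+T1}. ind (W * p) (sh (Suc k) - a)) = (\<Sum>k<T1. ind (W * p) (sh (Suc (k + i * T1)) - a))"
        using sum.shift_bounds_nat_ivl[of "\<lambda>k. ind (W * p) (sh (Suc k) - a)" 0 "i*T1" T1] by (simp add: lessThan_atLeast0 add.commute)
      also have "... = (\<Sum>k<T1. ind W (sh (Suc k) - a) * ind p ((sh (Suc k) - a) - int T1 * int i))"
      proof (rule sum.cong[OF refl])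
        fix k
        have "ind W (sh (Suc (k + i * T1)) - a) = ind W (sh (Suc k) - a)"
          using W1[of "Suc k" i] by (intro ind_cong) simp
        moreover have "ind p (sh (Suc (k + i * T1)) - a) = ind p ((sh (Suc k) - a) - int T1 * int i)"
          using p2[of "Suc k" i] by (intro ind_cong) (simp add: algebra_simps)
        ultimately show "ind (W * p) (sh (Suc (k + i * T1)) - a) = ind W (sh (Suc k) - a) * ind p ((sh (Suc k) - a) - int T1 * int i)"
          by (simp add: ind_prod)
      qed
      finally show "(\<Sum>k\<in>{i*T1..<i*T1+T1}. ind (W * p) (sh (Suc k) - a)) = (\<Sum>k<T1. ind W (sh (Suc k) - a) * ind p ((sh (Suc k) - a) - int T1 * int i))" .
    qed
    also have "... = (\<Sum>k<T1. ind W (sh (Suc k) - a) * (\<Sum>i<p. ind p ((sh (Suc k) - a) - int T1 * int i)))"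
      by (subst sum.swap) (simp add: sum_distrib_left)
    also have "... = (\<Sum>k<(p - 1) * T. ind W (sh (Suc k) - a))"
      using sum_ind_linear[OF p(1) nd] by (simp add: T1_def mult.commute)
    finally have "(\<Sum>k<T1 * p. ind (W * p) (sh (Suc k) - a)) * real (W * p) = (\<Sum>k<(p - 1) * T. ind W (sh (Suc k) - a)) * real W * real p"
      by simp
    also have "... = real ((p - 1) * T) * real p" by (simp only: equidist_sum_multiple[OF E])
    also have "... = real (T1 * p)" by (simp add: T1_def mult.commute)
    finally show "(\<Sum>k<T1 * p. ind (W * p) (sh (Suc k) - a)) * real (W * p) = real (T1 * p)" .
  qed
qed

text \<open>Primes are adjoined in increasing order. The prime divisors of \<open>T\<close> then
  stay below the next prime, which supplies the hypothesis that \<open>p\<close> does not divide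
  \<open>T\<close> in \<open>equidist_step\<close>.\<close>

lemma equidist_primorial:
  "\<exists>T. equidist (\<Prod>{p. prime p & p <= n}) T & (\<forall>q. prime q --> q dvd T --> q <= n)"
proof (induction n)
  case 0
  have "{p::nat. prime p & p <= 0} = {}" by auto
  thus ?case using equidist_1 by (intro exI[of _ 1]) (simp only:, auto)
next
  case (Suc n)
  then obtain T where T: "equidist (\<Prod>{p. prime p & p <= n}) T" "\<And>q. prime q ==> q dvd T ==> q <= n" by blast
  show ?case
  proof (cases "prime (Suc n)")
    case False
    hence "{p. prime p & p <= Suc n} = {p. prime p & p <= n}" using le_Suc_eq by auto
    thus ?thesis using T by (auto intro!: exI[of _ T] le_SucI)
  next
    case True
    define p where "p = Suc n"
    have p: "prime p" using True by (simp add: p_def)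
    have "{q. prime q & q <= Suc n} = insert p {q. prime q & q <= n}" using True by (auto simp: p_def le_Suc_eq)
    hence W: "\<Prod>{q. prime q & q <= Suc n} = \<Prod>{q. prime q & q <= n} * p" by (simp add: p_def mult.commute)
    have "\<not> p dvd T" using T(2)[OF p] by (auto simp: p_def)
    moreover have "coprime (\<Prod>{q. prime q & q <= n}) p"
    proof (rule prod_coprime_left)
      fix q assume "q \<in> {q. prime q & q <= n}"
      thus "coprime q p" using p by (intro primes_coprime) (auto simp: p_def)
    qed
    ultimately have E: "equidist (\<Prod>{q. prime q & q <= Suc n}) (T * (p - 1) * p)"
      unfolding W using T(1) p by (intro equidist_step)
    have "q <= Suc n" if q: "prime q" "q dvd T * (p - 1) * p" for q
    proof -
      have "q dvd T \<or> q dvd p - 1 \<or> q dvd p" using q by (simp add: prime_dvd_mult_iff)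
      thus ?thesis
      proof (elim disjE)
        assume "q dvd T" thus ?thesis using T(2)[of q] q by simp
      next
        assume "q dvd p - 1"
        moreover have "p - 1 > 0" using prime_gt_1_nat[OF p] by simp
        ultimately have "q <= p - 1" by (intro dvd_imp_le)
        thus ?thesis by (simp add: p_def)
      next
        assume "q dvd p" thus ?thesis using dvd_imp_le[of q p] by (simp add: p_def)
      qed
    qed
    thus ?thesis using E by blast
  qed
qed

lemma equidist_count:
  assumes "equidist W T"
  shows "(\<Sum>k<K. ind W (sh (Suc k) - a)) <= (real K + real T) / real W"
    "(real K - real T) / real W <= (\<Sum>k<K. ind W (sh (Suc k) - a))"
proof -
  have T0: "T > 0" "W > 0" using assms by (auto simp: equidist_def)
  have K: "K <= (K div T + 1) * T" "(K div T) * T <= K"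
    using T0 by (auto simp: dividend_less_times_div less_imp_le mult.commute)
  have "(\<Sum>k<K. ind W (sh (Suc k) - a)) <= (\<Sum>k<(K div T + 1) * T. ind W (sh (Suc k) - a))"
    using K by (intro sum_mono2) auto
  also have "... = real ((K div T + 1) * T) / real W"
    using equidist_sum_multiple[OF assms, of a "K div T + 1"] T0 by (simp add: field_simps)
  also have "... <= (real K + real T) / real W"
  proof (rule divide_right_mono)
    have "real ((K div T + 1) * T) = real (K div T * T) + real T" by (simp add: algebra_simps)
    also have "... <= real K + real T" using K(2) by (intro add_right_mono of_nat_mono)
    finally show "real ((K div T + 1) * T) <= real K + real T" .
  qed simp
  finally show "(\<Sum>k<K. ind W (sh (Suc k) - a)) <= (real K + real T) / real W" .
  have "(real K - real T) / real W <= real ((K div T) * T) / real W"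
  proof (rule divide_right_mono)
    have "real K <= real ((K div T + 1) * T)" using K(1) by (rule of_nat_mono)
    also have "... = real (K div T * T) + real T" by (simp add: algebra_simps)
    finally show "real K - real T <= real ((K div T) * T)" by simp
  qed simp
  also have "... = (\<Sum>k<(K div T) * T. ind W (sh (Suc k) - a))"
    using equidist_sum_multiple[OF assms, of a "K div T"] T0 by (simp add: field_simps)
  also have "... <= (\<Sum>k<K. ind W (sh (Suc k) - a))" using K by (intro sum_mono2) auto
  finally show "(real K - real T) / real W <= (\<Sum>k<K. ind W (sh (Suc k) - a))" .
qed

text \<open>Expand \<open>f\<close> over residue classes and count each class. The error depends on
  the period \<open>T\<close> but not on \<open>K\<close>.\<close>

lemma equidist_average:
  assumes E: "equidist W T" and f: "per W f" "\<And>m. 0 <= f m" "\<And>m. f m <= C"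
  shows "\<bar>(\<Sum>k<K. f (sh (Suc k))) - real K * mean W f\<bar> <= C * real T"
proof -
  have W0: "W > 0" using E by (auto simp: equidist_def)
  have C0: "0 <= C" using f(2,3)[of 0] by linarith
  have exp: "f m = (\<Sum>a\<in>{0..<int W}. f a * ind W (m - a))" for m
  proof -
    have "f a * ind W (m - a) = (if a = m mod int W then f m else 0)" if "a \<in> {0..<int W}" for a
    proof (cases "a = m mod int W")
      case True
      hence "ind W (m - a) = 1" by (simp add: ind_def)
      thus ?thesis using True f(1) by (simp add: per_def)
    next
      case False
      hence "\<not> int W dvd m - a" using that by (metis atLeastLessThan_iff mod_eq_dvd_iff mod_pos_pos_trivial)
      thus ?thesis using False by (simp add: ind_def)
    qed
    hence "(\<Sum>a\<in>{0..<int W}. f a * ind W (m - a)) = (\<Sum>a\<in>{0..<int W}. if a = m mod int W then f m else 0)"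
      by (intro sum.cong) auto
    also have "... = f m" using W0 by simp
    finally show ?thesis ..
  qed
  have "(\<Sum>k<K. f (sh (Suc k))) = (\<Sum>a\<in>{0..<int W}. f a * (\<Sum>k<K. ind W (sh (Suc k) - a)))"
    by (subst exp) (subst sum.swap, simp add: sum_distrib_left)
  moreover have "real K * mean W f = (\<Sum>a\<in>{0..<int W}. f a * (real K / real W))"
    unfolding mean_def sum_distrib_right[symmetric] by simp
  ultimately have "(\<Sum>k<K. f (sh (Suc k))) - real K * mean W f = (\<Sum>a\<in>{0..<int W}. f a * ((\<Sum>k<K. ind W (sh (Suc k) - a)) - real K / real W))"
    by (simp add: sum_subtractf right_diff_distrib)
  also have "\<bar>...\<bar> <= (\<Sum>a\<in>{0..<int W}. \<bar>f a * ((\<Sum>k<K. ind W (sh (Suc k) - a)) - real K / real W)\<bar>)"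
    by (rule sum_abs)
  also have "... <= (\<Sum>a\<in>{0..<int W}. C * (real T / real W))"
  proof (rule sum_mono)
    fix a
    have "\<bar>(\<Sum>k<K. ind W (sh (Suc k) - a)) - real K / real W\<bar> <= real T / real W"
      using equidist_count[OF E, where a = a and K = K] by (simp add: add_divide_distrib diff_divide_distrib abs_le_iff)
    thus "\<bar>f a * ((\<Sum>k<K. ind W (sh (Suc k) - a)) - real K / real W)\<bar> <= C * (real T / real W)"
      unfolding abs_mult using f(2,3)[of a] C0 by (intro mult_mono) auto
  qed
  also have "... = C * real T" using W0 by simp
  finally show ?thesis .
qed

section \<open>Divisibility of shifts by a single prime\<close>

lemma count_small_prime:
  assumes "prime p" "p * p <= K"
  shows "(\<Sum>k<K. ind p (sh (Suc k) - c)) <= 2 * real K / real p"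
proof -
  have "equidist (1 * p) (1 * (p - 1) * p)"
    using assms prime_gt_1_nat[of p] by (intro equidist_step equidist_1) auto
  hence "(\<Sum>k<K. ind p (sh (Suc k) - c)) <= (real K + real ((p - 1) * p)) / real p"
    using equidist_count(1)[of p "(p - 1) * p" c K] by simp
  also have "real ((p - 1) * p) <= real K"
    using assms(2) by (intro of_nat_mono) (metis diff_le_self le_trans mult_le_mono1)
  finally show ?thesis by (simp add: divide_right_mono)
qed

lemma ratio_strict: assumes "1 <= h" "h < h'" shows "int h' * (2 ^ h - 1) < int h * (2 ^ h' - 1)"
proof -
  define g where "g = (\<lambda>n. (2 ^ Suc n - 1) / real (Suc n))"
  have "strict_mono g" unfolding strict_mono_Suc_iff
  proof
    fix n
    have "(real n + 2) * (2 * 2 ^ n - 1) < (real n + 1) * (4 * 2 ^ n - 1)"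
      by (simp add: algebra_simps add_strict_increasing)
    thus "g n < g (Suc n)" by (simp add: g_def field_simps)
  qed
  hence "g (h - 1) < g (h' - 1)" using assms by (simp add: strict_mono_less)
  moreover have "Suc (h - 1) = h" "Suc (h' - 1) = h'" using assms by auto
  ultimately have "(2 ^ h - 1) / real h < (2 ^ h' - 1) / real h'" unfolding g_def by metis
  hence "real h' * (2 ^ h - 1) < real h * (2 ^ h' - 1)" using assms by (simp add: field_simps)
  hence "real_of_int (int h' * (2 ^ h - 1)) < real_of_int (int h * (2 ^ h' - 1))" by simp
  thus ?thesis by (simp only: of_int_less_iff)
qed

text \<open>Three hits in a window would give two congruences linear in the same power of 2.
  Eliminating it leaves \<open>h * (2 ^ h' - 1) - h' * (2 ^ h - 1)\<close> as a multiple of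
  \<open>p\<close>. This integer is positive by \<open>ratio_strict\<close> and smaller than
  \<open>l * 2 ^ l\<close>, a contradiction.\<close>

lemma count_window:
  assumes p: "prime p" "p ~= 2" and l: "l * 2 ^ l <= p"
  shows "card {k \<in> {u..<u+l}. int p dvd sh (Suc k) - c} <= 2"
proof (rule ccontr)
  define S where "S = {k \<in> {u..<u+l}. int p dvd sh (Suc k) - c}"
  assume "\<not> card {k \<in> {u..<u+l}. int p dvd sh (Suc k) - c} <= 2"
  hence c3: "card S >= 3" by (simp add: S_def)
  have fS: "finite S" by (simp add: S_def)
  have ne: "S ~= {}" using c3 by auto
  have "card (S - {Min S, Max S}) >= 1" using c3 card_Diff_subset[of "{Min S, Max S}" S] fS ne
    card_insert_le_m1[of 2 "{Max S}" "Min S"] by (simp add: card_insert_if)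
  then obtain k1 where k1: "k1 \<in> S" "k1 ~= Min S" "k1 ~= Max S" by (metis Diff_iff card.empty ex_in_conv insertCI not_one_le_zero)
  define k0 k2 where "k0 = Min S" "k2 = Max S"
  have k: "k0 \<in> S" "k2 \<in> S" "k0 < k1" "k1 < k2" using k1 fS ne by (auto simp: k0_k2_def le_neq_implies_less)
  define h h' where "h = k1 - k0" "h' = k2 - k0"
  have h: "1 <= h" "h < h'" "h' < l" "k1 = k0 + h" "k2 = k0 + h'" using k by (auto simp: h_h'_def S_def)
  have dv: "int p dvd 2 ^ Suc k0 * (2 ^ j - 1) - int j" if "k0 + j \<in> S" for j
  proof -
    have "int p dvd sh (Suc (k0 + j)) - c" "int p dvd sh (Suc k0) - c" using that k(1) by (auto simp: S_def)
    hence "int p dvd (sh (Suc (k0 + j)) - c) - (sh (Suc k0) - c)" by (rule dvd_diff)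
    thus ?thesis by (simp add: sh_def power_add algebra_simps)
  qed
  have d1: "int p dvd 2 ^ Suc k0 * (2 ^ h - 1) - int h" using dv[of h] k1(1) h by simp
  have d2: "int p dvd 2 ^ Suc k0 * (2 ^ h' - 1) - int h'" using dv[of h'] k(2) h by simp
  \<comment> \<open>The combination in which the terms free of the power of 2 cancel.\<close>
  have "int p dvd int h * (2 ^ Suc k0 * (2 ^ h' - 1) - int h') - int h' * (2 ^ Suc k0 * (2 ^ h - 1) - int h)"
    using d1 d2 by (intro dvd_diff) auto
  hence "int p dvd 2 ^ Suc k0 * (int h * (2 ^ h' - 1) - int h' * (2 ^ h - 1))"
    by (simp only: right_diff_distrib mult.left_commute mult.commute[of "int h'" "int h"]) (simp add: algebra_simps)
  moreover have "\<not> int p dvd 2 ^ Suc k0"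
  proof
    assume "int p dvd 2 ^ Suc k0"
    hence "p dvd 2 ^ Suc k0" using int_dvd_int_iff[of p "2 ^ Suc k0"] by simp
    hence "p dvd 2" using p(1) prime_dvd_power by blast
    thus False using p primes_dvd_imp_eq two_is_prime_nat by blast
  qed
  moreover have "prime (int p)" using p by simp
  ultimately have "int p dvd int h * (2 ^ h' - 1) - int h' * (2 ^ h - 1)" using prime_dvd_mult_iff by blast
  moreover have pos: "0 < int h * (2 ^ h' - 1) - int h' * (2 ^ h - 1)" using ratio_strict[OF h(1,2)] by simp
  ultimately have "int p <= int h * (2 ^ h' - 1) - int h' * (2 ^ h - 1)" by (intro zdvd_imp_le)
  also have "... <= int h * (2 ^ h' - 1)" by simp
  also have "... < int l * 2 ^ l"
  proof -
    have "int h * (2 ^ h' - 1) <= int l * (2 ^ h' - 1)" using h by (intro mult_right_mono) auto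
    also have "... < int l * 2 ^ l"
    proof (rule mult_strict_left_mono)
      have "(2::int) ^ h' <= 2 ^ l" using h by (intro power_increasing) auto
      thus "(2::int) ^ h' - 1 < 2 ^ l" by linarith
    qed (use h in auto)
    finally show ?thesis .
  qed
  also have "... = int (l * 2 ^ l)" by simp
  also have "... <= int p" using l by (simp only: of_nat_le_iff)
  finally show False by simp
qed

lemma count_windows:
  assumes p: "prime p" "p ~= 2" and l: "l >= 1" "l * 2 ^ l <= p"
  shows "(\<Sum>k<K. ind p (sh (Suc k) - c)) <= 2 * (real K / real l + 1)"
proof -
  have "(\<Sum>k<K. ind p (sh (Suc k) - c)) <= (\<Sum>k<(K div l + 1) * l. ind p (sh (Suc k) - c))"
    using l(1) by (intro sum_mono2) (auto simp: dividend_less_times_div less_imp_le mult.commute)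
  also have "... = (\<Sum>i<K div l + 1. \<Sum>k\<in>{i*l..<i*l+l}. ind p (sh (Suc k) - c))"
    by (rule sum.nat_group[symmetric])
  also have "... <= (\<Sum>i<K div l + 1. 2)"
  proof (rule sum_mono)
    fix i
    have "(\<Sum>k\<in>{i*l..<i*l+l}. ind p (sh (Suc k) - c)) = real (card {k \<in> {i*l..<i*l+l}. int p dvd sh (Suc k) - c})"
      unfolding ind_def by (subst sum.inter_filter[symmetric]) auto
    also have "... <= real 2" by (intro of_nat_mono count_window p l)
    finally show "(\<Sum>k\<in>{i*l..<i*l+l}. ind p (sh (Suc k) - c)) <= 2" by simp
  qed
  also have "... = 2 * (real (K div l) + 1)" by simp
  also have "... <= 2 * (real K / real l + 1)"
    using of_nat_div_le_of_nat[of K l, where ?'a = real] by (intro mult_left_mono add_right_mono) auto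
  finally show ?thesis .
qed

section \<open>Averages of the correction factors at primes dividing a difference\<close>

text \<open>The factor by which the local densities at the primes of \<open>A\<close> exceed their
  generic value, in the form of the corrections \<open>1 + 7 / p\<close> above; \<open>c\<close> is
  flexible so that powers of the factor can be absorbed.\<close>

definition tau :: "real => nat set => int => real" where
  "tau c A m = (\<Prod>p\<in>A. 1 + c / real p * ind p m)"

lemma tau_eq: "finite A ==> tau c A m = (\<Prod>p | p \<in> A & int p dvd m. 1 + c / real p)"
  unfolding tau_def by (rule prod.mono_neutral_cong_right) (auto simp: ind_def)

lemma tau_ge_1: "0 <= c ==> 1 <= tau c A m"
  unfolding tau_def by (intro prod_ge_1) auto

lemma tau_Un: "finite A ==> finite B ==> A \<inter> B = {} ==> tau c (A \<union> B) m = tau c A m * tau c B m"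
  unfolding tau_def by (rule prod.union_disjoint)

text \<open>Multiplying the primes in increasing order, each one adds its own share times the
  product over the smaller primes.\<close>

lemma prod_telescope_le:
  assumes "finite S" "finite A" "S \<subseteq> A" "0 <= c"
  shows "(\<Prod>p\<in>S. 1 + c / real p) - 1 <= (\<Sum>p\<in>S. c / real p * (\<Prod>q | q \<in> A & q < p. 1 + c / real (q::nat)))"
  using assms(1,3)
proof (induction S rule: finite_linorder_max_induct)
  case (insert b S)
  have "(\<Prod>p\<in>S. 1 + c / real p) <= (\<Prod>q | q \<in> A & q < b. 1 + c / real q)"
    using insert assms by (intro prod_mono2) auto
  hence "c / real b * (\<Prod>p\<in>S. 1 + c / real p) <= c / real b * (\<Prod>q | q \<in> A & q < b. 1 + c / real q)"
    using assms(4) by (intro mult_left_mono) auto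
  moreover have "b \<notin> S" using insert by auto
  ultimately show ?case using insert by (simp add: algebra_simps)
qed simp

lemma sum_powr_tail:
  obtains D where "D >= 0"
    "\<And>w A. w >= 1 ==> finite A ==> (\<And>n. n \<in> A ==> w < n) ==> (\<Sum>n\<in>A. real n powr (-7/4)) <= D / sqrt (real w)"
proof -
  define D where "D = (\<Sum>n. real n powr (-5/4))"
  have sm: "summable (\<lambda>n. real n powr (-5/4))" by (subst summable_real_powr_iff) auto
  have D0: "D >= 0" unfolding D_def by (intro suminf_nonneg sm) auto
  have "(\<Sum>n\<in>A. real n powr (-7/4)) <= D / sqrt (real w)" if "w >= 1" "finite A" "\<And>n. n \<in> A ==> w < n" for w A
  proof -
    have "(\<Sum>n\<in>A. real n powr (-7/4)) <= (\<Sum>n\<in>A. real n powr (-5/4) * (1 / sqrt (real w)))"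
    proof (rule sum_mono)
      fix n assume "n \<in> A"
      hence n: "real w <= real n" "0 < real w" using that(1) that(3)[of n] by auto
      have "real n powr (-7/4) = real n powr (-5/4) * real n powr (-1/2)" by (simp flip: powr_add)
      also have "real n powr (-1/2) = 1 / sqrt (real n)" using n by (simp add: powr_minus_divide powr_half_sqrt)
      also have "... <= 1 / sqrt (real w)" using n by (intro divide_left_mono) auto
      finally show "real n powr (-7/4) <= real n powr (-5/4) * (1 / sqrt (real w))" by (simp add: mult_left_mono)
    qed
    also have "... = (\<Sum>n\<in>A. real n powr (-5/4)) * (1 / sqrt (real w))" by (rule sum_distrib_right[symmetric])
    also have "... <= D * (1 / sqrt (real w))"
      unfolding D_def using that(2) sm by (intro mult_right_mono sum_le_suminf) auto
    finally show ?thesis by simp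
  qed
  with D0 show thesis using that by blast
qed

text \<open>For \<open>p * p <= K\<close> the shifts hit a class modulo \<open>p\<close> at most
  \<open>2 * K / p\<close> times. With a factor \<open>p powr (1/4)\<close> lost to smaller primes,
  a convergent sum of \<open>p powr (-7/4)\<close> over \<open>p > w\<close> is left.\<close>

lemma tau_small_average:
  assumes c: "c >= 0"
  obtains D where "D >= 0" "\<And>w K A c0. w >= 1 ==> finite A ==> (\<And>p. p \<in> A ==> prime p & w < p & p * p <= K)
     ==> (\<Sum>k<K. tau c A (sh (Suc k) - c0) - 1) <= real K * D / sqrt (real w)"
proof -
  obtain C where C: "C >= 1" "\<And>n A. n > 0 ==> finite A ==> (\<And>p. p \<in> A ==> prime p & p <= n) ==> exp (c * (\<Sum>p\<in>A. 1 / real p)) <= C * real n powr (1/4)"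
    using exp_sum_inverse_primes[OF c] by metis
  obtain D1 where D1: "D1 >= 0" "\<And>w A. w >= 1 ==> finite A ==> (\<And>n. n \<in> A ==> w < n) ==> (\<Sum>n\<in>A. real n powr (-7/4)) <= D1 / sqrt (real w)"
    using sum_powr_tail by metis
  define D where "D = 2 * c * C * D1"
  have D0: "D >= 0" using c C D1 by (simp add: D_def)
  have "(\<Sum>k<K. tau c A (sh (Suc k) - c0) - 1) <= real K * D / sqrt (real w)"
    if w: "w >= 1" and A: "finite A" "\<And>p. p \<in> A ==> prime p & w < p & p * p <= K" for w K A c0
  proof -
    have pt: "tau c A m - 1 <= (\<Sum>p\<in>A. c * C * real p powr (-3/4) * ind p m)" for m
    proof -
      have "tau c A m - 1 <= (\<Sum>p | p \<in> A & int p dvd m. c / real p * (\<Prod>q | q \<in> A & q < p. 1 + c / real q))"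
        unfolding tau_eq[OF A(1)] using A c by (intro prod_telescope_le) auto
      also have "... <= (\<Sum>p | p \<in> A & int p dvd m. c * C * real p powr (-3/4))"
      proof (rule sum_mono)
        fix p assume p: "p \<in> {p \<in> A. int p dvd m}"
        hence p0: "p > 0" using A(2) prime_gt_0_nat by auto
        have "(\<Prod>q | q \<in> A & q < p. 1 + c / real q) <= exp (\<Sum>q | q \<in> A & q < p. c / real q)"
          using c by (intro prod_one_plus_le_exp) auto
        also have "... = exp (c * (\<Sum>q | q \<in> A & q < p. 1 / real q))" by (simp add: sum_distrib_left)
        also have "... <= C * real p powr (1/4)" using A p0 by (intro C(2)) auto
        finally have "c / real p * (\<Prod>q | q \<in> A & q < p. 1 + c / real q) <= c / real p * (C * real p powr (1/4))"
          using c by (intro mult_left_mono) auto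
        also have "... = c * C * (real p powr (-1) * real p powr (1/4))" using p0 by (simp only: powr_minus_divide powr_one) simp
        also have "real p powr (-1) * real p powr (1/4) = real p powr (-3/4)"
          using powr_add[of "real p" "-1" "1/4"] by simp
        finally show "c / real p * (\<Prod>q | q \<in> A & q < p. 1 + c / real q) <= c * C * real p powr (-3/4)" .
      qed
      also have "... = (\<Sum>p\<in>A. c * C * real p powr (-3/4) * ind p m)"
        using A(1) by (intro sum.mono_neutral_cong_left) (auto simp: ind_def)
      finally show ?thesis .
    qed
    have "(\<Sum>k<K. tau c A (sh (Suc k) - c0) - 1) <= (\<Sum>k<K. \<Sum>p\<in>A. c * C * real p powr (-3/4) * ind p (sh (Suc k) - c0))"
      by (intro sum_mono pt)
    also have "... = (\<Sum>p\<in>A. c * C * real p powr (-3/4) * (\<Sum>k<K. ind p (sh (Suc k) - c0)))"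
      by (subst sum.swap) (simp add: sum_distrib_left)
    also have "... <= (\<Sum>p\<in>A. c * C * real p powr (-3/4) * (2 * real K / real p))"
      using A c C by (intro sum_mono mult_left_mono count_small_prime) auto
    also have "... = (\<Sum>p\<in>A. 2 * c * C * real K * real p powr (-7/4))"
    proof (rule sum.cong[OF refl])
      fix p assume "p \<in> A"
      hence "p > 0" using A(2) prime_gt_0_nat by auto
      hence "1 / real p = real p powr (-1)" by (simp add: powr_minus_divide)
      hence eq: "real p powr (-3/4) * (1 / real p) = real p powr (-7/4)"
        using powr_add[of "real p" "-3/4" "-1"] by simp
      show "c * C * real p powr (-3/4) * (2 * real K / real p) = 2 * c * C * real K * real p powr (-7/4)"
        unfolding eq[symmetric] by simp
    qed
    also have "... = 2 * c * C * real K * (\<Sum>p\<in>A. real p powr (-7/4))" by (simp add: sum_distrib_left)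
    also have "... <= 2 * c * C * real K * (D1 / sqrt (real w))"
      using A w c C by (intro mult_left_mono D1(2)) auto
    finally show ?thesis by (simp add: D_def mult_ac)
  qed
  from that[OF D0 this] show thesis .
qed

text \<open>For \<open>p\<close> between the square root and the square of \<open>K\<close> the
  count of hits comes from windows of length \<open>l\<close> instead of equidistribution. Over this
  range the reciprocals of the primes have a bounded sum, so the gain \<open>1 / l\<close> is
  enough.\<close>

lemma tau_mid_average:
  assumes c: "c >= 0" and K: "K >= 3" and l: "l >= 1" "real (l * 2 ^ l) <= sqrt (real K)"
    and A: "finite A" "\<And>p. p \<in> A ==> prime p & K < p * p & p <= K\<^sup>2"
  shows "(\<Sum>k<K. tau c A (sh (Suc k) - c0) - 1) <= 32 * c * exp (16 * c) * (real K / real l + 1)"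
proof -
  have big: "sqrt (real K) <= real p" if "p \<in> A" for p
  proof -
    have "real K <= real (p * p)" using A(2)[OF that] by (intro of_nat_mono) auto
    hence "sqrt (real K) <= sqrt (real p * real p)" by (intro real_sqrt_le_mono) simp
    thus ?thesis by simp
  qed
  have l3: "1 <= ln (real K)"
  proof -
    have "exp 1 <= (3::real)" using exp_le by simp
    also have "... <= real K" using K by simp
    finally show ?thesis using K by (simp add: ln_ge_iff)
  qed
  have s16: "(\<Sum>p\<in>A. 1 / real p) <= 16"
  proof -
    have "(\<Sum>p\<in>A. 1 / real p) <= (ln (real (K\<^sup>2)) + 4) / ln (sqrt (real K))"
      using K A big by (intro sum_inverse_primes_above) auto
    also have "... = (2 * ln (real K) + 4) / (ln (real K) / 2)" using K by (simp add: ln_sqrt ln_realpow)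
    also have "... <= 16" using l3 by (simp add: field_simps)
    finally show ?thesis .
  qed
  have pt: "tau c A m - 1 <= c * exp (16 * c) * (\<Sum>p\<in>A. 1 / real p * ind p m)" for m
  proof -
    define y where "y = c * (\<Sum>p\<in>A. 1 / real p * ind p m)"
    have y0: "0 <= y" unfolding y_def using c by (intro mult_nonneg_nonneg sum_nonneg) auto
    have "(\<Sum>p\<in>A. 1 / real p * ind p m) <= (\<Sum>p\<in>A. 1 / real p)" by (intro sum_mono mult_left_le) auto
    hence y1: "y <= 16 * c" unfolding y_def using s16 c mult_left_mono[of "\<Sum>p\<in>A. 1 / real p * ind p m" 16 c] by simp
    have "tau c A m <= exp (\<Sum>p\<in>A. c / real p * ind p m)" unfolding tau_def using c by (intro prod_one_plus_le_exp) auto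
    also have "(\<Sum>p\<in>A. c / real p * ind p m) = y" by (simp add: y_def sum_distrib_left)
    finally have "tau c A m - 1 <= exp y - 1" by simp
    also have "... <= y * exp y"
    proof -
      have "1 - y <= exp (- y)" using exp_ge_add_one_self[of "-y"] by simp
      hence "(1 - y) * exp y <= exp (- y) * exp y" by (intro mult_right_mono) auto
      thus ?thesis by (simp add: algebra_simps flip: exp_add)
    qed
    also have "... <= y * exp (16 * c)" using y0 y1 by (intro mult_left_mono) auto
    finally show ?thesis by (simp add: y_def mult_ac)
  qed
  have "(\<Sum>k<K. tau c A (sh (Suc k) - c0) - 1) <= (\<Sum>k<K. c * exp (16 * c) * (\<Sum>p\<in>A. 1 / real p * ind p (sh (Suc k) - c0)))"
    by (intro sum_mono pt)
  also have "... = c * exp (16 * c) * (\<Sum>p\<in>A. 1 / real p * (\<Sum>k<K. ind p (sh (Suc k) - c0)))"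
    unfolding sum_distrib_left[symmetric] by (subst sum.swap) (simp only: sum_distrib_left)
  also have "... <= c * exp (16 * c) * (\<Sum>p\<in>A. 1 / real p * (2 * (real K / real l + 1)))"
  proof (intro mult_left_mono sum_mono count_windows)
    fix p assume p: "p \<in> A"
    show "prime p" using A p by auto
    have "real (l * 2 ^ l) <= real p" using l(2) big[OF p] by linarith
    thus lp: "l * 2 ^ l <= p" by (simp only: of_nat_le_iff)
    \<comment> \<open>\<open>p = 2\<close> would force \<open>K = 3\<close>, which leaves no room
      for \<open>l >= 1\<close> under the bound on \<open>l * 2 ^ l\<close>.\<close>
    show "p ~= 2"
    proof
      assume "p = 2"
      hence "K < 4" using A(2)[OF p] by simp
      hence "K = 3" using K by simp
      hence "real (l * 2 ^ l) <= sqrt 3" using l(2) by simp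
      also have "... < sqrt 4" by (rule real_sqrt_less_mono) simp
      finally have "real (l * 2 ^ l) < real 2" by simp
      hence "l * 2 ^ l < 2" by (simp only: of_nat_less_iff)
      moreover have "2 ^ 1 <= (2::nat) ^ l" using l(1) by (intro power_increasing) auto
      ultimately show False using l(1) mult_le_mono[of 1 l 2 "2 ^ l"] by simp
    qed
  qed (use c l in auto)
  also have "... = c * exp (16 * c) * (2 * (real K / real l + 1)) * (\<Sum>p\<in>A. 1 / real p)"
    by (simp add: sum_distrib_right sum_distrib_left mult_ac)
  also have "... <= c * exp (16 * c) * (2 * (real K / real l + 1)) * 16"
    using s16 c by (intro mult_left_mono) auto
  finally show ?thesis by (simp add: algebra_simps)
qed

lemma card_prime_divisors_le:
  assumes "finite A" "\<And>p. p \<in> A ==> prime p & int p dvd m" "m ~= 0" "\<bar>m\<bar> <= 2 ^ n"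
  shows "card A <= n"
proof -
  have "ind (\<Prod>A) m = 1"
    using prod_ind_primes[of A m] prod_ind_subset[of A m] assms by auto
  hence "int (\<Prod>A) dvd m" by (simp add: ind_def split: if_splits)
  hence "int (\<Prod>A) <= \<bar>m\<bar>" using assms(3) by (intro zdvd_imp_le) auto
  also have "... <= 2 ^ n" by fact
  finally have "\<Prod>A <= 2 ^ n" by (metis of_nat_le_iff of_nat_numeral of_nat_power)
  moreover have "(\<Prod>p\<in>A. 2) <= \<Prod>A" using assms(2) prime_ge_2_nat by (intro prod_mono) auto
  ultimately have "(2::nat) ^ card A <= 2 ^ n" by (metis le_trans prod_constant)
  thus ?thesis by (simp add: power_le_imp_le_exp)
qed

text \<open>A nonzero integer of size at most \<open>2 ^ n\<close> has at most \<open>n\<close>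
  prime divisors, and each of those beyond the square of \<open>K\<close> contributes at most
  \<open>c / (real K)\<^sup>2\<close> to the exponent.\<close>

lemma tau_large_le:
  assumes "c >= 0" "finite A" "\<And>p. p \<in> A ==> prime p & K\<^sup>2 < p" "m ~= 0" "\<bar>m\<bar> <= 2 ^ n" "K > 0"
  shows "tau c A m <= exp (c * real n / (real K)\<^sup>2)"
proof -
  let ?B = "{p \<in> A. int p dvd m}"
  have "tau c A m <= exp (\<Sum>p\<in>?B. c / real p)"
    unfolding tau_eq[OF assms(2)] using assms(1) by (intro prod_one_plus_le_exp) auto
  also have "(\<Sum>p\<in>?B. c / real p) <= (\<Sum>p\<in>?B. c / (real K)\<^sup>2)"
  proof (rule sum_mono)
    fix p assume "p \<in> ?B"
    hence "real (K\<^sup>2) <= real p" using assms(3)[of p] by (intro of_nat_mono) auto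
    hence "(real K)\<^sup>2 <= real p" by simp
    moreover have "0 < (real K)\<^sup>2" using assms(6) by simp
    ultimately show "c / real p <= c / (real K)\<^sup>2" using assms(1) by (intro divide_left_mono mult_pos_pos) linarith+
  qed
  also have "... = real (card ?B) * (c / (real K)\<^sup>2)" by simp
  also have "... <= real n * (c / (real K)\<^sup>2)"
    using assms by (intro mult_right_mono of_nat_mono card_prime_divisors_le[of _ m]) auto
  finally show ?thesis by (simp add: mult.commute)
qed

lemma tau_square_le: assumes "c >= 0" shows "(tau c A m)\<^sup>2 <= tau (2 * c + c\<^sup>2) A m"
proof -
  have "(tau c A m)\<^sup>2 = (\<Prod>p\<in>A. (1 + c / real p * ind p m)\<^sup>2)" by (simp add: tau_def prod_power_distrib)
  also have "... <= (\<Prod>p\<in>A. 1 + (2 * c + c\<^sup>2) / real p * ind p m)"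
  proof (rule prod_mono)
    fix p assume "p \<in> A"
    show "0 <= (1 + c / real p * ind p m)\<^sup>2 & (1 + c / real p * ind p m)\<^sup>2 <= 1 + (2 * c + c\<^sup>2) / real p * ind p m"
    proof (cases "p = 0 \<or> \<not> int p dvd m")
      case True thus ?thesis by (auto simp: ind_def)
    next
      case False
      hence p: "real p >= 1" "ind p m = 1" by (auto simp: ind_def)
      have "c\<^sup>2 / (real p)\<^sup>2 <= c\<^sup>2 / real p" using p by (intro divide_left_mono) (auto simp: power2_eq_square)
      thus ?thesis using p zero_le_power2[of "1 + c / real p"] by (simp add: power2_sum power_divide add_divide_distrib)
    qed
  qed
  finally show ?thesis by (simp add: tau_def)
qed

text \<open>Primes are split at the square root and at the square of \<open>K\<close>, one range for
  each of the three preceding bounds. \<open>D\<close> is fixed before \<open>w\<close>, so a large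
  \<open>w\<close> makes the average excess as small as desired, uniformly in \<open>A\<close> and
  \<open>c0\<close>.\<close>

lemma tau_average:
  assumes c: "c >= 0"
  obtains D where "D >= 0" "\<And>w. w >= 1 ==> \<forall>\<^sub>F K in sequentially. \<forall>A c0. finite A --> (\<forall>p\<in>A. prime p & w < p) --> \<bar>c0\<bar> <= 4 * 2 ^ K
     --> (\<Sum>k | k < K & sh (Suc k) ~= c0. tau c A (sh (Suc k) - c0) - 1) <= real K * D / sqrt (real w)"
proof -
  define c2 where "c2 = 2 * c + c\<^sup>2"
  have c2: "c2 >= 0" using c by (simp add: c2_def)
  obtain D1 where D1: "D1 >= 0" "\<And>w K A c0. w >= 1 ==> finite A ==> (\<And>p. p \<in> A ==> prime p & w < p & p * p <= K)
     ==> (\<Sum>k<K. tau c2 A (sh (Suc k) - c0) - 1) <= real K * D1 / sqrt (real w)"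
    using tau_small_average[OF c2] by metis
  define E where "E = 32 * c2 * exp (16 * c2)"
  have E0: "E >= 0" using c2 by (simp add: E_def)
  \<comment> \<open>The window length grows to infinity while \<open>l * 2 ^ l\<close> remains below
    the square root of \<open>K\<close>.\<close>
  define l where "l = (\<lambda>K::nat. nat \<lfloor>log 2 (real K) / 8\<rfloor>)"
  have lim_l: "filterlim (\<lambda>K. real (l K)) at_top sequentially"
  proof -
    have "filterlim (\<lambda>K::nat. log 2 (real K) / 8 - 1) at_top sequentially" by real_asymp
    thus ?thesis by (rule filterlim_at_top_mono) (auto intro!: always_eventually simp: l_def, linarith)
  qed
  have small: "\<forall>\<^sub>F K in sequentially. E * (real K / real (l K) + 1) + 2 * real K * (exp (c * real (K + 3) / (real K)\<^sup>2) - 1) <= real K * 1 / sqrt (real w)"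
    if "w >= 1" for w :: nat
  proof -
    define e where "e = 1 / sqrt (real w)"
    have e: "e > 0" using that by (simp add: e_def)
    have "((\<lambda>K. E / real (l K)) \<longlongrightarrow> 0) sequentially" by (rule tendsto_divide_0[OF tendsto_const filterlim_at_top_imp_at_infinity[OF lim_l]])
    moreover have "((\<lambda>K. E / real K + 2 * (exp (c * real (K + 3) / (real K)\<^sup>2) - 1)) \<longlongrightarrow> 0) sequentially" by real_asymp
    ultimately have "((\<lambda>K. E / real (l K) + (E / real K + 2 * (exp (c * real (K + 3) / (real K)\<^sup>2) - 1))) \<longlongrightarrow> 0 + 0) sequentially"
      by (rule tendsto_add)
    hence "\<forall>\<^sub>F K in sequentially. E / real (l K) + (E / real K + 2 * (exp (c * real (K + 3) / (real K)\<^sup>2) - 1)) < e"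
      using e by (intro order_tendstoD) auto
    with eventually_gt_at_top[of 0] show ?thesis
    proof eventually_elim
      case (elim K)
      hence le: "real K * (E / real (l K) + (E / real K + 2 * (exp (c * real (K + 3) / (real K)\<^sup>2) - 1))) <= real K * e"
        by (intro mult_left_mono) auto
      have "real K * (E / L + (E / real K + 2 * Y)) = E * (real K / L + 1) + 2 * real K * Y" for L Y
        using elim(1) by (simp add: distrib_left)
      note this[symmetric]
      also note le
      finally show ?case by (simp add: e_def)
    qed
  qed
  have lsmall: "\<forall>\<^sub>F K in sequentially. real (l K * 2 ^ l K) <= sqrt (real K) & l K >= 1"
  proof -
    have "\<forall>\<^sub>F K::nat in sequentially. log 2 (real K) / 8 * 2 powr (log 2 (real K) / 8) <= sqrt (real K)" by real_asymp
    moreover have "\<forall>\<^sub>F K in sequentially. real (l K) >= 1" using lim_l unfolding filterlim_at_top by blast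
    ultimately show ?thesis using eventually_ge_at_top[of 1]
    proof eventually_elim
      case (elim K)
      have "0 <= log 2 (real K) / 8" using elim(3) by simp
      hence "real (l K) <= log 2 (real K) / 8" unfolding l_def by (rule of_nat_floor)
      hence "real (l K) * 2 powr real (l K) <= log 2 (real K) / 8 * 2 powr (log 2 (real K) / 8)"
        by (intro mult_mono powr_mono) auto
      thus ?case using elim by (simp add: powr_realpow)
    qed
  qed
  have exp2: "\<forall>\<^sub>F K::nat in sequentially. exp (c * real (K + 3) / (real K)\<^sup>2) <= 2"
  proof -
    have "((\<lambda>K::nat. exp (c * real (K + 3) / (real K)\<^sup>2)) \<longlongrightarrow> 1) sequentially" by real_asymp
    hence "\<forall>\<^sub>F K::nat in sequentially. exp (c * real (K + 3) / (real K)\<^sup>2) < 2" by (rule order_tendstoD) simp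
    thus ?thesis by eventually_elim simp
  qed
  show thesis
  proof (rule that[of "D1 + 1"])
    fix w :: nat assume w: "w >= 1"
    show "\<forall>\<^sub>F K in sequentially. \<forall>A c0. finite A --> (\<forall>p\<in>A. prime p & w < p) --> \<bar>c0\<bar> <= 4 * 2 ^ K
     --> (\<Sum>k | k < K & sh (Suc k) ~= c0. tau c A (sh (Suc k) - c0) - 1) <= real K * (D1 + 1) / sqrt (real w)"
      using small[OF w] lsmall exp2 eventually_ge_at_top[of 3]
    proof eventually_elim
      case (elim K)
      show ?case
      proof (intro allI impI)
        fix A :: "nat set" and c0 :: int assume A: "finite A" "\<forall>p\<in>A. prime p & w < p" and c0: "\<bar>c0\<bar> <= 4 * 2 ^ K"
        define A1 A2 A3 where "A1 = {p\<in>A. p * p <= K}" "A2 = {p\<in>A. K < p * p & p <= K\<^sup>2}" "A3 = {p\<in>A. K < p * p & K\<^sup>2 < p}"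
        note Ad = this
        have fA: "finite A1" "finite A2" "finite A3" using A by (auto simp: Ad)
        have U: "A = (A1 \<union> A2) \<union> A3" by (auto simp: Ad)
        define X where "X = exp (c * real (K + 3) / (real K)\<^sup>2)"
        have X: "1 <= X" "X <= 2" using elim(3) c by (auto simp: X_def)
        \<comment> \<open>The factors of the small and middle primes are separated by the
          arithmetic-geometric mean inequality; their squares explain the larger constant
          \<open>c2\<close>. The factor of the largest primes lies between 1 and
          \<open>X <= 2\<close>.\<close>
        have pt: "tau c A (sh (Suc k) - c0) - 1 <= (tau c2 A1 (sh (Suc k) - c0) - 1) + (tau c2 A2 (sh (Suc k) - c0) - 1) + (X - 1)"
          if k: "k < K" "sh (Suc k) ~= c0" for k
        proof -
          define m where "m = sh (Suc k) - c0"
          have "\<bar>m\<bar> <= 2 ^ (K + 3)"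
          proof -
            have "sh (Suc k) <= 2 ^ Suc k" by (rule sh_le_power)
            also have "... <= 2 ^ K" using k by (intro power_increasing) auto
            finally show ?thesis using sh_pos[of "Suc k"] c0 by (simp add: m_def power_add)
          qed
          hence t3: "tau c A3 m <= X" unfolding X_def
            using A c k elim(4) by (intro tau_large_le fA) (auto simp: Ad m_def)
          define a b where "a = tau c A1 m" "b = tau c A2 m"
          have ab: "1 <= a" "1 <= b" using c by (auto simp: a_b_def tau_ge_1)
          have sq: "a\<^sup>2 <= tau c2 A1 m" "b\<^sup>2 <= tau c2 A2 m" unfolding a_b_def c2_def using c by (auto intro: tau_square_le)
          have "tau c A m = a * b * tau c A3 m" unfolding U a_b_def using fA by (simp add: tau_Un Ad Int_def disjoint_iff)
          also have "... <= a * b * X" using ab t3 by (intro mult_left_mono) auto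
          finally have "tau c A m <= a * b * X" .
          moreover have "a * b * X <= (a\<^sup>2 + b\<^sup>2) / 2 * X"
            using sum_squares_bound[of a b] X by (intro mult_right_mono) auto
          moreover have "(a\<^sup>2 + b\<^sup>2) / 2 * X - 1 <= (a\<^sup>2 - 1) + (b\<^sup>2 - 1) + (X - 1)"
          proof -
            have "((a\<^sup>2 - 1) + (b\<^sup>2 - 1)) / 2 * X <= ((a\<^sup>2 - 1) + (b\<^sup>2 - 1)) / 2 * 2"
              using one_le_power[OF ab(1), of 2] one_le_power[OF ab(2), of 2] X by (intro mult_left_mono) (simp_all add: field_simps)
            moreover have "((a\<^sup>2 - 1) + (b\<^sup>2 - 1)) / 2 * X = (a\<^sup>2 + b\<^sup>2) / 2 * X - X" by (simp add: field_simps)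
            ultimately show ?thesis by simp
          qed
          ultimately show ?thesis using sq unfolding m_def by linarith
        qed
        have "(\<Sum>k | k < K & sh (Suc k) ~= c0. tau c A (sh (Suc k) - c0) - 1)
          <= (\<Sum>k | k < K & sh (Suc k) ~= c0. (tau c2 A1 (sh (Suc k) - c0) - 1) + (tau c2 A2 (sh (Suc k) - c0) - 1) + (X - 1))"
          by (intro sum_mono pt) auto
        also have "... <= (\<Sum>k<K. (tau c2 A1 (sh (Suc k) - c0) - 1) + (tau c2 A2 (sh (Suc k) - c0) - 1) + (X - 1))"
        proof (rule sum_mono2)
          fix k
          show "0 <= (tau c2 A1 (sh (Suc k) - c0) - 1) + (tau c2 A2 (sh (Suc k) - c0) - 1) + (X - 1)"
            using X tau_ge_1[OF c2, of A1 "sh (Suc k) - c0"] tau_ge_1[OF c2, of A2 "sh (Suc k) - c0"] by linarith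
        qed auto
        also have "... = (\<Sum>k<K. tau c2 A1 (sh (Suc k) - c0) - 1) + (\<Sum>k<K. tau c2 A2 (sh (Suc k) - c0) - 1) + real K * (X - 1)"
          by (simp only: sum.distrib sum_constant card_lessThan)
        also have "(\<Sum>k<K. tau c2 A1 (sh (Suc k) - c0) - 1) <= real K * D1 / sqrt (real w)"
          using A w by (intro D1(2) fA) (auto simp: Ad)
        also have "(\<Sum>k<K. tau c2 A2 (sh (Suc k) - c0) - 1) <= E * (real K / real (l K) + 1)"
          unfolding E_def using A elim c2 by (intro tau_mid_average fA) (auto simp: Ad)
        also have "real K * (X - 1) <= 2 * real K * (exp (c * real (K + 3) / (real K)\<^sup>2) - 1)"
          using X unfolding X_def[symmetric] by simp
        finally show "(\<Sum>k | k < K & sh (Suc k) ~= c0. tau c A (sh (Suc k) - c0) - 1) <= real K * (D1 + 1) / sqrt (real w)"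
          using elim(1) by (simp add: distrib_left add_divide_distrib)
      qed
    qed
  qed (use D1 in auto)
qed

section \<open>Brun's sieve on doubly exponential blocks\<close>

definition blk :: "nat => nat set" where
  "blk j = {p. prime p & 2 ^ 2 ^ j < p & p <= 2 ^ 2 ^ Suc j}"

definition upto_primes :: "nat => nat set" where
  "upto_primes n = {p. prime p & p <= n}"

definition mid_primes :: "nat => nat => nat set" where
  "mid_primes j0 J = {p. prime p & 2 ^ 2 ^ j0 < p & p <= 2 ^ 2 ^ J}"

text \<open>Exact for the smallest primes, then one Brun weight for each block of primes from
  \<open>y\<close> to \<open>y\<^sup>2\<close>. Each earlier block gets one more level of
  truncation: the excesses form a geometric series of size \<open>1 / 4 ^ b\<close>, while the cost
  remains a fixed power of the sieving limit because the logarithms of the blocks halve.\<close>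

definition nu :: "nat => nat => nat => int => real" where
  "nu b j0 J m = unsieved (upto_primes (2 ^ 2 ^ j0)) m * (\<Prod>j\<in>{j0..<J}. brun (b + (J - 1 - j)) (blk j) m)"

lemma finite_blk [simp]: "finite (blk j)" and finite_upto_primes [simp]: "finite (upto_primes n)"
  and finite_mid_primes [simp]: "finite (mid_primes j0 J)"
  by (auto simp: blk_def upto_primes_def mid_primes_def)

lemma tower_mono: "i <= j ==> (2::nat) ^ 2 ^ i <= 2 ^ 2 ^ j"
  by (intro power_increasing) auto

lemma blk_disjoint: assumes "i ~= j" shows "blk i \<inter> blk j = {}"
proof -
  have "blk i \<inter> blk j = {}" if "i < j" for i j
  proof -
    have "(2::nat) ^ 2 ^ Suc i <= 2 ^ 2 ^ j" using that by (intro tower_mono) auto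
    thus ?thesis by (auto simp: blk_def simp del: power_increasing_iff power_Suc)
  qed
  from this[of i j] this[of j i] assms show ?thesis by (cases i j rule: linorder_cases) auto
qed

lemma mid_primes_eq: assumes "j0 <= J" shows "mid_primes j0 J = (\<Union>j\<in>{j0..<J}. blk j)"
  using assms
proof (induction J rule: dec_induct)
  case base thus ?case by (auto simp: mid_primes_def)
next
  case (step n)
  have "(2::nat) ^ 2 ^ j0 <= 2 ^ 2 ^ n" "(2::nat) ^ 2 ^ n <= 2 ^ 2 ^ Suc n" using step by (auto intro!: tower_mono)
  hence "mid_primes j0 (Suc n) = mid_primes j0 n \<union> blk n"
    unfolding mid_primes_def blk_def by (auto simp del: power_increasing_iff power_Suc)
  thus ?case using step by (simp add: atLeastLessThanSuc Un_commute)
qed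

lemma upto_primes_split: assumes "j0 <= J"
  shows "upto_primes (2 ^ 2 ^ J) = upto_primes (2 ^ 2 ^ j0) \<union> mid_primes j0 J"
    "upto_primes (2 ^ 2 ^ j0) \<inter> mid_primes j0 J = {}"
  using tower_mono[OF assms] by (auto simp: upto_primes_def mid_primes_def simp del: power_increasing_iff)

lemma Prod_upto_primes: assumes "j0 <= J"
  shows "\<Prod>(upto_primes (2 ^ 2 ^ J)) = \<Prod>(upto_primes (2 ^ 2 ^ j0)) * (\<Prod>j\<in>{j0..<J}. \<Prod>(blk j))"
proof -
  have "\<Prod>(upto_primes (2 ^ 2 ^ J)) = \<Prod>(upto_primes (2 ^ 2 ^ j0)) * \<Prod>(mid_primes j0 J)"
    using upto_primes_split[OF assms] by (simp add: prod.union_disjoint)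
  also have "\<Prod>(mid_primes j0 J) = (\<Prod>j\<in>{j0..<J}. \<Prod>(blk j))"
    unfolding mid_primes_eq[OF assms] using blk_disjoint by (subst prod.UNION_disjoint) auto
  finally show ?thesis .
qed

lemma prod_mid_primes: assumes "j0 <= J" shows "(\<Prod>p\<in>mid_primes j0 J. f p) = (\<Prod>j\<in>{j0..<J}. \<Prod>p\<in>blk j. f p)"
  unfolding mid_primes_eq[OF assms] using blk_disjoint by (subst prod.UNION_disjoint) auto

lemma blk_prime: "p \<in> blk j ==> prime p" by (simp add: blk_def)

lemma upto_prime: "p \<in> upto_primes n ==> prime p" by (simp add: upto_primes_def)

lemma Prod_primes_pos: "(\<And>p. p \<in> A ==> prime p) ==> \<Prod>A > (0::nat)"
  by (intro prod_pos) (auto intro: prime_gt_0_nat)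

lemma coprime_Prod_primes:
  assumes "\<And>p. p \<in> A ==> prime p" "\<And>p. p \<in> B ==> prime p" "A \<inter> B = {}"
  shows "coprime (\<Prod>A) (\<Prod>B :: nat)"
proof (intro prod_coprime_left prod_coprime_right)
  fix p q assume "p \<in> A" "q \<in> B"
  thus "coprime p q" using assms by (intro primes_coprime) auto
qed

lemma sum_inverse_blk: "(\<Sum>p\<in>blk j. 1 / real p) <= 8"
proof (rule sum_inverse_primes_block)
  show "2 <= (2::nat) ^ 2 ^ j" using power_increasing[of 1 "2 ^ j" "2::nat"] by simp
  show "\<And>p. p \<in> blk j ==> prime p & 2 ^ 2 ^ j < p & p <= (2 ^ 2 ^ j)\<^sup>2"
    by (auto simp: blk_def power_mult[symmetric] mult.commute)
qed simp

lemma apc_per_brun: "per (\<Prod>(blk j)) (brun b (blk j))"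
  by (rule apc_per[OF apc_brun]) (auto simp: blk_prime)

lemma apc_per_unsieved: "per (\<Prod>(upto_primes n)) (unsieved (upto_primes n))"
  by (rule apc_per[OF apc_unsieved]) (auto intro: dvd_prodI)

lemma per_mult3: "per Q f ==> per Q (\<lambda>m. f (m + h1) * f (m + h2) * f (m + h3))"
  by (intro per_mult per_shift)

lemma mean_nu3:
  assumes "j0 <= J"
  shows "mean (\<Prod>(upto_primes (2 ^ 2 ^ J))) (\<lambda>m. nu b j0 J (m + h1) * nu b j0 J (m + h2) * nu b j0 J (m + h3))
    = (\<Prod>p\<in>upto_primes (2 ^ 2 ^ j0). lp p h1 h2 h3) *
      (\<Prod>j\<in>{j0..<J}. mean (\<Prod>(blk j)) (\<lambda>m. brun (b + (J - 1 - j)) (blk j) (m + h1) * brun (b + (J - 1 - j)) (blk j) (m + h2) * brun (b + (J - 1 - j)) (blk j) (m + h3)))"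
proof -
  define f where "f = (\<lambda>j m. brun (b + (J - 1 - j)) (blk j) (m + h1) * brun (b + (J - 1 - j)) (blk j) (m + h2) * brun (b + (J - 1 - j)) (blk j) (m + h3))"
  define g where "g = (\<lambda>m. unsieved (upto_primes (2 ^ 2 ^ j0)) (m + h1) * unsieved (upto_primes (2 ^ 2 ^ j0)) (m + h2) * unsieved (upto_primes (2 ^ 2 ^ j0)) (m + h3))"
  have f: "per (\<Prod>(blk j)) (f j)" for j unfolding f_def by (intro per_mult3 apc_per_brun)
  have g: "per (\<Prod>(upto_primes (2 ^ 2 ^ j0))) g" unfolding g_def by (intro per_mult3 apc_per_unsieved)
  have "mean (\<Prod>(upto_primes (2 ^ 2 ^ J))) (\<lambda>m. nu b j0 J (m + h1) * nu b j0 J (m + h2) * nu b j0 J (m + h3))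
    = mean (\<Prod>(upto_primes (2 ^ 2 ^ j0)) * (\<Prod>j\<in>{j0..<J}. \<Prod>(blk j))) (\<lambda>m. g m * (\<Prod>j\<in>{j0..<J}. f j m))"
    unfolding Prod_upto_primes[OF assms] nu_def f_def g_def prod.distrib by (simp add: mult_ac)
  also have "... = mean (\<Prod>(upto_primes (2 ^ 2 ^ j0))) g * mean (\<Prod>j\<in>{j0..<J}. \<Prod>(blk j)) (\<lambda>m. \<Prod>j\<in>{j0..<J}. f j m)"
  proof (rule mean_mult_coprime[OF g])
    show "per (\<Prod>j\<in>{j0..<J}. \<Prod>(blk j)) (\<lambda>m. \<Prod>j\<in>{j0..<J}. f j m)"
    proof (rule per_prod)
      fix i assume "i \<in> {j0..<J}"
      thus "per (\<Prod>j\<in>{j0..<J}. \<Prod>(blk j)) (f i)" by (intro per_dvd[OF f] dvd_prodI[of "{j0..<J}" i "\<lambda>j. \<Prod>(blk j)"]) auto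
    qed
    show "coprime (\<Prod>(upto_primes (2 ^ 2 ^ j0))) (\<Prod>j\<in>{j0..<J}. \<Prod>(blk j))"
    proof (rule prod_coprime_right, rule coprime_Prod_primes)
      fix j assume "j \<in> {j0..<J}"
      hence "(2::nat) ^ 2 ^ j0 <= 2 ^ 2 ^ j" by (intro tower_mono) auto
      thus "upto_primes (2 ^ 2 ^ j0) \<inter> blk j = {}" by (auto simp: upto_primes_def blk_def simp del: power_increasing_iff)
    qed (auto simp: upto_prime blk_prime)
    show "0 < (\<Prod>j\<in>{j0..<J}. \<Prod>(blk j))" by (intro prod_pos Prod_primes_pos) (auto simp: blk_prime)
    show "0 < \<Prod>(upto_primes (2 ^ 2 ^ j0))" by (intro Prod_primes_pos upto_prime)
  qed
  also have "mean (\<Prod>(upto_primes (2 ^ 2 ^ j0))) g = (\<Prod>p\<in>upto_primes (2 ^ 2 ^ j0). lp p h1 h2 h3)"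
    unfolding g_def by (rule mean_unsieved3) (auto simp: upto_prime)
  also have "mean (\<Prod>j\<in>{j0..<J}. \<Prod>(blk j)) (\<lambda>m. \<Prod>j\<in>{j0..<J}. f j m) = (\<Prod>j\<in>{j0..<J}. mean (\<Prod>(blk j)) (f j))"
  proof (rule mean_prod_coprime)
    fix i j :: nat assume "i ~= j"
    thus "coprime (\<Prod>(blk i)) (\<Prod>(blk j))" by (intro coprime_Prod_primes blk_disjoint) (auto simp: blk_prime)
  next
    fix i show "0 < \<Prod>(blk i)" by (rule Prod_primes_pos) (simp add: blk_prime)
  qed (auto intro: f)
  finally show ?thesis unfolding f_def .
qed

lemma sum_quarter_powers: "(\<Sum>j\<in>{j0..<J}. 1 / 4 ^ (b + (J - 1 - j))) <= 2 / (4::real) ^ b"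
proof -
  have "(\<Sum>j\<in>{j0..<J}. 1 / 4 ^ (b + (J - 1 - j))) <= (\<Sum>j<J. 1 / (4::real) ^ (b + (J - 1 - j)))"
    by (intro sum_mono2) auto
  also have "... = (\<Sum>i<J. 1 / (4::real) ^ (b + i))"
    using sum.nat_diff_reindex[of "\<lambda>i. 1 / (4::real) ^ (b + i)" J] by simp
  also have "... = 1 / 4 ^ b * (\<Sum>i<J. (1/4) ^ i)"
    by (simp add: sum_distrib_left power_add power_divide)
  also have "... <= 1 / 4 ^ b * 2"
  proof (rule mult_left_mono)
    have "(\<Sum>i<J. (1/4::real) ^ i) <= (\<Sum>i. (1/4) ^ i)"
      by (intro sum_le_suminf summable_geometric) auto
    also have "... = 4 / 3" by (subst suminf_geometric) auto
    finally show "(\<Sum>i<J. (1/4::real) ^ i) <= 2" by simp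
  qed simp
  finally show ?thesis by simp
qed

text \<open>Each block has a sum of reciprocals at most 8, whence \<open>1560 = 195 * 8\<close>; the
  factor 6 is 3 from the three exchanges times 2 from \<open>sum_quarter_powers\<close>.\<close>

lemma mean_nu3_le:
  assumes J: "j0 <= J" and r: "r <= 3"
    and t: "\<And>p. p \<in> mid_primes j0 J ==> 0 <= t p" "\<And>p. p \<in> mid_primes j0 J ==> lp p h1 h2 h3 <= (1 - 1 / real p) ^ r * (1 + t p)"
  shows "mean (\<Prod>(upto_primes (2 ^ 2 ^ J))) (\<lambda>m. nu b j0 J (m + h1) * nu b j0 J (m + h2) * nu b j0 J (m + h3))
    <= (\<Prod>p\<in>upto_primes (2 ^ 2 ^ j0). lp p h1 h2 h3) * ((\<Prod>p\<in>mid_primes j0 J. 1 - 1 / real p) ^ r * (\<Prod>p\<in>mid_primes j0 J. 1 + t p) * exp (6 * exp 1560 / 4 ^ b))"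
proof -
  have sub: "p \<in> mid_primes j0 J" if "p \<in> blk j" "j \<in> {j0..<J}" for p j using that mid_primes_eq[OF J] by auto
  have "(\<Prod>j\<in>{j0..<J}. mean (\<Prod>(blk j)) (\<lambda>m. brun (b + (J - 1 - j)) (blk j) (m + h1) * brun (b + (J - 1 - j)) (blk j) (m + h2) * brun (b + (J - 1 - j)) (blk j) (m + h3)))
    <= (\<Prod>j\<in>{j0..<J}. (\<Prod>p\<in>blk j. 1 - 1 / real p) ^ r * (\<Prod>p\<in>blk j. 1 + t p) * (1 + 3 * exp (195 * 8) / 4 ^ (b + (J - 1 - j))))"
  proof (rule prod_mono, intro conjI)
    fix j assume j: "j \<in> {j0..<J}"
    show "mean (\<Prod>(blk j)) (\<lambda>m. brun (b + (J - 1 - j)) (blk j) (m + h1) * brun (b + (J - 1 - j)) (blk j) (m + h2) * brun (b + (J - 1 - j)) (blk j) (m + h3))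
      <= (\<Prod>p\<in>blk j. 1 - 1 / real p) ^ r * (\<Prod>p\<in>blk j. 1 + t p) * (1 + 3 * exp (195 * 8) / 4 ^ (b + (J - 1 - j)))"
      using j t sub by (intro mean_brun3_le sum_inverse_blk r) (auto simp: blk_prime)
    show "0 <= mean (\<Prod>(blk j)) (\<lambda>m. brun (b + (J - 1 - j)) (blk j) (m + h1) * brun (b + (J - 1 - j)) (blk j) (m + h2) * brun (b + (J - 1 - j)) (blk j) (m + h3))"
      by (intro mean_nonneg mult_nonneg_nonneg brun_nonneg) auto
  qed
  also have "... = (\<Prod>p\<in>mid_primes j0 J. 1 - 1 / real p) ^ r * (\<Prod>p\<in>mid_primes j0 J. 1 + t p) * (\<Prod>j\<in>{j0..<J}. 1 + 3 * exp (195 * 8) / 4 ^ (b + (J - 1 - j)))"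
    unfolding prod_mid_primes[OF J] by (simp add: prod.distrib prod_power_distrib)
  also have "... <= (\<Prod>p\<in>mid_primes j0 J. 1 - 1 / real p) ^ r * (\<Prod>p\<in>mid_primes j0 J. 1 + t p) * exp (6 * exp 1560 / 4 ^ b)"
  proof (rule mult_left_mono)
    have "(\<Prod>j\<in>{j0..<J}. 1 + 3 * exp (195 * 8) / 4 ^ (b + (J - 1 - j))) <= exp (\<Sum>j\<in>{j0..<J}. 3 * exp (195 * 8) / 4 ^ (b + (J - 1 - j)) :: real)"
      by (rule prod_one_plus_le_exp) auto
    also have "(\<Sum>j\<in>{j0..<J}. 3 * exp (195 * 8) / 4 ^ (b + (J - 1 - j)) :: real) = 3 * exp 1560 * (\<Sum>j\<in>{j0..<J}. 1 / 4 ^ (b + (J - 1 - j)))"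
      by (simp add: sum_distrib_left)
    also have "exp ... <= exp (3 * exp 1560 * (2 / 4 ^ b))"
      unfolding exp_le_cancel_iff by (intro mult_left_mono sum_quarter_powers) auto
    finally show "(\<Prod>j\<in>{j0..<J}. 1 + 3 * exp (195 * 8) / 4 ^ (b + (J - 1 - j))) <= exp (6 * exp 1560 / 4 ^ b :: real)" by simp
    show "0 <= (\<Prod>p\<in>mid_primes j0 J. 1 - 1 / real p) ^ r * (\<Prod>p\<in>mid_primes j0 J. 1 + t p)"
    proof (intro mult_nonneg_nonneg zero_le_power prod_nonneg)
      fix p assume p: "p \<in> mid_primes j0 J"
      hence "p > 0" by (auto simp: mid_primes_def prime_gt_0_nat)
      thus "0 <= 1 - 1 / real p" by simp
      show "0 <= 1 + t p" using t(1)[OF p] by simp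
    qed
  qed
  finally show ?thesis unfolding mean_nu3[OF J] by (rule mult_left_mono) (auto intro!: prod_nonneg lp_nonneg)
qed

lemma nu_nonneg: "0 <= nu b j0 J m"
  unfolding nu_def by (intro mult_nonneg_nonneg unsieved_bounds prod_nonneg) (auto intro: brun_nonneg)

lemma Nats_prod: "(\<And>i. i \<in> I ==> f i \<in> \<nat>) ==> (\<Prod>i\<in>I. f i :: real) \<in> \<nat>"
  by (induction I rule: infinite_finite_induct) auto

lemma brun_Nats: "finite P ==> brun b P m \<in> \<nat>"
  by (auto simp: brun_eq unsieved_eq)

text \<open>The values are natural numbers. The first moment can therefore be read off the
  three-point bound with all three points equal.\<close>

lemma nu_le_cube: "nu b j0 J m <= nu b j0 J m * nu b j0 J m * nu b j0 J m"
proof -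
  have "nu b j0 J m \<in> \<nat>" unfolding nu_def
    by (intro Nats_mult Nats_prod brun_Nats) (auto simp: unsieved_eq)
  then obtain n where n: "nu b j0 J m = real n" by (auto elim: Nats_cases)
  have "n <= n * n * n" by (cases n) auto
  hence "real n <= real (n * n * n)" by (rule of_nat_mono)
  thus ?thesis unfolding n by simp
qed

lemma nu_prime: assumes "prime p" "2 ^ 2 ^ J < p" "j0 <= J" shows "nu b j0 J (int p) = 1"
proof -
  have no: "\<not> int q dvd int p" if "prime q" "q <= 2 ^ 2 ^ J" for q
    using that assms primes_dvd_imp_eq[of q p] by auto
  have "unsieved (upto_primes (2 ^ 2 ^ j0)) (int p) = 1"
    unfolding unsieved_def ind_def using no tower_mono[OF assms(3)]
    by (intro prod.neutral) (auto simp: upto_primes_def simp del: power_increasing_iff int_dvd_int_iff)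
  moreover have "brun b' (blk j) (int p) = 1" if "j \<in> {j0..<J}" for j b'
  proof -
    have "(2::nat) ^ 2 ^ Suc j <= 2 ^ 2 ^ J" using that by (intro tower_mono) auto
    hence "{q \<in> blk j. int q dvd int p} = {}" using no
      by (auto simp: blk_def simp del: power_increasing_iff power_Suc int_dvd_int_iff)
    hence "om (blk j) (int p) = 0" by (simp add: om_def del: int_dvd_int_iff)
    thus ?thesis by (simp add: brun_eq unsieved_eq)
  qed
  ultimately show ?thesis by (simp add: nu_def)
qed

text \<open>The cost of the blocks is a power of 2 whose exponent sums the block lengths times the
  truncations; it is dominated by the last block.\<close>

lemma apc_nu:
  assumes "j0 <= J" "\<Prod>(upto_primes (2 ^ 2 ^ J)) dvd Q"
  shows "apc Q (2 ^ 2 ^ 2 ^ j0 * real (2 ^ 2 ^ J) ^ (4 * (b + 1))) (nu b j0 J)"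
proof -
  have sub: "A \<subseteq> upto_primes (2 ^ 2 ^ J) ==> \<Prod>A dvd Q" for A
    using assms(2) by (meson dvd_trans prod_dvd_prod_subset finite_upto_primes)
  have blk_sub: "blk j \<subseteq> upto_primes (2 ^ 2 ^ J)" if "j < J" for j
    using tower_mono[of "Suc j" J] that by (auto simp: blk_def upto_primes_def simp del: power_increasing_iff power_Suc)
  have "apc Q (2 ^ card (upto_primes (2 ^ 2 ^ j0))) (unsieved (upto_primes (2 ^ 2 ^ j0)))"
  proof (rule apc_unsieved)
    fix p assume "p \<in> upto_primes (2 ^ 2 ^ j0)"
    hence "{p} \<subseteq> upto_primes (2 ^ 2 ^ J)" using tower_mono[OF assms(1)] by (auto simp: upto_primes_def simp del: power_increasing_iff)
    from sub[OF this] show "p dvd Q" by simp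
  qed simp
  moreover have "card (upto_primes n) <= n" for n
  proof -
    have "upto_primes n \<subseteq> {1..n}" by (auto simp: upto_primes_def dest: prime_ge_1_nat)
    from card_mono[OF _ this] show ?thesis by simp
  qed
  ultimately have 1: "apc Q (2 ^ 2 ^ 2 ^ j0) (unsieved (upto_primes (2 ^ 2 ^ j0)))"
    by (elim apc_mono) (auto intro: power_increasing)
  have 2: "apc Q (\<Prod>j\<in>{j0..<J}. real ((2 ^ 2 ^ Suc j) ^ (2 * (b + (J - 1 - j))))) (\<lambda>m. \<Prod>j\<in>{j0..<J}. brun (b + (J - 1 - j)) (blk j) m)"
  proof (rule apc_prod)
    fix j assume j: "j \<in> {j0..<J}"
    have "card (blk j) + 1 <= 2 ^ 2 ^ Suc j"
    proof -
      have "blk j \<subseteq> {2..2 ^ 2 ^ Suc j}" by (auto simp: blk_def prime_ge_2_nat)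
      from card_mono[OF _ this] have "card (blk j) <= 2 ^ 2 ^ Suc j - 1" by simp
      moreover have "(1::nat) <= 2 ^ 2 ^ Suc j" by simp
      ultimately show ?thesis by linarith
    qed
    hence le: "real ((card (blk j) + 1) ^ (2 * (b + (J - 1 - j)))) <= real ((2 ^ 2 ^ Suc j) ^ (2 * (b + (J - 1 - j))))"
      by (intro of_nat_mono power_mono) auto
    show "apc Q (real ((2 ^ 2 ^ Suc j) ^ (2 * (b + (J - 1 - j))))) (brun (b + (J - 1 - j)) (blk j))"
      using j by (intro apc_mono[OF apc_brun le] sub blk_sub) (auto simp: blk_prime)
  qed simp
  \<comment> \<open>The extra terms \<open>4 * n + 4 * (b + 1)\<close> on the left strengthen the
    claim so that it passes through the induction.\<close>
  have e: "(\<Sum>j<n. 2 ^ Suc j * (2 * (b + (n - 1 - j)))) + 4 * n + 4 * (b + 1) <= 2 ^ n * (4 * (b + 1))" for n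
  proof (induction n)
    case (Suc n)
    have "(\<Sum>j<Suc n. 2 ^ Suc j * (2 * (b + (Suc n - 1 - j)))) = (\<Sum>j<n. 2 ^ Suc j * (2 * (b + (n - 1 - j)))) + (\<Sum>j<n. 2 ^ Suc j * 2) + 2 ^ Suc n * (2 * b)"
    proof -
      have "(\<Sum>j<n. 2 ^ Suc j * (2 * (b + (Suc n - 1 - j)))) = (\<Sum>j<n. 2 ^ Suc j * (2 * (b + (n - 1 - j))) + 2 ^ Suc j * 2)"
      proof (rule sum.cong[OF refl])
        fix j assume "j \<in> {..<n}"
        hence "Suc n - 1 - j = (n - 1 - j) + 1" by auto
        thus "2 ^ Suc j * (2 * (b + (Suc n - 1 - j))) = 2 ^ Suc j * (2 * (b + (n - 1 - j))) + 2 ^ Suc j * (2::nat)"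
          by (simp only: distrib_left mult_1_right add.assoc[symmetric])
      qed
      thus ?thesis by (simp add: sum.distrib)
    qed
    moreover have "(\<Sum>j<n. 2 ^ Suc j * 2) + 4 = 2 ^ n * (4::nat)"
      by (induction n) auto
    ultimately show ?case using Suc by (simp add: algebra_simps)
  qed simp
  have "(\<Prod>j\<in>{j0..<J}. real ((2 ^ 2 ^ Suc j) ^ (2 * (b + (J - 1 - j))))) <= (\<Prod>j<J. real ((2 ^ 2 ^ Suc j) ^ (2 * (b + (J - 1 - j)))))"
    by (intro prod_mono2) (auto simp: one_le_power)
  also have "... = real (2 ^ (\<Sum>j<J. 2 ^ Suc j * (2 * (b + (J - 1 - j)))))"
    by (simp add: power_sum power_mult[symmetric])
  also have "... <= real (2 ^ (2 ^ J * (4 * (b + 1))))"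
    using e[of J] by (intro of_nat_mono power_increasing) auto
  also have "... = real (2 ^ 2 ^ J) ^ (4 * (b + 1))" by (simp add: power_mult)
  finally have 3: "(\<Prod>j\<in>{j0..<J}. real ((2 ^ 2 ^ Suc j) ^ (2 * (b + (J - 1 - j))))) <= real (2 ^ 2 ^ J) ^ (4 * (b + 1))" .
  show ?thesis unfolding nu_def by (rule apc_mult[OF 1 apc_mono[OF 2 3]])
qed

lemma sum_inverse_squares_above:
  assumes "w > 0" "finite A" "\<And>n. n \<in> A ==> w < n" shows "(\<Sum>n\<in>A. 1 / (real n)\<^sup>2) <= 1 / real w"
proof -
  have *: "(\<Sum>n\<in>{w<..w+k}. 1 / (real n)\<^sup>2) <= 1 / real w - 1 / real (w + k)" for k
  proof (induction k)
    case (Suc k)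
    have "{w<..w + Suc k} = insert (w + Suc k) {w<..w+k}" by auto
    hence "(\<Sum>n\<in>{w<..w+Suc k}. 1 / (real n)\<^sup>2) = 1 / (real (w + Suc k))\<^sup>2 + (\<Sum>n\<in>{w<..w+k}. 1 / (real n)\<^sup>2)" by simp
    also have "1 / (real (w + Suc k))\<^sup>2 <= 1 / (real (w + k) * real (w + Suc k))"
      using assms(1) by (intro divide_left_mono) (auto simp: power2_eq_square intro!: mult_right_mono)
    also have "... = 1 / real (w + k) - 1 / real (w + Suc k)" using assms(1) by (simp add: field_simps)
    finally show ?case using Suc by simp
  qed simp
  have "A \<subseteq> {w<..w + Max (insert 0 A)}" using assms by (auto simp: trans_le_add2)
  hence "(\<Sum>n\<in>A. 1 / (real n)\<^sup>2) <= (\<Sum>n\<in>{w<..w + Max (insert 0 A)}. 1 / (real n)\<^sup>2)" by (intro sum_mono2) auto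
  also have "... <= 1 / real w - 1 / real (w + Max (insert 0 A))" by (rule *)
  also have "... <= 1 / real w" by simp
  finally show ?thesis .
qed

lemma weierstrass_prod_ineq:
  assumes "finite A" "\<And>i. i \<in> A ==> f i \<in> {0..1::real}" shows "1 - (\<Sum>i\<in>A. f i) <= (\<Prod>i\<in>A. 1 - f i)"
  using assms
proof (induction A rule: finite_induct)
  case (insert x A)
  have x: "0 <= f x" "f x <= 1" using insert by auto
  have "(\<Prod>i\<in>A. 1 - f i) <= 1" using insert by (intro prod_le_1) auto
  hence "f x * (\<Prod>i\<in>A. 1 - f i) <= f x * 1" using x by (intro mult_left_mono)
  thus ?case using insert by (simp add: algebra_simps)
qed simp

lemma tower_gt_4: "1 <= j0 ==> (4::nat) <= 2 ^ 2 ^ j0"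
  using tower_mono[of 1 j0] by simp

text \<open>Replace \<open>nu\<close> by the smaller exact sieve, whose two-point density at
  \<open>p\<close> is at least \<open>1 - 2 / p\<close>. This is at least the square of
  \<open>1 - 1 / p\<close> up to a factor \<open>1 - 4 / p ^ 2\<close>, and the product of these
  factors is close to 1.\<close>

lemma mean_nu_pair_ge:
  assumes J: "j0 <= J" "1 <= j0"
  shows "(\<Prod>p\<in>upto_primes (2 ^ 2 ^ j0). lp p h1 h2 h2) * ((\<Prod>p\<in>mid_primes j0 J. 1 - 1 / real p)\<^sup>2 * (1 - 4 / 2 ^ 2 ^ j0))
    <= mean (\<Prod>(upto_primes (2 ^ 2 ^ J))) (\<lambda>m. nu b j0 J (m + h1) * nu b j0 J (m + h2))"
proof -
  define A where "A = upto_primes (2 ^ 2 ^ J)"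
  have uA: "unsieved A m = unsieved (upto_primes (2 ^ 2 ^ j0)) m * (\<Prod>j\<in>{j0..<J}. unsieved (blk j) m)" for m
    unfolding A_def upto_primes_split(1)[OF J(1)] unsieved_def
    using upto_primes_split(2)[OF J(1)] by (simp add: prod.union_disjoint prod_mid_primes[OF J(1)])
  have le: "unsieved A m <= nu b j0 J m" for m unfolding uA nu_def
    using unsieved_bounds by (intro mult_left_mono prod_mono) (auto intro: unsieved_le_brun)
  have sq: "unsieved A m * unsieved A m = unsieved A m" for m unfolding A_def by (simp add: unsieved_eq)
  have P: "4 < real p & prime p" if "p \<in> mid_primes j0 J" for p
    using that tower_gt_4[OF J(2)] by (auto simp: mid_primes_def)
  have "(\<Prod>p\<in>mid_primes j0 J. 1 - 1 / real p)\<^sup>2 * (1 - 4 / 2 ^ 2 ^ j0) <= (\<Prod>p\<in>mid_primes j0 J. (1 - 1 / real p)\<^sup>2) * (\<Prod>p\<in>mid_primes j0 J. 1 - 4 / (real p)\<^sup>2)"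
  proof -
    have "1 - 4 / 2 ^ 2 ^ j0 <= 1 - (\<Sum>p\<in>mid_primes j0 J. 4 / (real p)\<^sup>2)"
    proof -
      have "(\<Sum>p\<in>mid_primes j0 J. 1 / (real p)\<^sup>2) <= 1 / real (2 ^ 2 ^ j0)"
        by (rule sum_inverse_squares_above) (auto simp: mid_primes_def)
      thus ?thesis by (simp add: sum_distrib_left[of 4 "\<lambda>p. 1 / (real p)\<^sup>2", simplified, symmetric])
    qed
    also have "... <= (\<Prod>p\<in>mid_primes j0 J. 1 - 4 / (real p)\<^sup>2)"
    proof (rule weierstrass_prod_ineq[OF finite_mid_primes])
      fix p assume p: "p \<in> mid_primes j0 J"
      have "4 <= (real p)\<^sup>2" using P[OF p] power_mono[of 2 "real p" 2] by simp
      hence "4 / (real p)\<^sup>2 <= 4 / 4" using P[OF p] by (intro divide_left_mono) auto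
      thus "4 / (real p)\<^sup>2 \<in> {0..1}" by simp
    qed
    finally show ?thesis unfolding prod_power_distrib by (intro mult_left_mono prod_nonneg) auto
  qed
  also have "... = (\<Prod>p\<in>mid_primes j0 J. (1 - 1 / real p)\<^sup>2 * (1 - 4 / (real p)\<^sup>2))" by (simp add: prod.distrib)
  also have "... <= (\<Prod>p\<in>mid_primes j0 J. lp p h1 h2 h2)"
  proof (rule prod_mono, intro conjI)
    fix p assume p: "p \<in> mid_primes j0 J"
    define x where "x = 1 / real p"
    have x: "0 <= x" "x <= 1 / 4" using P[OF p] by (auto simp: x_def field_simps)
    have "x * x <= (1/4) * (1/4)" using x by (intro mult_mono) auto
    hence "0 <= 1 - 4 * x\<^sup>2" by (simp add: power2_eq_square)
    thus "0 <= (1 - 1 / real p)\<^sup>2 * (1 - 4 / (real p)\<^sup>2)" by (simp add: x_def power_divide)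
    have "(1 - 2 * x) - (1 - x)\<^sup>2 * (1 - 4 * x\<^sup>2) = x\<^sup>2 * (3 - 8 * x + 4 * x\<^sup>2)"
      by (simp add: power2_eq_square algebra_simps)
    also have "... >= 0" using x by (intro mult_nonneg_nonneg) auto
    finally have "(1 - x)\<^sup>2 * (1 - 4 * x\<^sup>2) <= 1 - 2 * x" by simp
    also have "... <= lp p h1 h2 h2" using lp_pair_ge[of p h1 h2] P[OF p] by (simp add: x_def)
    finally show "(1 - 1 / real p)\<^sup>2 * (1 - 4 / (real p)\<^sup>2) <= lp p h1 h2 h2" by (simp add: x_def power_divide)
  qed
  finally have "(\<Prod>p\<in>upto_primes (2 ^ 2 ^ j0). lp p h1 h2 h2) * ((\<Prod>p\<in>mid_primes j0 J. 1 - 1 / real p)\<^sup>2 * (1 - 4 / 2 ^ 2 ^ j0))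
     <= (\<Prod>p\<in>upto_primes (2 ^ 2 ^ j0). lp p h1 h2 h2) * (\<Prod>p\<in>mid_primes j0 J. lp p h1 h2 h2)"
    by (intro mult_left_mono prod_nonneg lp_nonneg)
  also have "... = (\<Prod>p\<in>A. lp p h1 h2 h2)"
    unfolding A_def upto_primes_split(1)[OF J(1)] using upto_primes_split(2)[OF J(1)] by (simp add: prod.union_disjoint)
  also have "... = mean (\<Prod>A) (\<lambda>m. unsieved A (m + h1) * unsieved A (m + h2) * unsieved A (m + h2))"
    by (rule mean_unsieved3[symmetric]) (auto simp: A_def upto_prime)
  also have "... = mean (\<Prod>A) (\<lambda>m. unsieved A (m + h1) * unsieved A (m + h2))" by (simp add: mult.assoc sq)
  also have "... <= mean (\<Prod>A) (\<lambda>m. nu b j0 J (m + h1) * nu b j0 J (m + h2))"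
    using le unsieved_bounds nu_nonneg by (intro mean_mono mult_mono) auto
  finally show ?thesis unfolding A_def .
qed

section \<open>Prime pairs on average over the shifts\<close>

text \<open>The primes left to Selberg's sieve: beyond the limit of \<open>nu\<close> and up to the
  level \<open>R\<close>.\<close>

definition large_primes :: "nat => real => nat set" where
  "large_primes J R = {p. prime p & 2 ^ 2 ^ J < p & real p <= R}"

lemma finite_large_primes [simp]: "finite (large_primes J R)"
proof (rule finite_subset)
  show "large_primes J R \<subseteq> {..nat \<lceil>R\<rceil>}" by (auto simp: large_primes_def) linarith
qed simp

lemma tau_mult_le: assumes "c >= 0" "\<And>p. p \<in> A ==> prime p" shows "tau c A (x * y) <= tau c A x * tau c A y"
  unfolding tau_def prod.distrib[symmetric]
proof (rule prod_mono, intro conjI)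
  fix p assume p: "p \<in> A"
  show "0 <= 1 + c / real p * ind p (x * y)" using assms by simp
  have "int p dvd x * y \<longleftrightarrow> int p dvd x \<or> int p dvd y" using assms(2)[OF p] by (simp add: prime_dvd_mult_iff)
  moreover define t where "t = c / real p"
  have t: "0 <= t" using assms(1) by (simp add: t_def)
  ultimately have "1 + t * ind p (x * y) <= (1 + t * ind p x) * (1 + t * ind p y)"
    by (auto simp: ind_def mult_le_cancel_left1)
  thus "1 + c / real p * ind p (x * y) <= (1 + c / real p * ind p x) * (1 + c / real p * ind p y)"
    by (simp add: t_def)
qed

text \<open>\<open>511 = 8 ^ 3 - 1\<close> is the sum of the coefficients of the cube of
  \<open>1 + 7 * x\<close> without its constant term.\<close>

lemma tau_cube_le: "tau 7 A m ^ 3 <= tau 511 A m"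
proof -
  have "tau 7 A m ^ 3 = (\<Prod>p\<in>A. (1 + 7 / real p * ind p m) ^ 3)" by (simp add: tau_def prod_power_distrib)
  also have "... <= tau 511 A m" unfolding tau_def
  proof (rule prod_mono, intro conjI)
    fix p assume "p \<in> A"
    show "0 <= (1 + 7 / real p * ind p m) ^ 3" by simp
    show "(1 + 7 / real p * ind p m) ^ 3 <= 1 + 511 / real p * ind p m"
    proof (cases "p = 0 \<or> \<not> int p dvd m")
      case True thus ?thesis by (auto simp: ind_def)
    next
      case False
      define x where "x = 1 / real p"
      have x: "0 <= x" "x <= 1" using False by (auto simp: x_def)
      have "x * x <= x * 1" using x by (intro mult_left_mono) auto
      moreover have "x * x * x <= x * 1 * 1" using x by (intro mult_mono) auto
      moreover have "(1 + 7 * x) ^ 3 = 1 + 21 * x + 147 * (x * x) + 343 * (x * x * x)"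
        by (simp add: power3_eq_cube algebra_simps)
      ultimately have "(1 + 7 * x) ^ 3 <= 1 + 511 * x" by simp
      thus ?thesis using False by (simp add: ind_def x_def)
    qed
  qed
  finally show ?thesis .
qed

lemma amgm3: assumes "1 <= a" "1 <= b" "1 <= (c::real)" shows "a * b * c <= (a ^ 3 + b ^ 3 + c ^ 3) / 3"
proof -
  have "(a ^ 3 + b ^ 3 + c ^ 3) - 3 * (a * b * c) = (a + b + c) * ((a - b)\<^sup>2 + (b - c)\<^sup>2 + (a - c)\<^sup>2) / 2"
    by (simp add: power2_eq_square power3_eq_cube algebra_simps)
  moreover have "0 <= (a + b + c) * ((a - b)\<^sup>2 + (b - c)\<^sup>2 + (a - c)\<^sup>2) / 2" using assms by simp
  ultimately show ?thesis by simp
qed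

text \<open>Collects the two inputs on the shifts: exact equidistribution modulo the small primes,
  and on average a small excess \<open>eta\<close> of the corrections at the middle primes.\<close>

locale pair_setup =
  fixes b j0 J K T :: nat and R eta :: real
  assumes j0: "1 <= j0" "j0 <= J" and R1: "R >= 1"
    and equi: "equidist (\<Prod>(upto_primes (2 ^ 2 ^ j0))) T"
    and tauK: "\<And>c0. \<bar>c0\<bar> <= 4 * 2 ^ K ==>
       (\<Sum>k | k < K & sh (Suc k) ~= c0. tau 511 (mid_primes j0 J) (sh (Suc k) - c0) - 1) <= real K * eta"
begin

sublocale selberg_weights "large_primes J R" R
proof
  show "finite (large_primes J R)" by simp
  show "\<And>p. p \<in> large_primes J R ==> prime p" by (simp add: large_primes_def)
qed (rule R1)

definition "QA = \<Prod>(upto_primes (2 ^ 2 ^ J))"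
definition "QL = \<Prod>(large_primes J R)"
definition "V0 = (\<Prod>p\<in>upto_primes (2 ^ 2 ^ j0). 1 - 1 / real p)"
definition "Vm = (\<Prod>p\<in>mid_primes j0 J. 1 - 1 / real p)"
definition "V = (\<Prod>p\<in>upto_primes (2 ^ 2 ^ J). 1 - 1 / real p)"
definition "cnu = (2 ^ 2 ^ 2 ^ j0 * real (2 ^ 2 ^ J) ^ (4 * (b + 1)) :: real)"
definition "eb = exp (6 * exp 1560 / 4 ^ b :: real)"
definition "sL = (\<Sum>p\<in>large_primes J R. 1 / real p)"
text \<open>The deviation in \<open>mean_lam_two_point\<close> for primes beyond
  \<open>2 ^ 2 ^ J\<close>; a difference of two elements of \<open>dd\<close> over
  \<open>pairs\<close> has at most \<open>K + 3\<close> prime divisors.\<close>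

definition "E1 = 16 * (real K + 3) / 2 ^ 2 ^ J * exp (15 * sL) + 16 * sL / 2 ^ 2 ^ J * exp (6 * sL)"

abbreviation "nn \<equiv> nu b j0 J"

text \<open>The sieve majorant of the second prime: equal to 1 at primes beyond both sieve limits
  and nonnegative everywhere.\<close>

definition beta :: "int => real" where "beta m = nn m * (lam m)\<^sup>2"
definition pairs :: "(nat \<times> nat) set" where "pairs = {e. fst e < K & snd e < K & fst e ~= snd e}"
definition dd :: "nat \<times> nat => int" where "dd e = sh (Suc (snd e)) - sh (Suc (fst e))"
text \<open>At a prime \<open>m\<close> this bounds the number of index pairs whose difference leads
  from \<open>m\<close> to another large prime. It is studied at all integers \<open>m\<close>,
  weighted by \<open>nn\<close>.\<close>

definition FF :: "int => real" where "FF m = (\<Sum>e\<in>pairs. beta (m + dd e))"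

lemma pairs_eq: "pairs = (SIGMA k:{..<K}. {l. l < K & l ~= k})"
  by (auto simp: pairs_def)

lemma finite_pairs [simp]: "finite pairs" by (simp add: pairs_eq)

lemma V_eq: "V = V0 * Vm"
  unfolding V_def V0_def Vm_def upto_primes_split(1)[OF j0(2)]
  using upto_primes_split(2)[OF j0(2)] by (simp add: prod.union_disjoint)

lemma one_minus_inverse_prime: "prime p ==> 0 < 1 - 1 / real p & 1 - 1 / real p <= 1"
  using prime_gt_1_nat[of p] by simp

lemma V_pos: "0 < V0" "0 < Vm" "0 < V" "V0 <= 1" "Vm <= 1"
proof -
  have "0 < (\<Prod>p\<in>A. 1 - 1 / real p) & (\<Prod>p\<in>A. 1 - 1 / real p) <= 1" if "\<And>p. p \<in> A ==> prime p" for A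
    using one_minus_inverse_prime[OF that] by (intro conjI prod_pos prod_le_1) (auto intro: less_imp_le)
  from this[of "upto_primes (2 ^ 2 ^ j0)"] this[of "mid_primes j0 J"] this[of "upto_primes (2 ^ 2 ^ J)"]
  show "0 < V0" "0 < Vm" "0 < V" "V0 <= 1" "Vm <= 1"
    unfolding V0_def Vm_def V_def by (auto simp: upto_primes_def mid_primes_def)
qed

lemma eb_ge_1: "1 <= eb" by (simp add: eb_def)

lemma QA_pos: "QA > 0" and QL_pos: "QL > 0" and QAQL: "coprime QA QL"
  unfolding QA_def QL_def
  by (auto intro!: Prod_primes_pos[unfolded neq0_conv] coprime_Prod_primes simp: upto_primes_def large_primes_def prime_gt_0_nat)

lemma beta_nonneg: "0 <= beta m" unfolding beta_def by (simp add: nu_nonneg)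

lemma per_nn: "per QA nn" unfolding QA_def by (rule apc_per[OF apc_nu[OF j0(2)]]) simp

lemma per_lam: "per QL lam" unfolding QL_def by (rule apc_per[OF apc_lam]) simp

lemma apc_nn: "apc (QA * QL) cnu nn" unfolding cnu_def QA_def by (rule apc_nu[OF j0(2)]) simp

lemma apc_beta: "apc (QA * QL) (cnu * (R * R)) beta"
proof -
  have "apc (QA * QL) R lam" unfolding QL_def by (rule apc_lam) simp
  hence "apc (QA * QL) (cnu * (R * R)) (\<lambda>m. nn m * (lam m * lam m))" by (intro apc_mult apc_nn)
  thus ?thesis by (simp add: beta_def[abs_def] power2_eq_square)
qed

text \<open>\<open>nu_le_cube\<close> reduces this to the three-point mean with equal points, where
  no correction factors arise.\<close>

lemma sum_nn_le: "(\<Sum>m\<in>{0..<int y}. nn m) <= real y * (V * eb) + cnu"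
proof -
  have "apc QA cnu nn" unfolding cnu_def QA_def by (rule apc_nu[OF j0(2)]) simp
  from apc_estimate[OF this QA_pos, of y] have "(\<Sum>m\<in>{0..<int y}. nn m) <= real y * mean QA nn + cnu" by linarith
  also have "mean QA nn <= V * eb"
  proof -
    have "mean QA nn <= mean QA (\<lambda>m. nn (m + 0) * nn (m + 0) * nn (m + 0))"
      by (intro mean_mono) (use nu_le_cube in simp)
    also have "... <= (\<Prod>p\<in>upto_primes (2 ^ 2 ^ j0). lp p 0 0 0) * (Vm ^ 1 * (\<Prod>p\<in>mid_primes j0 J. 1 + 0) * eb)"
      unfolding QA_def Vm_def eb_def
      by (rule mean_nu3_le[OF j0(2)]) (auto simp: lp_same mid_primes_def prime_gt_0_nat)
    also have "(\<Prod>p\<in>upto_primes (2 ^ 2 ^ j0). lp p 0 0 0) = V0"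
      unfolding V0_def by (intro prod.cong) (auto simp: lp_same upto_primes_def prime_gt_0_nat)
    finally show ?thesis by (simp add: V_eq)
  qed
  finally show ?thesis by (simp add: mult_left_mono)
qed

definition II :: "int => real" where "II = unsieved (upto_primes (2 ^ 2 ^ j0))"
definition "WW = \<Prod>(upto_primes (2 ^ 2 ^ j0))"

lemma WW_pos: "WW > 0" using equi by (auto simp: equidist_def WW_def)

lemma II01: "0 <= II m" "II m <= 1" "II m * II m = II m"
  by (auto simp: II_def unsieved_eq)

lemma per_II: "per WW II" unfolding WW_def II_def by (rule apc_per_unsieved)

lemma mean_II: "mean WW II = V0"
proof -
  have "mean WW II = mean WW (\<lambda>m. II (m + 0) * II (m + 0) * II (m + 0))" by (simp add: II01)
  also have "... = (\<Prod>p\<in>upto_primes (2 ^ 2 ^ j0). lp p 0 0 0)"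
    unfolding WW_def II_def by (rule mean_unsieved3) (auto simp: upto_prime)
  also have "... = V0" unfolding V0_def by (intro prod.cong) (auto simp: lp_same upto_primes_def prime_gt_0_nat)
  finally show ?thesis .
qed

text \<open>The part of \<open>FF\<close> seen by the exactly sieved primes, with the diagonal
  \<open>k = l\<close> included.\<close>

definition H :: "int => real" where "H m = (\<Sum>k<K. \<Sum>l<K. II (m + (sh (Suc l) - sh (Suc k))))"

text \<open>For every fixed \<open>k\<close> and \<open>m\<close> the inner sum runs over a full set
  of shifts and is equidistributed. Hence \<open>H\<close> is almost constant, pointwise and not
  merely on average, which is why the singular series disappears from the variance.\<close>

lemma H_bounds: "\<bar>H m - (real K)\<^sup>2 * V0\<bar> <= real K * real T"
proof -
  have "\<bar>(\<Sum>l<K. II (m + (sh (Suc l) - sh (Suc k)))) - real K * V0\<bar> <= 1 * real T" for k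
  proof -
    let ?f = "\<lambda>x. II (x + (m - sh (Suc k)))"
    have "\<bar>(\<Sum>l<K. ?f (sh (Suc l))) - real K * mean WW ?f\<bar> <= 1 * real T"
      by (rule equidist_average[OF equi[folded WW_def]]) (auto simp: II01 intro: per_shift per_II)
    moreover have "mean WW ?f = V0" using mean_shift[OF per_II WW_pos, of "m - sh (Suc k)"] mean_II by simp
    ultimately show ?thesis by (simp add: algebra_simps)
  qed
  hence "(\<Sum>k<K. \<bar>(\<Sum>l<K. II (m + (sh (Suc l) - sh (Suc k)))) - real K * V0\<bar>) <= (\<Sum>k<K. real T)" by (intro sum_mono) simp
  moreover have "\<bar>\<Sum>k<K. (\<Sum>l<K. II (m + (sh (Suc l) - sh (Suc k)))) - real K * V0\<bar> <= (\<Sum>k<K. \<bar>(\<Sum>l<K. II (m + (sh (Suc l) - sh (Suc k)))) - real K * V0\<bar>)"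
    by (rule sum_abs)
  ultimately show ?thesis by (simp add: H_def sum_subtractf power2_eq_square mult.assoc)
qed

lemma sum_pairs_split: "(\<Sum>k<K. \<Sum>l<K. f (sh (Suc l) - sh (Suc k))) = (\<Sum>e\<in>pairs. f (dd e)) + real K * (f 0 :: real)"
proof -
  have "(\<Sum>k<K. \<Sum>l<K. f (sh (Suc l) - sh (Suc k))) = (\<Sum>k<K. f 0 + (\<Sum>l | l < K & l ~= k. f (sh (Suc l) - sh (Suc k))))"
  proof (rule sum.cong[OF refl])
    fix k assume k: "k \<in> {..<K}"
    have "{..<K} - {k} = {l. l < K & l ~= k}" by auto
    with sum.remove[of "{..<K}" k "\<lambda>l. f (sh (Suc l) - sh (Suc k))"] k
    show "(\<Sum>l<K. f (sh (Suc l) - sh (Suc k))) = f 0 + (\<Sum>l | l < K & l ~= k. f (sh (Suc l) - sh (Suc k)))" by simp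
  qed
  also have "... = real K * f 0 + (\<Sum>k<K. \<Sum>l | l < K & l ~= k. f (sh (Suc l) - sh (Suc k)))" by (simp add: sum.distrib)
  also have "(\<Sum>k<K. \<Sum>l | l < K & l ~= k. f (sh (Suc l) - sh (Suc k))) = (\<Sum>e\<in>pairs. f (dd e))"
    unfolding pairs_eq by (subst sum.Sigma) (auto simp: dd_def case_prod_beta)
  finally show ?thesis by simp
qed

text \<open>Multiply the lower bound for \<open>H\<close> by \<open>II\<close> and take the mean;
  the last \<open>real K\<close> pays for removing the diagonal.\<close>

lemma sum_E2_ge: "V0 * ((real K)\<^sup>2 * V0 - real K * real T) - real K <= (\<Sum>e\<in>pairs. mean WW (\<lambda>m. II m * II (m + dd e)))"
proof -
  have "V0 * ((real K)\<^sup>2 * V0 - real K * real T) = mean WW (\<lambda>m. ((real K)\<^sup>2 * V0 - real K * real T) * II m)"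
    by (simp add: mean_cmult mean_II)
  also have "... <= mean WW (\<lambda>m. II m * H m)"
  proof (rule mean_mono)
    fix m
    have "(real K)\<^sup>2 * V0 - real K * real T <= H m" using H_bounds[of m] by linarith
    thus "((real K)\<^sup>2 * V0 - real K * real T) * II m <= II m * H m" using II01[of m] by (simp add: mult.commute mult_left_mono)
  qed
  also have "... = (\<Sum>k<K. \<Sum>l<K. mean WW (\<lambda>m. II m * II (m + (sh (Suc l) - sh (Suc k)))))"
    unfolding H_def sum_distrib_left mean_sum ..
  also have "... = (\<Sum>e\<in>pairs. mean WW (\<lambda>m. II m * II (m + dd e))) + real K * mean WW (\<lambda>m. II m * II (m + 0))"
    by (rule sum_pairs_split)
  also have "real K * mean WW (\<lambda>m. II m * II (m + 0)) <= real K * 1"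
    using mean_II V_pos by (intro mult_left_mono) (simp_all add: II01)
  finally show ?thesis by simp
qed

lemma sum_E3_le: "(\<Sum>e\<in>pairs. \<Sum>e'\<in>pairs. mean WW (\<lambda>m. II m * II (m + dd e) * II (m + dd e'))) <= V0 * ((real K)\<^sup>2 * V0 + real K * real T)\<^sup>2"
proof -
  have "(\<Sum>e\<in>pairs. \<Sum>e'\<in>pairs. mean WW (\<lambda>m. II m * II (m + dd e) * II (m + dd e'))) = mean WW (\<lambda>m. II m * (\<Sum>e\<in>pairs. II (m + dd e))\<^sup>2)"
  proof -
    have "II m * (\<Sum>e\<in>pairs. II (m + dd e))\<^sup>2 = (\<Sum>e\<in>pairs. \<Sum>e'\<in>pairs. II m * II (m + dd e) * II (m + dd e'))" for m
      unfolding power2_eq_square sum_product by (simp only: sum_distrib_left mult.assoc)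
    thus ?thesis by (simp only: mean_sum)
  qed
  also have "... <= mean WW (\<lambda>m. ((real K)\<^sup>2 * V0 + real K * real T)\<^sup>2 * II m)"
  proof (rule mean_mono)
    fix m
    have "(\<Sum>e\<in>pairs. II (m + dd e)) <= H m"
      unfolding H_def using sum_pairs_split[of "\<lambda>d. II (m + d)"] II01(1)[of m] by simp
    also have "... <= (real K)\<^sup>2 * V0 + real K * real T" using H_bounds[of m] by linarith
    finally have "(\<Sum>e\<in>pairs. II (m + dd e))\<^sup>2 <= ((real K)\<^sup>2 * V0 + real K * real T)\<^sup>2"
      by (intro power_mono sum_nonneg II01)
    thus "II m * (\<Sum>e\<in>pairs. II (m + dd e))\<^sup>2 <= ((real K)\<^sup>2 * V0 + real K * real T)\<^sup>2 * II m"
      using II01(1)[of m] by (simp add: mult.commute mult_left_mono)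
  qed
  also have "... = V0 * ((real K)\<^sup>2 * V0 + real K * real T)\<^sup>2" by (simp add: mean_cmult mean_II)
  finally show ?thesis .
qed

lemma lp_prod_E3: "(\<Prod>p\<in>upto_primes (2 ^ 2 ^ j0). lp p h1 h2 h3) = mean WW (\<lambda>m. II (m + h1) * II (m + h2) * II (m + h3))"
  unfolding WW_def II_def by (rule mean_unsieved3[symmetric]) (auto simp: upto_prime)

text \<open>The mean of \<open>nn m * beta (m + dd e)\<close> splits into the exactly sieved primes,
  the middle blocks and Selberg's \<open>1 / G\<close>. Only the first part depends on the pair
  after the lower bound, and \<open>sum_E2_ge\<close> averages it.\<close>

lemma sum_nnF_ge:
  "real y * (Vm\<^sup>2 * (1 - 4 / 2 ^ 2 ^ j0) * (1 / G) * (V0 * ((real K)\<^sup>2 * V0 - real K * real T) - real K)) - (real K)\<^sup>2 * (cnu * (cnu * (R * R)))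
    <= (\<Sum>m\<in>{0..<int y}. nn m * FF m)"
proof -
  have f4: "0 <= 1 - 4 / (2::real) ^ 2 ^ j0"
  proof -
    have "real 4 <= real (2 ^ 2 ^ j0)" using tower_gt_4[OF j0(1)] by (rule of_nat_mono)
    thus ?thesis by simp
  qed
  have one: "real y * (Vm\<^sup>2 * (1 - 4 / 2 ^ 2 ^ j0) * (1 / G) * mean WW (\<lambda>m. II m * II (m + dd e))) - cnu * (cnu * (R * R))
      <= (\<Sum>m\<in>{0..<int y}. nn m * beta (m + dd e))" for e
  proof -
    have "apc (QA * QL) (cnu * (cnu * (R * R))) (\<lambda>m. nn m * beta (m + dd e))"
      by (intro apc_mult apc_nn apc_shift apc_beta)
    from apc_estimate[OF this, of y] have "real y * mean (QA * QL) (\<lambda>m. nn m * beta (m + dd e)) - cnu * (cnu * (R * R)) <= (\<Sum>m\<in>{0..<int y}. nn m * beta (m + dd e))"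
      using QA_pos QL_pos by simp
    moreover have "mean (QA * QL) (\<lambda>m. nn m * beta (m + dd e)) = mean QA (\<lambda>m. nn (m + 0) * nn (m + dd e)) * mean QL (\<lambda>m. (lam (m + dd e))\<^sup>2)"
    proof -
      have "mean (QA * QL) (\<lambda>m. (nn (m + 0) * nn (m + dd e)) * (lam (m + dd e))\<^sup>2) = mean QA (\<lambda>m. nn (m + 0) * nn (m + dd e)) * mean QL (\<lambda>m. (lam (m + dd e))\<^sup>2)"
        by (intro mean_mult_coprime per_mult per_shift per_nn QAQL QA_pos QL_pos per_comp[where h = "\<lambda>x. x\<^sup>2"] per_lam)
      thus ?thesis by (simp add: beta_def mult.assoc)
    qed
    moreover have "mean QL (\<lambda>m. (lam (m + dd e))\<^sup>2) = 1 / G"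
      using mean_shift[of QL "\<lambda>m. (lam m)\<^sup>2" "dd e"] mean_lam_sq QL_pos per_comp[OF per_lam, of "\<lambda>x. x\<^sup>2"] by (simp add: QL_def)
    moreover have "mean WW (\<lambda>m. II m * II (m + dd e)) * (Vm\<^sup>2 * (1 - 4 / 2 ^ 2 ^ j0)) <= mean QA (\<lambda>m. nn (m + 0) * nn (m + dd e))"
    proof -
      have "(\<Prod>p\<in>upto_primes (2 ^ 2 ^ j0). lp p 0 (dd e) (dd e)) = mean WW (\<lambda>m. II m * II (m + dd e))"
        unfolding lp_prod_E3 by (simp add: mult.assoc II01)
      thus ?thesis using mean_nu_pair_ge[OF j0(2,1), of 0 "dd e" b] by (simp add: Vm_def QA_def)
    qed
    ultimately have "real y * (mean WW (\<lambda>m. II m * II (m + dd e)) * (Vm\<^sup>2 * (1 - 4 / 2 ^ 2 ^ j0)) * (1 / G)) <= real y * mean (QA * QL) (\<lambda>m. nn m * beta (m + dd e))"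
      using G_pos by (simp add: mult_left_mono mult_right_mono divide_right_mono)
    thus ?thesis using \<open>real y * mean (QA * QL) _ - _ <= _\<close> by (simp add: mult_ac)
  qed
  have card: "real (card pairs) <= (real K)\<^sup>2"
  proof -
    have "pairs \<subseteq> {..<K} \<times> {..<K}" by (auto simp: pairs_def)
    from card_mono[OF _ this] have "card pairs <= K * K" by (simp add: card_cartesian_product)
    hence "real (card pairs) <= real (K * K)" by (rule of_nat_mono)
    thus ?thesis by (simp add: power2_eq_square)
  qed
  define c1 where "c1 = real y * (Vm\<^sup>2 * (1 - 4 / 2 ^ 2 ^ j0) * (1 / G))"
  have c1: "0 <= c1" unfolding c1_def using f4 G_pos by simp
  have cc: "0 <= cnu * (cnu * (R * R))" using R1 by (simp add: cnu_def)
  have "c1 * (V0 * ((real K)\<^sup>2 * V0 - real K * real T) - real K) - (real K)\<^sup>2 * (cnu * (cnu * (R * R)))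
     <= c1 * (\<Sum>e\<in>pairs. mean WW (\<lambda>m. II m * II (m + dd e))) - real (card pairs) * (cnu * (cnu * (R * R)))"
    using sum_E2_ge c1 card cc by (intro diff_mono mult_left_mono mult_right_mono)
  also have "... = (\<Sum>e\<in>pairs. c1 * mean WW (\<lambda>m. II m * II (m + dd e)) - cnu * (cnu * (R * R)))"
    by (simp add: sum_subtractf sum_distrib_left)
  also have "... <= (\<Sum>e\<in>pairs. \<Sum>m\<in>{0..<int y}. nn m * beta (m + dd e))"
    using one by (intro sum_mono) (simp add: c1_def mult.assoc)
  also have "... = (\<Sum>m\<in>{0..<int y}. nn m * FF m)" by (subst sum.swap) (simp add: FF_def sum_distrib_left)
  finally show ?thesis by (simp add: c1_def mult.assoc)
qed

lemma dd_bound: "e \<in> pairs ==> \<bar>dd e\<bar> <= 2 ^ K"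
proof -
  assume e: "e \<in> pairs"
  have "sh (Suc k) <= 2 ^ K & 1 <= sh (Suc k)" if "k < K" for k
  proof -
    have "sh (Suc k) <= 2 ^ Suc k" by (rule sh_le_power)
    also have "... <= (2::int) ^ K" using that by (intro power_increasing) auto
    finally show ?thesis using sh_pos by auto
  qed
  from this[of "fst e"] this[of "snd e"] e show ?thesis by (auto simp: pairs_def dd_def)
qed

lemma dd_nonzero: "e \<in> pairs ==> dd e ~= 0"
  using sh_inj[of "Suc (fst e)" "Suc (snd e)"] by (auto simp: pairs_def dd_def)

text \<open>The Sidon property in the form used for the second moment: distinct pairs give three
  distinct points \<open>m\<close>, \<open>m + dd e\<close>, \<open>m + dd e'\<close>.\<close>

lemma dd_inj: "e \<in> pairs ==> e' \<in> pairs ==> dd e = dd e' ==> e = e'"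
  using sh_sidon[of "Suc (fst e)" "Suc (snd e)" "Suc (fst e')" "Suc (snd e')"]
  by (auto simp: pairs_def dd_def prod_eq_iff)

lemma mid_gt_4: "p \<in> mid_primes j0 J ==> prime p & 4 < p"
  using tower_gt_4[OF j0(1)] by (auto simp: mid_primes_def)

text \<open>The differences of the points \<open>0\<close>, \<open>dd e\<close> and
  \<open>dd e'\<close> are, up to sign, the three factors in the argument of
  \<open>tau\<close>.\<close>

lemma mean_off_diagonal:
  assumes e: "e \<in> pairs" "e' \<in> pairs" "e ~= e'"
  shows "mean (QA * QL) (\<lambda>m. nn m * beta (m + dd e) * beta (m + dd e'))
    <= mean WW (\<lambda>m. II m * II (m + dd e) * II (m + dd e')) * tau 7 (mid_primes j0 J) (dd e * dd e' * (dd e - dd e')) * (Vm ^ 3 * eb * ((1 / G)\<^sup>2 + E1))"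
proof -
  let ?d = "dd e" and ?d' = "dd e'"
  have ne: "?d - ?d' ~= 0" using dd_inj[OF e(1,2)] e(3) by auto
  have "mean (QA * QL) (\<lambda>m. nn m * beta (m + ?d) * beta (m + ?d'))
     = mean (QA * QL) (\<lambda>m. (nn (m + 0) * nn (m + ?d) * nn (m + ?d')) * ((lam (m + ?d))\<^sup>2 * (lam (m + ?d'))\<^sup>2))"
    by (simp add: beta_def mult_ac)
  also have "... = mean QA (\<lambda>m. nn (m + 0) * nn (m + ?d) * nn (m + ?d')) * mean QL (\<lambda>m. (lam (m + ?d))\<^sup>2 * (lam (m + ?d'))\<^sup>2)"
    by (intro mean_mult_coprime per_mult per_shift[of _ nn] per_nn QAQL QA_pos QL_pos per_comp[where h = "\<lambda>x. x\<^sup>2"] per_shift[of _ lam] per_lam)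
  also have "... <= (mean WW (\<lambda>m. II m * II (m + ?d) * II (m + ?d')) * (Vm ^ 3 * tau 7 (mid_primes j0 J) (?d * ?d' * (?d - ?d')) * eb)) * ((1 / G)\<^sup>2 + E1)"
  proof (rule mult_mono)
    have "mean QA (\<lambda>m. nn (m + 0) * nn (m + ?d) * nn (m + ?d')) <= (\<Prod>p\<in>upto_primes (2 ^ 2 ^ j0). lp p 0 ?d ?d') *
       (Vm ^ 3 * (\<Prod>p\<in>mid_primes j0 J. 1 + 7 / real p * ind p (?d * ?d' * (?d - ?d'))) * eb)"
      unfolding QA_def Vm_def eb_def
    proof (rule mean_nu3_le[OF j0(2)])
      fix p assume p: "p \<in> mid_primes j0 J"
      have "lp p 0 ?d ?d' <= (1 - 1 / real p) ^ 3 * (1 + (if int p dvd (0 - ?d) * (0 - ?d') * (?d - ?d') then 7 / real p else 0))"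
        using mid_gt_4[OF p] by (intro lp_triple_le) auto
      moreover have "(0 - ?d) * (0 - ?d') * (?d - ?d') = ?d * ?d' * (?d - ?d')" by simp
      ultimately show "lp p 0 ?d ?d' <= (1 - 1 / real p) ^ 3 * (1 + 7 / real p * ind p (?d * ?d' * (?d - ?d')))"
        by (auto simp: ind_def split: if_splits)
    qed auto
    thus "mean QA (\<lambda>m. nn (m + 0) * nn (m + ?d) * nn (m + ?d')) <= mean WW (\<lambda>m. II m * II (m + ?d) * II (m + ?d')) * (Vm ^ 3 * tau 7 (mid_primes j0 J) (?d * ?d' * (?d - ?d')) * eb)"
      unfolding lp_prod_E3 tau_def by simp
    have z0: "(0::real) < 2 ^ 2 ^ J" by simp
    have "(\<Sum>p | p \<in> large_primes J R & int p dvd ?d - ?d'. 16 / real p) <= (\<Sum>p | p \<in> large_primes J R & int p dvd ?d - ?d'. 16 / 2 ^ 2 ^ J)"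
    proof (rule sum_mono)
      fix p assume "p \<in> {p \<in> large_primes J R. int p dvd ?d - ?d'}"
      hence "real (2 ^ 2 ^ J) <= real p" "0 < real p" by (intro of_nat_mono, auto simp: large_primes_def prime_gt_0_nat)
      thus "16 / real p <= 16 / 2 ^ 2 ^ J" by (intro divide_left_mono mult_pos_pos) auto
    qed
    also have "... = real (card {p \<in> large_primes J R. int p dvd ?d - ?d'}) * (16 / 2 ^ 2 ^ J)" by simp
    also have "... <= real (K + 3) * (16 / 2 ^ 2 ^ J)"
    proof (intro mult_right_mono of_nat_mono card_prime_divisors_le[of _ "?d - ?d'"])
      have "\<bar>?d - ?d'\<bar> <= 2 ^ K + 2 ^ K" using dd_bound[OF e(1)] dd_bound[OF e(2)] by linarith
      also have "... <= 2 ^ (K + 3)" by (simp add: power_add)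
      finally show "\<bar>?d - ?d'\<bar> <= 2 ^ (K + 3)" .
      show "finite {p \<in> large_primes J R. int p dvd ?d - ?d'}" by simp
    qed (use ne in \<open>auto simp: large_primes_def\<close>)
    finally have a: "(\<Sum>p | p \<in> large_primes J R & int p dvd ?d - ?d'. 16 / real p) <= 16 * (real K + 3) / 2 ^ 2 ^ J" by (simp add: mult.commute)
    have "(\<Sum>p\<in>large_primes J R. 16 / (real p)\<^sup>2) <= (\<Sum>p\<in>large_primes J R. 16 / 2 ^ 2 ^ J * (1 / real p))"
    proof (rule sum_mono)
      fix p assume "p \<in> large_primes J R"
      hence "real (2 ^ 2 ^ J) <= real p" "0 < real p" by (intro of_nat_mono, auto simp: large_primes_def prime_gt_0_nat)
      hence "2 ^ 2 ^ J * real p <= real p * real p" "(0::real) < 2 ^ 2 ^ J * real p" "0 < real p" by (auto intro: mult_right_mono)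
      hence "16 / (real p * real p) <= 16 / (2 ^ 2 ^ J * real p)" by (intro divide_left_mono mult_pos_pos) auto
      thus "16 / (real p)\<^sup>2 <= 16 / 2 ^ 2 ^ J * (1 / real p)" by (simp add: power2_eq_square)
    qed
    also have "... = 16 / 2 ^ 2 ^ J * sL" unfolding sL_def by (rule sum_distrib_left[symmetric])
    finally have c: "(\<Sum>p\<in>large_primes J R. 16 / (real p)\<^sup>2) <= 16 * sL / 2 ^ 2 ^ J" by simp
    have "mean QL (\<lambda>m. (lam (m + ?d))\<^sup>2 * (lam (m + ?d'))\<^sup>2) <= (1 / G)\<^sup>2 + (\<Sum>p | p \<in> large_primes J R & int p dvd ?d - ?d'. 16 / real p) * exp (15 * sL)
        + (\<Sum>p\<in>large_primes J R. 16 / (real p)\<^sup>2) * exp (6 * sL)"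
      unfolding QL_def sL_def by (rule mean_lam_two_point)
    also have "... <= (1 / G)\<^sup>2 + 16 * (real K + 3) / 2 ^ 2 ^ J * exp (15 * sL) + 16 * sL / 2 ^ 2 ^ J * exp (6 * sL)"
      by (intro add_mono mult_right_mono a c) auto
    finally show "mean QL (\<lambda>m. (lam (m + ?d))\<^sup>2 * (lam (m + ?d'))\<^sup>2) <= (1 / G)\<^sup>2 + E1" by (simp add: E1_def)
    have "0 <= tau 7 (mid_primes j0 J) (?d * ?d' * (?d - ?d'))" using tau_ge_1[of 7] by (meson order.trans zero_le_numeral zero_le_one)
    thus "0 <= mean WW (\<lambda>m. II m * II (m + ?d) * II (m + ?d')) * (Vm ^ 3 * tau 7 (mid_primes j0 J) (?d * ?d' * (?d - ?d')) * eb)"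
      using V_pos eb_ge_1 by (intro mult_nonneg_nonneg mean_nonneg II01) auto
  qed (auto intro!: mean_nonneg)
  finally show ?thesis by (simp only: mult_ac)
qed

text \<open>The fourth power of \<open>lam\<close> is estimated crudely, without the saving
  \<open>1 / G\<close>. There are at most \<open>K ^ 2\<close> such terms against about
  \<open>K ^ 4\<close> others, which outweighs the loss.\<close>

lemma mean_diagonal:
  assumes e: "e \<in> pairs"
  shows "mean (QA * QL) (\<lambda>m. nn m * beta (m + dd e) * beta (m + dd e)) <= tau 511 (mid_primes j0 J) (dd e) * (Vm\<^sup>2 * eb * exp (15 * sL))"
proof -
  let ?d = "dd e"
  have "mean (QA * QL) (\<lambda>m. nn m * beta (m + ?d) * beta (m + ?d))
     = mean (QA * QL) (\<lambda>m. (nn (m + 0) * nn (m + ?d) * nn (m + ?d)) * (lam (m + ?d)) ^ 4)"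
    by (simp add: beta_def mult_ac power2_eq_square power4_eq_xxxx)
  also have "... = mean QA (\<lambda>m. nn (m + 0) * nn (m + ?d) * nn (m + ?d)) * mean QL (\<lambda>m. (lam (m + ?d)) ^ 4)"
    by (intro mean_mult_coprime per_mult per_shift[of _ nn] per_nn QAQL QA_pos QL_pos per_comp[where h = "\<lambda>x. x ^ 4"] per_shift[of _ lam] per_lam)
  also have "... <= (1 * (Vm\<^sup>2 * tau 511 (mid_primes j0 J) ?d * eb)) * exp (15 * sL)"
  proof (rule mult_mono)
    have t1: "1 <= tau 7 (mid_primes j0 J) ?d" by (simp add: tau_ge_1)
    have "mean QA (\<lambda>m. nn (m + 0) * nn (m + ?d) * nn (m + ?d)) <= (\<Prod>p\<in>upto_primes (2 ^ 2 ^ j0). lp p 0 ?d ?d) *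
       (Vm\<^sup>2 * (\<Prod>p\<in>mid_primes j0 J. 1 + 7 / real p * ind p ?d) * eb)"
      unfolding QA_def Vm_def eb_def
    proof (rule mean_nu3_le[OF j0(2)])
      fix p assume p: "p \<in> mid_primes j0 J"
      have "lp p 0 ?d ?d <= (1 - 1 / real p)\<^sup>2 * (1 + (if int p dvd 0 - ?d then 7 / real p else 0))"
        using mid_gt_4[OF p] by (intro lp_pair_le) auto
      thus "lp p 0 ?d ?d <= (1 - 1 / real p)\<^sup>2 * (1 + 7 / real p * ind p ?d)"
        by (auto simp: ind_def split: if_splits)
    qed auto
    also have "(\<Prod>p\<in>mid_primes j0 J. 1 + 7 / real p * ind p ?d) = tau 7 (mid_primes j0 J) ?d" by (simp add: tau_def)
    also have "(\<Prod>p\<in>upto_primes (2 ^ 2 ^ j0). lp p 0 ?d ?d) * (Vm\<^sup>2 * tau 7 (mid_primes j0 J) ?d * eb) <= 1 * (Vm\<^sup>2 * tau 511 (mid_primes j0 J) ?d * eb)"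
    proof (intro mult_mono mult_left_mono prod_le_1 conjI)
      have "tau 7 (mid_primes j0 J) ?d <= tau 7 (mid_primes j0 J) ?d ^ 3" using t1 power_increasing[of 1 3 "tau 7 (mid_primes j0 J) ?d"] by simp
      also have "... <= tau 511 (mid_primes j0 J) ?d" by (rule tau_cube_le)
      finally show "tau 7 (mid_primes j0 J) ?d <= tau 511 (mid_primes j0 J) ?d" .
    qed (use eb_ge_1 t1 tau_ge_1[of 511 "mid_primes j0 J" ?d] in \<open>auto simp: lp_nonneg lp_le_1 upto_primes_def prime_gt_0_nat intro!: prod_nonneg\<close>)
    finally show "mean QA (\<lambda>m. nn (m + 0) * nn (m + ?d) * nn (m + ?d)) <= 1 * (Vm\<^sup>2 * tau 511 (mid_primes j0 J) ?d * eb)" .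
    show "mean QL (\<lambda>m. (lam (m + ?d)) ^ 4) <= exp (15 * sL)"
      using mean_shift[of QL "\<lambda>m. (lam m) ^ 4" ?d] mean_lam_pow4_le QL_pos per_comp[OF per_lam, of "\<lambda>x. x ^ 4"] by (simp add: QL_def sL_def)
    show "0 <= 1 * (Vm\<^sup>2 * tau 511 (mid_primes j0 J) ?d * eb)"
      using eb_ge_1 tau_ge_1[of 511 "mid_primes j0 J" ?d] by simp
  qed (auto intro!: mean_nonneg)
  finally show ?thesis by (simp only: mult_ac mult_1_left)
qed

lemma card_pairs: "real (card pairs) <= (real K)\<^sup>2"
proof -
  have "pairs \<subseteq> {..<K} \<times> {..<K}" by (auto simp: pairs_def)
  from card_mono[OF _ this] have "card pairs <= K * K" by (simp add: card_cartesian_product)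
  hence "real (card pairs) <= real (K * K)" by (rule of_nat_mono)
  thus ?thesis by (simp add: power2_eq_square)
qed

text \<open>For a fixed first index, \<open>tauK\<close> applies with \<open>sh (Suc k) + c\<close>
  as the excluded value; its size explains the 3 here against the 4 in the locale.\<close>

lemma sum_tau_shift:
  assumes "\<bar>c\<bar> <= 3 * 2 ^ K" shows "(\<Sum>e\<in>{e\<in>pairs. dd e ~= c}. tau 511 (mid_primes j0 J) (dd e - c) - 1) <= (real K)\<^sup>2 * eta"
proof -
  have "(\<Sum>e\<in>{e\<in>pairs. dd e ~= c}. tau 511 (mid_primes j0 J) (dd e - c) - 1)
     <= (\<Sum>e\<in>(SIGMA k:{..<K}. {l. l < K & sh (Suc l) ~= sh (Suc k) + c}). tau 511 (mid_primes j0 J) (dd e - c) - 1)"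
    by (intro sum_mono2) (auto simp: pairs_def dd_def tau_ge_1)
  also have "... = (\<Sum>k<K. \<Sum>l | l < K & sh (Suc l) ~= sh (Suc k) + c. tau 511 (mid_primes j0 J) (sh (Suc l) - (sh (Suc k) + c)) - 1)"
    by (subst sum.Sigma) (auto simp: dd_def case_prod_beta algebra_simps)
  also have "... <= (\<Sum>k<K. real K * eta)"
  proof (rule sum_mono, rule tauK)
    fix k assume k: "k \<in> {..<K}"
    have "sh (Suc k) <= 2 ^ Suc k" by (rule sh_le_power)
    also have "... <= (2::int) ^ K" using k by (intro power_increasing) auto
    finally show "\<bar>sh (Suc k) + c\<bar> <= 4 * 2 ^ K" using assms sh_pos[of "Suc k"] by linarith
  qed
  finally show ?thesis by (simp add: power2_eq_square)
qed

lemma sum_tau_pairs: "(\<Sum>e\<in>pairs. tau 511 (mid_primes j0 J) (dd e) - 1) <= (real K)\<^sup>2 * eta"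
proof -
  have "{e\<in>pairs. dd e ~= 0} = pairs" using dd_nonzero by auto
  thus ?thesis using sum_tau_shift[of 0] by simp
qed

lemma eta_nonneg: "K > 0 ==> 0 <= eta"
proof -
  assume K: "K > 0"
  have "0 <= (\<Sum>k | k < K & sh (Suc k) ~= 0. tau 511 (mid_primes j0 J) (sh (Suc k) - 0) - 1)"
    by (intro sum_nonneg) (simp add: tau_ge_1)
  also have "... <= real K * eta" by (rule tauK) simp
  finally show ?thesis using K by (simp add: zero_le_mult_iff)
qed

text \<open>\<open>tau\<close> is submultiplicative, and \<open>amgm3\<close> splits the product
  into cubes of single factors, which \<open>tau 511\<close> absorbs. Each of the three families of
  differences is then averaged alone.\<close>

lemma sum_tau_quads:
  "(\<Sum>e\<in>pairs. \<Sum>e'\<in>pairs - {e}. tau 7 (mid_primes j0 J) (dd e * dd e' * (dd e - dd e')) - 1) <= (real K) ^ 4 * eta"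
proof (cases "K = 0")
  case True
  have "pairs = {}" unfolding pairs_def using True by simp
  thus ?thesis using True by simp
next
  case False
  define t where "t = (\<lambda>m. tau 511 (mid_primes j0 J) m - 1)"
  have t0: "0 <= t m" for m by (simp add: t_def tau_ge_1)
  have K2: "0 <= (real K)\<^sup>2 * eta" using eta_nonneg False by simp
  have pt: "tau 7 (mid_primes j0 J) (x * y * z) - 1 <= (t x + t y + t z) / 3" for x y z
  proof -
    define a b c where "a = tau 7 (mid_primes j0 J) x" "b = tau 7 (mid_primes j0 J) y" "c = tau 7 (mid_primes j0 J) z"
    note d = this
    have g: "1 <= a" "1 <= b" "1 <= c" unfolding d by (auto simp: tau_ge_1)
    have "tau 7 (mid_primes j0 J) (x * y * z) <= tau 7 (mid_primes j0 J) (x * y) * c"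
      unfolding d using mid_gt_4 by (intro tau_mult_le) auto
    also have "... <= (a * b) * c"
      unfolding d using mid_gt_4 tau_ge_1[of 7 "mid_primes j0 J" z] by (intro mult_right_mono tau_mult_le) auto
    also have "... <= (a ^ 3 + b ^ 3 + c ^ 3) / 3" using amgm3[OF g] by simp
    also have "... <= ((t x + 1) + (t y + 1) + (t z + 1)) / 3"
      unfolding d t_def using tau_cube_le[of "mid_primes j0 J"] by (intro divide_right_mono add_mono) auto
    finally show ?thesis by simp
  qed
  have "(\<Sum>e\<in>pairs. \<Sum>e'\<in>pairs - {e}. tau 7 (mid_primes j0 J) (dd e * dd e' * (dd e - dd e')) - 1)
     <= (\<Sum>e\<in>pairs. \<Sum>e'\<in>pairs - {e}. (t (dd e) + t (dd e') + t (dd e - dd e')) / 3)"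
    by (intro sum_mono pt)
  also have "... = ((\<Sum>e\<in>pairs. \<Sum>e'\<in>pairs - {e}. t (dd e)) + (\<Sum>e\<in>pairs. \<Sum>e'\<in>pairs - {e}. t (dd e')) + (\<Sum>e\<in>pairs. \<Sum>e'\<in>pairs - {e}. t (dd e - dd e'))) / 3"
    by (simp only: sum.distrib sum_divide_distrib[symmetric])
  also have "... <= (((real K)\<^sup>2 * ((real K)\<^sup>2 * eta)) + ((real K)\<^sup>2 * ((real K)\<^sup>2 * eta)) + ((real K)\<^sup>2 * ((real K)\<^sup>2 * eta))) / 3"
  proof (intro divide_right_mono add_mono)
    have "(\<Sum>e\<in>pairs. \<Sum>e'\<in>pairs - {e}. t (dd e)) <= (\<Sum>e\<in>pairs. \<Sum>e'\<in>pairs. t (dd e))"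
      by (intro sum_mono sum_mono2) (auto simp: t0)
    also have "... = real (card pairs) * (\<Sum>e\<in>pairs. t (dd e))" by (simp add: sum_distrib_left)
    also have "... <= (real K)\<^sup>2 * ((real K)\<^sup>2 * eta)"
      using sum_tau_pairs K2 by (intro mult_mono card_pairs) (auto simp: t_def sum_nonneg tau_ge_1)
    finally show "(\<Sum>e\<in>pairs. \<Sum>e'\<in>pairs - {e}. t (dd e)) <= (real K)\<^sup>2 * ((real K)\<^sup>2 * eta)" .
    have "(\<Sum>e\<in>pairs. \<Sum>e'\<in>pairs - {e}. t (dd e')) <= (\<Sum>e\<in>pairs. \<Sum>e'\<in>pairs. t (dd e'))"
      by (intro sum_mono sum_mono2) (auto simp: t0)
    also have "... = real (card pairs) * (\<Sum>e\<in>pairs. t (dd e))" by simp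
    also have "... <= (real K)\<^sup>2 * ((real K)\<^sup>2 * eta)"
      using sum_tau_pairs K2 by (intro mult_mono card_pairs) (auto simp: t_def sum_nonneg tau_ge_1)
    finally show "(\<Sum>e\<in>pairs. \<Sum>e'\<in>pairs - {e}. t (dd e')) <= (real K)\<^sup>2 * ((real K)\<^sup>2 * eta)" .
    have "(\<Sum>e\<in>pairs. \<Sum>e'\<in>pairs - {e}. t (dd e - dd e')) = (\<Sum>x\<in>(SIGMA e:pairs. pairs - {e}). t (dd (fst x) - dd (snd x)))"
      by (subst sum.Sigma) (auto simp: case_prod_beta)
    also have "... = (\<Sum>x\<in>(SIGMA e':pairs. {e\<in>pairs. dd e ~= dd e'}). t (dd (snd x) - dd (fst x)))"
      by (rule sum.reindex_bij_witness[where i = prod.swap and j = prod.swap]) (auto dest: dd_inj)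
    also have "... = (\<Sum>e'\<in>pairs. \<Sum>e\<in>{e\<in>pairs. dd e ~= dd e'}. t (dd e - dd e'))"
      by (subst sum.Sigma) (auto simp: case_prod_beta)
    also have "... <= (\<Sum>e'\<in>pairs. (real K)\<^sup>2 * eta)"
    proof (rule sum_mono)
      fix e' assume "e' \<in> pairs"
      hence "\<bar>dd e'\<bar> <= 3 * 2 ^ K" using dd_bound[of e'] by auto
      thus "(\<Sum>e\<in>{e\<in>pairs. dd e ~= dd e'}. t (dd e - dd e')) <= (real K)\<^sup>2 * eta" unfolding t_def by (rule sum_tau_shift)
    qed
    also have "... <= (real K)\<^sup>2 * ((real K)\<^sup>2 * eta)" using mult_right_mono[OF card_pairs K2] by simp
    finally show "(\<Sum>e\<in>pairs. \<Sum>e'\<in>pairs - {e}. t (dd e - dd e')) <= (real K)\<^sup>2 * ((real K)\<^sup>2 * eta)" .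
  qed simp
  also have "... = (real K) ^ 4 * eta" by (simp add: power4_eq_xxxx power2_eq_square)
  finally show ?thesis .
qed

lemma sum_nnF2_le:
  "(\<Sum>m\<in>{0..<int y}. nn m * (FF m)\<^sup>2) <= real y * ((Vm ^ 3 * eb * ((1 / G)\<^sup>2 + E1)) * (V0 * ((real K)\<^sup>2 * V0 + real K * real T)\<^sup>2 + real K ^ 4 * eta)
     + (Vm\<^sup>2 * eb * exp (15 * sL)) * ((real K)\<^sup>2 + (real K)\<^sup>2 * eta)) + real K ^ 4 * (cnu * (cnu * (R * R)) * (cnu * (R * R)))"
proof -
  define f where "f = (\<lambda>e e'. mean (QA * QL) (\<lambda>m. nn m * beta (m + dd e) * beta (m + dd e')))"
  define CC where "CC = cnu * (cnu * (R * R)) * (cnu * (R * R))"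
  have CC0: "0 <= CC" using R1 by (simp add: CC_def cnu_def)
  have one: "(\<Sum>m\<in>{0..<int y}. nn m * beta (m + dd e) * beta (m + dd e')) <= real y * f e e' + CC" for e e'
  proof -
    have "apc (QA * QL) CC (\<lambda>m. nn m * beta (m + dd e) * beta (m + dd e'))"
      unfolding CC_def by (intro apc_mult apc_nn apc_shift apc_beta)
    from apc_estimate[OF this, of y] show ?thesis unfolding f_def using QA_pos QL_pos by simp
  qed
  define c3 where "c3 = Vm ^ 3 * eb * ((1 / G)\<^sup>2 + E1)"
  have sL0: "0 <= sL" unfolding sL_def by (intro sum_nonneg) auto
  have c3: "0 <= c3" unfolding c3_def E1_def using V_pos eb_ge_1 sL0 by (intro mult_nonneg_nonneg add_nonneg_nonneg) auto
  define g where "g = (\<lambda>e e'. mean WW (\<lambda>m. II m * II (m + dd e) * II (m + dd e')))"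
  define t where "t = (\<lambda>e e'. tau 7 (mid_primes j0 J) (dd e * dd e' * (dd e - dd e')))"
  have g01: "0 <= g e e'" "g e e' <= 1" for e e'
  proof -
    show "0 <= g e e'" unfolding g_def by (intro mean_nonneg mult_nonneg_nonneg II01)
    have "g e e' <= mean WW (\<lambda>m. 1)" unfolding g_def by (intro mean_mono mult_le_one II01 mult_nonneg_nonneg)
    thus "g e e' <= 1" using WW_pos by simp
  qed
  have t1: "1 <= t e e'" for e e' unfolding t_def by (simp add: tau_ge_1)
  have off: "f e e' <= (g e e' + (t e e' - 1)) * c3" if "e \<in> pairs" "e' \<in> pairs - {e}" for e e'
  proof -
    have "f e e' <= g e e' * t e e' * c3" unfolding f_def g_def t_def c3_def using that by (intro mean_off_diagonal) auto
    \<comment> \<open>Since \<open>g\<close> is at most 1 and \<open>t\<close> at least 1, the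
      excess \<open>t - 1\<close> separates from \<open>g\<close>; small and middle primes can be
      averaged independently.\<close>
    also have "g e e' * t e e' <= g e e' + (t e e' - 1)"
      using mult_right_mono[of "g e e'" 1 "t e e' - 1"] g01[of e e'] t1[of e e'] by (simp add: algebra_simps)
    finally show ?thesis using c3 by (simp add: mult_right_mono)
  qed
  have "(\<Sum>m\<in>{0..<int y}. nn m * (FF m)\<^sup>2) = (\<Sum>m\<in>{0..<int y}. \<Sum>e\<in>pairs. \<Sum>e'\<in>pairs. nn m * beta (m + dd e) * beta (m + dd e'))"
    unfolding FF_def power2_eq_square sum_product by (simp only: sum_distrib_left mult.assoc)
  also have "... = (\<Sum>e\<in>pairs. \<Sum>m\<in>{0..<int y}. \<Sum>e'\<in>pairs. nn m * beta (m + dd e) * beta (m + dd e'))" by (rule sum.swap)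
  also have "... = (\<Sum>e\<in>pairs. \<Sum>e'\<in>pairs. \<Sum>m\<in>{0..<int y}. nn m * beta (m + dd e) * beta (m + dd e'))" by (intro sum.cong refl sum.swap)
  also have "... <= (\<Sum>e\<in>pairs. \<Sum>e'\<in>pairs. real y * f e e' + CC)" by (intro sum_mono one)
  also have "... = real y * (\<Sum>e\<in>pairs. \<Sum>e'\<in>pairs. f e e') + (real (card pairs))\<^sup>2 * CC"
    by (simp add: sum.distrib sum_distrib_left power2_eq_square)
  also have "(\<Sum>e\<in>pairs. \<Sum>e'\<in>pairs. f e e') = (\<Sum>e\<in>pairs. f e e) + (\<Sum>e\<in>pairs. \<Sum>e'\<in>pairs - {e}. f e e')"
    by (simp add: sum.distrib[symmetric] sum.remove)
  also have "(\<Sum>e\<in>pairs. f e e) <= (Vm\<^sup>2 * eb * exp (15 * sL)) * ((real K)\<^sup>2 + (real K)\<^sup>2 * eta)"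
  proof -
    have "(\<Sum>e\<in>pairs. f e e) <= (\<Sum>e\<in>pairs. tau 511 (mid_primes j0 J) (dd e) * (Vm\<^sup>2 * eb * exp (15 * sL)))"
      unfolding f_def by (intro sum_mono mean_diagonal)
    also have "... = (Vm\<^sup>2 * eb * exp (15 * sL)) * (real (card pairs) + (\<Sum>e\<in>pairs. tau 511 (mid_primes j0 J) (dd e) - 1))"
      by (simp add: sum_subtractf sum_distrib_right mult.commute)
    also have "... <= (Vm\<^sup>2 * eb * exp (15 * sL)) * ((real K)\<^sup>2 + (real K)\<^sup>2 * eta)"
      using eb_ge_1 by (intro mult_left_mono add_mono card_pairs sum_tau_pairs) auto
    finally show ?thesis .
  qed
  also have "(\<Sum>e\<in>pairs. \<Sum>e'\<in>pairs - {e}. f e e') <= c3 * (V0 * ((real K)\<^sup>2 * V0 + real K * real T)\<^sup>2 + real K ^ 4 * eta)"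
  proof -
    have "(\<Sum>e\<in>pairs. \<Sum>e'\<in>pairs - {e}. f e e') <= (\<Sum>e\<in>pairs. \<Sum>e'\<in>pairs - {e}. (g e e' + (t e e' - 1)) * c3)"
      using off by (intro sum_mono) auto
    also have "... = c3 * ((\<Sum>e\<in>pairs. \<Sum>e'\<in>pairs - {e}. g e e') + (\<Sum>e\<in>pairs. \<Sum>e'\<in>pairs - {e}. t e e' - 1))"
    proof -
      have "(\<Sum>e\<in>pairs. \<Sum>e'\<in>pairs - {e}. (g e e' + (t e e' - 1)) * c3) = (\<Sum>e\<in>pairs. \<Sum>e'\<in>pairs - {e}. g e e' + (t e e' - 1)) * c3"
        by (simp only: sum_distrib_right)
      thus ?thesis by (simp only: sum.distrib mult.commute)
    qed
    also have "... <= c3 * (V0 * ((real K)\<^sup>2 * V0 + real K * real T)\<^sup>2 + real K ^ 4 * eta)"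
    proof (intro mult_left_mono add_mono c3)
      have "(\<Sum>e\<in>pairs. \<Sum>e'\<in>pairs - {e}. g e e') <= (\<Sum>e\<in>pairs. \<Sum>e'\<in>pairs. g e e')"
        using g01 by (intro sum_mono sum_mono2) auto
      also have "... <= V0 * ((real K)\<^sup>2 * V0 + real K * real T)\<^sup>2" unfolding g_def by (rule sum_E3_le)
      finally show "(\<Sum>e\<in>pairs. \<Sum>e'\<in>pairs - {e}. g e e') <= V0 * ((real K)\<^sup>2 * V0 + real K * real T)\<^sup>2" .
      show "(\<Sum>e\<in>pairs. \<Sum>e'\<in>pairs - {e}. t e e' - 1) <= real K ^ 4 * eta" unfolding t_def by (rule sum_tau_quads)
    qed
    finally show ?thesis .
  qed
  also have "(real (card pairs))\<^sup>2 * CC <= real K ^ 4 * CC"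
  proof (rule mult_right_mono[OF _ CC0])
    have "(real (card pairs))\<^sup>2 <= ((real K)\<^sup>2)\<^sup>2" by (intro power_mono card_pairs) auto
    thus "(real (card pairs))\<^sup>2 <= real K ^ 4" by simp
  qed
  finally show ?thesis unfolding c3_def CC_def by (simp add: mult_left_mono add.commute)
qed

text \<open>The relative variance. Its leading terms are second moment, minus twice the first
  moment, plus mass, that is \<open>1 - 2 + 1\<close>; the last two summands come from the diagonal
  and from the remainders of all the progressions.\<close>

definition "Delta y = eb * (1 + E1 * G\<^sup>2) * ((1 + real T / (real K * V0))\<^sup>2 + eta / V0 ^ 3)
   - 2 * (1 - 4 / 2 ^ 2 ^ j0) * (1 - real T / (real K * V0) - 1 / (real K * V0\<^sup>2)) + eb
   + eb * exp (15 * sL) * (1 + eta) * G\<^sup>2 / ((real K)\<^sup>2 * V * V0\<^sup>2)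
   + 4 * cnu ^ 3 * R ^ 4 * G\<^sup>2 / (real y * V ^ 3)"

lemma G_ge_1: "1 <= G"
proof -
  have "1 / phi {} <= G" unfolding G_def
    by (rule member_le_sum) (use phi_pos supp_subset in \<open>auto intro: less_imp_le\<close>)
  thus ?thesis by (simp add: phi_def)
qed

lemma cnu_ge_1: "1 <= cnu"
  unfolding cnu_def by (intro mult_ge1_I one_le_power) auto

lemma V_le_1: "V <= 1" using V_pos mult_le_one[of V0 Vm] by (simp add: V_eq)

text \<open>The expected value of \<open>FF\<close> is \<open>c\<close>, so the scale of the second
  moment is \<open>B\<close>: the mass \<open>y * V\<close> of the weight times the square of
  \<open>c\<close>.\<close>

lemma variance_le:
  assumes K: "K > 0" and y: "y > 0"
  shows "(\<Sum>m\<in>{0..<int y}. nn m * (FF m - (real K)\<^sup>2 * V / G)\<^sup>2) <= real y * (real K ^ 4 * V ^ 3 / G\<^sup>2) * Delta y"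
proof -
  define c where "c = (real K)\<^sup>2 * V / G"
  define B where "B = real y * (real K ^ 4 * V ^ 3 / G\<^sup>2)"
  define u where "u = real T / (real K * V0)"
  define i where "i = 1 - 4 / (2::real) ^ 2 ^ j0"
  note G = G_pos
  have Vm: "Vm = V / V0" using V_pos by (simp add: V_eq)
  have c0: "0 <= c" unfolding c_def using V_pos G by simp
  have KR: "real K > 0" "real y > 0" using K y by auto
  have c_le: "c <= (real K)\<^sup>2"
  proof -
    have "V / G <= 1" using V_le_1 G_ge_1 by simp
    hence "(real K)\<^sup>2 * (V / G) <= (real K)\<^sup>2 * 1" by (intro mult_left_mono) auto
    thus ?thesis by (simp add: c_def)
  qed
  \<comment> \<open>One bound for all remainders; the largest comes from the triple correlation,
    with three factors \<open>cnu\<close> and four factors \<open>R\<close>.\<close>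
  define q where "q = cnu ^ 3 * R ^ 4"
  have q: "cnu * (cnu * (R * R)) * (cnu * (R * R)) = q" by (simp add: q_def power3_eq_cube power4_eq_xxxx mult_ac)
  have R2: "1 <= R * R" using R1 by (simp add: mult_ge1_I)
  have q1: "cnu * (cnu * (R * R)) <= q"
  proof -
    have "1 <= cnu * (R * R)" using cnu_ge_1 R2 by (rule mult_ge1_I)
    hence "cnu * (cnu * (R * R)) * 1 <= cnu * (cnu * (R * R)) * (cnu * (R * R))"
      using cnu_ge_1 R2 by (intro mult_left_mono) auto
    thus ?thesis using q by simp
  qed
  have q2: "cnu <= q"
  proof -
    have "1 <= cnu * (R * R)" using cnu_ge_1 R2 by (rule mult_ge1_I)
    hence "cnu * 1 <= cnu * (cnu * (R * R))" using cnu_ge_1 by (intro mult_left_mono) auto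
    thus ?thesis using q1 by simp
  qed
  have q0: "0 <= q" using q2 cnu_ge_1 by linarith
  have S0: "c\<^sup>2 * (\<Sum>m\<in>{0..<int y}. nn m) <= B * eb + real K ^ 4 * q"
  proof -
    have "c\<^sup>2 * (\<Sum>m\<in>{0..<int y}. nn m) <= c\<^sup>2 * (real y * (V * eb) + cnu)" by (intro mult_left_mono sum_nn_le) auto
    also have "... = B * eb + c\<^sup>2 * cnu" by (simp add: B_def c_def power_divide power_mult_distrib distrib_left add_divide_distrib power2_eq_square power3_eq_cube power4_eq_xxxx mult_ac)
    also have "c\<^sup>2 * cnu <= ((real K)\<^sup>2)\<^sup>2 * q" using c_le c0 q2 cnu_ge_1 by (intro mult_mono power_mono) auto
    finally show ?thesis by simp
  qed
  have S1: "B * (i * (1 - u - 1 / (real K * V0\<^sup>2))) - real K ^ 4 * q <= c * (\<Sum>m\<in>{0..<int y}. nn m * FF m)"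
  proof -
    have "B * (i * (1 - u - 1 / (real K * V0\<^sup>2))) = c * (real y * (Vm\<^sup>2 * i * (1 / G) * (V0 * ((real K)\<^sup>2 * V0 - real K * real T) - real K)))"
    proof -
      have "V0 * ((real K)\<^sup>2 * V0 - real K * real T) - real K = (real K)\<^sup>2 * V0\<^sup>2 * (1 - u - 1 / (real K * V0\<^sup>2))"
        unfolding u_def using KR V_pos by (simp add: field_simps power2_eq_square)
      moreover have "c * (real y * (Vm\<^sup>2 * i * (1 / G) * ((real K)\<^sup>2 * V0\<^sup>2 * X))) = B * (i * X)" for X
        unfolding c_def B_def Vm using V_pos G by (simp add: power_divide power2_eq_square power3_eq_cube power4_eq_xxxx mult_ac)
      ultimately show ?thesis by simp
    qed
    moreover have "c * ((real K)\<^sup>2 * (cnu * (cnu * (R * R)))) <= (real K)\<^sup>2 * ((real K)\<^sup>2 * q)"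
      using c_le c0 q1 cnu_ge_1 R2 by (intro mult_mono) auto
    moreover have "(real K)\<^sup>2 * ((real K)\<^sup>2 * q) = real K ^ 4 * q" by (simp add: power4_eq_xxxx power2_eq_square)
    moreover have "c * (real y * (Vm\<^sup>2 * i * (1 / G) * (V0 * ((real K)\<^sup>2 * V0 - real K * real T) - real K)) - (real K)\<^sup>2 * (cnu * (cnu * (R * R)))) <= c * (\<Sum>m\<in>{0..<int y}. nn m * FF m)"
      unfolding i_def by (intro mult_left_mono sum_nnF_ge c0)
    ultimately show ?thesis by (simp add: right_diff_distrib)
  qed
  define D2 where "D2 = eb * exp (15 * sL) * (1 + eta) * G\<^sup>2 / ((real K)\<^sup>2 * V * V0\<^sup>2)"
  have S2: "(\<Sum>m\<in>{0..<int y}. nn m * (FF m)\<^sup>2) <= B * (eb * (1 + E1 * G\<^sup>2) * ((1 + u)\<^sup>2 + eta / V0 ^ 3)) + B * D2 + real K ^ 4 * q"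
  proof -
    have e1: "real y * ((Vm ^ 3 * eb * ((1 / G)\<^sup>2 + E1)) * (V0 * ((real K)\<^sup>2 * V0 + real K * real T)\<^sup>2 + real K ^ 4 * eta)) = B * (eb * (1 + E1 * G\<^sup>2) * ((1 + u)\<^sup>2 + eta / V0 ^ 3))"
    proof -
      have f: "(real K)\<^sup>2 * V0 + real K * real T = (real K)\<^sup>2 * V0 * (1 + u)" unfolding u_def using KR V_pos by (simp add: field_simps power2_eq_square)
      have a: "V0 * ((real K)\<^sup>2 * V0 + real K * real T)\<^sup>2 + real K ^ 4 * eta = real K ^ 4 * V0 ^ 3 * ((1 + u)\<^sup>2 + eta / V0 ^ 3)"
        unfolding f using V_pos by (simp add: power_mult_distrib distrib_left power2_eq_square power3_eq_cube power4_eq_xxxx mult_ac)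
      have b: "(1 / G)\<^sup>2 + E1 = (1 + E1 * G\<^sup>2) / G\<^sup>2" using G by (simp add: power_divide add_divide_distrib)
      show ?thesis unfolding a b B_def Vm using V_pos by (simp add: power_divide mult_ac)
    qed
    have e2: "real y * ((Vm\<^sup>2 * eb * exp (15 * sL)) * ((real K)\<^sup>2 + (real K)\<^sup>2 * eta)) = B * D2"
    proof -
      have "(real K)\<^sup>2 + (real K)\<^sup>2 * eta = (real K)\<^sup>2 * (1 + eta)" by (simp add: distrib_left)
      thus ?thesis unfolding B_def D2_def Vm using V_pos G KR by (simp add: power_divide power2_eq_square power3_eq_cube power4_eq_xxxx mult_ac)
    qed
    show ?thesis using sum_nnF2_le[of y] unfolding distrib_left[of "real y"] e1 e2 q by simp
  qed
  have "(\<Sum>m\<in>{0..<int y}. nn m * (FF m - c)\<^sup>2) = (\<Sum>m\<in>{0..<int y}. nn m * (FF m)\<^sup>2) - 2 * (c * (\<Sum>m\<in>{0..<int y}. nn m * FF m)) + c\<^sup>2 * (\<Sum>m\<in>{0..<int y}. nn m)"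
    by (simp add: power2_diff sum.distrib sum_subtractf sum_distrib_left algebra_simps)
  also have "... <= (B * (eb * (1 + E1 * G\<^sup>2) * ((1 + u)\<^sup>2 + eta / V0 ^ 3)) + B * D2 + real K ^ 4 * q)
     - 2 * (B * (i * (1 - u - 1 / (real K * V0\<^sup>2))) - real K ^ 4 * q) + (B * eb + real K ^ 4 * q)"
  proof (rule add_mono[OF diff_mono[OF S2] S0])
    show "2 * (B * (i * (1 - u - 1 / (real K * V0\<^sup>2))) - real K ^ 4 * q) <= 2 * (c * (\<Sum>m\<in>{0..<int y}. nn m * FF m))"
      by (rule mult_left_mono[OF S1]) simp
  qed
  also have "... = B * (eb * (1 + E1 * G\<^sup>2) * ((1 + u)\<^sup>2 + eta / V0 ^ 3) - 2 * i * (1 - u - 1 / (real K * V0\<^sup>2)) + eb + D2) + 4 * (real K ^ 4 * q)"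
    by (simp add: algebra_simps)
  also have "4 * (real K ^ 4 * q) = B * (4 * cnu ^ 3 * R ^ 4 * G\<^sup>2 / (real y * V ^ 3))"
    unfolding B_def q_def using KR V_pos G by (simp add: field_simps)
  finally show ?thesis unfolding c_def B_def[symmetric] Delta_def u_def i_def D2_def by (simp add: distrib_left mult.assoc)
qed

text \<open>The primes removed by \<open>nu\<close> play the part of \<open>T\<close> in
  \<open>G_ge\<close>. The density \<open>V\<close> cancels, and the sieve constant depends on the
  level \<open>R\<close> alone.\<close>

lemma VG_le: assumes "R > 1" shows "V / G <= 1 / ln R"
proof -
  have "V * ln R <= G" unfolding V_def
  proof (rule G_ge)
    fix p assume "prime p" "real p <= R"
    thus "p \<in> upto_primes (2 ^ 2 ^ J) \<union> large_primes J R" by (auto simp: upto_primes_def large_primes_def)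
  qed (auto simp: upto_primes_def large_primes_def)
  thus ?thesis using G_pos assms by (simp add: field_simps)
qed

lemma V_le_ln: "V <= 1 / ln (2 ^ 2 ^ J)"
proof -
  define z :: nat where "z = 2 ^ 2 ^ J"
  have z2: "z >= 2" using power_increasing[of 1 "2 ^ J" "2::nat"] by (simp add: z_def)
  have "ln (real z) <= ln (real (z + 1))" using z2 by simp
  also have "... <= harm z" using ln_le_harm[of z] by (simp add: add.commute)
  also have "... = (\<Sum>n\<in>{1..z}. 1 / real n)" by (simp add: harm_def inverse_eq_divide)
  also have "... <= (\<Prod>p\<in>upto_primes z. if p \<in> {} then 1 / (real p - 1) else 1 / (1 - 1 / real p))"
  proof (rule sum_inverse_smooth_le)
    fix n assume n: "n \<in> {1..z}"
    have "p \<in> upto_primes z" if "p \<in> prime_factors n" for p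
      using that n dvd_imp_le[of p n] by (auto simp: upto_primes_def)
    thus "n > 0 & prime_factors n \<subseteq> upto_primes z & {} \<subseteq> prime_factors n" using n by auto
  qed (auto simp: upto_primes_def)
  also have "... = 1 / V" by (simp add: V_def z_def prod_dividef)
  finally have "ln (real z) <= 1 / V" .
  moreover have "0 < ln (real z)" using z2 by simp
  ultimately show ?thesis using V_pos by (simp add: z_def field_simps)
qed

lemma Delta_nonneg: assumes "K > 0" "y > 0" shows "0 <= Delta y"
proof -
  have "0 <= (\<Sum>m\<in>{0..<int y}. nn m * (FF m - (real K)\<^sup>2 * V / G)\<^sup>2)" by (intro sum_nonneg mult_nonneg_nonneg nu_nonneg) auto
  also have "... <= real y * (real K ^ 4 * V ^ 3 / G\<^sup>2) * Delta y" by (rule variance_le) fact+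
  finally have "0 <= real y * (real K ^ 4 * V ^ 3 / G\<^sup>2) * Delta y" .
  moreover have "0 < real y * (real K ^ 4 * V ^ 3 / G\<^sup>2)" using assms V_pos G_pos by (intro mult_pos_pos divide_pos_pos) auto
  ultimately show ?thesis by (simp only: zero_le_mult_iff) linarith
qed

text \<open>Cauchy-Schwarz over the primes. As \<open>nn\<close> is 1 there, the variance over
  primes is part of the weighted variance over all integers. The price is the ratio of the two
  masses, about \<open>ln y / ln (2 ^ 2 ^ J)\<close>, which is bounded.\<close>

lemma sum_primes_FF_le:
  assumes K: "K > 0" and y: "y > 0" and R: "R > 1" and PP: "finite PP" "\<And>p. p \<in> PP ==> prime p & 2 ^ 2 ^ J < p & p < y"
  shows "(\<Sum>p\<in>PP. FF (int p)) <= (real K)\<^sup>2 / ln R * (real (card PP) + sqrt (real (card PP) * real y * Delta y / ln (2 ^ 2 ^ J)))"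
proof -
  define c where "c = (real K)\<^sup>2 * V / G"
  define n where "n = real (card PP)"
  have c0: "0 <= c" unfolding c_def using V_pos G_pos by simp
  have lz: "0 < ln ((2::real) ^ 2 ^ J)" by simp
  have D0: "0 <= Delta y" by (rule Delta_nonneg) fact+
  have "(\<Sum>p\<in>PP. FF (int p) - c)\<^sup>2 <= n * (\<Sum>p\<in>PP. (FF (int p) - c)\<^sup>2)"
    using Cauchy_Schwarz_ineq_sum[of "\<lambda>_. 1" "\<lambda>p. FF (int p) - c" PP] by (simp add: n_def)
  also have "(\<Sum>p\<in>PP. (FF (int p) - c)\<^sup>2) = (\<Sum>p\<in>PP. nn (int p) * (FF (int p) - c)\<^sup>2)"
    using PP nu_prime[OF _ _ j0(2)] by (intro sum.cong) auto
  also have "... = (\<Sum>m\<in>int ` PP. nn m * (FF m - c)\<^sup>2)" by (subst sum.reindex) (auto simp: inj_on_def)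
  also have "... <= (\<Sum>m\<in>{0..<int y}. nn m * (FF m - c)\<^sup>2)" using PP nu_nonneg by (intro sum_mono2) auto
  also have "... <= real y * (real K ^ 4 * V ^ 3 / G\<^sup>2) * Delta y" unfolding c_def by (rule variance_le) fact+
  also have "... = c\<^sup>2 * (real y * V * Delta y)" by (simp add: c_def power_divide power_mult_distrib power2_eq_square power3_eq_cube power4_eq_xxxx mult_ac)
  also have "... <= c\<^sup>2 * (real y * (1 / ln (2 ^ 2 ^ J)) * Delta y)"
    using V_le_ln D0 by (intro mult_left_mono mult_right_mono) auto
  finally have "(\<Sum>p\<in>PP. FF (int p) - c)\<^sup>2 <= n * (c\<^sup>2 * (real y * (1 / ln (2 ^ 2 ^ J)) * Delta y))"
    by (simp add: n_def mult_left_mono)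
  also have "... = c\<^sup>2 * (n * real y * Delta y / ln (2 ^ 2 ^ J))" by simp
  finally have "\<bar>\<Sum>p\<in>PP. FF (int p) - c\<bar> <= sqrt (c\<^sup>2 * (n * real y * Delta y / ln (2 ^ 2 ^ J)))"
    by (metis real_sqrt_abs real_sqrt_le_mono)
  hence "(\<Sum>p\<in>PP. FF (int p) - c) <= c * sqrt (n * real y * Delta y / ln (2 ^ 2 ^ J))"
    using c0 unfolding real_sqrt_mult by simp
  hence "(\<Sum>p\<in>PP. FF (int p)) <= c * (n + sqrt (n * real y * Delta y / ln (2 ^ 2 ^ J)))"
    by (simp add: sum_subtractf n_def distrib_left mult.commute)
  also have "... <= (real K)\<^sup>2 / ln R * (n + sqrt (n * real y * Delta y / ln (2 ^ 2 ^ J)))"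
  proof (rule mult_right_mono)
    show "c <= (real K)\<^sup>2 / ln R" unfolding c_def using VG_le[OF R] mult_left_mono[of "V / G" "1 / ln R" "(real K)\<^sup>2"] by simp
    show "0 <= n + sqrt (n * real y * Delta y / ln (2 ^ 2 ^ J))" using D0 lz by (auto simp: n_def)
  qed
  finally show ?thesis by (simp add: n_def)
qed

lemma lam_prime: assumes "prime p" "R < real p" shows "lam (int p) = 1"
proof -
  have "lam (int p) = (\<Sum>S\<in>{{}}. rho S * ind (\<Prod>S) (int p))" unfolding lam_def
  proof (rule sum.mono_neutral_right)
    show "\<forall>S\<in>supp - {{}}. rho S * ind (\<Prod>S) (int p) = 0"
    proof
      fix S assume S: "S \<in> supp - {{}}"
      then obtain q where q: "q \<in> S" by auto
      hence qp: "prime q" "real q <= R" using S supp_subset[of S] by (auto simp: large_primes_def)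
      have "\<not> q dvd p" using qp assms primes_dvd_imp_eq[of q p] by auto
      moreover have "ind (\<Prod>S) (int p) = (if \<forall>p'\<in>S. int p' dvd int p then 1 else 0)" using S supp_subset by (intro ind_Prod) auto
      ultimately show "rho S * ind (\<Prod>S) (int p) = 0" using q by auto
    qed
  qed auto
  also have "... = 1" by (simp add: ind_def)
  finally show ?thesis .
qed

lemma beta_prime: assumes "prime p" "R < real p" "2 ^ 2 ^ J < p" shows "beta (int p) = 1"
  unfolding beta_def using lam_prime[OF assms(1,2)] nu_prime[OF assms(1,3) j0(2)] by simp

text \<open>Each prime of \<open>PP\<close> has weight 1, so a lower bound for the number of primes
  yields one for the density \<open>V\<close>.\<close>

lemma V_ge: assumes "finite PP" "\<And>p. p \<in> PP ==> prime p & 2 ^ 2 ^ J < p & p < y"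
  shows "real (card PP) <= real y * (V * eb) + cnu"
proof -
  have "real (card PP) = (\<Sum>p\<in>PP. nn (int p))" using assms nu_prime[OF _ _ j0(2)] by simp
  also have "... = (\<Sum>m\<in>int ` PP. nn m)" by (subst sum.reindex) (auto simp: inj_on_def)
  also have "... <= (\<Sum>m\<in>{0..<int y}. nn m)" using assms nu_nonneg by (intro sum_mono2) auto
  also have "... <= real y * (V * eb) + cnu" by (rule sum_nn_le)
  finally show ?thesis .
qed

end

section \<open>The prime number theorem\<close>

text \<open>The summand of the zeta series for the integer \<open>n + 1\<close>, so that series
  start at \<open>n = 0\<close>.\<close>

definition npow :: "nat => complex => complex" where
  "npow n s = of_nat (Suc n) powr (- s)"

lemma norm_npow: "norm (npow n s) = real (Suc n) powr (- Re s)"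
  unfolding npow_def using norm_powr_real_powr[of "of_nat (Suc n)" "-s"] by (simp del: of_nat_Suc)

lemma nat_powr_exp: "of_nat (Suc n) powr z = exp (z * complex_of_real (ln (real (Suc n))))"
  using Ln_of_nat[of "Suc n"] by (simp add: powr_def del: of_nat_Suc)

lemma npow_deriv: "(npow n has_field_derivative - of_real (ln (real (Suc n))) * npow n s) (at s)"
  unfolding npow_def nat_powr_exp by (auto intro!: derivative_eq_intros simp del: of_nat_Suc)

definition half_plane :: "real => complex set" where "half_plane c = {s. Re s > c}"

lemma open_half_plane [simp]: "open (half_plane c)"
  unfolding half_plane_def by (rule open_halfspace_Re_gt)

lemma summable_Suc_powr: "a > 1 ==> summable (\<lambda>n. real (Suc n) powr (- a))"
  using summable_real_powr_iff[of "- a"] summable_Suc_iff[of "\<lambda>n. real n powr (- a)"] by simp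

text \<open>The function \<open>(s - 1) \<zeta>(s)\<close>, written as a series that converges for \<open>Re s > 0\<close>.\<close>

definition Hterm :: "nat => complex => complex" where
  "Hterm n s = of_nat (Suc (Suc n)) powr (1 - s) - of_nat (Suc n) powr (1 - s) - (1 - s) * npow n s"

text \<open>\<open>Hterm\<close> is the first-order Taylor remainder of
  \<open>z powr (1 - s)\<close> between consecutive integers; the second derivative supplies the
  factor \<open>(1 - s) * s\<close> and one more power of decay.\<close>

lemma Hterm_bound:
  assumes "Re s > 0"
  shows "norm (Hterm n s) <= norm (1 - s) * norm s * real (Suc n) powr (- Re s - 1)"
proof -
  define S where "S = closed_segment (of_nat (Suc n)) (of_nat (Suc (Suc n)) :: complex)"
  define f where "f = (\<lambda>i z. if i = 0 then z powr (1 - s) else if i = Suc 0 then (1 - s) * z powr (- s) else (1 - s) * (- s) * z powr (- s - 1))"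
  have S: "\<exists>x\<ge>real (Suc n). z = of_real x" if z: "z \<in> S" for z
  proof -
    have "z \<in> closed_segment (complex_of_real (real (Suc n))) (complex_of_real (real (Suc (Suc n))))"
      using z by (simp only: S_def of_real_of_nat_eq)
    hence "z \<in> complex_of_real ` closed_segment (real (Suc n)) (real (Suc (Suc n)))" by (simp only: closed_segment_of_real)
    then obtain x where "x \<in> closed_segment (real (Suc n)) (real (Suc (Suc n)))" "z = of_real x" by blast
    thus ?thesis by (auto simp: closed_segment_eq_real_ivl)
  qed
  have "norm (f 0 (of_nat (Suc (Suc n))) - (\<Sum>i\<le>1. f i (of_nat (Suc n)) * (of_nat (Suc (Suc n)) - of_nat (Suc n)) ^ i / (fact i)))
     <= (norm (1 - s) * norm s * real (Suc n) powr (- Re s - 1)) * norm (of_nat (Suc (Suc n)) - of_nat (Suc n) :: complex) ^ (Suc 1) / fact 1"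
  proof (rule complex_Taylor[where S = S])
    fix i z assume z: "z \<in> S" and i: "i <= (1::nat)"
    obtain x where x: "x >= real (Suc n)" "z = of_real x" using S[OF z] by blast
    hence nz: "z \<notin> \<real>\<^sub>\<le>\<^sub>0" by (auto simp: complex_nonpos_Reals_iff)
    have "i = 0 \<or> i = Suc 0" using i by auto
    thus "(f i has_field_derivative f (Suc i) z) (at z within S)"
    proof
      assume "i = 0"
      thus ?thesis unfolding f_def using nz by (auto intro!: derivative_eq_intros)
    next
      assume "i = Suc 0"
      thus ?thesis unfolding f_def using nz by (auto intro!: derivative_eq_intros)
    qed
  next
    fix z assume "z \<in> S"
    then obtain x where x: "x >= real (Suc n)" "z = of_real x" using S by blast
    have "norm (z powr (- s - 1)) = x powr (- Re s - 1)" using x norm_powr_real_powr[of z "- s - 1"] by simp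
    also have "... <= real (Suc n) powr (- Re s - 1)" using x assms by (intro powr_mono2') auto
    finally show "norm (f (Suc 1) z) <= norm (1 - s) * norm s * real (Suc n) powr (- Re s - 1)"
      by (simp add: f_def norm_mult mult_left_mono)
  qed (auto simp: S_def)
  thus ?thesis by (simp add: f_def Hterm_def npow_def algebra_simps)
qed

text \<open>A majorant that holds for bounded arguments in each closed smaller half-plane gives
  local uniform convergence: take a ball of half the distance to the boundary.\<close>

lemma series_deriv_half_plane:
  fixes f f' :: "nat => complex => complex"
  assumes d: "\<And>n s. Re s > c ==> (f n has_field_derivative f' n s) (at s)"
    and bd: "\<And>a M. a > c ==> \<exists>h. summable h & (\<forall>n s. Re s >= a --> norm s <= M --> norm (f n s) <= h n)"
  obtains g g' where "\<And>s. Re s > c ==> (\<lambda>n. f n s) sums g s" "\<And>s. Re s > c ==> (\<lambda>n. f' n s) sums g' s"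
    "\<And>s. Re s > c ==> (g has_field_derivative g' s) (at s)"
proof -
  have "\<exists>g g'. \<forall>x\<in>half_plane c. ((\<lambda>n. f n x) sums g x) & ((\<lambda>n. f' n x) sums g' x) & (g has_field_derivative g' x) (at x)"
  proof (rule series_and_derivative_comparison_complex[OF open_half_plane])
    fix x assume x: "x \<in> half_plane c"
    define a where "a = (Re x + c) / 2"
    define e where "e = (Re x - c) / 2"
    have ae: "a > c" "e > 0" using x by (auto simp: a_def e_def half_plane_def)
    obtain h where h: "summable h" "\<And>n s. Re s >= a ==> norm s <= norm x + e ==> norm (f n s) <= h n"
      using bd[OF ae(1)] by blast
    define h' where "h' = (\<lambda>n. complex_of_real (h n))"
    have h0: "0 <= h n" for n
    proof -
      have "norm (f n x) <= h n" using ae by (intro h(2)) (auto simp: a_def e_def field_simps)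
      thus ?thesis using norm_ge_zero order.trans by blast
    qed
    have "\<forall>y\<in>ball x e \<inter> half_plane c. norm (f n y) <= norm (h' n)" for n
    proof
      fix y assume y: "y \<in> ball x e \<inter> half_plane c"
      hence n: "norm (x - y) < e" by (simp add: dist_norm)
      have "Re x - Re y <= norm (x - y)" using complex_Re_le_cmod[of "x - y"] by simp
      hence "Re y >= a" using n by (simp add: a_def e_def field_simps)
      moreover have "norm y <= norm x + e" using n norm_triangle_ineq2[of y x] by (simp add: norm_minus_commute)
      ultimately show "norm (f n y) <= norm (h' n)" using h(2)[of y n] h0[of n] by (simp add: h'_def)
    qed
    moreover have "summable h'" unfolding h'_def using h(1) by (simp add: summable_of_real)
    moreover have "range h' \<subseteq> \<real>\<^sub>\<ge>\<^sub>0" using h0 by (auto simp: h'_def)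
    ultimately show "\<exists>d h. 0 < d & summable h & range h \<subseteq> \<real>\<^sub>\<ge>\<^sub>0 & (\<forall>\<^sub>F n in sequentially. \<forall>y\<in>ball x d \<inter> half_plane c. cmod (f n y) <= cmod (h n))"
      using ae(2) by (intro exI[of _ e] exI[of _ h'] conjI always_eventually allI) auto
  next
    fix n x assume "x \<in> half_plane c"
    thus "(f n has_field_derivative f' n x) (at x)" by (intro d) (simp add: half_plane_def)
  qed
  thus ?thesis using that by (auto simp: half_plane_def)
qed

lemma H_exists:
  obtains H H' where "\<And>s. Re s > 0 ==> (\<lambda>n. Hterm n s) sums (H s - 1)"
    "\<And>s. Re s > 0 ==> (H has_field_derivative H' s) (at s)"
proof -
  define f' where "f' = (\<lambda>n s. deriv (Hterm n) s)"
  obtain g g' where g: "\<And>s. Re s > 0 ==> (\<lambda>n. Hterm n s) sums g s" "\<And>s. Re s > 0 ==> (\<lambda>n. f' n s) sums g' s"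
    "\<And>s. Re s > 0 ==> (g has_field_derivative g' s) (at s)"
  proof (rule series_deriv_half_plane[of 0 Hterm f'])
    fix n s assume "Re s > (0::real)"
    have "Hterm n field_differentiable (at s)" unfolding Hterm_def npow_def nat_powr_exp field_differentiable_def
      by (rule exI) (auto intro!: derivative_eq_intros simp del: of_nat_Suc)
    thus "(Hterm n has_field_derivative f' n s) (at s)" unfolding f'_def by (simp add: field_differentiable_derivI)
  next
    fix a M :: real assume a: "a > 0"
    have "norm (Hterm n s) <= (1 + M) * M * real (Suc n) powr (- (a + 1))" if s: "Re s >= a" "norm s <= M" for n s
    proof -
      have "norm (Hterm n s) <= norm (1 - s) * norm s * real (Suc n) powr (- Re s - 1)" using s a by (intro Hterm_bound) auto
      also have "... <= (1 + M) * M * real (Suc n) powr (- (a + 1))"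
      proof (intro mult_mono powr_mono)
        show "norm (1 - s) <= 1 + M" using norm_triangle_ineq4[of 1 s] s by simp
        show "0 <= (1 + M) * M" using s norm_ge_zero[of s] by (intro mult_nonneg_nonneg) linarith+
        show "0 <= 1 + M" using s norm_ge_zero[of s] by linarith
      qed (use s in auto)
      finally show ?thesis .
    qed
    moreover have "summable (\<lambda>n. (1 + M) * M * real (Suc n) powr (- (a + 1)))"
      using a by (intro summable_mult summable_Suc_powr) auto
    ultimately show "\<exists>h. summable h & (\<forall>n s. Re s >= a --> norm s <= M --> norm (Hterm n s) <= h n)" by blast
  qed blast
  show ?thesis
  proof (rule that[of "\<lambda>s. 1 + g s" g'])
    fix s :: complex assume s: "Re s > 0"
    show "(\<lambda>n. Hterm n s) sums (1 + g s - 1)" using g(1)[OF s] by simp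
    show "((\<lambda>s. 1 + g s) has_field_derivative g' s) (at s)" using g(3)[OF s] by (auto intro!: derivative_eq_intros)
  qed
qed

definition L :: "complex => complex" where
  "L s = (\<Sum>n. of_real (mangoldt (Suc n)) * npow n s)"

definition zeta :: "complex => complex" where "zeta s = (\<Sum>n. npow n s)"

lemma zeta_deriv:
  assumes "Re s > 1"
  shows "(\<lambda>n. npow n s) sums zeta s"
    and "\<exists>D. (\<lambda>n. - of_real (ln (real (Suc n))) * npow n s) sums D & (zeta has_field_derivative D) (at s)"
proof -
  obtain g g' where g: "\<And>s. Re s > 1 ==> (\<lambda>n. npow n s) sums g s"
    "\<And>s. Re s > 1 ==> (\<lambda>n. - of_real (ln (real (Suc n))) * npow n s) sums g' s"
    "\<And>s. Re s > 1 ==> (g has_field_derivative g' s) (at s)"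
  proof (rule series_deriv_half_plane[of 1 npow "\<lambda>n s. - of_real (ln (real (Suc n))) * npow n s"])
    fix n s show "(npow n has_field_derivative - of_real (ln (real (Suc n))) * npow n s) (at s)" by (rule npow_deriv)
  next
    fix a M :: real assume a: "a > 1"
    have "norm (npow n s) <= real (Suc n) powr (- a)" if "Re s >= a" for n s
      unfolding norm_npow using that by (intro powr_mono) auto
    thus "\<exists>h. summable h & (\<forall>n s. Re s >= a --> norm s <= M --> norm (npow n s) <= h n)"
      using summable_Suc_powr[OF a] by blast
  qed blast
  have gz: "g s = zeta s" if "Re s > 1" for s using g(1)[OF that] by (simp add: zeta_def sums_iff)
  show "(\<lambda>n. npow n s) sums zeta s" using g(1)[OF assms] gz[OF assms] by simp
  have "(zeta has_field_derivative g' s) (at s)"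
  proof (rule has_field_derivative_transform_within_open[OF g(3)[OF assms] open_half_plane[of 1]])
    show "s \<in> half_plane 1" using assms by (simp add: half_plane_def)
    show "\<And>x. x \<in> half_plane 1 ==> g x = zeta x" by (simp add: gz half_plane_def)
  qed
  thus "\<exists>D. (\<lambda>n. - of_real (ln (real (Suc n))) * npow n s) sums D & (zeta has_field_derivative D) (at s)"
    using g(2)[OF assms] by blast
qed

text \<open>The first two parts of \<open>Hterm\<close> telescope to \<open>-1\<close>, hence the
  offset in \<open>h - 1\<close>.\<close>

lemma H_eq_zeta:
  assumes H: "(\<lambda>n. Hterm n s) sums (h - 1)" and s: "Re s > 1" shows "h = (s - 1) * zeta s"
proof -
  have "(\<lambda>n. of_nat (Suc n) powr (1 - s)) \<longlonglongrightarrow> 0"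
  proof (rule tendsto_norm_zero_cancel)
    have "norm (of_nat (Suc n) powr (1 - s) :: complex) = real (Suc n) powr (1 - Re s)" for n
      using norm_powr_real_powr[of "of_nat (Suc n)" "1 - s"] by (simp del: of_nat_Suc)
    moreover have "(\<lambda>n. real (Suc n) powr (1 - Re s)) \<longlonglongrightarrow> 0" using s by real_asymp
    ultimately show "(\<lambda>n. norm (of_nat (Suc n) powr (1 - s) :: complex)) \<longlonglongrightarrow> 0" by simp
  qed
  from telescope_sums[OF this] have "(\<lambda>n. of_nat (Suc (Suc n)) powr (1 - s) - of_nat (Suc n) powr (1 - s)) sums (0 - 1)" by simp
  from sums_diff[OF this sums_mult[OF zeta_deriv(1)[OF s], of "1 - s"]]
  have "(\<lambda>n. Hterm n s) sums (0 - 1 - (1 - s) * zeta s)" by (simp add: Hterm_def)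
  from sums_unique2[OF this H] show ?thesis by (simp add: algebra_simps)
qed

lemma L_summable: assumes "Re s > 1" shows "summable (\<lambda>n. norm (of_real (mangoldt (Suc n)) * npow n s))"
proof -
  define a where "a = (Re s + 1) / 2"
  have a: "a > 1" "a < Re s" using assms by (auto simp: a_def)
  have "(\<lambda>n. real (Suc n) powr (- (Re s - a)) * ln (real (Suc n))) \<longlonglongrightarrow> 0" using a by real_asymp
  hence "Bseq (\<lambda>n. real (Suc n) powr (- (Re s - a)) * ln (real (Suc n)))" by (rule convergent_imp_Bseq[OF convergentI])
  then obtain B where B: "\<And>n. norm (real (Suc n) powr (- (Re s - a)) * ln (real (Suc n))) <= B" unfolding Bseq_def by blast
  show ?thesis
  proof (rule summable_comparison_test)
    show "summable (\<lambda>n. B * real (Suc n) powr (- a))" using a by (intro summable_mult summable_Suc_powr)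
    have "norm (of_real (mangoldt (Suc n)) * npow n s) <= B * real (Suc n) powr (- a)" for n
    proof -
      have "norm (of_real (mangoldt (Suc n)) * npow n s) <= ln (real (Suc n)) * real (Suc n) powr (- Re s)"
        unfolding norm_mult norm_npow using mangoldt_le[of "Suc n"] by (intro mult_right_mono) (auto simp del: of_nat_Suc)
      also have "real (Suc n) powr (- Re s) = real (Suc n) powr (- (Re s - a)) * real (Suc n) powr (- a)" by (simp flip: powr_add)
      also have "ln (real (Suc n)) * ... = (real (Suc n) powr (- (Re s - a)) * ln (real (Suc n))) * real (Suc n) powr (- a)" by simp
      also have "... <= B * real (Suc n) powr (- a)" using B[of n] by (intro mult_right_mono) (auto intro: order.trans[OF abs_ge_self])
      finally show ?thesis .
    qed
    thus "\<exists>N. \<forall>n\<ge>N. norm (norm (of_real (mangoldt (Suc n)) * npow n s)) <= B * real (Suc n) powr (- a)" by simp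
  qed
qed

lemma L_sums: "Re s > 1 ==> (\<lambda>n. of_real (mangoldt (Suc n)) * npow n s) sums L s"
  unfolding L_def by (rule summable_sums[OF summable_norm_cancel[OF L_summable]])

lemma has_sum_Suc_iff: "(\<lambda>n. f (Suc n)) sums S ==> summable (\<lambda>n. norm (f (Suc n))) ==> (f has_sum S) {1::nat..}" for f :: "nat => complex"
proof -
  assume "(\<lambda>n. f (Suc n)) sums S" "summable (\<lambda>n. norm (f (Suc n)))"
  hence "((\<lambda>n. f (Suc n)) has_sum S) UNIV" by (intro norm_summable_imp_has_sum)
  hence "((f \<circ> Suc) has_sum S) UNIV" by (simp add: o_def)
  hence "(f has_sum S) (range Suc)" by (subst has_sum_reindex) auto
  moreover have "range Suc = {1..}" by (auto simp: image_def Suc_le_eq gr0_conv_Suc)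
  ultimately show ?thesis by simp
qed

text \<open>The Dirichlet product of the von Mangoldt series with the zeta series has coefficients
  \<open>ln n\<close>, and the derivative of zeta has their negatives.\<close>

lemma zeta_L: assumes s: "Re s > 1" shows "(zeta has_field_derivative - (zeta s * L s)) (at s)"
proof -
  obtain D where D: "(\<lambda>n. - of_real (ln (real (Suc n))) * npow n s) sums D" "(zeta has_field_derivative D) (at s)"
    using zeta_deriv(2)[OF s] by blast
  define f where "f = (\<lambda>n::nat. of_nat n powr (- s) :: complex)"
  define g where "g = (\<lambda>n::nat. of_real (mangoldt n) * f n :: complex)"
  have fS: "f (Suc n) = npow n s" for n by (simp add: f_def npow_def)
  have sf: "summable (\<lambda>n. norm (f (Suc n)))" unfolding fS norm_npow using s by (rule summable_Suc_powr)
  have hf: "(f has_sum zeta s) {1..}" using zeta_deriv(1)[OF s] sf by (intro has_sum_Suc_iff) (simp_all add: fS)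
  have hg: "(g has_sum L s) {1..}" using L_sums[OF s] L_summable[OF s] by (intro has_sum_Suc_iff) (simp_all add: g_def fS)
  have nf: "(\<lambda>n. norm (f n)) summable_on {1..}" and ng: "(\<lambda>n. norm (g n)) summable_on {1..}"
    using hf hg by (auto simp flip: summable_on_iff_abs_summable_on_complex intro: has_sum_imp_summable)
  have "(\<lambda>x. norm (g (fst x) * f (snd x))) summable_on ({1..} \<times> {1..})"
  proof (rule summable_on_SigmaI)
    show "((\<lambda>b. norm (g (fst (a, b)) * f (snd (a, b)))) has_sum (norm (g a) * infsum (\<lambda>n. norm (f n)) {1..})) {1..}" for a
      using has_sum_cmult_right[OF has_sum_infsum[OF nf], of "norm (g a)"] by (simp add: norm_mult)
    show "(\<lambda>a. norm (g a) * infsum (\<lambda>n. norm (f n)) {1..}) summable_on {1..}"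
      using ng by (rule summable_on_cmult_left)
  qed auto
  hence "(\<lambda>x. g (fst x) * f (snd x)) summable_on ({1..} \<times> {1..})"
    by (simp only: summable_on_iff_abs_summable_on_complex)
  then obtain X where X: "((\<lambda>x. g (fst x) * f (snd x)) has_sum X) ({1..} \<times> {1..})" unfolding summable_on_def by blast
  have "((\<lambda>a. g a * zeta s) has_sum X) {1..}"
    by (rule has_sum_SigmaD[OF X]) (use has_sum_cmult_right[OF hf] in simp)
  moreover have "((\<lambda>a. g a * zeta s) has_sum (L s * zeta s)) {1..}" by (rule has_sum_cmult_left[OF hg])
  ultimately have "X = L s * zeta s" by (rule has_sum_unique)
  with X have prod: "((\<lambda>(a, b). g a * f b) has_sum (L s * zeta s)) ({1..} \<times> {1..})" by (simp only: case_prod_unfold)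
  \<comment> \<open>Absolute convergence allows the pairs \<open>(a, b)\<close> to be regrouped by
    the product \<open>n = a * b\<close>.\<close>
  have "((\<lambda>(n, d). g d * f (n div d)) has_sum (L s * zeta s)) (SIGMA n:{1..}. {d. d dvd n})"
  proof -
    have "((\<lambda>(a, b). g a * f b) has_sum (L s * zeta s)) ({1..} \<times> {1..}) \<longleftrightarrow>
        ((\<lambda>(n, d). g d * f (n div d)) has_sum (L s * zeta s)) (SIGMA n:{1..}. {d. d dvd n})"
    proof (rule has_sum_reindex_bij_witness[where i = "\<lambda>(n, d). (d, n div d)" and j = "\<lambda>(a, b). (a * b, a)"])
      fix x assume "x \<in> (SIGMA n:{1..}. {d. d dvd (n::nat)})"
      then obtain n d where x: "x = (n, d)" "n >= 1" "d dvd n" by auto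
      then obtain k where "n = d * k" by auto
      thus "(case x of (n, d) => (d, n div d)) \<in> {1..} \<times> {1..}" using x by (auto simp: Suc_le_eq)
    qed (auto simp: Suc_le_eq)
    thus ?thesis using prod by blast
  qed
  hence "((\<lambda>n. \<Sum>d | d dvd n. g d * f (n div d)) has_sum (L s * zeta s)) {1..}"
  proof (rule has_sum_SigmaD)
    fix n :: nat assume "n \<in> {1..}"
    hence "finite {d. d dvd n}" by simp
    from has_sum_finite[OF this, of "\<lambda>d. g d * f (n div d)"]
    show "((\<lambda>d. case (n, d) of (n, d) => g d * f (n div d)) has_sum (\<Sum>d | d dvd n. g d * f (n div d))) {d. d dvd n}" by simp
  qed
  moreover have "(\<Sum>d | d dvd n. g d * f (n div d)) = of_real (ln (real n)) * f n" if n: "n \<in> {1..}" for n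
  proof -
    have "(\<Sum>d | d dvd n. g d * f (n div d)) = (\<Sum>d | d dvd n. of_real (mangoldt d) * f n)"
    proof (rule sum.cong[OF refl])
      fix d assume d: "d \<in> {d. d dvd n}"
      hence "f d * f (n div d) = f n"
      proof -
        obtain k where k: "n = d * k" using d by auto
        hence dk: "d > 0" "k > 0" using n by (auto intro: Nat.gr0I)
        have "f (d * k) = f d * f k" unfolding f_def of_nat_mult using powr_times_real[of "of_nat d" "of_nat k" "- s"] by simp
        thus ?thesis using k dk by simp
      qed
      thus "g d * f (n div d) = of_real (mangoldt d) * f n" by (simp add: g_def mult.assoc)
    qed
    also have "... = of_real (\<Sum>d | d dvd n. mangoldt d) * f n" by (simp add: sum_distrib_right)
    also have "(\<Sum>d | d dvd n. mangoldt d) = ln (real n)" using n mangoldt_sum[of n, where ?'a = real] by simp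
    finally show ?thesis .
  qed
  ultimately have "((\<lambda>n. of_real (ln (real n)) * f n) has_sum (L s * zeta s)) {1..}"
    using has_sum_cong[of "{1..}" "\<lambda>n. \<Sum>d | d dvd n. g d * f (n div d)" "\<lambda>n. of_real (ln (real n)) * f n"] by blast
  moreover have "range Suc = {1..}" by (auto simp: image_def Suc_le_eq gr0_conv_Suc)
  ultimately have "((\<lambda>n. of_real (ln (real n)) * f n) \<circ> Suc has_sum (L s * zeta s)) UNIV"
    using has_sum_reindex[of Suc UNIV "\<lambda>n. of_real (ln (real n)) * f n"] by simp
  from has_sum_imp_sums[OF this] have "(\<lambda>n. of_real (ln (real (Suc n))) * npow n s) sums (L s * zeta s)"
    by (simp add: o_def fS del: of_nat_Suc)
  from sums_minus[OF this] have "(\<lambda>n. - of_real (ln (real (Suc n))) * npow n s) sums (- (L s * zeta s))" by simp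
  from sums_unique2[OF this D(1)] D(2) show ?thesis by (simp add: mult.commute)
qed

definition H :: "complex => complex" where "H s = 1 + (\<Sum>n. Hterm n s)"

lemma H_props:
  shows H_sums: "Re s > 0 ==> (\<lambda>n. Hterm n s) sums (H s - 1)"
    and H_holomorphic: "H holomorphic_on half_plane 0"
proof -
  obtain h h' where h: "\<And>s. Re s > 0 ==> (\<lambda>n. Hterm n s) sums (h s - 1)"
    "\<And>s. Re s > 0 ==> (h has_field_derivative h' s) (at s)" using H_exists by metis
  have eq: "h s = H s" if "Re s > 0" for s using h(1)[OF that] by (simp add: H_def sums_iff)
  show "Re s > 0 ==> (\<lambda>n. Hterm n s) sums (H s - 1)" using h(1)[of s] eq[of s] by simp
  have "h holomorphic_on half_plane 0" unfolding holomorphic_on_def half_plane_def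
    using h(2) by (auto simp: field_differentiable_def intro: has_field_derivative_at_within)
  thus "H holomorphic_on half_plane 0" by (rule holomorphic_transform) (simp add: eq half_plane_def)
qed

lemma H_deriv: "Re s > 0 ==> (H has_field_derivative deriv H s) (at s)"
  using holomorphic_derivI[OF H_holomorphic open_half_plane] by (simp add: half_plane_def)

lemma H_1: "H 1 = 1"
  by (simp add: H_def Hterm_def del: of_nat_Suc)

lemma H_zeta: "Re s > 1 ==> H s = (s - 1) * zeta s"
  using H_eq_zeta[OF H_sums] by simp

text \<open>Stated without dividing by \<open>H s\<close>, because the absence of zeros is
  established only in \<open>H_nonzero\<close>.\<close>

lemma deriv_H: assumes "Re s > 1" shows "deriv H s = H s / (s - 1) - H s * L s"
proof -
  have "((\<lambda>s. (s - 1) * zeta s) has_field_derivative (zeta s + (s - 1) * (- (zeta s * L s)))) (at s)"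
    by (rule derivative_eq_intros zeta_L assms refl | simp)+
  hence "(H has_field_derivative (zeta s + (s - 1) * (- (zeta s * L s)))) (at s)"
    by (rule has_field_derivative_transform_within_open[OF _ open_half_plane[of 1]]) (use assms in \<open>auto simp: half_plane_def H_zeta\<close>)
  hence "deriv H s = zeta s + (s - 1) * (- (zeta s * L s))" by (rule DERIV_imp_deriv)
  moreover have "s ~= 1" using assms by auto
  moreover from this have "zeta s = H s / (s - 1)" using H_zeta[OF assms] by simp
  ultimately show ?thesis by simp
qed

text \<open>\<open>k\<close> is the order of vanishing at \<open>s0\<close>, recovered as the
  residue of the logarithmic derivative along a horizontal ray.\<close>

lemma H_log_deriv_limit:
  assumes s0: "Re s0 > 0"
  obtains k :: nat where "k = 0 \<longleftrightarrow> H s0 ~= 0"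
    "((\<lambda>x::real. of_real x * deriv H (s0 + of_real x) / H (s0 + of_real x)) \<longlongrightarrow> of_nat k) (at_right 0)"
    "\<forall>\<^sub>F x in at_right 0. H (s0 + of_real x) ~= 0"
proof -
  have hol: "H holomorphic_on half_plane 0" by (rule H_holomorphic)
  have sin: "s0 \<in> half_plane 0" using s0 by (simp add: half_plane_def)
  have lim0: "((\<lambda>x::real. s0 + of_real x) \<longlongrightarrow> s0) (at_right 0)"
    by (rule tendsto_eq_intros refl | simp)+
  have xlim: "((\<lambda>x::real. complex_of_real x) \<longlongrightarrow> 0) (at_right 0)" by (rule tendsto_eq_intros refl | simp)+
  show thesis
  proof (cases "H s0 = 0")
    case False
    have "isCont H s0" using H_deriv[OF s0] by (rule DERIV_isCont)
    hence HL: "((\<lambda>x::real. H (s0 + of_real x)) \<longlongrightarrow> H s0) (at_right 0)" using lim0 by (rule isCont_tendsto_compose)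
    have "deriv H holomorphic_on half_plane 0" by (rule holomorphic_deriv[OF hol open_half_plane])
    hence "isCont (deriv H) s0" using sin by (metis continuous_on_eq_continuous_at holomorphic_on_imp_continuous_on open_half_plane)
    hence "((\<lambda>x::real. deriv H (s0 + of_real x)) \<longlongrightarrow> deriv H s0) (at_right 0)" using lim0 by (rule isCont_tendsto_compose)
    hence "((\<lambda>x::real. of_real x * deriv H (s0 + of_real x) / H (s0 + of_real x)) \<longlongrightarrow> 0 * deriv H s0 / H s0) (at_right 0)"
      using HL False xlim by (intro tendsto_intros)
    moreover have "\<forall>\<^sub>F x in at_right 0. H (s0 + of_real x) ~= 0" using HL False by (rule tendsto_imp_eventually_ne)
    ultimately show thesis using False by (intro that[of 0]) auto
  next
    case True
    have "connected (half_plane 0)" unfolding half_plane_def by (intro convex_connected convex_halfspace_Re_gt)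
    moreover have "\<not> H constant_on half_plane 0"
    proof
      assume "H constant_on half_plane 0"
      then obtain c where "\<And>x. x \<in> half_plane 0 ==> H x = c" unfolding constant_on_def by blast
      from this[of 1] this[OF sin] show False using True H_1 by (simp add: half_plane_def)
    qed
    ultimately obtain g r n where g: "0 < n" "0 < r" "ball s0 r \<subseteq> half_plane 0" "g holomorphic_on ball s0 r"
      "\<And>w. w \<in> ball s0 r ==> H w = (w - s0) ^ n * g w" "\<And>w. w \<in> ball s0 r ==> g w ~= 0"
      using holomorphic_factor_zero_nonconstant[OF hol open_half_plane _ sin True] by metis
    have gd: "(g has_field_derivative deriv g w) (at w)" if "w \<in> ball s0 r" for w
      using holomorphic_derivI[OF g(4) _ that] by simp
    have ev: "\<forall>\<^sub>F x in at_right (0::real). 0 < x & x < r" using g(2) by (auto simp: eventually_at_right_field)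
    have inb: "s0 + of_real x \<in> ball s0 r" if "0 < x & x < r" for x :: real using that by (simp add: dist_norm)
    have eqq: "of_real x * deriv H (s0 + of_real x) / H (s0 + of_real x) = of_nat n + of_real x * deriv g (s0 + of_real x) / g (s0 + of_real x)"
      if x: "0 < x & x < r" for x :: real
    proof -
      let ?w = "s0 + of_real x"
      have w: "?w \<in> ball s0 r" by (rule inb[OF x])
      have "((\<lambda>w. (w - s0) ^ n * g w) has_field_derivative (of_nat n * (?w - s0) ^ (n - 1) * g ?w + (?w - s0) ^ n * deriv g ?w)) (at ?w)"
        by (rule derivative_eq_intros gd w refl | simp)+
      hence "(H has_field_derivative (of_nat n * (?w - s0) ^ (n - 1) * g ?w + (?w - s0) ^ n * deriv g ?w)) (at ?w)"
        by (rule has_field_derivative_transform_within_open[OF _ open_ball w]) (simp add: g(5))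
      hence d: "deriv H ?w = of_nat n * of_real x ^ (n - 1) * g ?w + of_real x ^ n * deriv g ?w"
        using DERIV_imp_deriv by fastforce
      have xn: "complex_of_real x ^ n = of_real x * of_real x ^ (n - 1)" using g(1) by (cases n) auto
      have "of_real x * deriv H ?w = of_real x ^ n * (of_nat n * g ?w + of_real x * deriv g ?w)"
        unfolding d xn by (simp add: algebra_simps)
      moreover have "H ?w = of_real x ^ n * g ?w" using g(5)[OF w] by simp
      moreover have "of_real x ^ n ~= (0::complex)" "g ?w ~= 0" using x g(6)[OF w] by auto
      ultimately show ?thesis by (simp add: field_simps)
    qed
    have sb: "s0 \<in> ball s0 r" using g(2) by simp
    have "isCont g s0" using gd[OF sb] by (rule DERIV_isCont)
    hence gl: "((\<lambda>x::real. g (s0 + of_real x)) \<longlongrightarrow> g s0) (at_right 0)" using lim0 by (rule isCont_tendsto_compose)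
    have "deriv g holomorphic_on ball s0 r" by (rule holomorphic_deriv[OF g(4) open_ball])
    hence "isCont (deriv g) s0" using sb by (metis continuous_on_eq_continuous_at holomorphic_on_imp_continuous_on open_ball)
    hence "((\<lambda>x::real. deriv g (s0 + of_real x)) \<longlongrightarrow> deriv g s0) (at_right 0)" using lim0 by (rule isCont_tendsto_compose)
    hence "((\<lambda>x::real. of_nat n + of_real x * deriv g (s0 + of_real x) / g (s0 + of_real x)) \<longlongrightarrow> of_nat n + 0 * deriv g s0 / g s0) (at_right 0)"
      using gl g(6)[OF sb] xlim by (intro tendsto_intros)
    hence "((\<lambda>x::real. of_nat n + of_real x * deriv g (s0 + of_real x) / g (s0 + of_real x)) \<longlongrightarrow> of_nat n) (at_right 0)" by simp
    hence "((\<lambda>x::real. of_real x * deriv H (s0 + of_real x) / H (s0 + of_real x)) \<longlongrightarrow> of_nat n) (at_right 0)"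
      by (rule Lim_transform_eventually) (use ev in eventually_elim, simp add: eqq)
    moreover have "\<forall>\<^sub>F x in at_right 0. H (s0 + of_real x) ~= 0"
      using ev by eventually_elim (use g(5,6) inb in auto)
    ultimately show thesis using True g(1) by (intro that[of n]) auto
  qed
qed

text \<open>\<open>L\<close> is minus the logarithmic derivative of zeta: the pole at 1 contributes
  1, a zero of \<open>H\<close> its negative order.\<close>

lemma xL_limit:
  assumes s0: "Re s0 >= 1"
  obtains k :: nat where "k = 0 \<longleftrightarrow> H s0 ~= 0"
    "((\<lambda>x::real. of_real x * L (s0 + of_real x)) \<longlongrightarrow> (if s0 = 1 then 1 else 0) - of_nat k) (at_right 0)"
proof -
  obtain k :: nat where k: "k = 0 \<longleftrightarrow> H s0 ~= 0"
    "((\<lambda>x::real. of_real x * deriv H (s0 + of_real x) / H (s0 + of_real x)) \<longlongrightarrow> of_nat k) (at_right 0)"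
    "\<forall>\<^sub>F x in at_right 0. H (s0 + of_real x) ~= 0"
    by (rule H_log_deriv_limit[of s0]) (use s0 in linarith)
  have pos: "\<forall>\<^sub>F x in at_right (0::real). x > 0" by (rule eventually_at_right_less)
  have l1: "((\<lambda>x::real. of_real x / (s0 + of_real x - 1)) \<longlongrightarrow> (if s0 = 1 then 1 else 0)) (at_right 0)"
  proof (cases "s0 = 1")
    case True
    have "\<forall>\<^sub>F x in at_right (0::real). (1::complex) = of_real x / (s0 + of_real x - 1)" using pos by eventually_elim (simp add: True)
    thus ?thesis using True by (simp add: tendsto_eventually eventually_mono[OF _ sym])
  next
    case False
    have "((\<lambda>x::real. complex_of_real x / (s0 + of_real x - 1)) \<longlongrightarrow> of_real 0 / (s0 + of_real 0 - 1)) (at_right 0)"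
      using False by (intro tendsto_intros) auto
    thus ?thesis using False by simp
  qed
  have "((\<lambda>x::real. of_real x / (s0 + of_real x - 1) - of_real x * deriv H (s0 + of_real x) / H (s0 + of_real x)) \<longlongrightarrow> (if s0 = 1 then 1 else 0) - of_nat k) (at_right 0)"
    by (intro tendsto_diff l1 k(2))
  hence "((\<lambda>x::real. of_real x * L (s0 + of_real x)) \<longlongrightarrow> (if s0 = 1 then 1 else 0) - of_nat k) (at_right 0)"
  proof (rule Lim_transform_eventually)
    show "\<forall>\<^sub>F x in at_right 0. of_real x / (s0 + of_real x - 1) - of_real x * deriv H (s0 + of_real x) / H (s0 + of_real x) = of_real x * L (s0 + of_real x)"
      using pos k(3)
    proof eventually_elim
      case (elim x)
      have "Re (s0 + of_real x) > 1" using s0 elim by simp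
      from deriv_H[OF this] have "deriv H (s0 + of_real x) / H (s0 + of_real x) = 1 / (s0 + of_real x - 1) - L (s0 + of_real x)"
        using elim(2) by (simp add: diff_divide_distrib)
      hence "of_real x * (deriv H (s0 + of_real x) / H (s0 + of_real x)) = of_real x * (1 / (s0 + of_real x - 1) - L (s0 + of_real x))" by simp
      thus ?case by (simp add: right_diff_distrib)
    qed
  qed
  with k(1) show thesis by (rule that)
qed

lemma Re_mult_num: "Re (numeral k * z) = numeral k * Re z" by simp

text \<open>The classical inequality
  \<open>3 + 4 * cos v + cos (2 * v) = 2 * (1 + cos v)\<^sup>2 >= 0\<close>, applied to every term
  of the series.\<close>

lemma Re_L_combination:
  assumes "x > 0" shows "0 <= Re (3 * L (1 + of_real x) + 4 * L (1 + \<i> * of_real t + of_real x) + L (1 + \<i> * of_real (2 * t) + of_real x))"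
proof -
  define f where "f = (\<lambda>n s. of_real (mangoldt (Suc n)) * npow n s :: complex)"
  have sm: "(\<lambda>n. f n (1 + \<i> * of_real t + of_real x)) sums L (1 + \<i> * of_real t + of_real x)" for t unfolding f_def using assms by (intro L_sums) simp
  have "(\<lambda>n. 3 * f n (1 + \<i> * of_real 0 + of_real x) + 4 * f n (1 + \<i> * of_real t + of_real x) + f n (1 + \<i> * of_real (2 * t) + of_real x))
    sums (3 * L (1 + \<i> * of_real 0 + of_real x) + 4 * L (1 + \<i> * of_real t + of_real x) + L (1 + \<i> * of_real (2 * t) + of_real x))"
    by (intro sums_add sums_mult sm)
  hence ss: "(\<lambda>n. Re (3 * f n (1 + \<i> * of_real 0 + of_real x) + 4 * f n (1 + \<i> * of_real t + of_real x) + f n (1 + \<i> * of_real (2 * t) + of_real x)))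
    sums Re (3 * L (1 + \<i> * of_real 0 + of_real x) + 4 * L (1 + \<i> * of_real t + of_real x) + L (1 + \<i> * of_real (2 * t) + of_real x))"
    by (rule sums_Re)
  have nn: "0 <= Re (3 * f n (1 + \<i> * of_real 0 + of_real x) + 4 * f n (1 + \<i> * of_real t + of_real x) + f n (1 + \<i> * of_real (2 * t) + of_real x))" for n
  proof -
    define l where "l = ln (real (Suc n))"
    have re: "Re (f n (1 + \<i> * of_real u + of_real x)) = mangoldt (Suc n) * exp (- ((1 + x) * l)) * cos (u * l)" for u
    proof -
      have "npow n (1 + \<i> * of_real u + of_real x) = exp (of_real (- ((1 + x) * l)) + \<i> * of_real (- (u * l)))"
        unfolding npow_def nat_powr_exp l_def by (simp add: algebra_simps)
      also have "... = of_real (exp (- ((1 + x) * l))) * cis (- (u * l))" by (simp add: exp_add exp_of_real cis_conv_exp del: of_real_minus)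
      finally show ?thesis by (simp add: f_def del: of_real_exp)
    qed
    define c where "c = cos (t * l)"
    define a where "a = mangoldt (Suc n) * exp (- ((1 + x) * l))"
    have c2: "cos (2 * t * l) = 2 * c\<^sup>2 - 1" using cos_double_cos[of "t * l"] by (simp add: c_def mult.assoc)
    have r0: "Re (f n (1 + \<i> * of_real 0 + of_real x)) = a" using re[of 0] by (simp add: a_def)
    have r1: "Re (f n (1 + \<i> * of_real t + of_real x)) = a * c" using re[of t] by (simp only: a_def c_def)
    have r2: "Re (f n (1 + \<i> * of_real (2 * t) + of_real x)) = a * (2 * c\<^sup>2 - 1)" using re[of "2 * t"] by (simp only: a_def c2)
    have "Re (3 * f n (1 + \<i> * of_real 0 + of_real x) + 4 * f n (1 + \<i> * of_real t + of_real x) + f n (1 + \<i> * of_real (2 * t) + of_real x))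
       = 3 * a + 4 * (a * c) + a * (2 * c\<^sup>2 - 1)" using r0 r1 r2 by (simp only: plus_complex.sel(1) Re_mult_num)
    also have "... = a * (2 * (1 + c)\<^sup>2)" by (simp add: power2_eq_square algebra_simps)
    finally show ?thesis by (simp add: mangoldt_nonneg a_def)
  qed
  have "0 <= Re (3 * L (1 + \<i> * of_real 0 + of_real x) + 4 * L (1 + \<i> * of_real t + of_real x) + L (1 + \<i> * of_real (2 * t) + of_real x))"
    by (rule sums_le[OF nn sums_zero ss])
  thus ?thesis by simp
qed

lemma H_nonzero: assumes "Re s0 >= 1" shows "H s0 ~= 0"
proof (cases "Re s0 = 1")
  case True
  define t where "t = Im s0"
  have s0: "s0 = 1 + \<i> * of_real t" using True by (simp add: t_def complex_eq_iff)
  show ?thesis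
  proof (cases "t = 0")
    case True thus ?thesis using s0 H_1 by simp
  next
    case False
    obtain k0 :: nat where k0: "k0 = 0 \<longleftrightarrow> H 1 ~= 0" "((\<lambda>x::real. of_real x * L (1 + of_real x)) \<longlongrightarrow> (if (1::complex) = 1 then 1 else 0) - of_nat k0) (at_right 0)"
      by (rule xL_limit[of 1]) simp
    have "k0 = 0" using k0(1) H_1 by simp
    obtain k1 :: nat where k1: "k1 = 0 \<longleftrightarrow> H s0 ~= 0" "((\<lambda>x::real. of_real x * L (s0 + of_real x)) \<longlongrightarrow> (if s0 = 1 then 1 else 0) - of_nat k1) (at_right 0)"
      by (rule xL_limit[OF assms])
    define s2 where "s2 = 1 + \<i> * of_real (2 * t)"
    obtain k2 :: nat where k2: "k2 = 0 \<longleftrightarrow> H s2 ~= 0" "((\<lambda>x::real. of_real x * L (s2 + of_real x)) \<longlongrightarrow> (if s2 = 1 then 1 else 0) - of_nat k2) (at_right 0)"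
      by (rule xL_limit[of s2]) (simp add: s2_def)
    have ne: "s0 ~= 1" "s2 ~= 1" using False by (auto simp: s0 s2_def)
    have "((\<lambda>x::real. Re (3 * (of_real x * L (1 + of_real x)) + 4 * (of_real x * L (s0 + of_real x)) + of_real x * L (s2 + of_real x))) \<longlongrightarrow> Re (3 * (1 - of_nat k0) + 4 * (0 - of_nat k1) + (0 - of_nat k2))) (at_right 0)"
      using k0(2) k1(2) k2(2) ne by (intro tendsto_intros) auto
    moreover have "\<forall>\<^sub>F x in at_right (0::real). 0 <= Re (3 * (of_real x * L (1 + of_real x)) + 4 * (of_real x * L (s0 + of_real x)) + of_real x * L (s2 + of_real x))"
      using eventually_at_right_less[of "0::real"]
    proof eventually_elim
      case (elim x)
      have "0 <= x * Re (3 * L (1 + of_real x) + 4 * L (s0 + of_real x) + L (s2 + of_real x))"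
        using Re_L_combination[OF elim, of t] elim by (simp add: s0 s2_def)
      also have "... = Re (of_real x * (3 * L (1 + of_real x) + 4 * L (s0 + of_real x) + L (s2 + of_real x)))" by simp
      finally show ?case by (simp add: algebra_simps)
    qed
    \<comment> \<open>In the limit \<open>3 - 4 * k1 - k2 >= 0\<close>, which excludes a zero of any
      positive order \<open>k1\<close>.\<close>
    ultimately have "0 <= Re (3 * (1 - of_nat k0) + 4 * (0 - of_nat k1) + (0 - of_nat k2))"
      by (intro tendsto_lowerbound) auto
    hence "4 * real k1 + real k2 <= 3" using \<open>k0 = 0\<close> by simp
    hence "k1 = 0" by (cases k1) auto
    thus ?thesis using k1(1) by simp
  qed
next
  case False
  hence s1: "Re s0 > 1" using assms by simp
  obtain k :: nat where k: "k = 0 \<longleftrightarrow> H s0 ~= 0" "((\<lambda>x::real. of_real x * L (s0 + of_real x)) \<longlongrightarrow> (if s0 = 1 then 1 else 0) - of_nat k) (at_right 0)"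
    by (rule xL_limit[OF assms])
  \<comment> \<open>To the right of the line the series of \<open>L\<close> is bounded along the
    ray, so the limit is 0 and the order \<open>k\<close> vanishes.\<close>
  define B where "B = (\<Sum>n. norm (of_real (mangoldt (Suc n)) * npow n s0))"
  have bd: "norm (L (s0 + of_real x)) <= B" if "x > 0" for x
  proof -
    have le: "norm (of_real (mangoldt (Suc n)) * npow n (s0 + of_real x)) <= norm (of_real (mangoldt (Suc n)) * npow n s0)" for n
      unfolding norm_mult norm_npow using that by (intro mult_left_mono powr_mono) (auto simp: mangoldt_nonneg)
    have sm: "summable (\<lambda>n. norm (of_real (mangoldt (Suc n)) * npow n (s0 + of_real x)))" using s1 that by (intro L_summable) simp
    have "norm (L (s0 + of_real x)) <= (\<Sum>n. norm (of_real (mangoldt (Suc n)) * npow n (s0 + of_real x)))"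
      unfolding L_def by (rule summable_norm[OF sm])
    also have "... <= B" unfolding B_def by (intro suminf_le le sm L_summable s1)
    finally show ?thesis .
  qed
  have "((\<lambda>x::real. of_real x * L (s0 + of_real x)) \<longlongrightarrow> 0) (at_right 0)"
  proof (rule Lim_null_comparison)
    show "\<forall>\<^sub>F x in at_right 0. norm (of_real x * L (s0 + of_real x)) <= x * B"
      using eventually_at_right_less[of "0::real"]
    proof eventually_elim
      case (elim x) thus ?case using bd[OF elim] by (simp add: norm_mult mult_left_mono)
    qed
    show "((\<lambda>x::real. x * B) \<longlongrightarrow> 0) (at_right 0)" by (rule tendsto_eq_intros refl | simp)+
  qed
  moreover have "s0 ~= 1" using s1 by auto
  ultimately have "0 = (0 - of_nat k :: complex)" using tendsto_unique[OF trivial_limit_at_right_real _ k(2)] by simp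
  thus ?thesis using k(1) by simp
qed

section \<open>The Fejer kernel and its Fourier transform\<close>

definition fw :: "real => real => real" where "fw l y = max 0 (1 - \<bar>y\<bar> / l)"

text \<open>The Fourier transform of the triangle \<open>fw l\<close>, with the limiting value
  \<open>l\<close> at the removable singularity.\<close>

definition fejer :: "real => real => real" where
  "fejer l u = (if u = 0 then l else 2 * (1 - cos (l * u)) / (l * u\<^sup>2))"

lemma cis_measurable [measurable]: "cis \<in> borel_measurable borel"
  by (intro borel_measurable_continuous_onI continuous_intros)

lemma integrable_compact_support:
  fixes h :: "real => 'a :: euclidean_space"
  assumes c: "continuous_on UNIV h" and z: "\<And>y. \<bar>y\<bar> > l ==> h y = 0"
  shows "integrable lborel h"
proof -
  have "set_integrable lborel {-l..l} h"
    by (rule borel_integrable_atLeastAtMost') (rule continuous_on_subset[OF c], simp)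
  moreover have "(\<lambda>y. indicator {-l..l} y *\<^sub>R h y) = h"
    using z by (force simp: indicator_def fun_eq_iff)
  ultimately show ?thesis by (simp add: set_integrable_def)
qed

lemma fw_continuous: "continuous_on UNIV (fw l)"
  unfolding fw_def by (cases "l = 0") (simp_all add: continuous_intros)

lemma fw_measurable [measurable]: "fw l \<in> borel_measurable borel"
  using fw_continuous by (rule borel_measurable_continuous_onI)

lemma fw_nonneg: "0 <= fw l y" by (simp add: fw_def)

lemma fw_support: "l > 0 ==> \<bar>y\<bar> >= l ==> fw l y = 0" by (simp add: fw_def)

lemma fw_integrable: "l > 0 ==> integrable lborel (fw l)"
  by (rule integrable_compact_support[OF fw_continuous, of l]) (simp add: fw_support)

lemma fw_transform:
  assumes l: "l > 0"
  shows "(LBINT y. of_real (fw l y) * cis (y * u)) = of_real (fejer l u)"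
proof -
  define h where "h = (\<lambda>y. of_real (fw l y) * cis (y * u))"
  have hc: "continuous_on UNIV h" unfolding h_def by (intro continuous_intros fw_continuous)
  have hi: "integrable lborel h"
    by (rule integrable_compact_support[OF hc, of l]) (simp add: h_def fw_support l)
  define E where "E = (\<lambda>y. cis (y * u))"
  have Ed: "(E has_vector_derivative (\<i> * of_real u * E y)) (at y within S)" for y S
    unfolding E_def cis_conv_exp
    by (rule has_vector_derivative_real_field derivative_eq_intros refl | simp)+
  \<comment> \<open>The triangle has a corner at 0, so a separate primitive is given on either side
    of it.\<close>
  have "\<exists>F1 F2. (\<forall>y\<in>{-l..0}. (F1 has_vector_derivative h y) (at y within {-l..0})) \<and>
     (\<forall>y\<in>{0..l}. (F2 has_vector_derivative h y) (at y within {0..l})) \<and>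
     F1 0 - F1 (-l) + (F2 l - F2 0) = of_real (fejer l u)"
  proof (cases "u = 0")
    case True
    define F1 F2 where "F1 = (\<lambda>y::real. complex_of_real (y + y\<^sup>2 / (2 * l)))" and "F2 = (\<lambda>y::real. complex_of_real (y - y\<^sup>2 / (2 * l)))"
    have "(F1 has_vector_derivative h y) (at y within {-l..0})" if "y \<in> {-l..0}" for y
    proof -
      have "((\<lambda>y. y + y\<^sup>2 / (2 * l)) has_field_derivative fw l y) (at y within {-l..0})"
        using that l unfolding fw_def
        by (auto intro!: derivative_eq_intros simp: field_simps max_def)
      from has_vector_derivative_of_real[OF this, where ?'a = complex] show ?thesis by (simp add: F1_def h_def True)
    qed
    moreover have "(F2 has_vector_derivative h y) (at y within {0..l})" if "y \<in> {0..l}" for y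
    proof -
      have "((\<lambda>y. y - y\<^sup>2 / (2 * l)) has_field_derivative fw l y) (at y within {0..l})"
        using that l unfolding fw_def
        by (auto intro!: derivative_eq_intros simp: field_simps max_def)
      from has_vector_derivative_of_real[OF this, where ?'a = complex] show ?thesis by (simp add: F2_def h_def True)
    qed
    moreover have "F1 0 - F1 (-l) + (F2 l - F2 0) = of_real (fejer l u)"
      using l by (simp add: F1_def F2_def fejer_def True power2_eq_square)
    ultimately show ?thesis by blast
  next
    case False
    define w where "w = \<i> * complex_of_real u"
    have w0: "w ~= 0" using False by (simp add: w_def)
    have lw: "complex_of_real l * w\<^sup>2 ~= 0" using w0 l by simp
    define F1 F2 where "F1 = (\<lambda>y::real. of_real (1 + y / l) * E y / w - E y / (of_real l * w\<^sup>2))"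
      and "F2 = (\<lambda>y::real. of_real (1 - y / l) * E y / w + E y / (of_real l * w\<^sup>2))"
    have Ed': "(E has_vector_derivative (w * E y)) (at y within S)" for y S using Ed by (simp add: w_def)
    have lin: "((\<lambda>y. complex_of_real (1 + c * y)) has_vector_derivative of_real c) (at y within S)" for c y S
    proof -
      have "((\<lambda>y. 1 + c * y) has_field_derivative c) (at y within S)"
        by (auto intro!: derivative_eq_intros)
      thus ?thesis by (rule has_vector_derivative_of_real)
    qed
    have gen: "((\<lambda>y. of_real (1 + c * y) * E y * (1 / w) - E y * (of_real c / w\<^sup>2)) has_vector_derivative
        (of_real (1 + c * y) * E y)) (at y within S)" for c y S
    proof -
      have "((\<lambda>y. of_real (1 + c * y) * E y * (1 / w) - E y * (of_real c / w\<^sup>2)) has_vector_derivative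
        ((of_real (1 + c * y) * (w * E y) + of_real c * E y) * (1 / w) - (w * E y) * (of_real c / w\<^sup>2))) (at y within S)"
        by (intro has_vector_derivative_diff has_vector_derivative_mult_left has_vector_derivative_mult lin Ed')
      also have "(of_real (1 + c * y) * (w * E y) + of_real c * E y) * (1 / w) - (w * E y) * (of_real c / w\<^sup>2) = of_real (1 + c * y) * E y"
        using w0 by (simp add: field_simps power2_eq_square)
      finally show ?thesis .
    qed
    have F1g: "F1 = (\<lambda>y. of_real (1 + (1 / l) * y) * E y * (1 / w) - E y * (of_real (1 / l) / w\<^sup>2))"
      unfolding F1_def by (simp add: fun_eq_iff)
    have F2g: "F2 = (\<lambda>y. of_real (1 + (- 1 / l) * y) * E y * (1 / w) - E y * (of_real (- 1 / l) / w\<^sup>2))"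
      unfolding F2_def by (simp add: fun_eq_iff)
    have "(F1 has_vector_derivative h y) (at y within {-l..0})" if "y \<in> {-l..0}" for y
    proof -
      have "h y = of_real (1 + (1 / l) * y) * E y" using that l by (simp add: h_def E_def fw_def max_def field_simps)
      thus ?thesis unfolding F1g by (simp only: gen)
    qed
    moreover have "(F2 has_vector_derivative h y) (at y within {0..l})" if "y \<in> {0..l}" for y
    proof -
      have "h y = of_real (1 + (- 1 / l) * y) * E y" using that l by (simp add: h_def E_def fw_def max_def field_simps)
      thus ?thesis unfolding F2g by (simp only: gen)
    qed
    moreover have "F1 0 - F1 (-l) + (F2 l - F2 0) = of_real (fejer l u)"
    proof -
      have w2: "w\<^sup>2 = - of_real (u\<^sup>2)" by (simp add: w_def power_mult_distrib)
      have "E l + E (-l) = of_real (2 * cos (l * u))" by (simp add: E_def complex_eq_iff)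
      have "F1 0 - F1 (-l) + (F2 l - F2 0) = (E l + E (-l) - 2) / (of_real l * w\<^sup>2)"
        using l by (simp add: F1_def F2_def E_def add_divide_distrib diff_divide_distrib)
      also have "E l + E (-l) = of_real (2 * cos (l * u))" by (simp add: E_def complex_eq_iff)
      also have "(of_real (2 * cos (l * u)) - 2) / (of_real l * w\<^sup>2) = complex_of_real ((2 * cos (l * u) - 2) / (l * (- u\<^sup>2)))"
        unfolding w2 by simp
      also have "(2 * cos (l * u) - 2) / (l * (- u\<^sup>2)) = fejer l u" using False l by (simp add: fejer_def field_simps)
      finally show ?thesis .
    qed
    ultimately show ?thesis by blast
  qed
  then obtain F1 F2 where F: "\<And>y. y \<in> {-l..0} ==> (F1 has_vector_derivative h y) (at y within {-l..0})"
    "\<And>y. y \<in> {0..l} ==> (F2 has_vector_derivative h y) (at y within {0..l})"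
    "F1 0 - F1 (-l) + (F2 l - F2 0) = of_real (fejer l u)" by blast
  have "(h has_integral (F1 0 - F1 (-l))) {-l..0}" using l F(1) by (intro fundamental_theorem_of_calculus) auto
  moreover have "(h has_integral (F2 l - F2 0)) {0..l}" using l F(2) by (intro fundamental_theorem_of_calculus) auto
  ultimately have "(h has_integral (F1 0 - F1 (-l) + (F2 l - F2 0))) {-l..l}" using l by (intro has_integral_combine[of "-l" 0 l]) auto
  hence a: "(h has_integral (F1 0 - F1 (-l) + (F2 l - F2 0))) UNIV"
    by (rule has_integral_on_superset) (auto simp: h_def fw_support l)
  have "integral\<^sup>L lborel h = F1 0 - F1 (-l) + (F2 l - F2 0)"
    by (rule has_integral_unique[OF has_integral_integral_lborel[OF hi] a])
  thus ?thesis unfolding F(3) by (simp only: h_def)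
qed

lemma one_minus_cos_le: "1 - cos x <= x\<^sup>2 / 2" for x :: real
proof -
  have "cos x = 1 - 2 * (sin (x / 2))\<^sup>2" using cos_double_sin[of "x / 2"] by simp
  moreover have "(sin (x / 2))\<^sup>2 <= (x / 2)\<^sup>2" using abs_sin_x_le_abs_x[of "x / 2"] unfolding abs_le_square_iff .
  ultimately show ?thesis by (simp add: power_divide)
qed

lemma fejer_nonneg: "l > 0 ==> 0 <= fejer l u"
  by (simp add: fejer_def)

lemma fejer_le: assumes l: "l > 0" shows "fejer l u <= (l + 4 / l) * inverse (1 + u\<^sup>2)"
proof (cases "u = 0")
  case True thus ?thesis using l by (simp add: fejer_def)
next
  case False
  have "fejer l u <= 2 * ((l * u)\<^sup>2 / 2) / (l * u\<^sup>2)" unfolding fejer_def using False l one_minus_cos_le[of "l * u"]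
    by (auto intro!: divide_right_mono simp del: times_divide_eq_right)
  also have "... = l" using False l by (simp add: power_mult_distrib power2_eq_square)
  finally have a: "fejer l u <= l" .
  have "u\<^sup>2 * fejer l u = 2 * (1 - cos (l * u)) / l" using False l by (simp add: fejer_def)
  also have "... <= 4 / l"
  proof (rule divide_right_mono)
    have "2 * (1 - c) <= 4" if "-1 <= c" for c :: real
    proof -
      have "1 - c <= 2" using that by linarith
      from mult_left_mono[OF this, of 2] show ?thesis by simp
    qed
    thus "2 * (1 - cos (l * u)) <= 4" by (simp only: cos_ge_minus_one)
  qed (use l in simp)
  finally have "(1 + u\<^sup>2) * fejer l u <= l + 4 / l" using a by (simp add: distrib_right)
  moreover have "1 + u\<^sup>2 > 0" by (simp add: add_pos_nonneg)
  ultimately show ?thesis by (simp add: field_simps)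
qed

lemma fejer_measurable [measurable]: "fejer l \<in> borel_measurable borel"
  unfolding fejer_def by measurable

lemma integrable_inverse_square: "integrable lborel (\<lambda>x::real. inverse (1 + x\<^sup>2))"
proof -
  have nz: "1 + x\<^sup>2 ~= 0" for x :: real using zero_le_power2[of x] by linarith
  have "set_integrable lborel (einterval (-\<infinity>) \<infinity>) (\<lambda>x::real. inverse (1 + x\<^sup>2))"
  proof (rule interval_integral_FTC_nonneg(1))
    show "DERIV arctan x :> inverse (1 + x\<^sup>2)" for x by (rule DERIV_arctan)
    show "isCont (\<lambda>x. inverse (1 + x\<^sup>2)) x" for x :: real using nz by (intro continuous_intros) auto
    show "((arctan \<circ> real_of_ereal) \<longlongrightarrow> - (pi / 2)) (at_right (- \<infinity>))"
      unfolding ereal_tendsto_simps by (rule tendsto_arctan_at_bot)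
    show "((arctan \<circ> real_of_ereal) \<longlongrightarrow> pi / 2) (at_left \<infinity>)"
      unfolding ereal_tendsto_simps by (rule tendsto_arctan_at_top)
  qed auto
  thus ?thesis by (simp add: set_integrable_def)
qed

lemma fejer_integrable: assumes l: "l > 0" shows "integrable lborel (fejer l)"
proof (rule Bochner_Integration.integrable_bound)
  show "integrable lborel (\<lambda>u. (l + 4 / l) * inverse (1 + u\<^sup>2))"
    by (intro integrable_mult_right integrable_inverse_square)
  show "AE u in lborel. norm (fejer l u) <= norm ((l + 4 / l) * inverse (1 + u\<^sup>2))"
    using fejer_le[OF l] fejer_nonneg[OF l] by (intro AE_I2) (auto intro: order.trans[OF _ abs_ge_self])
qed simp

lemma fejer_scale: "l > 0 ==> fejer 1 (l * u) = fejer l u / l"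
  by (simp add: fejer_def power_mult_distrib power2_eq_square)

definition fc :: real where "fc = integral\<^sup>L lborel (fejer 1)"
definition ftail :: "real => real" where "ftail x = (LBINT v. indicator {v. \<bar>v\<bar> > x} v * fejer 1 v)"

lemma fejer_shift_integrable: "l > 0 ==> integrable lborel (\<lambda>t. fejer l (T - t))"
  using lborel_integrable_real_affine[OF fejer_integrable, of l "-1" T] by simp

lemma fejer_total: assumes l: "l > 0" shows "(LBINT t. fejer l (T - t)) = fc"
proof -
  have "fc = \<bar>- l\<bar> *\<^sub>R (LBINT t. fejer 1 (l * T + (- l) * t))" unfolding fc_def
    using l by (intro lborel_integral_real_affine) simp
  also have "(\<lambda>t. fejer 1 (l * T + (- l) * t)) = (\<lambda>t. fejer l (T - t) / l)"
    using fejer_scale[OF l] by (auto simp: right_diff_distrib[symmetric])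
  finally show ?thesis using l by simp
qed

lemma fejer_tail: assumes l: "l > 0"
  shows "(LBINT t. indicator {t. \<bar>T - t\<bar> > d} t * fejer l (T - t)) = ftail (l * d)"
proof -
  have "ftail (l * d) = \<bar>- l\<bar> *\<^sub>R (LBINT t. indicator {v. \<bar>v\<bar> > l * d} (l * T + (- l) * t) * fejer 1 (l * T + (- l) * t))"
    unfolding ftail_def using l by (intro lborel_integral_real_affine) simp
  also have "(\<lambda>t. indicator {v. \<bar>v\<bar> > l * d} (l * T + (- l) * t) * fejer 1 (l * T + (- l) * t)) =
     (\<lambda>t. (indicator {t. \<bar>T - t\<bar> > d} t * fejer l (T - t)) / l)"
  proof
    fix t
    have e: "l * T + (- l) * t = l * (T - t)" by (simp add: algebra_simps)
    have "(\<bar>l * (T - t)\<bar> > l * d) = (\<bar>T - t\<bar> > d)" using l by (simp add: abs_mult)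
    thus "indicator {v. \<bar>v\<bar> > l * d} (l * T + (- l) * t) * fejer 1 (l * T + (- l) * t) = (indicator {t. \<bar>T - t\<bar> > d} t * fejer l (T - t)) / l"
      unfolding e fejer_scale[OF l] by (simp add: indicator_def)
  qed
  finally show ?thesis using l by simp
qed

lemma ftail_tendsto: "(ftail \<longlongrightarrow> 0) at_top"
proof -
  have "((\<lambda>x. (LBINT v. indicator {v. \<bar>v\<bar> > x} v * fejer 1 v)) \<longlongrightarrow> (LBINT v::real. 0::real)) at_top"
  proof (rule integral_dominated_convergence_at_top[where w = "fejer 1"])
    show "integrable lborel (fejer 1)" by (rule fejer_integrable) simp
    show "\<forall>\<^sub>F x in at_top. AE v in lborel. norm (indicator {v. \<bar>v\<bar> > x} v * fejer 1 v) <= fejer 1 v"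
      by (intro always_eventually allI AE_I2) (simp add: indicator_def fejer_nonneg)
    show "AE v in lborel. ((\<lambda>x. indicator {v. \<bar>v\<bar> > x} v * fejer 1 v) \<longlongrightarrow> 0) at_top"
    proof (intro AE_I2 tendsto_eventually)
      fix v :: real
      show "\<forall>\<^sub>F x in at_top. indicator {v. \<bar>v\<bar> > x} v * fejer 1 v = 0"
        using eventually_ge_at_top[of "\<bar>v\<bar>"] by eventually_elim simp
    qed
  qed auto
  thus ?thesis by (simp add: ftail_def[abs_def])
qed

text \<open>A zero integral would make the nonnegative kernel vanish almost everywhere, but it is
  positive on the interval from 0 to 1.\<close>

lemma fc_pos: "fc > 0"
proof -
  have n: "\<And>u. 0 <= fejer 1 u" by (simp add: fejer_nonneg)
  have "fc ~= 0"
  proof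
    assume "fc = 0"
    hence "AE u in lborel. fejer 1 u = 0" unfolding fc_def
      using integral_nonneg_eq_0_iff_AE[OF fejer_integrable[of 1]] n by simp
    hence "AE u in lborel. u \<notin> {0<..<1::real}"
    proof eventually_elim
      case (elim u)
      show ?case
      proof
        assume u: "u \<in> {0<..<1}"
        hence "cos u < cos 0" using pi_gt3 by (intro cos_monotone_0_pi) auto
        thus False using elim u by (simp add: fejer_def)
      qed
    qed
    hence "emeasure lborel {0<..<1::real} = 0"
      by (subst (asm) AE_iff_measurable[of "{0<..<1}"]) auto
    thus False by simp
  qed
  moreover have "fc >= 0" unfolding fc_def using n by (intro Bochner_Integration.integral_nonneg) auto
  ultimately show ?thesis by simp
qed


lemma exp_integral:
  fixes c a :: real assumes c: "c > 0"
  shows "integrable lborel (\<lambda>t. indicator {a..} t * exp (- c * t))"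
    and "(LBINT t. indicator {a..} t * exp (- c * t)) = exp (- c * a) / c"
proof -
  have lim: "((\<lambda>t. - exp (- c * t) / c) \<longlongrightarrow> 0) at_top" using c by real_asymp
  have lim2: "((\<lambda>t. - exp (- c * t) / c) \<longlongrightarrow> - exp (- c * a) / c) (at_right a)"
    by (intro tendsto_intros) (use c in auto)
  have D: "DERIV (\<lambda>t. - exp (- c * t) / c) x :> exp (- c * x)" for x
    using c by (auto intro!: derivative_eq_intros)
  have A: "(((\<lambda>t. - exp (- c * t) / c) \<circ> real_of_ereal) \<longlongrightarrow> - exp (- c * a) / c) (at_right (ereal a))"
    "(((\<lambda>t. - exp (- c * t) / c) \<circ> real_of_ereal) \<longlongrightarrow> 0) (at_left \<infinity>)"
    unfolding ereal_tendsto_simps by (rule lim2, rule lim)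
  have ct: "isCont (\<lambda>t. exp (- c * t)) x" for x by (intro continuous_intros)
  have nn: "AE x in lborel. ereal a < ereal x --> ereal x < \<infinity> --> 0 <= exp (- c * x)" by simp
  have si: "set_integrable lborel (einterval (ereal a) \<infinity>) (\<lambda>t. exp (- c * t))"
    by (rule interval_integral_FTC_nonneg(1)[OF _ D ct nn A]) simp
  have "(LBINT t=ereal a..\<infinity>. exp (- c * t)) = 0 - (- exp (- c * a) / c)"
    by (rule interval_integral_FTC_nonneg(2)[OF _ D ct nn A]) simp
  hence v: "(LBINT t. indicator {a<..} t * exp (- c * t)) = exp (- c * a) / c"
    by (simp add: interval_integral_Ioi set_lebesgue_integral_def)
  have si': "integrable lborel (\<lambda>t. indicator {a<..} t * exp (- c * t))"
    using si by (simp add: set_integrable_def einterval_eq(3))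
  have ae: "AE t in lborel. indicator {a<..} t * exp (- c * t) = indicator {a..} t * exp (- c * t)"
    using AE_lborel_singleton[of a] by eventually_elim (auto simp: indicator_def)
  show "integrable lborel (\<lambda>t. indicator {a..} t * exp (- c * t))"
    by (rule integrable_cong_AE_imp[OF si' _ ae]) simp
  show "(LBINT t. indicator {a..} t * exp (- c * t)) = exp (- c * a) / c"
    using v integral_cong_AE[OF _ _ ae] by simp
qed

lemma cexp_integral:
  fixes s :: complex and a :: real assumes s: "Re s > 0"
  shows "integrable lborel (\<lambda>t. indicator {a..} t *\<^sub>R exp (- s * of_real t))"
    and "(LBINT t. indicator {a..} t *\<^sub>R exp (- s * of_real t)) = exp (- s * of_real a) / s"
proof -
  have s0: "s ~= 0" using s by auto
  show int: "integrable lborel (\<lambda>t. indicator {a..} t *\<^sub>R exp (- s * of_real t))"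
    by (rule Bochner_Integration.integrable_bound[OF exp_integral(1)[OF s, of a]])
       (auto simp: indicator_def norm_exp_eq_Re intro!: AE_I2)
  have lim: "((\<lambda>t. - exp (- s * of_real t) / s) \<longlongrightarrow> 0) at_top"
  proof (rule Lim_null_comparison)
    show "\<forall>\<^sub>F t in at_top. norm (- exp (- s * of_real t) / s) <= exp (- Re s * t) / norm s"
      by (intro always_eventually) (simp add: norm_divide norm_exp_eq_Re)
    show "((\<lambda>t. exp (- Re s * t) / norm s) \<longlongrightarrow> 0) at_top" using s s0 by real_asymp
  qed
  have lim2: "((\<lambda>t. - exp (- s * of_real t) / s) \<longlongrightarrow> - exp (- s * of_real a) / s) (at_right a)"
    by (intro tendsto_intros) (use s0 in auto)
  have A: "(((\<lambda>t. - exp (- s * of_real t) / s) \<circ> real_of_ereal) \<longlongrightarrow> - exp (- s * of_real a) / s) (at_right (ereal a))"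
    "(((\<lambda>t. - exp (- s * of_real t) / s) \<circ> real_of_ereal) \<longlongrightarrow> 0) (at_left \<infinity>)"
    unfolding ereal_tendsto_simps by (rule lim2, rule lim)
  have ct: "isCont (\<lambda>t. exp (- s * of_real t)) x" for x by (intro continuous_intros)
  have D: "((\<lambda>t. - exp (- s * of_real t) / s) has_vector_derivative exp (- s * of_real x)) (at x)" for x
    by (rule has_vector_derivative_real_field) (use s0 in \<open>auto intro!: derivative_eq_intros\<close>)
  have ae: "AE t in lborel. indicator {a..} t *\<^sub>R exp (- s * of_real t) = indicator {a<..} t *\<^sub>R exp (- s * of_real t)"
    using AE_lborel_singleton[of a] by eventually_elim (auto simp: indicator_def)
  have "integrable lborel (\<lambda>t. indicator {a<..} t *\<^sub>R exp (- s * of_real t))"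
    by (rule integrable_cong_AE_imp[OF int _ ae]) simp
  hence si: "set_integrable lborel (einterval (ereal a) \<infinity>) (\<lambda>t. exp (- s * of_real t))"
    by (simp add: set_integrable_def einterval_eq(3))
  have "(LBINT t=ereal a..\<infinity>. exp (- s * of_real t)) = 0 - (- exp (- s * of_real a) / s)"
    by (rule interval_integral_FTC_integrable[OF _ D ct si A]) simp
  hence "(LBINT t. indicator {a<..} t *\<^sub>R exp (- s * of_real t)) = exp (- s * of_real a) / s"
    by (simp add: interval_integral_Ioi set_lebesgue_integral_def)
  thus "(LBINT t. indicator {a..} t *\<^sub>R exp (- s * of_real t)) = exp (- s * of_real a) / s"
    using integral_cong_AE[OF _ _ ae] by simp
qed

section \<open>The Laplace transform of the Chebyshev function\<close>

definition pe :: "real => real" where "pe t = psi (nat \<lfloor>exp t\<rfloor>)"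

lemma pe_mono: "mono pe"
  unfolding pe_def by (intro monoI psi_mono nat_mono floor_mono) simp

lemma pe_measurable [measurable]: "pe \<in> borel_measurable borel"
  by (rule borel_measurable_mono[OF pe_mono])

lemma pe_nonneg: "0 <= pe t" by (simp add: pe_def psi_nonneg)

lemma pe_le: "pe t <= 4 * exp t"
proof -
  have "pe t <= 4 * real (nat \<lfloor>exp t\<rfloor>)" unfolding pe_def by (rule psi_le)
  also have "real (nat \<lfloor>exp t\<rfloor>) <= exp t" by simp
  finally show ?thesis by simp
qed

lemma pe_neg: "t < 0 ==> pe t = 0"
proof -
  assume "t < 0"
  hence "\<lfloor>exp t\<rfloor> = 0" by (intro floor_unique) auto
  thus ?thesis by (simp add: pe_def psi_def)
qed

text \<open>\<open>pe\<close> is a sum of steps starting at \<open>ln (Suc n)\<close>, and each step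
  integrates to \<open>npow n s / s\<close>. Absolute convergence permits exchanging sum and
  integral.\<close>

lemma pe_laplace:
  assumes s: "Re s > 1"
  shows "integrable lborel (\<lambda>t. of_real (pe t) * exp (- s * of_real t))"
    and "(LBINT t. of_real (pe t) * exp (- s * of_real t)) = L s / s"
proof -
  have s0: "Re s > 0" using s by simp
  define f where "f = (\<lambda>n t. complex_of_real (mangoldt (Suc n)) * (indicator {ln (real (Suc n))..} t *\<^sub>R exp (- s * of_real t)))"
  have fi: "integrable lborel (f n)" for n unfolding f_def by (intro integrable_mult_right cexp_integral s0)
  have fv: "integral\<^sup>L lborel (f n) = of_real (mangoldt (Suc n)) * npow n s / s" for n
    unfolding f_def Bochner_Integration.integral_mult_right_zero cexp_integral(2)[OF s0] npow_def nat_powr_exp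
    by (simp add: mult.commute del: of_nat_Suc of_real_mangoldt)
  have nf: "norm (f n t) = mangoldt (Suc n) * (indicator {ln (real (Suc n))..} t * exp (- Re s * t))" for n t
    by (simp add: f_def norm_mult norm_exp_eq_Re mangoldt_nonneg del: of_nat_Suc)
  have nv: "(LBINT t. norm (f n t)) = norm (of_real (mangoldt (Suc n)) * npow n s) / Re s" for n
    unfolding nf Bochner_Integration.integral_mult_right_zero exp_integral(2)[OF s0]
    by (simp add: norm_mult norm_npow powr_def mangoldt_nonneg del: of_nat_Suc)
  have sm: "summable (\<lambda>n. (LBINT t. norm (f n t)))"
    unfolding nv by (intro summable_divide L_summable s)
  have fin: "f n t = 0" if "n \<notin> {..<nat \<lfloor>exp t\<rfloor>}" for n t
  proof -
    have "nat \<lfloor>exp t\<rfloor> <= n" using that by simp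
    hence "\<lfloor>exp t\<rfloor> <= int n" by simp
    hence "exp t < real (Suc n)" unfolding floor_le_iff by simp
    hence "ln (exp t) < ln (real (Suc n))" by (subst ln_less_cancel_iff) auto
    hence "t < ln (real (Suc n))" by simp
    thus ?thesis by (simp add: f_def del: of_nat_Suc)
  qed
  have in1: "f n t = of_real (mangoldt (Suc n)) * exp (- s * of_real t)" if "n \<in> {..<nat \<lfloor>exp t\<rfloor>}" for n t
  proof -
    have "int (Suc n) <= \<lfloor>exp t\<rfloor>" using that by (simp add: zless_nat_eq_int_zless)
    hence "real (Suc n) <= exp t" by (simp only: le_floor_iff of_int_of_nat_eq)
    hence "ln (real (Suc n)) <= ln (exp t)" by (subst ln_le_cancel_iff) auto
    hence "ln (real (Suc n)) <= t" by (simp del: of_nat_Suc)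
    thus ?thesis by (simp add: f_def del: of_nat_Suc)
  qed
  have sums: "summable (\<lambda>n. norm (f n t))" for t
    by (rule summable_finite[of "{..<nat \<lfloor>exp t\<rfloor>}"]) (use fin in auto)
  have sv: "(\<Sum>n. f n t) = of_real (pe t) * exp (- s * of_real t)" for t
  proof -
    have "(\<Sum>n. f n t) = (\<Sum>n<nat \<lfloor>exp t\<rfloor>. f n t)" by (rule suminf_finite) (use fin in auto)
    also have "... = (\<Sum>n<nat \<lfloor>exp t\<rfloor>. of_real (mangoldt (Suc n)) * exp (- s * of_real t))"
      by (intro sum.cong refl in1)
    also have "... = of_real (pe t) * exp (- s * of_real t)"
      by (simp add: pe_def psi_def sum.atLeast1_atMost_eq sum_distrib_right)
    finally show ?thesis .
  qed
  show "integrable lborel (\<lambda>t. of_real (pe t) * exp (- s * of_real t))"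
    using integrable_suminf[OF fi _ sm] sums by (simp add: sv)
  have "(LBINT t. \<Sum>n. f n t) = (\<Sum>n. integral\<^sup>L lborel (f n))"
    by (rule integral_suminf[OF fi _ sm]) (use sums in auto)
  also have "... = L s / s" unfolding fv using sums_divide[OF L_sums[OF s], of s] by (simp add: sums_iff)
  finally show "(LBINT t. of_real (pe t) * exp (- s * of_real t)) = L s / s" by (simp only: sv)
qed

text \<open>The relative error in the prime number theorem on a logarithmic scale, cut off to the
  left of 0.\<close>

definition Be :: "real => real" where "Be t = pe t * exp (- t) - indicator {0..} t"

lemma Be_measurable [measurable]: "Be \<in> borel_measurable borel" unfolding Be_def by measurable

lemma Be_bound: "\<bar>Be t\<bar> <= 4"
proof -
  have "pe t * exp (- t) <= 4 * exp t * exp (- t)" by (intro mult_right_mono pe_le) simp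
  also have "... = 4" by (simp add: exp_minus)
  finally have "pe t * exp (- t) <= 4" .
  moreover have "0 <= pe t * exp (- t)" by (simp add: pe_nonneg)
  ultimately show ?thesis by (cases "t >= 0") (simp_all add: Be_def abs_le_iff)
qed

lemma Be_neg: "t < 0 ==> Be t = 0" by (simp add: Be_def pe_neg)

text \<open>This is \<open>L s / s - 1 / (s - 1)\<close> after the pole at 1 has been cancelled, so
  it makes sense on the line \<open>Re s = 1\<close>.\<close>

definition gg :: "complex => complex" where "gg s = - 1 / s - deriv H s / (s * H s)"

lemma gg_continuous: "continuous_on {s. Re s >= 1} gg"
proof -
  have sub: "{s. Re s >= 1} \<subseteq> half_plane 0" by (auto simp: half_plane_def)
  have "continuous_on {s. Re s >= 1} H"
    using H_holomorphic sub by (meson continuous_on_subset holomorphic_on_imp_continuous_on)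
  moreover have "continuous_on {s. Re s >= 1} (deriv H)"
    using holomorphic_deriv[OF H_holomorphic open_half_plane] sub by (meson continuous_on_subset holomorphic_on_imp_continuous_on)
  moreover have "s ~= 0" if "Re s >= 1" for s using that by auto
  ultimately show ?thesis unfolding gg_def by (intro continuous_intros) (auto simp: H_nonzero)
qed

lemma Be_laplace:
  assumes e: "e > 0"
  shows "(LBINT t. of_real (Be t * exp (- e * t)) * cis (- y * t)) = gg (1 + of_real e + \<i> * of_real y)"
proof -
  define s where "s = 1 + of_real e + \<i> * complex_of_real y"
  have s1: "Re s > 1" "Re (s - 1) > 0" using e by (simp_all add: s_def)
  have nz: "s ~= 0" "s - 1 ~= 0" "H s ~= 0" using s1 H_nonzero[of s] by auto
  have eq: "of_real (Be t * exp (- e * t)) * cis (- y * t) = of_real (pe t) * exp (- s * of_real t) - indicator {0..} t *\<^sub>R exp (- (s - 1) * of_real t)" for t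
  proof -
    have e1: "exp (- (s - 1) * of_real t) = of_real (exp (- e * t)) * cis (- y * t)"
      unfolding s_def cis_conv_exp exp_of_real[symmetric] exp_add[symmetric] by (simp add: algebra_simps)
    have e2: "exp (- s * of_real t) = of_real (exp (- t)) * exp (- (s - 1) * of_real t)"
      unfolding exp_of_real[symmetric] exp_add[symmetric] by (simp add: algebra_simps)
    show ?thesis unfolding e2 e1 Be_def by (simp add: algebra_simps scaleR_conv_of_real)
  qed
  have "(LBINT t. of_real (Be t * exp (- e * t)) * cis (- y * t)) = L s / s - 1 / (s - 1)"
    unfolding eq Bochner_Integration.integral_diff[OF pe_laplace(1)[OF s1(1)] cexp_integral(1)[OF s1(2)]]
      pe_laplace(2)[OF s1(1)] cexp_integral(2)[OF s1(2)] by simp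
  also have "... = gg s"
  proof -
    have "L s = 1 / (s - 1) - deriv H s / H s" using deriv_H[OF s1(1)] nz by (simp add: field_simps)
    hence "L s / s - 1 / (s - 1) = (1 / (s - 1)) / s - 1 / (s - 1) - deriv H s / (s * H s)" by (simp add: diff_divide_distrib mult.commute)
    also have "(1 / (s - 1)) / s - 1 / (s - 1) = - 1 / s" using nz by (simp add: divide_simps)
    finally show ?thesis by (simp add: gg_def)
  qed
  finally show ?thesis by (simp add: s_def)
qed


section \<open>The Tauberian argument\<close>

text \<open>Fubini's theorem for the triangle against the Laplace transform. The damping
  \<open>exp (- e * t)\<close> keeps the double integral absolutely convergent.\<close>

lemma fejer_Be_identity_eps:
  assumes l: "l > 0" and e: "e > 0"
  shows "(LBINT y. of_real (fw l y) * cis (y * T) * gg (1 + of_real e + \<i> * of_real y)) =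
    of_real ((LBINT t. Be t * exp (- e * t) * fejer l (T - t)))"
proof -
  define b where "b = (\<lambda>t. Be t * exp (- e * t))"
  have bm [measurable]: "b \<in> borel_measurable borel" unfolding b_def by measurable
  have bi: "integrable lborel b"
  proof (rule Bochner_Integration.integrable_bound)
    show "integrable lborel (\<lambda>t. 4 * (indicator {0..} t * exp (- e * t)))"
      by (intro integrable_mult_right exp_integral(1) e)
    show "AE t in lborel. norm (b t) <= norm (4 * (indicator {0..} t * exp (- e * t)))"
    proof (rule AE_I2)
      fix t show "norm (b t) <= norm (4 * (indicator {0..} t * exp (- e * t)))"
        using Be_neg[of t] Be_bound[of t] by (cases "t < 0") (auto simp: b_def abs_mult intro: mult_right_mono)
    qed
  qed simp
  define f where "f = (\<lambda>y t. of_real (fw l y) * cis (y * T) * (of_real (b t) * cis (- y * t)))"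
  have fm: "case_prod f \<in> borel_measurable (lborel \<Otimes>\<^sub>M lborel)" unfolding f_def by measurable
  have nf: "norm (f y t) = fw l y * norm (b t)" for y t by (simp add: f_def norm_mult fw_nonneg)
  have fi: "integrable (lborel \<Otimes>\<^sub>M lborel) (case_prod f)"
  proof (rule lborel_pair.Fubini_integrable[OF fm])
    show "integrable lborel (\<lambda>y. (LBINT t. norm (case (y, t) of (y, t) => f y t)))"
      using fw_integrable[OF l] by (simp add: nf)
    show "AE y in lborel. integrable lborel (\<lambda>t. case (y, t) of (y, t) => f y t)"
    proof (rule AE_I2)
      fix y
      have "integrable lborel (\<lambda>t. f y t)"
        by (rule Bochner_Integration.integrable_bound[OF integrable_mult_right[OF bi, of "fw l y"]])
           (auto intro!: AE_I2 simp: nf abs_mult fw_nonneg, simp add: f_def)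
      thus "integrable lborel (\<lambda>t. case (y, t) of (y, t) => f y t)" by simp
    qed
  qed
  have "(LBINT y. of_real (fw l y) * cis (y * T) * gg (1 + of_real e + \<i> * of_real y)) =
      (LBINT y. (LBINT t. f y t))"
    unfolding f_def Bochner_Integration.integral_mult_right_zero b_def Be_laplace[OF e] ..
  also have "... = (LBINT t. (LBINT y. f y t))"
    by (rule lborel_pair.Fubini_integral[OF fi, symmetric])
  also have "... = (LBINT t. complex_of_real (b t * fejer l (T - t)))"
  proof (rule Bochner_Integration.integral_cong[OF refl])
    fix t
    have "f y t = of_real (b t) * (of_real (fw l y) * cis (y * (T - t)))" for y
    proof -
      have "cis (y * T) * cis (- y * t) = cis (y * (T - t))" by (simp add: cis_mult right_diff_distrib)
      thus ?thesis unfolding f_def by (metis mult.assoc mult.commute)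
    qed
    thus "(LBINT y. f y t) = complex_of_real (b t * fejer l (T - t))"
      by (simp only: Bochner_Integration.integral_mult_right_zero fw_transform[OF l] of_real_mult)
  qed
  also have "... = of_real ((LBINT t. b t * fejer l (T - t)))" by (rule integral_complex_of_real)
  finally show ?thesis unfolding b_def .
qed

lemma gg_bound: obtains M where "M >= 0" "\<And>s. 1 <= Re s ==> Re s <= 2 ==> \<bar>Im s\<bar> <= l ==> norm (gg s) <= M"
proof -
  define S where "S = cbox (Complex 1 (- l)) (Complex 2 l)"
  have inS: "s \<in> S \<longleftrightarrow> 1 <= Re s & Re s <= 2 & \<bar>Im s\<bar> <= l" for s by (auto simp: S_def in_cbox_complex_iff abs_le_iff)
  have "compact (gg ` S)"
    by (rule compact_continuous_image[OF continuous_on_subset[OF gg_continuous]]) (auto simp: inS, simp add: S_def)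
  hence "bounded (gg ` S)" by (rule compact_imp_bounded)
  then obtain M where M: "\<And>x. x \<in> gg ` S ==> norm x <= M" unfolding bounded_iff by blast
  show thesis
  proof (rule that[of "max 0 M"])
    fix s assume "1 <= Re s" "Re s <= 2" "\<bar>Im s\<bar> <= l"
    hence "gg s \<in> gg ` S" by (simp add: inS)
    from M[OF this] show "norm (gg s) <= max 0 M" by simp
  qed simp
qed

definition hh :: "real => real => complex" where "hh l y = of_real (fw l y) * gg (1 + \<i> * of_real y)"

lemma hh_continuous: "continuous_on UNIV (hh l)"
  unfolding hh_def
  by (intro continuous_intros fw_continuous continuous_on_compose2[OF gg_continuous]) auto

text \<open>Let the damping tend to 0. Both sides are dominated: one because \<open>Be\<close> is
  bounded, the other because \<open>gg\<close> is bounded on a compact rectangle that reaches the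
  line.\<close>

lemma fejer_Be_identity:
  assumes l: "l > 0"
  shows "of_real ((LBINT t. Be t * fejer l (T - t))) = (LBINT y. hh l y * cis (y * T))"
proof -
  obtain M where M: "M >= 0" "\<And>s. 1 <= Re s ==> Re s <= 2 ==> \<bar>Im s\<bar> <= l ==> norm (gg s) <= M" using gg_bound[of l] by blast
  define e where "e = (\<lambda>n::nat. 1 / real (Suc n))"
  have e: "e n > 0" "e n <= 1" for n by (simp_all add: e_def)
  have e0: "e \<longlonglongrightarrow> 0" unfolding e_def by real_asymp
  have gm: "continuous_on UNIV (\<lambda>y::real. gg (1 + of_real (e n) + \<i> * of_real y))" for n
    by (intro continuous_intros continuous_on_compose2[OF gg_continuous]) (use e(1)[of n] in auto)
  have "(\<lambda>n. (LBINT t. Be t * exp (- e n * t) * fejer l (T - t))) \<longlonglongrightarrow> (LBINT t. Be t * fejer l (T - t))"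
  proof (rule integral_dominated_convergence[where w = "\<lambda>t. 4 * fejer l (T - t)"])
    show "integrable lborel (\<lambda>t. 4 * fejer l (T - t))" by (intro integrable_mult_right fejer_shift_integrable l)
    show "AE t in lborel. (\<lambda>n. Be t * exp (- e n * t) * fejer l (T - t)) \<longlonglongrightarrow> Be t * fejer l (T - t)"
    proof (rule AE_I2)
      fix t
      have "(\<lambda>n. Be t * exp (- e n * t) * fejer l (T - t)) \<longlonglongrightarrow> Be t * exp (- 0 * t) * fejer l (T - t)"
        by (intro tendsto_intros e0)
      thus "(\<lambda>n. Be t * exp (- e n * t) * fejer l (T - t)) \<longlonglongrightarrow> Be t * fejer l (T - t)" by simp
    qed
    show "AE t in lborel. norm (Be t * exp (- e n * t) * fejer l (T - t)) <= 4 * fejer l (T - t)" for n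
    proof (rule AE_I2)
      fix t
      have "\<bar>Be t * exp (- e n * t)\<bar> <= 4"
      proof (cases "t < 0")
        case False
        hence "exp (- e n * t) <= 1" using e(1)[of n] by (simp add: mult_nonneg_nonneg less_imp_le)
        hence "\<bar>Be t\<bar> * exp (- e n * t) <= 4 * 1" by (intro mult_mono Be_bound) auto
        thus ?thesis by (simp add: abs_mult)
      qed (simp add: Be_neg)
      thus "norm (Be t * exp (- e n * t) * fejer l (T - t)) <= 4 * fejer l (T - t)"
        using fejer_nonneg[OF l] by (simp add: abs_mult[of _ "fejer l (T - t)"] mult_right_mono)
    qed
  qed auto
  hence "(\<lambda>n. complex_of_real ((LBINT t. Be t * exp (- e n * t) * fejer l (T - t)))) \<longlonglongrightarrow> of_real ((LBINT t. Be t * fejer l (T - t)))"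
    by (rule tendsto_of_real)
  moreover have "(\<lambda>n. (LBINT y. of_real (fw l y) * cis (y * T) * gg (1 + of_real (e n) + \<i> * of_real y))) \<longlonglongrightarrow> (LBINT y. hh l y * cis (y * T))"
  proof (rule integral_dominated_convergence[where w = "\<lambda>y. fw l y * M"])
    show "integrable lborel (\<lambda>y. fw l y * M)" by (intro integrable_mult_left fw_integrable l)
    show "(\<lambda>y. hh l y * cis (y * T)) \<in> borel_measurable lborel"
      using borel_measurable_continuous_onI[OF hh_continuous[of l]] by simp
    show "(\<lambda>y. of_real (fw l y) * cis (y * T) * gg (1 + of_real (e n) + \<i> * of_real y)) \<in> borel_measurable lborel" for n
      using borel_measurable_continuous_onI[OF gm[of n]] by simp
    show "AE y in lborel. (\<lambda>n. of_real (fw l y) * cis (y * T) * gg (1 + of_real (e n) + \<i> * of_real y)) \<longlonglongrightarrow> hh l y * cis (y * T)"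
    proof (rule AE_I2)
      fix y
      have "(\<lambda>n. gg (1 + of_real (e n) + \<i> * of_real y)) \<longlonglongrightarrow> gg (1 + of_real 0 + \<i> * of_real y)"
      proof (rule continuous_on_tendsto_compose[OF gg_continuous])
        show "(\<lambda>n. 1 + of_real (e n) + \<i> * of_real y) \<longlonglongrightarrow> 1 + of_real 0 + \<i> * complex_of_real y" by (intro tendsto_intros e0)
      qed (use e(1) in \<open>auto intro!: always_eventually less_imp_le\<close>)
      from tendsto_mult_left[OF this, of "of_real (fw l y) * cis (y * T)"]
      show "(\<lambda>n. of_real (fw l y) * cis (y * T) * gg (1 + of_real (e n) + \<i> * of_real y)) \<longlonglongrightarrow> hh l y * cis (y * T)"
        by (simp add: hh_def mult_ac)
    qed
    show "AE y in lborel. norm (of_real (fw l y) * cis (y * T) * gg (1 + of_real (e n) + \<i> * of_real y)) <= fw l y * M" for n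
    proof (rule AE_I2)
      fix y
      show "norm (of_real (fw l y) * cis (y * T) * gg (1 + of_real (e n) + \<i> * of_real y)) <= fw l y * M"
      proof (cases "\<bar>y\<bar> >= l")
        case False
        have "norm (gg (1 + of_real (e n) + \<i> * of_real y)) <= M" using False e[of n] by (intro M(2)) auto
        thus ?thesis using fw_nonneg[of l y] by (simp add: norm_mult mult_left_mono)
      qed (simp add: fw_support l)
    qed
  qed
  ultimately show ?thesis unfolding fejer_Be_identity_eps[OF l e(1)] by (rule LIMSEQ_unique)
qed

text \<open>Translation by \<open>pi / T n\<close> changes the sign of the oscillating factor.
  Averaging the two forms leaves \<open>h\<close> minus its translate, which tends to 0 by
  continuity.\<close>

lemma riemann_lebesgue:
  fixes h :: "real => complex"
  assumes c: "continuous_on UNIV h" and z: "\<And>y. \<bar>y\<bar> > l ==> h y = 0" and T: "filterlim T at_top sequentially"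
  shows "(\<lambda>n. (LBINT y. h y * cis (y * T n))) \<longlonglongrightarrow> 0"
proof -
  define a where "a = (\<lambda>n::nat. pi / T n)"
  have hm [measurable]: "h \<in> borel_measurable borel" by (rule borel_measurable_continuous_onI[OF c])
  have Tpos: "\<forall>\<^sub>F n in sequentially. T n > 4" using T by (simp add: filterlim_at_top_dense)
  have a0: "a \<longlonglongrightarrow> 0" unfolding a_def using T by (intro real_tendsto_divide_at_top[OF tendsto_const])
  have hi: "integrable lborel (\<lambda>y. h y * cis (y * t))" for t
    by (rule integrable_compact_support[of _ l]) (use c z in \<open>auto intro!: continuous_intros\<close>)
  have "compact (h ` {-l..l})" by (intro compact_continuous_image continuous_on_subset[OF c]) auto
  hence "bounded (h ` {-l..l})" by (rule compact_imp_bounded)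
  then obtain M where M: "\<And>x. x \<in> h ` {-l..l} ==> norm x <= M" unfolding bounded_iff by blast
  have hM: "norm (h y) <= max 0 M" for y
  proof (cases "\<bar>y\<bar> > l")
    case False
    hence "h y \<in> h ` {-l..l}" by (intro imageI) auto
    from M[OF this] show ?thesis by simp
  qed (simp add: z)
  have key: "norm ((LBINT y. h y * cis (y * T n))) <= (1/2) * (LBINT y. norm (h y - h (a n + y)))" if n: "T n > 4" for n
  proof -
    define I where "I = (LBINT y. h y * cis (y * T n))"
    have eq: "h (a n + 1 * y) * cis ((a n + 1 * y) * T n) = - (h (a n + y) * cis (y * T n))" for y
    proof -
      have "(a n + 1 * y) * T n = y * T n + pi" using n by (simp add: a_def field_simps)
      hence "cis ((a n + 1 * y) * T n) = cis (y * T n) * cis pi" by (simp only: cis_mult)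
      thus ?thesis by simp
    qed
    have i2: "integrable lborel (\<lambda>y. - (h (a n + y) * cis (y * T n)))"
      using lborel_integrable_real_affine[OF hi[of "T n"], of 1 "a n"] unfolding eq by simp
    have "I = (LBINT y. - (h (a n + y) * cis (y * T n)))"
      unfolding I_def by (subst lborel_integral_real_affine[where c = 1 and t = "a n"]) (simp_all add: eq[simplified])
    hence "2 * I = (LBINT y. h y * cis (y * T n)) + (LBINT y. - (h (a n + y) * cis (y * T n)))"
      by (simp add: I_def)
    also have "... = (LBINT y. h y * cis (y * T n) + - (h (a n + y) * cis (y * T n)))"
      by (rule Bochner_Integration.integral_add[OF hi i2, symmetric])
    also have "norm ... <= (LBINT y. norm (h y * cis (y * T n) + - (h (a n + y) * cis (y * T n))))"
      by (rule integral_norm_bound)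
    also have "(\<lambda>y. norm (h y * cis (y * T n) + - (h (a n + y) * cis (y * T n)))) = (\<lambda>y. norm (h y - h (a n + y)))"
    proof
      fix y
      have "h y * cis (y * T n) + - (h (a n + y) * cis (y * T n)) = (h y - h (a n + y)) * cis (y * T n)" by (simp add: algebra_simps)
      thus "norm (h y * cis (y * T n) + - (h (a n + y) * cis (y * T n))) = norm (h y - h (a n + y))" by (simp add: norm_mult)
    qed
    finally show ?thesis by (simp add: I_def norm_mult)
  qed
  define hn where "hn = (\<lambda>n y. indicator {-l-1..l+1} y * norm (h y - h (a n + y)))"
  have "(\<lambda>n. integral\<^sup>L lborel (hn n)) \<longlonglongrightarrow> (LBINT y::real. 0::real)"
  proof (rule integral_dominated_convergence[where w = "\<lambda>y. indicator {-l-1..l+1} y * (2 * max 0 M)"])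
    show "integrable lborel (\<lambda>y. indicator {-l-1..l+1} y * (2 * max 0 M) :: real)"
      by (intro integrable_mult_left integrable_real_indicator) (auto simp: emeasure_lborel_Icc_eq)
    show "AE y in lborel. (\<lambda>n. hn n y) \<longlonglongrightarrow> 0"
    proof (rule AE_I2)
      fix y
      have "isCont h (0 + y)" using c by (simp add: continuous_on_eq_continuous_at)
      hence "(\<lambda>n. h (a n + y)) \<longlonglongrightarrow> h (0 + y)" by (rule isCont_tendsto_compose) (intro tendsto_intros a0)
      hence "(\<lambda>n. indicator {-l-1..l+1} y * norm (h y - h (a n + y))) \<longlonglongrightarrow> indicator {-l-1..l+1} y * norm (h y - h (0 + y))"
        by (intro tendsto_intros)
      thus "(\<lambda>n. hn n y) \<longlonglongrightarrow> 0" by (simp add: hn_def)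
    qed
    show "AE y in lborel. norm (hn n y) <= indicator {-l-1..l+1} y * (2 * max 0 M)" for n
    proof (rule AE_I2)
      fix y
      have "norm (h y - h (a n + y)) <= max 0 M + max 0 M" using norm_triangle_ineq4 hM hM by (rule order.trans[OF _ add_mono])
      thus "norm (hn n y) <= indicator {-l-1..l+1} y * (2 * max 0 M)" by (simp add: hn_def indicator_def)
    qed
  qed (simp_all add: hn_def)
  hence "(\<lambda>n. (1/2) * integral\<^sup>L lborel (hn n)) \<longlonglongrightarrow> (1/2) * 0" by (intro tendsto_mult_left) simp
  hence lim: "(\<lambda>n. (1/2) * integral\<^sup>L lborel (hn n)) \<longlonglongrightarrow> 0" by simp
  show ?thesis
  proof (rule Lim_null_comparison[OF _ lim])
    show "\<forall>\<^sub>F n in sequentially. norm ((LBINT y. h y * cis (y * T n))) <= (1/2) * integral\<^sup>L lborel (hn n)"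
      using Tpos
    proof eventually_elim
      case (elim n)
      have an: "0 < a n" "a n < 1" using elim pi_less_4 by (auto simp: a_def)
      have "hn n = (\<lambda>y. norm (h y - h (a n + y)))"
      proof
        fix y
        show "hn n y = norm (h y - h (a n + y))"
        proof (cases "y \<in> {-l-1..l+1}")
          case False
          hence "\<bar>y\<bar> > l" "\<bar>a n + y\<bar> > l" using an by auto
          thus ?thesis using False by (simp add: hn_def z)
        qed (simp add: hn_def)
      qed
      with key[OF elim] show ?case by simp
    qed
  qed
qed

lemma fejer_Be_tendsto:
  assumes "l > 0" "filterlim T at_top sequentially"
  shows "(\<lambda>n. (LBINT t. Be t * fejer l (T n - t))) \<longlonglongrightarrow> 0"
proof -
  have "(\<lambda>n. complex_of_real ((LBINT t. Be t * fejer l (T n - t)))) \<longlonglongrightarrow> 0"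
    unfolding fejer_Be_identity[OF assms(1)]
    by (rule riemann_lebesgue[OF hh_continuous _ assms(2), of l]) (simp add: hh_def fw_support assms(1))
  hence "(\<lambda>n. complex_of_real ((LBINT t. Be t * fejer l (T n - t)))) \<longlonglongrightarrow> of_real 0" by (simp only: of_real_0)
  thus ?thesis by (simp only: tendsto_of_real_iff)
qed

text \<open>Since \<open>pe\<close> increases, within distance \<open>d\<close> of \<open>T\<close>
  the normalised function is at most its value at \<open>T + d\<close> times
  \<open>exp (2 * d)\<close>. Farther away it is at most 4, which meets only the tail of the kernel.
  The term \<open>ftail (l * T)\<close> removes the part \<open>t < 0\<close>.\<close>

lemma fejer_Be_upper:
  assumes l: "l > 0" and d: "d > 0"
  shows "fc - ftail (l * T) + (LBINT t. Be t * fejer l (T - t)) \<le>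
    pe (T + d) * exp (- (T + d)) * exp (2 * d) * fc + 4 * ftail (l * d)"
proof -
  have fi: "integrable lborel (\<lambda>t. fejer l (T - t))" by (rule fejer_shift_integrable[OF l])
  have ii: "integrable lborel (\<lambda>t. g t * fejer l (T - t))" if [measurable]: "g \<in> borel_measurable borel" and "\<And>t. \<bar>g t\<bar> <= C" for g C
    by (rule Bochner_Integration.integrable_bound[OF integrable_mult_right[OF fi, of C]])
       (use that fejer_nonneg[OF l] order.trans[OF abs_ge_zero that(2)] in \<open>auto intro!: AE_I2 mult_right_mono simp: abs_mult\<close>)
  define A where "A = (\<lambda>t. pe t * exp (- t))"
  have A4: "\<bar>A t\<bar> <= 4" for t
  proof -
    have "pe t * exp (- t) <= 4 * exp t * exp (- t)" by (intro mult_right_mono pe_le) simp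
    also have "... = 4" by (simp add: exp_minus)
    finally show ?thesis by (simp add: A_def pe_nonneg)
  qed
  have Am [measurable]: "A \<in> borel_measurable borel" unfolding A_def by measurable
  have iA: "integrable lborel (\<lambda>t. A t * fejer l (T - t))" by (rule ii[OF Am A4])
  have iB: "integrable lborel (\<lambda>t. Be t * fejer l (T - t))" by (rule ii[OF Be_measurable Be_bound])
  have iT: "integrable lborel (\<lambda>t. indicator {t. \<bar>T - t\<bar> > x} t * fejer l (T - t))" for x
    by (rule ii[of _ 1]) (auto simp: indicator_def)
  have "fc - ftail (l * T) + (LBINT t. Be t * fejer l (T - t)) =
    (LBINT t. fejer l (T - t) - indicator {t. \<bar>T - t\<bar> > T} t * fejer l (T - t) + Be t * fejer l (T - t))"
    using fi iT[of T] iB by (simp add: fejer_total[OF l] fejer_tail[OF l])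
  also have "... <= (LBINT t. A t * fejer l (T - t))"
  proof (rule integral_mono)
    fix t
    \<comment> \<open>For \<open>t < 0\<close> both functions vanish, and the indicator is 1 because
      \<open>T - t > T\<close>.\<close>
    have "1 - indicator {t. \<bar>T - t\<bar> > T} t + Be t <= A t"
      by (cases "t < 0") (auto simp: Be_def A_def indicator_def pe_neg)
    from mult_right_mono[OF this fejer_nonneg[OF l, of "T - t"]]
    show "fejer l (T - t) - indicator {t. \<bar>T - t\<bar> > T} t * fejer l (T - t) + Be t * fejer l (T - t) <= A t * fejer l (T - t)"
      by (simp add: algebra_simps)
  qed (use fi iT[of T] iB iA in auto)
  also have "... <= (LBINT t. A (T + d) * exp (2 * d) * fejer l (T - t) + 4 * (indicator {t. \<bar>T - t\<bar> > d} t * fejer l (T - t)))"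
  proof (rule integral_mono)
    fix t
    have "A t <= A (T + d) * exp (2 * d) + 4 * indicator {t. \<bar>T - t\<bar> > d} t"
    proof (cases "\<bar>T - t\<bar> > d")
      case True
      have "0 <= A (T + d) * exp (2 * d)" by (simp add: A_def pe_nonneg)
      thus ?thesis using A4[of t] True by simp
    next
      case False
      hence t: "t <= T + d" "T - d <= t" by auto
      have "A t <= pe (T + d) * exp (- (T - d))" unfolding A_def
        using monoD[OF pe_mono t(1)] t(2) pe_nonneg by (intro mult_mono) auto
      also have "... = A (T + d) * exp (2 * d)" by (simp add: A_def mult.assoc flip: exp_add)
      finally show ?thesis using False by simp
    qed
    from mult_right_mono[OF this fejer_nonneg[OF l, of "T - t"]]
    show "A t * fejer l (T - t) <= A (T + d) * exp (2 * d) * fejer l (T - t) + 4 * (indicator {t. \<bar>T - t\<bar> > d} t * fejer l (T - t))"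
      by (simp add: algebra_simps)
  qed (use fi iT[of d] iA in auto)
  also have "... = A (T + d) * exp (2 * d) * fc + 4 * ftail (l * d)"
    using fi iT[of d] by (simp add: fejer_total[OF l] fejer_tail[OF l])
  finally show ?thesis by (simp add: A_def)
qed

lemma psi_lower:
  assumes e: "0 < e" "e < 1"
  shows "\<forall>\<^sub>F n in sequentially. (1 - e) * real n <= psi n"
proof -
  \<comment> \<open>Chosen so that the loss \<open>exp (2 * d)\<close> equals
    \<open>1 / (1 - e / 2)\<close>. Below, \<open>l = x / d\<close> makes the tail small, and
    \<open>T n + d = ln n\<close> evaluates \<open>pe\<close> at \<open>n\<close>.\<close>
  define d where "d = - ln (1 - e / 2) / 2"
  have d: "d > 0" "exp (2 * d) = 1 / (1 - e / 2)" using e by (simp_all add: d_def exp_minus field_simps)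
  have "\<forall>\<^sub>F x in at_top. ftail x < e * fc / 32" using ftail_tendsto fc_pos e by (intro order_tendstoD(2)[of _ 0]) auto
  then obtain x0 where "\<And>x. x >= x0 ==> ftail x < e * fc / 32" unfolding eventually_at_top_linorder by blast
  from this[of "max x0 1"] obtain x where x: "x > 0" "ftail x < e * fc / 32"
    by (intro that[of "max x0 1"]) auto
  define l where "l = x / d"
  have l: "l > 0" "l * d = x" using x d by (simp_all add: l_def)
  define T where "T = (\<lambda>n::nat. ln (real n) - d)"
  have T: "filterlim T at_top sequentially" unfolding T_def by real_asymp
  have "filterlim (\<lambda>n. l * T n) at_top sequentially" using l by (intro filterlim_tendsto_pos_mult_at_top[OF tendsto_const _ T]) auto
  hence "(\<lambda>n. ftail (l * T n)) \<longlonglongrightarrow> 0" using ftail_tendsto by (rule filterlim_compose[rotated])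
  hence "(\<lambda>n. - ftail (l * T n) + (LBINT t. Be t * fejer l (T n - t))) \<longlonglongrightarrow> - 0 + 0"
    by (intro tendsto_intros fejer_Be_tendsto l T)
  hence "\<forall>\<^sub>F n in sequentially. - ftail (l * T n) + (LBINT t. Be t * fejer l (T n - t)) > - (e * fc / 8)"
    using fc_pos e by (intro order_tendstoD(1)[of _ 0]) auto
  thus ?thesis using eventually_gt_at_top[of 0]
  proof eventually_elim
    case (elim n)
    have "fc - ftail (l * T n) + (LBINT t. Be t * fejer l (T n - t)) \<le>
       pe (T n + d) * exp (- (T n + d)) * exp (2 * d) * fc + 4 * ftail (l * d)" by (rule fejer_Be_upper[OF l(1) d(1)])
    also have "pe (T n + d) * exp (- (T n + d)) = psi n / real n"
      using elim(2) by (simp add: T_def pe_def exp_minus divide_inverse)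
    finally have "fc - e * fc / 8 <= psi n / real n * exp (2 * d) * fc + e * fc / 8" using elim(1) x(2) unfolding l(2) by linarith
    hence "(1 - e / 4) * fc <= (psi n / real n * exp (2 * d)) * fc" by (simp add: algebra_simps)
    hence "1 - e / 4 <= psi n / real n * exp (2 * d)" using fc_pos by (rule mult_right_le_imp_le)
    hence "1 - e / 4 <= (psi n / real n) / (1 - e / 2)" unfolding d(2) by simp
    moreover have "1 - e / 2 > 0" using e by simp
    ultimately have "(1 - e / 4) * (1 - e / 2) <= psi n / real n" by (simp only: pos_le_divide_eq)
    moreover have "1 - e <= (1 - e / 4) * (1 - e / 2)" using e by (simp add: algebra_simps)
    ultimately have "1 - e <= psi n / real n" by linarith
    thus ?case using elim(2) by (simp add: field_simps)
  qed
qed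

section \<open>Counting primes and prime pairs\<close>

text \<open>A prime \<open>p\<close> has at most \<open>ln n / ln p\<close> powers up to
  \<open>n\<close>, each of weight \<open>ln p\<close>.\<close>

lemma psi_le_prime_count: "n >= 1 ==> psi n <= real (card {p. prime p & p <= n}) * ln (real n)"
proof -
  assume n: "n >= 1"
  define P where "P = {p. prime p & p <= n}"
  have fP: "finite P" unfolding P_def by (rule finite_subset[of _ "{..n}"]) auto
  define S where "S = {d \<in> {1..n}. primepow d}"
  define B where "B = (\<lambda>p. {d \<in> {1..n}. primepow d & aprimedivisor d = p})"
  have "psi n = (\<Sum>d\<in>S. mangoldt d)" unfolding psi_def S_def
    by (intro sum.mono_neutral_right) (auto simp: mangoldt_def)
  also have "... = (\<Sum>d\<in>S. ln (real (aprimedivisor d)))" by (intro sum.cong) (auto simp: S_def mangoldt_def)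
  also have "... = (\<Sum>p\<in>P. \<Sum>d\<in>{d \<in> S. aprimedivisor d = p}. ln (real (aprimedivisor d)))"
  proof (rule sum.group[symmetric])
    show "aprimedivisor ` S \<subseteq> P"
    proof
      fix p assume "p \<in> aprimedivisor ` S"
      then obtain d where d: "d \<in> S" "p = aprimedivisor d" by auto
      have "prime p" using d by (auto simp: S_def primepow_gt_Suc_0 intro!: prime_aprimedivisor' dest: primepow_gt_Suc_0)
      moreover have "p dvd d" using d by (auto simp: S_def intro!: aprimedivisor_dvd' dest: primepow_gt_Suc_0)
      hence "p <= d" using d by (intro dvd_imp_le) (auto simp: S_def)
      ultimately show "p \<in> P" using d by (auto simp: P_def S_def)
    qed
  qed (auto simp: S_def fP)
  also have "... <= (\<Sum>p\<in>P. ln (real n))"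
  proof (rule sum_mono)
    fix p assume "p \<in> P"
    hence p: "prime p" "p <= n" by (auto simp: P_def)
    have lp: "ln (real p) > 0" using prime_gt_1_nat[OF p(1)] by simp
    define k where "k = nat \<lfloor>ln (real n) / ln (real p)\<rfloor>"
    have "{d \<in> S. aprimedivisor d = p} \<subseteq> (\<lambda>i. p ^ i) ` {1..k}"
    proof
      fix d assume d: "d \<in> {d \<in> S. aprimedivisor d = p}"
      hence "primepow d" "aprimedivisor d = p" "d <= n" by (auto simp: S_def)
      hence i0: "d = p ^ multiplicity p d" "d ~= 1" using primepow_decompose[of d] by auto
      obtain i where i: "d = p ^ i" "i > 0" by (rule that[OF i0(1)]) (use i0 in \<open>auto intro: Nat.gr0I\<close>)
      have "real i * ln (real p) <= ln (real n)" using i \<open>d <= n\<close> p(1) prime_gt_0_nat[OF p(1)] n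
        by (subst ln_realpow[symmetric]) (auto simp flip: of_nat_power)
      hence "real i <= ln (real n) / ln (real p)" using lp by (simp add: field_simps)
      hence "i <= k" unfolding k_def by (simp add: le_nat_floor)
      thus "d \<in> (\<lambda>i. p ^ i) ` {1..k}" using i by auto
    qed
    hence "card {d \<in> S. aprimedivisor d = p} <= card ((\<lambda>i. p ^ i) ` {1..k})" by (intro card_mono) auto
    also have "... <= k" using card_image_le[of "{1..k}" "\<lambda>i. p ^ i"] by simp
    finally have "real (card {d \<in> S. aprimedivisor d = p}) <= real k" by simp
    also have "real k <= ln (real n) / ln (real p)" unfolding k_def using lp n by (intro of_nat_floor) simp
    finally have "real (card {d \<in> S. aprimedivisor d = p}) <= ln (real n) / ln (real p)" .
    hence "real (card {d \<in> S. aprimedivisor d = p}) * ln (real p) <= ln (real n)" using lp by (simp add: field_simps)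
    thus "(\<Sum>d\<in>{d \<in> S. aprimedivisor d = p}. ln (real (aprimedivisor d))) <= ln (real n)" by simp
  qed
  finally show ?thesis by (simp add: P_def)
qed

definition twins :: "nat => nat \<times> nat => nat set" where
  "twins N e = {n. n <= N & prime (n + nat (sh (Suc (fst e)))) & prime (n + nat (sh (Suc (snd e))))}"

lemma finite_twins [simp]: "finite (twins N e)"
  by (rule finite_subset[of _ "{..N}"]) (auto simp: twins_def)

context pair_setup
begin

text \<open>For \<open>n > R'\<close> put \<open>p = n + s\<close> with the first shift
  \<open>s\<close>; then \<open>p + dd e\<close> is the second prime and \<open>beta\<close> is 1
  there. The at most \<open>R' + 1\<close> smaller \<open>n\<close> are counted trivially.\<close>

lemma sum_twins_le:
  assumes "real (2 ^ 2 ^ J) <= R'" "R <= R'" "N + 2 ^ K < y" and PP: "PP = {p. prime p & 2 ^ 2 ^ J < p & p < y}"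
  shows "(\<Sum>e\<in>pairs. real (card (twins N e))) <= (\<Sum>p\<in>PP. FF (int p)) + (real K)\<^sup>2 * (R' + 1)"
proof -
  have R'0: "0 <= R'" using assms(1) by (meson of_nat_0_le_iff order.trans)
  have fPP: "finite PP" unfolding PP by (rule finite_subset[of _ "{..y}"]) auto
  have one: "real (card (twins N e)) <= (\<Sum>p\<in>PP. beta (int p + dd e)) + (R' + 1)" if e: "e \<in> pairs" for e
  proof -
    define s t where "s = nat (sh (Suc (fst e)))" and "t = nat (sh (Suc (snd e)))"
    define A where "A = {n \<in> twins N e. real n > R'}"
    have st: "int s = sh (Suc (fst e))" "int t = sh (Suc (snd e))" using sh_pos[of "Suc (fst e)"] sh_pos[of "Suc (snd e)"] by (simp_all add: s_def t_def)
    have "sh (Suc (fst e)) <= 2 ^ K"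
    proof -
      have "sh (Suc (fst e)) <= sh K" using e by (intro sh_mono) (auto simp: pairs_def)
      thus ?thesis using sh_le_power[of K] by simp
    qed
    hence "int s <= int (2 ^ K)" using st by simp
    hence s2: "s <= 2 ^ K" by (simp only: of_nat_le_iff)
    have "twins N e \<subseteq> A \<union> {n. real n <= R'}" by (auto simp: A_def)
    moreover have "{n::nat. real n <= R'} = {..nat \<lfloor>R'\<rfloor>}" using R'0 by (auto simp: le_nat_floor le_floor_iff nat_le_iff le_nat_iff)
    ultimately have "card (twins N e) <= card (A \<union> {..nat \<lfloor>R'\<rfloor>})" by (intro card_mono) (auto simp: A_def)
    also have "... <= card A + card {..nat \<lfloor>R'\<rfloor>}" by (rule card_Un_le)
    finally have "real (card (twins N e)) <= real (card A) + (real (nat \<lfloor>R'\<rfloor>) + 1)" by simp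
    also have "real (nat \<lfloor>R'\<rfloor>) <= R'" using R'0 by simp
    also have "real (card A) <= (\<Sum>p\<in>PP. beta (int p + dd e))"
    proof -
      have b1: "beta (int (n + s) + dd e) = 1" if n: "n \<in> A" for n
      proof -
        have "int (n + s) + dd e = int (n + t)" by (simp add: dd_def st)
        moreover have "prime (n + t)" using n by (auto simp: A_def twins_def t_def)
        moreover have nR: "real n > R'" using n by (simp add: A_def)
        hence "R < real (n + t)" "real (2 ^ 2 ^ J) < real (n + t)" using assms(1,2) by simp_all
        ultimately show ?thesis using beta_prime[of "n + t"] by (simp only: of_nat_less_iff)
      qed
      have im: "(\<lambda>n. n + s) ` A \<subseteq> PP"
      proof
        fix p assume "p \<in> (\<lambda>n. n + s) ` A"
        then obtain n where n: "n \<in> A" "p = n + s" by auto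
        have "prime p" "n <= N" using n by (auto simp: A_def twins_def s_def)
        moreover have "R' < real n" using n by (simp add: A_def)
        from le_less_trans[OF assms(1) this]
        have "2 ^ 2 ^ J < n" by (simp only: of_nat_less_iff)
        ultimately show "p \<in> PP" using n(2) s2 assms(3) unfolding PP by auto
      qed
      have "real (card A) = (\<Sum>n\<in>A. beta (int (n + s) + dd e))" using b1 by simp
      also have "... = (\<Sum>p\<in>(\<lambda>n. n + s) ` A. beta (int p + dd e))" by (subst sum.reindex) (auto simp: inj_on_def)
      also have "... <= (\<Sum>p\<in>PP. beta (int p + dd e))" using im fPP beta_nonneg by (intro sum_mono2) auto
      finally show ?thesis .
    qed
    finally show ?thesis by simp
  qed
  have "(\<Sum>e\<in>pairs. real (card (twins N e))) <= (\<Sum>e\<in>pairs. (\<Sum>p\<in>PP. beta (int p + dd e)) + (R' + 1))"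
    by (intro sum_mono one)
  also have "... = (\<Sum>e\<in>pairs. \<Sum>p\<in>PP. beta (int p + dd e)) + real (card pairs) * (R' + 1)"
    by (simp add: sum.distrib)
  also have "(\<Sum>e\<in>pairs. \<Sum>p\<in>PP. beta (int p + dd e)) = (\<Sum>p\<in>PP. FF (int p))"
    unfolding FF_def by (rule sum.swap)
  also have "real (card pairs) <= (real K)\<^sup>2"
  proof -
    have "card pairs <= card ({..<K} \<times> {..<K})" by (intro card_mono) (auto simp: pairs_def)
    hence "card pairs <= K\<^sup>2" by (simp add: power2_eq_square)
    thus ?thesis by (simp flip: of_nat_power)
  qed
  finally show ?thesis using R'0 by (simp add: mult_right_mono)
qed

text \<open>Replaces the quantities that vary with \<open>J\<close> and \<open>K\<close> by explicit
  functions of \<open>l\<close>, to which limits in \<open>N\<close> can be applied.\<close>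

lemma Delta_le:
  assumes l: "l > 0" "l <= real K" "real K <= 2 * l" and s: "sL <= s" and zl: "0 < zl" "zl <= 2 ^ 2 ^ J"
    and V: "1 / (32 * l) <= V" and X: "cnu ^ 3 * R ^ 4 <= X * real y" and y: "y > 0" and V00: "V0 > 0" and eta: "0 <= eta"
  shows "Delta y <= eb * (1 + (16 * (2 * l + 3) / zl * exp (15 * s) + 16 * s / zl * exp (6 * s)) * exp (4 * s)) * ((1 + real T / V0 / l)\<^sup>2 + eta / V0 ^ 3)
     - 2 * (1 - 4 / 2 ^ 2 ^ j0) * (1 - real T / V0 / l - 1 / V0\<^sup>2 / l) + eb
     + 2 * (eb * exp (15 * s) * (1 + eta) * exp (4 * s) * 16 / V0\<^sup>2 / l) + 4 * X * exp (4 * s) * (32 * l) ^ 3"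
proof -
  have K0: "real K > 0" using l by linarith
  have eb0: "eb > 0" by (simp add: eb_def)
  have sL0: "0 <= sL" unfolding sL_def by (intro sum_nonneg) auto
  hence s0: "0 <= s" using s by simp
  have G2: "G\<^sup>2 <= exp (4 * s)" "0 <= G\<^sup>2"
  proof -
    have "G <= exp (2 * s)" using G_le s unfolding sL_def by (meson exp_le_cancel_iff mult_left_mono order.trans zero_le_numeral)
    hence "G\<^sup>2 <= (exp (2 * s))\<^sup>2" using G_ge_1 by (intro power_mono) auto
    also have "... = exp (4 * s)" by (simp add: power2_eq_square flip: exp_add)
    finally show "G\<^sup>2 <= exp (4 * s)" .
  qed simp
  have Vp: "V > 0"
  proof -
    have "0 < 1 / (32 * l)" using l by simp
    thus ?thesis using V by linarith
  qed
  have z0: "(0::real) < 2 ^ 2 ^ J" by simp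
  have E1: "E1 <= 16 * (2 * l + 3) / zl * exp (15 * s) + 16 * s / zl * exp (6 * s)" "0 <= E1"
    unfolding E1_def using l s s0 sL0 zl z0
    by (intro add_mono mult_mono frac_le add_nonneg_nonneg mult_nonneg_nonneg divide_nonneg_pos; auto)+
  have T1: "real T / (real K * V0) <= real T / V0 / l"
  proof -
    have "real T / (real K * V0) <= real T / (l * V0)" using l V00 K0 by (intro divide_left_mono mult_right_mono) auto
    thus ?thesis by (simp add: mult.commute)
  qed
  have T2: "1 / (real K * V0\<^sup>2) <= 1 / V0\<^sup>2 / l"
  proof -
    have "1 / (real K * V0\<^sup>2) <= 1 / (l * V0\<^sup>2)" using l V00 K0 by (intro divide_left_mono mult_right_mono) auto
    thus ?thesis by (simp add: mult.commute)
  qed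
  have T10: "0 <= real T / (real K * V0)" using V00 K0 by simp
  have A1: "eb * (1 + E1 * G\<^sup>2) * ((1 + real T / (real K * V0))\<^sup>2 + eta / V0 ^ 3) \<le>
     eb * (1 + (16 * (2 * l + 3) / zl * exp (15 * s) + 16 * s / zl * exp (6 * s)) * exp (4 * s)) * ((1 + real T / V0 / l)\<^sup>2 + eta / V0 ^ 3)"
  proof -
    have "E1 * G\<^sup>2 <= (16 * (2 * l + 3) / zl * exp (15 * s) + 16 * s / zl * exp (6 * s)) * exp (4 * s)"
      using E1 G2 order.trans[OF E1(2,1)] by (intro mult_mono) auto
    moreover have "(1 + real T / (real K * V0))\<^sup>2 <= (1 + real T / V0 / l)\<^sup>2" using T1 T10 by (intro power_mono) auto
    moreover have "0 <= E1 * G\<^sup>2" using E1 G2 by simp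
    moreover have "0 <= eta / V0 ^ 3" using eta V00 by simp
    moreover have "eb * (1 + u) * (v + x) <= eb * (1 + u') * (v' + x)" if "u <= u'" "v <= v'" "0 <= u" "0 <= x" "0 <= v" for u u' v v' x
      using that eb0 by (intro mult_mono add_mono order.refl mult_left_mono) auto
    ultimately show ?thesis by simp
  qed
  have A2: "2 * (1 - 4 / 2 ^ 2 ^ j0) * (1 - real T / V0 / l - 1 / V0\<^sup>2 / l) <= 2 * (1 - 4 / 2 ^ 2 ^ j0) * (1 - real T / (real K * V0) - 1 / (real K * V0\<^sup>2))"
  proof (rule mult_left_mono)
    have "(2::nat) ^ 1 <= 2 ^ j0" using j0(1) by (intro power_increasing) auto
    hence "(2::real) ^ 2 <= 2 ^ 2 ^ j0" by (intro power_increasing) auto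
    hence "4 / 2 ^ 2 ^ j0 <= (1::real)" by (subst pos_divide_le_eq) auto
    thus "0 <= 2 * (1 - 4 / 2 ^ 2 ^ j0 :: real)" by (intro mult_nonneg_nonneg) auto
  qed (use T1 T2 in linarith)
  have A3: "eb * exp (15 * sL) * (1 + eta) * G\<^sup>2 / ((real K)\<^sup>2 * V * V0\<^sup>2) <= 2 * (eb * exp (15 * s) * (1 + eta) * exp (4 * s) * 16 / V0\<^sup>2 / l)"
  proof -
    have "eb * exp (15 * sL) * (1 + eta) * G\<^sup>2 / ((real K)\<^sup>2 * V * V0\<^sup>2) <= eb * exp (15 * s) * (1 + eta) * exp (4 * s) / (l\<^sup>2 * (1 / (32 * l)) * V0\<^sup>2)"
    proof (rule frac_le)
      show "eb * exp (15 * sL) * (1 + eta) * G\<^sup>2 <= eb * exp (15 * s) * (1 + eta) * exp (4 * s)"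
        using eb0 s eta G2 by (intro mult_mono order.refl) auto
      show "l\<^sup>2 * (1 / (32 * l)) * V0\<^sup>2 <= (real K)\<^sup>2 * V * V0\<^sup>2"
        using l V Vp by (intro mult_mono power_mono order.refl) auto
    qed (use eb0 eta l V00 in auto)
    also have "... = 2 * (eb * exp (15 * s) * (1 + eta) * exp (4 * s) * 16 / V0\<^sup>2 / l)" using l V00 by (simp add: field_simps power2_eq_square)
    finally show ?thesis .
  qed
  have A4: "4 * cnu ^ 3 * R ^ 4 * G\<^sup>2 / (real y * V ^ 3) <= 4 * X * exp (4 * s) * (32 * l) ^ 3"
  proof -
    have Xy: "0 <= X * real y" using X cnu_ge_1 R1 by (meson mult_nonneg_nonneg order.trans zero_le_one zero_le_power)
    have "4 * cnu ^ 3 * R ^ 4 * G\<^sup>2 / (real y * V ^ 3) <= 4 * (X * real y) * exp (4 * s) / (real y * (1 / (32 * l)) ^ 3)"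
    proof (rule frac_le)
      have "4 * (cnu ^ 3 * R ^ 4) * G\<^sup>2 <= 4 * (X * real y) * exp (4 * s)" by (rule mult_mono[OF mult_left_mono[OF X] G2(1)]) (use Xy in auto)
      thus "4 * cnu ^ 3 * R ^ 4 * G\<^sup>2 <= 4 * (X * real y) * exp (4 * s)" by (simp only: mult.assoc)
      show "real y * (1 / (32 * l)) ^ 3 <= real y * V ^ 3" using V l by (intro mult_left_mono power_mono) auto
    qed (use Xy y l in auto)
    also have "... = 4 * X * exp (4 * s) * (32 * l) ^ 3" using y l by (simp add: field_simps)
    finally show ?thesis .
  qed
  show ?thesis unfolding Delta_def using A1 A2 A3 A4 by linarith
qed

end

section \<open>Asymptotic choice of the parameters\<close>

definition KK :: "nat => nat" where "KK N = nat (KN N)"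

text \<open>The double logarithm in \<open>KN\<close> costs nothing on the scale of
  \<open>ln N\<close>, but it makes every shift at most about \<open>N / (ln N)\<^sup>2\<close>,
  negligible against the number of primes.\<close>

lemma KK_props:
  shows KK_pos: "\<forall>\<^sub>F N in sequentially. KN N >= 1"
    and KK_ge: "c < 1 / ln 2 ==> \<forall>\<^sub>F N in sequentially. c * ln (real N) <= real (KK N)"
    and KK_le: "\<forall>\<^sub>F N in sequentially. real (KK N) <= ln (real N) / ln 2"
    and KK_pow: "\<forall>\<^sub>F N in sequentially. 2 ^ KK N <= real N / (ln (real N))\<^sup>2"
proof -
  define f where "f = (\<lambda>N::nat. log 2 (real N) - 2 * log 2 (ln (real N)))"
  have low: "c * ln (real N) + 1 <= f N ==> c * ln (real N) <= real (KK N)" for c N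
    unfolding f_def KK_def KN_def by linarith
  have "\<forall>\<^sub>F N in sequentially. 1 <= f N" unfolding f_def by real_asymp
  thus pos: "\<forall>\<^sub>F N in sequentially. KN N >= 1" by eventually_elim (simp add: f_def KN_def)
  show "\<forall>\<^sub>F N in sequentially. c * ln (real N) <= real (KK N)" if c: "c < 1 / ln 2"
  proof -
    have "\<forall>\<^sub>F N in sequentially. c * ln (real N) + 1 <= f N"
    proof -
      have "filterlim (\<lambda>N::nat. (1 / ln 2 - c) * ln (real N) - 2 * log 2 (ln (real N))) at_top sequentially" using c by real_asymp
      hence "\<forall>\<^sub>F N in sequentially. (1 / ln 2 - c) * ln (real N) - 2 * log 2 (ln (real N)) >= 1" by (simp add: filterlim_at_top)
      thus ?thesis by eventually_elim (simp add: f_def log_def left_diff_distrib)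
    qed
    thus ?thesis by eventually_elim (rule low)
  qed
  have up: "\<forall>\<^sub>F N in sequentially. real (KK N) <= f N" using pos
    by eventually_elim (simp add: KK_def KN_def f_def)
  have "\<forall>\<^sub>F N::nat in sequentially. ln (ln (real N)) >= 0" by real_asymp
  with up show "\<forall>\<^sub>F N in sequentially. real (KK N) <= ln (real N) / ln 2"
  proof eventually_elim
    case (elim N)
    have "log 2 (ln (real N)) >= 0" using elim(2) by (simp add: log_def)
    thus ?case using elim(1) unfolding f_def by (simp add: log_def[of 2 "real N"])
  qed
  have "\<forall>\<^sub>F N::nat in sequentially. ln (real N) > 0" by real_asymp
  with up show "\<forall>\<^sub>F N in sequentially. 2 ^ KK N <= real N / (ln (real N))\<^sup>2" using eventually_gt_at_top[of 0]
  proof eventually_elim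
    case (elim N)
    have "2 ^ KK N = 2 powr real (KK N)" by (simp add: powr_realpow)
    also have "... <= 2 powr f N" using elim(1) by simp
    also have "... = 2 powr log 2 (real N) / 2 powr (2 * log 2 (ln (real N)))" by (simp add: f_def powr_diff)
    also have "2 powr (2 * log 2 (ln (real N))) = (2 powr log 2 (ln (real N))) powr 2" by (simp add: powr_powr mult.commute)
    also have "2 powr log 2 (ln (real N)) = ln (real N)" using elim by simp
    also have "2 powr log 2 (real N) = real N" using elim by simp
    also have "ln (real N) powr 2 = (ln (real N))\<^sup>2" using elim by (simp add: powr_numeral)
    finally show ?case .
  qed
qed

lemma KK_at_top: "filterlim KK at_top sequentially"
proof -
  have "filterlim (\<lambda>N::nat. ln (real N)) at_top sequentially" by real_asymp
  moreover have "\<forall>\<^sub>F N in sequentially. 1 * ln (real N) <= real (KK N)" by (rule KK_ge) (use ln_2_less_1 in simp)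
  ultimately have "filterlim (\<lambda>N. real (KK N)) at_top sequentially"
    by (auto elim!: filterlim_at_top_mono)
  thus ?thesis by (simp add: filterlim_sequentially_iff_filterlim_real)
qed

text \<open>Each number \<open>2 ^ 2 ^ J\<close> is the square of its predecessor, so one of them
  falls between \<open>N powr (h / 2)\<close> and \<open>N powr h\<close>.\<close>

lemma double_exp_between:
  assumes "h > 0"
  shows "\<forall>\<^sub>F N in sequentially. \<exists>J\<ge>j0. real N powr (h / 2) <= real (2 ^ 2 ^ J) & real (2 ^ 2 ^ J) <= real N powr h"
proof -
  have "filterlim (\<lambda>N::nat. log 2 (h * log 2 (real N))) at_top sequentially" using assms by real_asymp
  hence "\<forall>\<^sub>F N in sequentially. log 2 (h * log 2 (real N)) >= real j0" by (simp add: filterlim_at_top)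
  moreover have "\<forall>\<^sub>F N::nat in sequentially. log 2 (real N) > 0" by real_asymp
  ultimately show ?thesis using eventually_gt_at_top[of 0]
  proof eventually_elim
    case (elim N)
    define x where "x = h * log 2 (real N)"
    have x: "x > 0" using elim assms by (simp add: x_def)
    define J where "J = nat \<lfloor>log 2 x\<rfloor>"
    have J: "real J <= log 2 x" "log 2 x <= real J + 1" "j0 <= J" using elim(1) unfolding J_def x_def by linarith+
    have "2 powr real J <= 2 powr log 2 x" using J by simp
    hence a: "2 ^ J <= x" using x by (simp add: powr_realpow)
    have "2 powr log 2 x <= 2 powr (real J + 1)" using J by simp
    hence b: "x / 2 <= 2 ^ J" using x by (simp add: powr_realpow powr_add)
    have N2: "real N powr c = 2 powr (c * log 2 (real N))" for c
    proof -
      have "2 powr (c * log 2 (real N)) = (2 powr log 2 (real N)) powr c" by (simp add: powr_powr mult.commute)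
      thus ?thesis using elim(3) by simp
    qed
    have e: "real (2 ^ 2 ^ J) = 2 powr (2 ^ J)" by (simp flip: powr_realpow)
    have "real (2 ^ 2 ^ J) <= real N powr h" unfolding e N2 using a by (simp add: x_def)
    moreover have "real N powr (h / 2) <= real (2 ^ 2 ^ J)" unfolding e N2 using b by (simp add: x_def)
    ultimately show ?case using J(3) by blast
  qed
qed


text \<open>The cube of the inverse density grows at most like \<open>w powr (1/4)\<close>, slower
  than the square root of \<open>w\<close> gained in \<open>tau_average\<close>.\<close>

lemma choose_sieve_level:
  assumes D: "D >= 0" and k: "k > 0"
  obtains j0 where "1 <= j0"
    "2 * (D / sqrt (real (2 ^ 2 ^ j0)) / (\<Prod>p\<in>upto_primes (2 ^ 2 ^ j0). 1 - 1 / real p) ^ 3) <= k"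
    "8 / (2 ^ 2 ^ j0 :: real) <= k"
proof -
  obtain C where C: "C >= 1" "\<And>n A. n > 0 ==> finite A ==> (\<And>p. p \<in> A ==> prime p & p <= n) ==> exp (6 * (\<Sum>p\<in>A. 1 / real p)) <= C * real n powr (1/4)"
    using exp_sum_inverse_primes[of 6] by auto
  have "((\<lambda>n::nat. 2 * D * C * (real n powr (1/4) / sqrt (real n))) \<longlongrightarrow> 0) sequentially" by real_asymp
  hence "\<forall>\<^sub>F n in sequentially. 2 * D * C * (real n powr (1/4) / sqrt (real n)) < k" using k by (rule order_tendstoD)
  moreover have "((\<lambda>n::nat. 8 / real n) \<longlongrightarrow> 0) sequentially" by real_asymp
  hence "\<forall>\<^sub>F n in sequentially. 8 / real n < k" using k by (rule order_tendstoD)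
  ultimately have "\<forall>\<^sub>F n in sequentially. 2 * D * C * (real n powr (1/4) / sqrt (real n)) < k & 8 / real n < k" by eventually_elim simp
  then obtain m where m: "\<And>n. n >= m ==> 2 * D * C * (real n powr (1/4) / sqrt (real n)) < k & 8 / real n < k"
    unfolding eventually_sequentially by blast
  define j0 where "j0 = max m 1"
  define w :: nat where "w = 2 ^ 2 ^ j0"
  have "j0 < 2 ^ j0" by (rule less_exp)
  also have "2 ^ j0 < w" unfolding w_def by (rule less_exp)
  finally have wm: "w >= m" "w > 0" by (auto simp: j0_def)
  define A where "A = upto_primes w"
  have A: "finite A" "\<And>p. p \<in> A ==> prime p & p <= w" by (auto simp: A_def upto_primes_def intro: finite_subset[of _ "{..w}"])
  define V where "V = (\<Prod>p\<in>A. 1 - 1 / real p)"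
  have "exp (- 2 * (\<Sum>p\<in>A. 1 / real p)) <= V" unfolding V_def using A by (intro prod_one_minus_ge_exp) auto
  hence Vpos: "V > 0" and V3: "exp (- 2 * (\<Sum>p\<in>A. 1 / real p)) ^ 3 <= V ^ 3" by (auto intro: less_le_trans[OF exp_gt_zero] power_mono)
  have "1 / V ^ 3 <= 1 / exp (- 2 * (\<Sum>p\<in>A. 1 / real p)) ^ 3" using V3 Vpos by (intro divide_left_mono mult_pos_pos) auto
  also have "... = exp (6 * (\<Sum>p\<in>A. 1 / real p))" by (simp add: exp_minus field_simps flip: exp_of_nat_mult)
  also have "... <= C * real w powr (1/4)" by (rule C(2)[OF wm(2) A])
  finally have iv: "1 / V ^ 3 <= C * real w powr (1/4)" .
  have "2 * (D / sqrt (real w) / V ^ 3) = 2 * (D / sqrt (real w)) * (1 / V ^ 3)" by simp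
  also have "... <= 2 * (D / sqrt (real w)) * (C * real w powr (1/4))" using iv D by (intro mult_left_mono) auto
  also have "... = 2 * D * C * (real w powr (1/4) / sqrt (real w))" by simp
  also have "... <= k" using m[OF wm(1)] by simp
  finally have r: "2 * (D / sqrt (real w) / V ^ 3) <= k" .
  have "8 / real w <= k" using m[OF wm(1)] by simp
  hence r2: "8 / (2 ^ 2 ^ j0 :: real) <= k" by (simp add: w_def)
  show thesis by (rule that[of j0, OF _ r[unfolded V_def A_def w_def] r2]) (simp add: j0_def)
qed

lemma prime_count_ge:
  assumes "0 < e" "e < 1"
  shows "\<forall>\<^sub>F n in sequentially. (1 - e) * (real n / ln (real n)) <= real (card (upto_primes n))"
  using psi_lower[OF assms] eventually_gt_at_top[of 1]
proof eventually_elim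
  case (elim n)
  have "(1 - e) * real n <= real (card (upto_primes n)) * ln (real n)" using elim psi_le_prime_count[of n] unfolding upto_primes_def by linarith
  thus ?case using elim(2) by (simp add: field_simps)
qed

lemma eventually_le_of_ratio:
  fixes f g :: "nat => real"
  assumes "(\<lambda>N. f N * g N / real N) \<longlonglongrightarrow> 0" "\<forall>\<^sub>F N in sequentially. g N > 0" "c > 0"
  shows "\<forall>\<^sub>F N in sequentially. f N <= c * (real N / g N)"
  using order_tendstoD(2)[OF assms(1,3)] assms(2) eventually_gt_at_top[of 0]
proof eventually_elim
  case (elim N)
  have "real N > 0" using elim by simp
  hence "f N * g N <= c * real N" using elim(1) by (simp add: pos_divide_less_eq)
  hence "f N <= c * real N / g N" using elim(2) by (simp only: pos_le_divide_eq)
  thus ?case by simp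
qed

lemma pair_bound_asymptotic:
  assumes eps: "0 < eps" "eps <= 1"
  shows "\<forall>\<^sub>F N in sequentially. (\<Sum>e | fst e < KK N & snd e < KK N & fst e ~= snd e. real (card (twins N e)))
    <= (4 + eps) * ((real (KK N))\<^sup>2 / ln (real N) * real (card (upto_primes (N + 2 ^ KK N))))"
proof -
  \<comment> \<open>The margin of the level below \<open>1 / 4\<close>; one hundredth of
    \<open>eps\<close> keeps \<open>(1 + a) / (1/4 - a)\<close> below
    \<open>4 + eps / 2\<close>.\<close>
  define a where "a = eps / 100"
  have a: "0 < a" "a <= 1/100" using eps by (auto simp: a_def)
  define cb :: real where "cb = 6 * exp 1560"
  \<comment> \<open>The admissible variance \<open>kap\<close> shrinks like
    \<open>1 / (b + 1)\<close>, whereas the excess of Brun's sieve decays like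
    \<open>1 / 4 ^ b\<close>; a large \<open>b\<close> therefore makes the excess fit.\<close>
  have "((\<lambda>b::nat. (real b + 1) * (exp (cb / 4 ^ b) - 1)) \<longlongrightarrow> 0) sequentially" by real_asymp
  hence "\<forall>\<^sub>F b in sequentially. (real b + 1) * (exp (cb / 4 ^ b) - 1) < a ^ 3 / 256" using a by (intro order_tendstoD(2)[of _ 0]) auto
  then obtain b where b: "(real b + 1) * (exp (cb / 4 ^ b) - 1) < a ^ 3 / 256" by (auto simp: eventually_sequentially)
  define EB where "EB = exp (cb / 4 ^ b)"
  \<comment> \<open>Makes \<open>cnu\<close> at most a constant times \<open>N powr a\<close>. With
    \<open>R = N powr (1/4 - a)\<close> the remainder of the triple correlation is then
    \<open>N powr (1 - a)\<close> up to a constant.\<close>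
  define h where "h = a / (4 * (real b + 1))"
  have h: "0 < h" "h <= 1/400" using a by (auto simp: h_def divide_simps)
  \<comment> \<open>Chosen so that \<open>8 * kap / h = a\<^sup>2\<close>, which bounds the square
    root in \<open>sum_primes_FF_le\<close> by \<open>a\<close> times the number of primes.\<close>
  define kap where "kap = h * a\<^sup>2 / 8"
  have kap: "0 < kap" using h a by (simp add: kap_def)
  have EB1: "1 <= EB" unfolding EB_def cb_def by simp
  have EBk: "2 * (EB - 1) <= kap / 4"
  proof -
    have "(EB - 1) * (real b + 1) <= a ^ 3 / 256" using b by (simp add: EB_def mult.commute)
    moreover have "real b + 1 > 0" by simp
    ultimately have "EB - 1 <= a ^ 3 / 256 / (real b + 1)" by (simp only: pos_le_divide_eq)
    hence "2 * (EB - 1) <= 2 * (a ^ 3 / 256 / (real b + 1))" by (rule mult_left_mono) simp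
    moreover have "kap / 4 = 2 * (a ^ 3 / 256 / (real b + 1))" by (simp add: kap_def h_def power2_eq_square power3_eq_cube field_simps)
    ultimately show ?thesis by (simp only:)
  qed
  have kap1: "kap <= 1"
  proof -
    have "h * a\<^sup>2 <= 1 * 1" using h a by (intro mult_mono power_le_one) auto
    thus ?thesis by (simp add: kap_def)
  qed
  have EB2: "EB <= 2" using EBk kap1 by simp
  obtain D where D: "D >= 0" "\<And>w. w >= 1 ==> \<forall>\<^sub>F K in sequentially. \<forall>A c0. finite A --> (\<forall>p\<in>A. prime p & w < p) --> \<bar>c0\<bar> <= 4 * 2 ^ K
     --> (\<Sum>k | k < K & sh (Suc k) ~= c0. tau 511 A (sh (Suc k) - c0) - 1) <= real K * D / sqrt (real w)"
    using tau_average[of 511] by auto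
  obtain j0 where j0: "1 <= j0"
    "2 * (D / sqrt (real (2 ^ 2 ^ j0)) / (\<Prod>p\<in>upto_primes (2 ^ 2 ^ j0). 1 - 1 / real p) ^ 3) <= kap / 4"
    "8 / (2 ^ 2 ^ j0 :: real) <= kap / 4"
    by (rule choose_sieve_level[OF D(1), of "kap / 4"]) (use kap in auto)
  define w :: nat where "w = 2 ^ 2 ^ j0"
  define V0 where "V0 = (\<Prod>p\<in>upto_primes (2 ^ 2 ^ j0). 1 - 1 / real p)"
  have V0: "V0 > 0" unfolding V0_def by (intro prod_pos) (auto simp: upto_primes_def dest: prime_gt_1_nat)
  define eta where "eta = D / sqrt (real w)"
  have eta: "eta >= 0" using D by (simp add: eta_def)
  have j2: "2 * (eta / V0 ^ 3) <= kap / 4" using j0(2) by (simp only: eta_def V0_def w_def)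
  obtain T where T: "equidist (\<Prod>(upto_primes (2 ^ 2 ^ j0))) T" using equidist_primorial[of "2 ^ 2 ^ j0"] unfolding upto_primes_def by blast
  \<comment> \<open>Bounds the sum of reciprocals of the large primes: they lie between
    \<open>N powr (h / 2)\<close> and \<open>N\<close>.\<close>
  define s where "s = 4 / h"
  define C0 :: real where "C0 = 2 ^ 2 ^ 2 ^ j0"
  have C0: "C0 > 0" by (simp add: C0_def)
  define W :: real where "W = 2 ^ 2 ^ j0"
  define TV where "TV = real T / V0"
  define c2 where "c2 = 1 / V0\<^sup>2"
  define e0 where "e0 = eta / V0 ^ 3"
  define c4 where "c4 = EB * exp (15 * s) * (1 + eta) * exp (4 * s) * 16 / V0\<^sup>2"
  define Dx where "Dx = (\<lambda>N::nat. EB * (1 + (16 * (2 * ln (real N) + 3) / real N powr (h / 2) * exp (15 * s) + 16 * s / real N powr (h / 2) * exp (6 * s)) * exp (4 * s)) * ((1 + TV / ln (real N))\<^sup>2 + e0)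
     - 2 * (1 - 4 / W) * (1 - TV / ln (real N) - c2 / ln (real N)) + EB
     + 2 * (c4 / ln (real N)) + 4 * (C0 ^ 3 * real N powr (- a)) * exp (4 * s) * (32 * ln (real N)) ^ 3)"
  have "(Dx \<longlongrightarrow> EB * (1 + (0 * exp (15 * s) + 0 * exp (6 * s)) * exp (4 * s)) * ((1 + 0)\<^sup>2 + e0)
     - 2 * (1 - 4 / W) * (1 - 0 - 0) + EB + 2 * 0 + 0) sequentially"
    unfolding Dx_def
  proof (intro tendsto_intros)
    show "(\<lambda>N::nat. 16 * (2 * ln (real N) + 3) / real N powr (h / 2)) \<longlonglongrightarrow> 0" using h by real_asymp
    show "(\<lambda>N::nat. 16 * s / real N powr (h / 2)) \<longlonglongrightarrow> 0" using h by real_asymp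
    show "(\<lambda>N::nat. TV / ln (real N)) \<longlonglongrightarrow> 0" by real_asymp
    show "(\<lambda>N::nat. TV / ln (real N)) \<longlonglongrightarrow> 0" by real_asymp
    show "(\<lambda>N::nat. c2 / ln (real N)) \<longlonglongrightarrow> 0" by real_asymp
    show "(\<lambda>N::nat. c4 / ln (real N)) \<longlonglongrightarrow> 0" by real_asymp
    show "(\<lambda>N::nat. 4 * (C0 ^ 3 * real N powr (- a)) * exp (4 * s) * (32 * ln (real N)) ^ 3) \<longlonglongrightarrow> 0" using a by real_asymp
  qed
  \<comment> \<open>The main terms cancel. What remains is the excess of Brun's sieve, the middle
    primes and \<open>8 / W\<close>, each at most a quarter of \<open>kap\<close>.\<close>
  moreover have "EB * (1 + (0 * exp (15 * s) + 0 * exp (6 * s)) * exp (4 * s)) * ((1 + 0)\<^sup>2 + e0)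
     - 2 * (1 - 4 / W) * (1 - 0 - 0) + EB + 2 * 0 + 0 < kap"
  proof -
    have "EB * e0 <= 2 * e0" using EB2 eta V0 by (intro mult_right_mono) (auto simp: e0_def)
    hence "EB * e0 <= kap / 4" using j2 unfolding e0_def by (rule order.trans)
    moreover have "8 / W <= kap / 4" using j0(3) by (simp add: W_def)
    ultimately have "2 * (EB - 1) + EB * e0 + 8 / W <= kap / 4 + kap / 4 + kap / 4" using EBk by (intro add_mono)
    also have "... < kap" using kap by simp
    finally have "2 * (EB - 1) + EB * e0 + 8 / W < kap" .
    thus ?thesis by (simp add: algebra_simps)
  qed
  ultimately have evD: "\<forall>\<^sub>F N in sequentially. Dx N < kap" by (rule order_tendstoD)
  have "\<forall>\<^sub>F K in sequentially. \<forall>A c0. finite A --> (\<forall>p\<in>A. prime p & w < p) --> \<bar>c0\<bar> <= 4 * 2 ^ K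
     --> (\<Sum>k | k < K & sh (Suc k) ~= c0. tau 511 A (sh (Suc k) - c0) - 1) <= real K * D / sqrt (real w)"
    by (rule D(2)) (simp add: w_def)
  hence evT: "\<forall>\<^sub>F N in sequentially. \<forall>A c0. finite A --> (\<forall>p\<in>A. prime p & w < p) --> \<bar>c0\<bar> <= 4 * 2 ^ KK N
     --> (\<Sum>k | k < KK N & sh (Suc k) ~= c0. tau 511 A (sh (Suc k) - c0) - 1) <= real (KK N) * D / sqrt (real w)"
    using KK_at_top by (rule eventually_compose_filterlim)
  have evK: "\<forall>\<^sub>F N in sequentially. 1 * ln (real N) <= real (KK N)" by (rule KK_ge) (use ln_2_less_1 in simp)
  have evpi: "\<forall>\<^sub>F N in sequentially. (1 - 1/2) * (real N / ln (real N)) <= real (card (upto_primes N))" by (rule prime_count_ge) auto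
  have ev1: "\<forall>\<^sub>F N::nat in sequentially. ln (real N) >= 4" by real_asymp
  have ev2: "\<forall>\<^sub>F N::nat in sequentially. C0 * real N powr a <= 1 * (real N / (8 * ln (real N)))"
    by (rule eventually_le_of_ratio) (use a in \<open>real_asymp | simp\<close>)+
  have ev3: "\<forall>\<^sub>F N::nat in sequentially. real N powr h <= 1 * (real N / (4 * ln (real N)))"
    by (rule eventually_le_of_ratio) (use h in \<open>real_asymp | simp\<close>)+
  have ev4: "\<forall>\<^sub>F N::nat in sequentially. real N powr (1/4) + 1 <= eps / 2 * (real N / (2 * ln (real N) * ln (real N)))"
    by (rule eventually_le_of_ratio) (use eps in \<open>real_asymp | simp\<close>)+
  show ?thesis
    using evD evT evK evpi ev1 ev2 ev3 ev4 KK_le KK_pow double_exp_between[OF h(1), of j0]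
  proof eventually_elim
    case (elim N)
    define l where "l = ln (real N)"
    define K where "K = KK N"
    define P1 where "P1 = real (card (upto_primes (N + 2 ^ K)))"
    have l4: "l >= 4" using elim(5) by (simp add: l_def)
    have N1: "real N > 1" using l4 unfolding l_def by (cases "N <= 1") (auto simp: le_Suc_eq)
    have ln2: "1/2 <= ln (2::real)" using ln2_ge_two_thirds by linarith
    have lK: "l <= real K" "real K <= 2 * l"
    proof -
      show "l <= real K" using elim(3) by (simp add: l_def K_def)
      have "real K <= l / ln 2" using elim(9) by (simp add: l_def K_def)
      also have "... <= l / (1/2)" using ln2 l4 by (intro divide_left_mono) auto
      finally show "real K <= 2 * l" by simp
    qed
    obtain J where J: "j0 <= J" "real N powr (h / 2) <= real (2 ^ 2 ^ J)" "real (2 ^ 2 ^ J) <= real N powr h" using elim(11) by blast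
    define R where "R = real N powr (1/4 - a)"
    have lnR: "ln R = (1/4 - a) * l" using N1 by (simp add: R_def l_def ln_powr)
    have R1: "R > 1" unfolding R_def using N1 a by (intro gr_one_powr) auto
    have lnz: "h / 2 * l <= ln (2 ^ 2 ^ J)"
    proof -
      have "ln (real N powr (h / 2)) <= ln (real (2 ^ 2 ^ J))" using J(2) N1 by (subst ln_le_cancel_iff) auto
      thus ?thesis using N1 by (simp add: l_def ln_powr)
    qed
    interpret P: pair_setup b j0 J K T R eta
    proof
      fix c0 :: int assume c0: "\<bar>c0\<bar> <= 4 * 2 ^ K"
      have "finite (mid_primes j0 J)" unfolding mid_primes_def by (rule finite_subset[of _ "{..2 ^ 2 ^ J}"]) auto
      moreover have "\<forall>p\<in>mid_primes j0 J. prime p & w < p" by (auto simp: mid_primes_def w_def)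
      ultimately show "(\<Sum>k | k < K & sh (Suc k) ~= c0. tau 511 (mid_primes j0 J) (sh (Suc k) - c0) - 1) <= real K * eta"
        using elim(2) c0 unfolding eta_def K_def by simp
    qed (use j0 J R1 T in auto)
    define y where "y = N + 2 ^ K + 1"
    have K2: "2 ^ K <= real N / 16"
    proof -
      have "2 ^ K <= real N / l\<^sup>2" using elim(10) by (simp add: K_def l_def)
      also have "... <= real N / 4\<^sup>2" using l4 N1 by (intro divide_left_mono power_mono mult_pos_pos) auto
      finally show ?thesis by simp
    qed
    have y: "real N <= real y" "real y <= 2 * real N" "y > 0" "N + 2 ^ K < y"
    proof -
      have "real y = real N + 2 ^ K + 1" by (simp add: y_def)
      moreover have "real N >= 2" using N1 by simp
      ultimately show "real y <= 2 * real N" using K2 by linarith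
    qed (simp_all add: y_def)
    define PP where "PP = {p. prime p & 2 ^ 2 ^ J < p & p < y}"
    have fU: "finite (upto_primes m)" for m unfolding upto_primes_def by (rule finite_subset[of _ "{..m}"]) auto
    have PPs: "PP \<subseteq> upto_primes (N + 2 ^ K)" by (auto simp: PP_def y_def upto_primes_def)
    have fPP: "finite PP" by (rule finite_subset[OF PPs fU])
    have PP: "\<And>p. p \<in> PP ==> prime p & 2 ^ 2 ^ J < p & p < y" by (simp add: PP_def)
    have cPP: "real (card PP) <= P1" unfolding P1_def using PPs fU by (simp add: card_mono)
    have P1N: "real N / (2 * l) <= P1"
    proof -
      have "real (card (upto_primes N)) <= P1" unfolding P1_def by (simp, intro card_mono fU) (auto simp: upto_primes_def)
      thus ?thesis using elim(4) by (simp add: l_def)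
    qed
    have P1PP: "P1 <= real (card PP) + real (2 ^ 2 ^ J)"
    proof -
      have "upto_primes (N + 2 ^ K) \<subseteq> PP \<union> {1..2 ^ 2 ^ J}" by (auto simp: PP_def y_def upto_primes_def dest: prime_ge_1_nat)
      hence "card (upto_primes (N + 2 ^ K)) <= card (PP \<union> {1..2 ^ 2 ^ J})" using fPP by (intro card_mono) auto
      also have "... <= card PP + card {1..(2::nat) ^ 2 ^ J}" by (rule card_Un_le)
      finally have "card (upto_primes (N + 2 ^ K)) <= card PP + 2 ^ 2 ^ J" by simp
      thus ?thesis unfolding P1_def by (simp only: of_nat_add[symmetric] of_nat_le_iff)
    qed
    have ebE: "P.eb = EB" by (simp add: P.eb_def EB_def cb_def)
    have V0E: "P.V0 = V0" by (simp add: P.V0_def V0_def)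
    have cnu: "P.cnu <= C0 * real N powr a"
    proof -
      have "real (2 ^ 2 ^ J) ^ (4 * (b + 1)) <= (real N powr h) ^ (4 * (b + 1))" using J(3) by (intro power_mono) auto
      also have "... = real N powr (h * real (4 * (b + 1)))" using N1 by (simp add: powr_powr flip: powr_realpow)
      also have "h * real (4 * (b + 1)) = a" by (simp add: h_def field_simps)
      finally have "real (2 ^ 2 ^ J) ^ (4 * (b + 1)) <= real N powr a" .
      thus ?thesis unfolding P.cnu_def C0_def by (intro mult_left_mono) auto
    qed
    \<comment> \<open>At least \<open>N / (2 * l)\<close> primes are present up to \<open>N\<close>.
      Removing those below the sieve limit and the remainder \<open>cnu\<close> leaves enough for
      this lower bound on the density.\<close>
    have V: "1 / (32 * l) <= P.V"
    proof -
      have "real N / (2 * l) - real N / (4 * l) <= real (card PP)" using P1N P1PP J(3) elim(7) by (simp add: l_def)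
      also have "... <= real y * (P.V * P.eb) + P.cnu" by (rule P.V_ge[OF fPP PP])
      also have "real y * (P.V * P.eb) <= (2 * real N) * (P.V * 2)" unfolding ebE using y P.V_pos EB2 EB1
        by (intro mult_mono) auto
      also have "P.cnu <= real N / (8 * l)" using cnu elim(6) by (simp add: l_def)
      finally have "real N / (2 * l) - real N / (4 * l) <= 2 * real N * (P.V * 2) + real N / (8 * l)" by simp
      hence "real N * (1 / (32 * l)) <= real N * P.V" using l4 by (simp add: field_simps)
      moreover have "0 < real N" using N1 by simp
      ultimately show ?thesis by (rule mult_left_le_imp_le)
    qed
    have sL: "P.sL <= s"
    proof -
      have "P.sL <= (ln (real N) + 4) / ln (2 ^ 2 ^ J)" unfolding P.sL_def
      proof (rule sum_inverse_primes_above)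
        have "(2::real) ^ 1 <= 2 ^ 2 ^ J" by (intro power_increasing) auto
        thus "(1::real) < 2 ^ 2 ^ J" by simp
        fix p assume p: "p \<in> large_primes J R"
        have "R <= real N powr 1" unfolding R_def using N1 a by (intro powr_mono) auto
        hence "real p <= real N" using p N1 by (simp add: large_primes_def)
        moreover have "real (2 ^ 2 ^ J) <= real p" using p by (simp only: of_nat_le_iff) (simp add: large_primes_def)
        ultimately show "prime p & 2 ^ 2 ^ J <= real p & p <= N" using p by (simp add: large_primes_def)
      qed (use N1 in auto)
      also have "... <= (2 * l) / (h / 2 * l)" using l4 lnz h by (intro frac_le) (auto simp: l_def)
      also have "... = s" using l4 h by (simp add: s_def field_simps)
      finally show ?thesis .
    qed
    define X where "X = C0 ^ 3 * real N powr (- a)"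
    have X: "P.cnu ^ 3 * R ^ 4 <= X * real y"
    proof -
      have "P.cnu ^ 3 * R ^ 4 <= (C0 * real N powr a) ^ 3 * R ^ 4" using cnu P.cnu_ge_1 by (intro mult_right_mono power_mono) auto
      also have "... = C0 ^ 3 * ((real N powr a) ^ 3 * (real N powr (1/4 - a)) ^ 4)" by (simp add: R_def power_mult_distrib)
      also have "(real N powr a) ^ 3 * (real N powr (1/4 - a)) ^ 4 = real N powr (a * 3 + (1/4 - a) * 4)"
      proof -
        have "(real N powr x) ^ k = real N powr (x * real k)" for x and k :: nat using N1 by (simp add: powr_powr flip: powr_realpow)
        from this[of a 3] this[of "1/4 - a" 4] show ?thesis by (simp only: powr_add of_nat_numeral)
      qed
      also have "a * 3 + (1/4 - a) * 4 = - a + 1" by simp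
      also have "C0 ^ 3 * real N powr (- a + 1) = X * real N"
      proof -
        have "real N powr (- a + 1) = real N powr (- a) * real N powr 1" by (rule powr_add)
        thus ?thesis using N1 unfolding X_def by (simp only: mult.assoc powr_one)
      qed
      also have "... <= X * real y" using y C0 by (intro mult_left_mono) (auto simp: X_def)
      finally show ?thesis .
    qed
    have DD: "P.Delta y <= kap"
    proof -
      have "P.Delta y <= Dx N" unfolding Dx_def TV_def c2_def e0_def c4_def W_def l_def[symmetric] X_def[symmetric] ebE[symmetric] V0E[symmetric]
        by (rule P.Delta_le[OF _ lK sL _ _ V X y(3)]) (use l4 J(2) N1 V0 eta V0E in auto)
      thus ?thesis using elim(1) by simp
    qed
    have DD0: "0 <= P.Delta y" using lK l4 y by (intro P.Delta_nonneg) auto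
    have P10: "0 <= P1" by (simp add: P1_def)
    have sq: "sqrt (real (card PP) * real y * P.Delta y / ln (2 ^ 2 ^ J)) <= a * P1"
    proof -
      have "real y <= 4 * P1 * l" using P1N y(2) l4 by (simp add: field_simps)
      hence "real (card PP) * real y * P.Delta y / ln (2 ^ 2 ^ J) <= P1 * (4 * P1 * l) * kap / (h / 2 * l)"
        using cPP DD DD0 lnz h l4 P10 kap by (intro frac_le mult_mono) auto
      also have "... = (a * P1)\<^sup>2" using l4 h by (simp add: kap_def field_simps power2_eq_square)
      finally have "sqrt (real (card PP) * real y * P.Delta y / ln (2 ^ 2 ^ J)) <= sqrt ((a * P1)\<^sup>2)" by (rule real_sqrt_le_mono)
      thus ?thesis using a P10 by simp
    qed
    define R' where "R' = real N powr (1/4)"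
    have "(\<Sum>e\<in>P.pairs. real (card (twins N e))) <= (\<Sum>p\<in>PP. P.FF (int p)) + (real K)\<^sup>2 * (R' + 1)"
    proof (rule P.sum_twins_le[OF _ _ y(4) PP_def])
      have "real N powr h <= R'" unfolding R'_def using N1 h by (intro powr_mono) auto
      thus "real (2 ^ 2 ^ J) <= R'" using J(3) by linarith
      show "R <= R'" unfolding R'_def R_def using N1 a by (intro powr_mono) auto
    qed
    also have "(\<Sum>p\<in>PP. P.FF (int p)) <= (real K)\<^sup>2 / ln R * (real (card PP) + sqrt (real (card PP) * real y * P.Delta y / ln (2 ^ 2 ^ J)))"
      by (rule P.sum_primes_FF_le[OF _ y(3) R1 fPP PP]) (use lK l4 in auto)
    also have "... <= (real K)\<^sup>2 / ln R * (P1 + a * P1)"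
      using cPP sq R1 by (intro mult_left_mono add_mono) auto
    also have "... = ((1 + a) / (1/4 - a)) * ((real K)\<^sup>2 / l * P1)"
      unfolding lnR using l4 a by (simp add: field_simps)
    also have "... <= (4 + eps / 2) * ((real K)\<^sup>2 / l * P1)"
    proof (rule mult_right_mono)
      have "eps * eps <= eps * 1" using eps by (intro mult_left_mono) auto
      hence "eps * eps <= eps" by simp
      moreover have "(4 + eps / 2) * (1/4 - a) = 1 + 17 / 200 * eps - eps * eps / 200" unfolding a_def by (simp add: field_simps)
      ultimately have "1 + a <= (4 + eps / 2) * (1/4 - a)" using eps unfolding a_def by linarith
      thus "(1 + a) / (1/4 - a) <= 4 + eps / 2" using a by (simp add: pos_divide_le_eq)
    qed (use P10 l4 in auto)
    also have "(real K)\<^sup>2 * (R' + 1) <= (real K)\<^sup>2 * (eps / 2 * (P1 / l))"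
    proof (rule mult_left_mono)
      have "R' + 1 <= eps / 2 * (real N / (2 * l) / l)" using elim(8) by (simp add: R'_def l_def mult.assoc)
      also have "... <= eps / 2 * (P1 / l)" using P1N l4 eps by (intro mult_left_mono divide_right_mono) auto
      finally show "R' + 1 <= eps / 2 * (P1 / l)" .
    qed simp
    also have "(4 + eps / 2) * ((real K)\<^sup>2 / l * P1) + (real K)\<^sup>2 * (eps / 2 * (P1 / l)) = (4 + eps) * ((real K)\<^sup>2 / l * P1)"
      by (simp add: algebra_simps add_divide_distrib)
    finally show ?case unfolding P.pairs_def unfolding l_def K_def P1_def by simp
  qed
qed

section \<open>The average of the singular series\<close>

definition tf :: "nat => real" where
  "tf p = (if prime p & 3 <= p then 1 - 1 / (real p - 1)\<^sup>2 else 1)"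

lemma tf_bounds: "0 < tf p" "tf p <= 1"
proof -
  have "1 / (real p - 1)\<^sup>2 < 1" if "3 <= p"
  proof -
    have "2\<^sup>2 <= (real p - 1)\<^sup>2" using that by (intro power_mono) auto
    thus ?thesis by (subst divide_less_eq_1_pos) auto
  qed
  thus "0 < tf p" by (simp add: tf_def)
qed (simp add: tf_def)

lemma twin_prime_const_limit:
  "(\<lambda>n. \<Prod>p\<le>n. tf p) \<longlonglongrightarrow> twin_prime_const" "0 < twin_prime_const"
proof -
  have "summable (\<lambda>p. norm (tf p - 1))"
  proof (rule summable_comparison_test)
    show "summable (\<lambda>p. 4 * inverse (real p ^ 2))" by (intro summable_mult inverse_power_summable) simp
    have "norm (norm (tf p - 1)) <= 4 * inverse (real p ^ 2)" for p
    proof (cases "prime p & 3 <= p")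
      case True
      have "real p <= 2 * (real p - 1)" using True by simp
      hence "(real p)\<^sup>2 <= (2 * (real p - 1))\<^sup>2" by (rule power_mono) simp
      hence sq: "(real p)\<^sup>2 <= 2\<^sup>2 * (real p - 1)\<^sup>2" by (simp only: power_mult_distrib)
      have "1 / x <= 4 * inverse y" if "y <= 2\<^sup>2 * x" "0 < x" "0 < y" for x y :: real using that by (simp add: field_simps)
      from this[OF sq] have "1 / (real p - 1)\<^sup>2 <= 4 * inverse (real p ^ 2)" using True by simp
      thus ?thesis using True by (simp add: tf_def)
    qed (auto simp: tf_def)
    thus "\<exists>N. \<forall>p\<ge>N. norm (norm (tf p - 1)) <= 4 * inverse (real p ^ 2)" by blast
  qed
  hence "convergent_prod tf" using abs_convergent_prod_conv_summable abs_convergent_prod_imp_convergent_prod by blast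
  moreover have nz: "\<And>p. tf p ~= 0" using tf_bounds(1) by (metis less_irrefl)
  ultimately obtain L where L: "(\<lambda>n. \<Prod>p\<le>n. tf p) \<longlonglongrightarrow> L" "L ~= 0" using convergent_prod_iff_nz_lim[of tf] by blast
  have "twin_prime_const = prodinf tf" by (simp add: twin_prime_const_def tf_def[abs_def])
  also have "... = L" by (rule prodinf_eq_prod_lim[OF L])
  finally have e: "twin_prime_const = L" .
  show "(\<lambda>n. \<Prod>p\<le>n. tf p) \<longlonglongrightarrow> twin_prime_const" using L e by simp
  have "0 <= L" by (rule LIMSEQ_le_const[OF L(1)]) (intro exI[of _ 0] allI impI prod_nonneg less_imp_le[OF tf_bounds(1)])
  thus "0 < twin_prime_const" using L(2) e by simp
qed

text \<open>Local factor of a singular series truncated to a finite set of primes. The prime 2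
  appears as a parity condition, so odd differences get the value 0.\<close>

definition gT :: "nat => int => real" where
  "gT p m = (if p = 2 then ind 2 m else 1 + (1 / (real p - 2)) * ind p m)"

definition FT :: "nat => int => real" where "FT n m = (\<Prod>p\<in>upto_primes n. gT p m)"

lemma gT_bounds: assumes "prime p" shows "0 <= gT p m" "gT p m <= 2"
proof -
  have p: "p = 2 \<or> p >= 3" using prime_ge_2_nat[OF assms] by linarith
  hence c: "1 / (real p - 2) <= 1 & 0 <= 1 / (real p - 2)" by auto
  show "0 <= gT p m" using c by (auto simp: gT_def)
  have "1 / (real p - 2) * ind p m <= 1 * 1" using c by (intro mult_mono) auto
  moreover have "ind 2 m <= 2" using ind_bounds(2)[of 2 m] by linarith
  ultimately show "gT p m <= 2" by (auto simp: gT_def)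
qed

lemma FT_bounds: "0 <= FT n m" "FT n m <= 2 ^ card (upto_primes n)"
proof -
  show "0 <= FT n m" unfolding FT_def using gT_bounds by (intro prod_nonneg) (auto simp: upto_primes_def)
  have "FT n m <= (\<Prod>p\<in>upto_primes n. 2)" unfolding FT_def using gT_bounds by (intro prod_mono) (auto simp: upto_primes_def)
  thus "FT n m <= 2 ^ card (upto_primes n)" by simp
qed

lemma per_gT: "per p (gT p)"
proof -
  have "per p (\<lambda>m. ind p (m + 0))" by (rule per_ind) simp
  hence "per p (ind p)" by simp
  from per_comp[OF this, of "\<lambda>x. if p = 2 then x else 1 + (1 / (real p - 2)) * x"]
  show ?thesis by (simp add: gT_def[abs_def] cong: if_cong)
qed

lemma per_FT: "per (\<Prod>(upto_primes n)) (FT n)"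
  unfolding FT_def[abs_def]
proof (rule per_prod)
  fix p assume "p \<in> upto_primes n"
  hence "p dvd \<Prod>(upto_primes n)" by (intro dvd_prodI[where f = "\<lambda>x. x"]) auto
  thus "per (\<Prod>(upto_primes n)) (gT p)" by (rule per_dvd[OF per_gT])
qed

lemma FT_minus: "FT n (- m) = FT n m"
proof -
  have "ind p (- m) = ind p m" for p by (simp add: ind_def)
  thus ?thesis unfolding FT_def gT_def by (simp only:)
qed

text \<open>For odd \<open>p\<close> the mean of the local factor is the inverse of the factor in
  the twin prime constant, since
  \<open>1 + 1 / (p * (p - 2)) = (p - 1)\<^sup>2 / (p * (p - 2))\<close>.\<close>

lemma mean_gT: assumes "prime p" shows "mean p (gT p) = (if p = 2 then 1/2 else 1 / tf p)"
proof -
  have p0: "p > 0" using assms prime_gt_0_nat by blast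
  have mi: "mean p (ind p) = 1 / real p" using mean_ind[of p p 0] p0 by simp
  show ?thesis
  proof (cases "p = 2")
    case True thus ?thesis using mi by (simp add: gT_def[abs_def])
  next
    case False
    hence p3: "p >= 3" using prime_ge_2_nat[OF assms] by linarith
    have "mean p (gT p) = mean p (\<lambda>m. 1 + (1 / (real p - 2)) * ind p m)" using False by (simp add: gT_def[abs_def])
    also have "... = 1 + (1 / (real p - 2)) * (1 / real p)" by (simp only: mean_add mean_cmult mi mean_const[OF p0])
    also have "... = 1 / tf p"
    proof -
      define x where "x = real p - 1"
      have x: "x >= 2" using p3 by (simp add: x_def)
      have xx: "x * x > 1 * 1" using x by (intro mult_strict_mono) auto
      have t: "tf p = (x * x - 1) / (x * x)" using assms p3 x by (simp add: tf_def x_def[symmetric] power2_eq_square field_simps)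
      have "1 + (1 / (x - 1)) * (1 / (x + 1)) = (x * x) / (x * x - 1)" using x xx by (simp add: field_simps)
      moreover have "x - 1 = real p - 2" "x + 1 = real p" by (simp_all add: x_def)
      ultimately show ?thesis using t by simp
    qed
    finally show ?thesis using False by simp
  qed
qed

lemma mean_FT: assumes "n >= 2" shows "mean (\<Prod>(upto_primes n)) (FT n) = 1 / 2 / (\<Prod>p\<le>n. tf p)"
proof -
  have "mean (\<Prod>(upto_primes n)) (FT n) = (\<Prod>p\<in>upto_primes n. mean p (gT p))"
    unfolding FT_def[abs_def] by (rule mean_prod_primes) (auto simp: per_gT upto_primes_def)
  also have "... = (\<Prod>p\<in>upto_primes n. if p = 2 then 1/2 else 1 / tf p)" by (intro prod.cong) (auto simp: mean_gT upto_primes_def)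
  also have "... = (\<Prod>p\<in>upto_primes n. (if p = 2 then 1/2 else 1) * (1 / tf p))" by (intro prod.cong) (auto simp: tf_def)
  also have "... = (\<Prod>p\<in>upto_primes n. if p = 2 then 1/2 else 1) * (\<Prod>p\<in>upto_primes n. 1 / tf p)" by (rule prod.distrib)
  also have "(\<Prod>p\<in>upto_primes n. if p = 2 then 1/2 else 1 :: real) = 1/2" using assms by (subst prod.delta) (auto simp: upto_primes_def)
  also have "(\<Prod>p\<in>upto_primes n. 1 / tf p) = (\<Prod>p\<le>n. 1 / tf p)" by (rule prod.mono_neutral_left) (auto simp: upto_primes_def tf_def)
  also have "... = 1 / (\<Prod>p\<le>n. tf p)" by (simp add: prod_dividef)
  finally show ?thesis by simp
qed

lemma shift_sh: "shift k h = sh (k + h) - sh k"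
  by (simp add: shift_def sh_def power_add algebra_simps)

text \<open>Truncation discards only factors that are at least 1, and the parity factor at 2 is at
  most 1.\<close>

lemma singular_series_ge:
  assumes "1 <= k" "1 <= h" shows "2 * twin_prime_const * FT n (shift k h) <= singular_series (shift k h)"
proof -
  define d where "d = shift k h"
  have "d > 0" unfolding d_def shift_sh using sh_strict_mono[of k "k + h"] assms by simp
  define B where "B = {p. prime p & int p dvd d & 2 < p}"
  have "B \<subseteq> {..nat d}"
  proof
    fix p assume "p \<in> B"
    hence "int p <= d" using \<open>d > 0\<close> by (auto simp: B_def intro: zdvd_imp_le)
    thus "p \<in> {..nat d}" by simp
  qed
  hence fB: "finite B" by (rule finite_subset) simp
  have "FT n d <= (\<Prod>p\<in>upto_primes n. if p \<in> B then 1 + 1 / (real p - 2) else 1)" unfolding FT_def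
  proof (rule prod_mono, intro conjI)
    fix p assume "p \<in> upto_primes n"
    hence p: "prime p" by (simp add: upto_primes_def)
    show "0 <= gT p d" by (rule gT_bounds[OF p])
    have "p = 2 \<or> 2 < p" using prime_ge_2_nat[OF p] by linarith
    thus "gT p d <= (if p \<in> B then 1 + 1 / (real p - 2) else 1)" using p by (auto simp: gT_def B_def ind_def)
  qed
  also have "... = (\<Prod>p\<in>upto_primes n \<inter> B. 1 + 1 / (real p - 2))" by (simp add: prod.inter_restrict)
  also have "... <= (\<Prod>p\<in>B. 1 + 1 / (real p - 2))" by (rule prod_mono2[OF fB]) (auto simp: B_def)
  finally have "2 * twin_prime_const * FT n d <= 2 * twin_prime_const * (\<Prod>p\<in>B. 1 + 1 / (real p - 2))"
    using twin_prime_const_limit(2) by (intro mult_left_mono) auto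
  thus ?thesis by (simp add: singular_series_def B_def d_def)
qed

lemma FT_odd: assumes "n >= 2" "odd (l + k)" shows "FT n (sh (Suc l) - sh (Suc k)) = 0"
proof -
  have "odd (sh (Suc l) - sh (Suc k))" using assms(2) by (simp add: sh_def)
  hence "gT 2 (sh (Suc l) - sh (Suc k)) = 0" by (simp add: gT_def ind_def)
  moreover have "2 \<in> upto_primes n" using assms(1) by (simp add: upto_primes_def)
  ultimately show ?thesis unfolding FT_def by (intro prod_zero) auto
qed

text \<open>Equidistribution gives every row \<open>k\<close> the full mean. By symmetry of
  \<open>FT\<close> the pairs with \<open>k < l\<close> carry half of the total, and the diagonal is
  bounded trivially.\<close>

lemma sum_FT_ge:
  assumes E: "equidist (\<Prod>(upto_primes n)) T"
  shows "(real K)\<^sup>2 * mean (\<Prod>(upto_primes n)) (FT n) - real K * (2 ^ card (upto_primes n) * (real T + 1))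
     <= 2 * (\<Sum>(k, l) | k < l & l < K. FT n (sh (Suc l) - sh (Suc k)))"
proof -
  define C :: real where "C = 2 ^ card (upto_primes n)"
  define mu where "mu = mean (\<Prod>(upto_primes n)) (FT n)"
  define g where "g = (\<lambda>(k, l). FT n (sh (Suc l) - sh (Suc k)))"
  have W: "\<Prod>(upto_primes n) > 0" using E by (simp add: equidist_def)
  have row: "real K * mu - C * real T <= (\<Sum>l<K. g (k, l))" for k
  proof -
    define f where "f = (\<lambda>m. FT n (m + - sh (Suc k)))"
    have "\<bar>(\<Sum>l<K. f (sh (Suc l))) - real K * mean (\<Prod>(upto_primes n)) f\<bar> <= C * real T"
      by (rule equidist_average[OF E]) (auto simp: f_def C_def FT_bounds intro!: per_shift[OF per_FT, of n "- sh (Suc k)", simplified])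
    moreover have "mean (\<Prod>(upto_primes n)) f = mu" unfolding f_def mu_def by (rule mean_shift[OF per_FT W])
    moreover have "(\<Sum>l<K. f (sh (Suc l))) = (\<Sum>l<K. g (k, l))" by (simp add: f_def g_def)
    ultimately have "\<bar>(\<Sum>l<K. g (k, l)) - real K * mu\<bar> <= C * real T" by (simp only:)
    from abs_le_D2[OF this] show ?thesis by (simp add: algebra_simps)
  qed
  define A where "A = {(k, l). k < l & l < K}"
  define A' where "A' = {(k, l). l < k & k < K}"
  define A0 where "A0 = (\<lambda>k. (k, k)) ` {..<K}"
  have "A \<subseteq> {..<K} \<times> {..<K}" "A' \<subseteq> {..<K} \<times> {..<K}" by (auto simp: A_def A'_def)
  hence fin: "finite A" "finite A'" "finite A0" by (auto simp: A0_def intro: finite_subset)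
  have "(\<Sum>k<K. real K * mu - C * real T) <= (\<Sum>k<K. \<Sum>l<K. g (k, l))" by (intro sum_mono row)
  also have "... = (\<Sum>e\<in>{..<K} \<times> {..<K}. g e)" by (simp add: sum.cartesian_product)
  also have "{..<K} \<times> {..<K} = (A \<union> A') \<union> A0" by (auto simp: A_def A'_def A0_def)
  also have "(\<Sum>e\<in>(A \<union> A') \<union> A0. g e) = sum g (A \<union> A') + sum g A0" using fin by (intro sum.union_disjoint) (auto simp: A_def A'_def A0_def)
  also have "sum g (A \<union> A') = sum g A + sum g A'" using fin by (intro sum.union_disjoint) (auto simp: A_def A'_def)
  also have "sum g A' = sum g A"
  proof (rule sum.reindex_bij_witness[where i = prod.swap and j = prod.swap])
    fix e assume "e \<in> A'"
    obtain k l where e: "e = (k, l)" by (cases e)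
    show "g (prod.swap e) = g e" using FT_minus[of n "sh (Suc l) - sh (Suc k)"] by (simp add: e g_def)
  qed (auto simp: A_def A'_def)
  also have "sum g A0 <= (\<Sum>e\<in>A0. C)" by (intro sum_mono) (auto simp: A0_def g_def C_def FT_bounds)
  also have "... <= real K * C"
  proof -
    have "card A0 <= K" unfolding A0_def using card_image_le[of "{..<K}" "\<lambda>k. (k, k)"] by simp
    thus ?thesis by (simp add: C_def mult_right_mono)
  qed
  finally have "real K * (real K * mu - C * real T) <= sum g A + sum g A + real K * C" by simp
  hence "(real K)\<^sup>2 * mu - real K * (C * (real T + 1)) <= 2 * sum g A" by (simp add: algebra_simps power2_eq_square)
  thus ?thesis by (simp add: C_def mu_def g_def A_def case_prod_unfold)
qed

lemma Phi_ge:
  assumes K: "KN N >= 1" and n: "n >= 2"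
  shows "2 * twin_prime_const * (\<Sum>(k, l) | k < l & l < KK N. FT n (sh (Suc l) - sh (Suc k))) / (real (KK N))\<^sup>2 <= Phi N"
proof -
  define K where "K = KK N"
  have KN: "KN N = int K" using K by (simp add: K_def KK_def)
  define f where "f = (\<lambda>(h, k). FT n (shift k h))"
  define A where "A = {(k, l). k < l & l < K}"
  define A2 where "A2 = {(k, l). k < l & l < K & even (l + k)}"
  define B where "B = (SIGMA h:{h. 1 <= h & int h <= KN N - 1 & even h}. {k. 1 <= k & int k <= KN N - int h})"
  have fA: "finite A" by (rule finite_subset[of _ "{..<K} \<times> {..<K}"]) (auto simp: A_def)
  have fh: "finite {h. 1 <= h & int h <= KN N - 1 & even h}" by (rule finite_subset[of _ "{..K}"]) (auto simp: KN)
  have fk: "finite {k. 1 <= k & int k <= KN N - int h}" for h by (rule finite_subset[of _ "{..K}"]) (auto simp: KN)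
  have "(\<Sum>(k, l)\<in>A. FT n (sh (Suc l) - sh (Suc k))) = (\<Sum>(k, l)\<in>A2. FT n (sh (Suc l) - sh (Suc k)))"
  proof (rule sum.mono_neutral_right[OF fA])
    show "\<forall>e\<in>A - A2. (case e of (k, l) => FT n (sh (Suc l) - sh (Suc k))) = 0"
    proof
      fix e assume e: "e \<in> A - A2"
      obtain k l where kl: "e = (k, l)" by (cases e)
      have "odd (l + k)" using e unfolding kl A_def A2_def by blast
      thus "(case e of (k, l) => FT n (sh (Suc l) - sh (Suc k))) = 0" using FT_odd[OF n] by (simp add: kl)
    qed
  qed (auto simp: A_def A2_def)
  also have "... = (\<Sum>e\<in>B. f e)"
  \<comment> \<open>The indices of \<open>Phi\<close> are \<open>h = l - k\<close> and exponent
    \<open>Suc k\<close>; the shifts here are numbered from 0, the exponents from 1.\<close>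
  proof (rule sum.reindex_bij_witness[where i = "\<lambda>(h, k). (k - 1, k + h - 1)" and j = "\<lambda>(k, l). (l - k, Suc k)"])
    fix e assume "e \<in> A2"
    then obtain k l where e: "e = (k, l)" "k < l" "l < K" "even (l + k)" by (auto simp: A2_def)
    show "(case (case e of (k, l) => (l - k, Suc k)) of (h, k) => (k - 1, k + h - 1)) = e" using e by simp
    show "(case e of (k, l) => (l - k, Suc k)) \<in> B" using e by (auto simp: B_def KN)
    show "f (case e of (k, l) => (l - k, Suc k)) = (case e of (k, l) => FT n (sh (Suc l) - sh (Suc k)))" using e by (simp add: f_def shift_sh)
  next
    fix e assume "e \<in> B"
    then obtain h k where e: "e = (h, k)" "1 <= h" "even h" "1 <= k" "k + h <= K" by (auto simp: B_def KN)
    show "(case (case e of (h, k) => (k - 1, k + h - 1)) of (k, l) => (l - k, Suc k)) = e" using e by simp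
    have "k + h - 1 + (k - 1) = 2 * (k - 1) + h" using e by simp
    hence "even (k + h - 1 + (k - 1))" using e by simp
    thus "(case e of (h, k) => (k - 1, k + h - 1)) \<in> A2" using e by (auto simp: A2_def)
  qed
  finally have eq: "(\<Sum>(k, l)\<in>A. FT n (sh (Suc l) - sh (Suc k))) = (\<Sum>e\<in>B. f e)" .
  have "2 * twin_prime_const * (\<Sum>e\<in>B. f e) = (\<Sum>e\<in>B. 2 * twin_prime_const * f e)" by (rule sum_distrib_left)
  also have "... <= (\<Sum>(h, k)\<in>B. singular_series (shift k h))"
    by (intro sum_mono) (auto simp: B_def f_def intro!: singular_series_ge)
  also have "... = (\<Sum>h | 1 <= h & int h <= KN N - 1 & even h. \<Sum>k | 1 <= k & int k <= KN N - int h. singular_series (shift k h))"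
    unfolding B_def using fh fk by (intro sum.Sigma[symmetric]) auto
  finally have "2 * twin_prime_const * (\<Sum>e\<in>B. f e) / (real K)\<^sup>2 <= Phi N"
    unfolding Phi_def KN by (simp add: divide_right_mono)
  thus ?thesis using eq by (simp add: A_def K_def)
qed

text \<open>The twin prime constant cancels against the inverse factors of the mean. The prefactor 2
  cancels the parity density, and the restriction to \<open>k < l\<close> leaves the value
  \<open>1 / 2\<close>.\<close>

lemma Phi_lower:
  assumes e: "e > 0" shows "\<forall>\<^sub>F N in sequentially. 1/2 - e <= Phi N"
proof -
  define c2 where "c2 = twin_prime_const"
  have c2: "c2 > 0" using twin_prime_const_limit(2) by (simp add: c2_def)
  have "(\<lambda>n. c2 * (1 / 2 / (\<Prod>p\<le>n. tf p))) \<longlonglongrightarrow> c2 * (1 / 2 / c2)"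
    using twin_prime_const_limit c2 unfolding c2_def by (intro tendsto_intros) auto
  hence "(\<lambda>n. c2 * (1 / 2 / (\<Prod>p\<le>n. tf p))) \<longlonglongrightarrow> 1 / 2" using c2 by simp
  hence "\<forall>\<^sub>F n in sequentially. c2 * (1 / 2 / (\<Prod>p\<le>n. tf p)) > 1/2 - e/2" using e by (intro order_tendstoD(1)[of _ "1/2"]) auto
  hence "\<forall>\<^sub>F n in sequentially. c2 * (1 / 2 / (\<Prod>p\<le>n. tf p)) > 1/2 - e/2 & n >= 2" using eventually_ge_at_top[of 2] by (rule eventually_conj)
  then obtain n where n: "c2 * (1 / 2 / (\<Prod>p\<le>n. tf p)) > 1/2 - e/2" "n >= 2" by (auto simp: eventually_sequentially)
  define mu where "mu = mean (\<Prod>(upto_primes n)) (FT n)"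
  have mu: "c2 * mu > 1/2 - e/2" using n mean_FT[OF n(2)] by (simp add: mu_def)
  obtain T where T: "equidist (\<Prod>(upto_primes n)) T" using equidist_primorial[of n] unfolding upto_primes_def by blast
  define B where "B = c2 * (2 ^ card (upto_primes n) * (real T + 1))"
  have "filterlim (\<lambda>N. real (KK N)) at_top sequentially" using KK_at_top by (simp add: filterlim_sequentially_iff_filterlim_real)
  hence "(\<lambda>N. B / real (KK N)) \<longlonglongrightarrow> 0" by (rule real_tendsto_divide_at_top[OF tendsto_const])
  hence "\<forall>\<^sub>F N in sequentially. B / real (KK N) < e / 2" using e by (intro order_tendstoD(2)[of _ 0]) auto
  thus ?thesis using KK_pos
  proof eventually_elim
    case (elim N)
    define K where "K = real (KK N)"
    have K: "K > 0" using elim(2) by (simp add: K_def KK_def)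
    define S where "S = (\<Sum>(k, l) | k < l & l < KK N. FT n (sh (Suc l) - sh (Suc k)))"
    have "K\<^sup>2 * mu - K * (2 ^ card (upto_primes n) * (real T + 1)) <= 2 * S" unfolding S_def mu_def K_def by (rule sum_FT_ge[OF T])
    hence "c2 * (K\<^sup>2 * mu - K * (2 ^ card (upto_primes n) * (real T + 1))) / K\<^sup>2 <= c2 * (2 * S) / K\<^sup>2"
      using c2 by (intro divide_right_mono mult_left_mono) auto
    also have "... = 2 * c2 * S / K\<^sup>2" by simp
    also have "... <= Phi N" unfolding c2_def S_def K_def by (rule Phi_ge[OF elim(2) n(2)])
    finally have "c2 * (K\<^sup>2 * mu - K * (2 ^ card (upto_primes n) * (real T + 1))) / K\<^sup>2 <= Phi N" .
    moreover have "c2 * (K\<^sup>2 * mu - K * (2 ^ card (upto_primes n) * (real T + 1))) / K\<^sup>2 = c2 * mu - B / K"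
    proof -
      have "c2 * (K\<^sup>2 * mu - K * x) / K\<^sup>2 = c2 * mu - (c2 * x) / K" for x using K by (simp add: field_simps power2_eq_square)
      thus ?thesis by (simp only: B_def)
    qed
    ultimately show ?case using elim(1) mu by (simp add: K_def)
  qed
qed

section \<open>Density of the represented integers\<close>

text \<open>The index \<open>k\<close> stands for the exponent \<open>Suc k\<close>. The condition
  \<open>Suc k < n\<close> ensures that \<open>m = n - Suc k\<close> is at least 1, and
  \<open>n + sh (Suc k)\<close> equals \<open>2 ^ Suc k + m\<close>.\<close>

definition reps :: "nat => nat => nat set" where
  "reps K n = {k. k < K & Suc k < n & prime (n + nat (sh (Suc k)))}"

lemma finite_reps [simp]: "finite (reps K n)" by (simp add: reps_def)

lemma reps_RN: assumes "n <= N" "reps K n ~= {}" shows "n \<in> RN N"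
proof -
  obtain k where k: "Suc k < n" "prime (n + nat (sh (Suc k)))" using assms(2) by (auto simp: reps_def)
  define m where "m = n - Suc k"
  have "int (2 ^ Suc k + m) = int (n + nat (sh (Suc k)))" using k(1) sh_pos[of "Suc k"] by (simp add: m_def sh_def of_nat_diff)
  hence "2 ^ Suc k + m = n + nat (sh (Suc k))" by (simp only: of_nat_eq_iff)
  hence "prime (2 ^ Suc k + m)" using k(2) by (simp only:)
  moreover have "n = m + Suc k" "1 <= m" using k(1) by (auto simp: m_def)
  ultimately show ?thesis unfolding RN_def using assms(1) by (intro CollectI conjI exI[of _ "Suc k"] exI[of _ m]) auto
qed

text \<open>For a given exponent every prime between \<open>2 ^ Suc k\<close> and \<open>N\<close>
  comes from an admissible \<open>n\<close> by subtracting the shift; at most \<open>2 ^ K\<close>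
  primes are lost.\<close>

lemma sum_reps_ge: "real K * (real (card (upto_primes N)) - 2 ^ K) <= (\<Sum>n\<le>N. real (card (reps K n)))"
proof -
  have one: "real (card (upto_primes N)) - 2 ^ K <= real (card {n. n <= N & Suc k < n & prime (n + nat (sh (Suc k)))})" if k: "k < K" for k
  proof -
    define s where "s = nat (sh (Suc k))"
    define B where "B = {n. n <= N & Suc k < n & prime (n + s)}"
    have s: "s + Suc k = 2 ^ Suc k"
    proof -
      have "int (s + Suc k) = int (2 ^ Suc k)" using sh_pos[of "Suc k"] by (simp add: s_def sh_def)
      thus ?thesis by (simp only: of_nat_eq_iff)
    qed
    have fB: "finite B" by (rule finite_subset[of _ "{..N}"]) (auto simp: B_def)
    have "upto_primes N \<subseteq> {1..2 ^ Suc k} \<union> (\<lambda>n. n + s) ` B"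
    proof
      fix p assume "p \<in> upto_primes N"
      hence p: "prime p" "p <= N" by (auto simp: upto_primes_def)
      show "p \<in> {1..2 ^ Suc k} \<union> (\<lambda>n. n + s) ` B"
      proof (cases "p <= 2 ^ Suc k")
        case True thus ?thesis using prime_ge_1_nat[OF p(1)] by simp
      next
        case False
        hence "p > s + Suc k" using s by simp
        hence "p - s \<in> B" "p = (p - s) + s" using p by (auto simp: B_def)
        thus ?thesis by blast
      qed
    qed
    hence "card (upto_primes N) <= card ({1..2 ^ Suc k} \<union> (\<lambda>n. n + s) ` B)" using fB by (intro card_mono) auto
    also have "... <= card {1..(2::nat) ^ Suc k} + card ((\<lambda>n. n + s) ` B)" by (rule card_Un_le)
    also have "... <= 2 ^ Suc k + card B" using card_image_le[OF fB] by simp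
    also have "(2::nat) ^ Suc k <= 2 ^ K" using k by (intro power_increasing) auto
    finally have "card (upto_primes N) <= 2 ^ K + card B" by simp
    hence "real (card (upto_primes N)) <= real (2 ^ K + card B)" by (simp only: of_nat_le_iff)
    thus ?thesis by (simp add: B_def s_def)
  qed
  have "real K * (real (card (upto_primes N)) - 2 ^ K) = (\<Sum>k<K. real (card (upto_primes N)) - 2 ^ K)" by simp
  also have "... <= (\<Sum>k<K. real (card {n. n <= N & Suc k < n & prime (n + nat (sh (Suc k)))}))" by (intro sum_mono one) simp
  also have "... = (\<Sum>k<K. \<Sum>n\<le>N. if k \<in> reps K n then 1 else 0)"
  proof (rule sum.cong[OF refl])
    fix k assume "k \<in> {..<K}"
    hence "{n \<in> {..N}. k \<in> reps K n} = {n. n <= N & Suc k < n & prime (n + nat (sh (Suc k)))}" by (auto simp: reps_def)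
    thus "real (card {n. n <= N & Suc k < n & prime (n + nat (sh (Suc k)))}) = (\<Sum>n\<le>N. if k \<in> reps K n then 1 else 0)"
      by (simp add: sum.If_cases Int_def)
  qed
  also have "... = (\<Sum>n\<le>N. \<Sum>k<K. if k \<in> reps K n then 1 else 0)" by (rule sum.swap)
  also have "... = (\<Sum>n\<le>N. real (card (reps K n)))"
  proof (rule sum.cong[OF refl])
    fix n
    have "{k \<in> {..<K}. k \<in> reps K n} = reps K n" by (auto simp: reps_def)
    thus "(\<Sum>k<K. if k \<in> reps K n then 1 else 0) = real (card (reps K n))" by (simp add: sum.If_cases Int_def)
  qed
  finally show ?thesis .
qed

text \<open>The square counts ordered pairs of representations; equal ones give the first moment,
  distinct ones lie in \<open>twins\<close>.\<close>

lemma sum_reps_square_le: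
  "(\<Sum>n\<le>N. (real (card (reps K n)))\<^sup>2) <= (\<Sum>n\<le>N. real (card (reps K n))) + (\<Sum>e | fst e < K & snd e < K & fst e ~= snd e. real (card (twins N e)))"
proof -
  define Q where "Q = {e::nat \<times> nat. fst e < K & snd e < K & fst e ~= snd e}"
  have fQ: "finite Q" by (rule finite_subset[of _ "{..<K} \<times> {..<K}"]) (auto simp: Q_def)
  define O1 where "O1 = (\<lambda>n. {e \<in> Q. n \<in> twins N e})"
  have "(real (card (reps K n)))\<^sup>2 <= real (card (reps K n)) + real (card (O1 n))" if n: "n <= N" for n
  proof -
    have "reps K n \<times> reps K n \<subseteq> (\<lambda>k. (k, k)) ` reps K n \<union> O1 n"
      using n by (auto simp: reps_def O1_def Q_def twins_def)
    hence "card (reps K n \<times> reps K n) <= card ((\<lambda>k. (k, k)) ` reps K n \<union> O1 n)" using fQ by (intro card_mono) (auto simp: O1_def)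
    also have "... <= card ((\<lambda>k. (k, k)) ` reps K n) + card (O1 n)" by (rule card_Un_le)
    also have "... <= card (reps K n) + card (O1 n)" by (simp add: card_image_le)
    finally have "card (reps K n) * card (reps K n) <= card (reps K n) + card (O1 n)" by simp
    hence "real (card (reps K n) * card (reps K n)) <= real (card (reps K n) + card (O1 n))" by (simp only: of_nat_le_iff)
    thus ?thesis by (simp add: power2_eq_square)
  qed
  hence "(\<Sum>n\<le>N. (real (card (reps K n)))\<^sup>2) <= (\<Sum>n\<le>N. real (card (reps K n)) + real (card (O1 n)))" by (intro sum_mono) simp
  also have "... = (\<Sum>n\<le>N. real (card (reps K n))) + (\<Sum>n\<le>N. real (card (O1 n)))" by (rule sum.distrib)
  also have "(\<Sum>n\<le>N. real (card (O1 n))) = (\<Sum>n\<le>N. \<Sum>e\<in>Q. if n \<in> twins N e then 1 else 0)"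
    using fQ by (intro sum.cong refl) (simp add: sum.If_cases O1_def Int_def)
  also have "... = (\<Sum>e\<in>Q. \<Sum>n\<le>N. if n \<in> twins N e then 1 else 0)" by (rule sum.swap)
  also have "... = (\<Sum>e\<in>Q. real (card (twins N e)))"
  proof (rule sum.cong[OF refl])
    fix e
    have "{n \<in> {..N}. n \<in> twins N e} = twins N e" by (auto simp: twins_def)
    thus "(\<Sum>n\<le>N. if n \<in> twins N e then 1 else 0) = real (card (twins N e))" by (simp add: sum.If_cases Int_def)
  qed
  finally show ?thesis by (simp add: Q_def)
qed

lemma RN_cauchy_schwarz:
  "(\<Sum>n\<le>N. real (card (reps K n)))\<^sup>2 <= real (card (RN N)) *
     ((\<Sum>n\<le>N. real (card (reps K n))) + (\<Sum>e | fst e < K & snd e < K & fst e ~= snd e. real (card (twins N e))))"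
proof -
  have sub: "RN N \<subseteq> {..N}" by (auto simp: RN_def)
  have "(\<Sum>n\<le>N. real (card (reps K n))) = (\<Sum>n\<in>RN N. 1 * real (card (reps K n)))"
    using sub reps_RN[of _ N K] by (simp, intro sum.mono_neutral_right) auto
  hence "(\<Sum>n\<le>N. real (card (reps K n)))\<^sup>2 = (\<Sum>n\<in>RN N. 1 * real (card (reps K n)))\<^sup>2" by (simp only:)
  also have "... <= (\<Sum>n\<in>RN N. 1\<^sup>2) * (\<Sum>n\<in>RN N. (real (card (reps K n)))\<^sup>2)" by (rule Cauchy_Schwarz_ineq_sum)
  also have "... = real (card (RN N)) * (\<Sum>n\<in>RN N. (real (card (reps K n)))\<^sup>2)" by simp
  also have "... <= real (card (RN N)) * (\<Sum>n\<le>N. (real (card (reps K n)))\<^sup>2)"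
    using sub by (intro mult_left_mono sum_mono2) auto
  also have "... <= real (card (RN N)) * ((\<Sum>n\<le>N. real (card (reps K n))) + (\<Sum>e | fst e < K & snd e < K & fst e ~= snd e. real (card (twins N e))))"
    by (intro mult_left_mono sum_reps_square_le) simp
  finally show ?thesis .
qed

text \<open>With \<open>K\<close> about \<open>ln N / ln 2\<close> the off-diagonal sum is at most
  about \<open>4 / ln 2\<close> times the first moment \<open>S\<close>, and \<open>S\<close> is
  about \<open>N / ln 2\<close>. Cauchy-Schwarz then gives the density \<open>1 / (ln 2 + 4)\<close>
  in the limit.\<close>

lemma RN_density_aux:
  assumes e: "0 < e" "e < 1"
  shows "\<forall>\<^sub>F N in sequentially. (1 - e) ^ 3 / (ln 2 + (4 + e) * (1 + e) / (1 - e)) * real N <= real (card (RN N))"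
proof -
  have "(1 - e) / ln 2 < 1 / ln 2" using e by (intro divide_strict_right_mono) auto
  note evK = KK_ge[OF this]
  \<comment> \<open>This threshold on \<open>ln N\<close> turns the bound
    \<open>N / (ln N)\<^sup>2\<close> for \<open>2 ^ KK N\<close> into \<open>e\<close> times the
    number of primes.\<close>
  have ev1: "\<forall>\<^sub>F N::nat in sequentially. ln (real N) > 1 / (e * (1 - e))"
    by (rule filterlim_at_top_dense[THEN iffD1, rule_format]) real_asymp
  show ?thesis
    using evK ev1 KK_le KK_pow KK_pos prime_count_ge[OF e] pair_bound_asymptotic[OF e(1) less_imp_le[OF e(2)]]
  proof eventually_elim
    case (elim N)
    define K l where "K = real (KK N)" and "l = ln (real N)"
    define p where "p = real (card (upto_primes N))"
    define S where "S = (\<Sum>n\<le>N. real (card (reps (KK N) n)))"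
    define X where "X = real (card (RN N))"
    define Off where "Off = (\<Sum>e | fst e < KK N & snd e < KK N & fst e ~= snd e. real (card (twins N e)))"
    have ee: "0 < 1 / (e * (1 - e))" using e by simp
    have l: "l > 0" "1 / (e * (1 - e)) < l" using elim(2) order.strict_trans[OF ee elim(2)] unfolding l_def by blast+
    have N0: "real N > 0" using l(1) unfolding l_def by (cases "N = 0") auto
    have K0: "K > 0" using elim(5) by (simp add: K_def KK_def)
    have pl: "(1 - e) * (real N / l) <= p" using elim(6) by (simp add: p_def l_def)
    have p0: "p > 0"
    proof -
      have "0 < (1 - e) * (real N / l)" using e N0 l by simp
      thus ?thesis using pl by linarith
    qed
    have pw: "2 ^ KK N <= e * p"
    proof -
      have "1 < l * (e * (1 - e))" using l(2) e by (simp add: pos_divide_less_eq)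
      hence "real N / l\<^sup>2 * 1 <= real N / l\<^sup>2 * (l * (e * (1 - e)))" using N0 by (intro mult_left_mono) auto
      also have "... = e * ((1 - e) * (real N / l))" using l by (simp add: power2_eq_square)
      also have "... <= e * p" using pl e by (intro mult_left_mono) auto
      finally show ?thesis using elim(4) by (simp add: l_def)
    qed
    have "K * (p - 2 ^ KK N) <= S" using sum_reps_ge[of "KK N" N] by (simp add: K_def p_def S_def)
    moreover have "(1 - e) * (K * p) <= K * (p - 2 ^ KK N)"
    proof -
      have "K * (p - e * p) <= K * (p - 2 ^ KK N)" using pw K0 by (intro mult_left_mono) auto
      thus ?thesis by (simp add: algebra_simps)
    qed
    ultimately have S: "(1 - e) * (K * p) <= S" by linarith
    have Kp: "K * p > 0" using K0 p0 by simp
    have S0: "S > 0"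
    proof -
      have "0 < (1 - e) * (K * p)" using e Kp by simp
      thus ?thesis using S by linarith
    qed
    have p1: "real (card (upto_primes (N + 2 ^ KK N))) <= (1 + e) * p"
    proof -
      have "upto_primes (N + 2 ^ KK N) \<subseteq> upto_primes N \<union> {N<..N + 2 ^ KK N}" by (auto simp: upto_primes_def)
      hence "card (upto_primes (N + 2 ^ KK N)) <= card (upto_primes N \<union> {N<..N + 2 ^ KK N})" by (intro card_mono) auto
      also have "... <= card (upto_primes N) + card {N<..N + 2 ^ KK N}" by (rule card_Un_le)
      finally have "card (upto_primes (N + 2 ^ KK N)) <= card (upto_primes N) + 2 ^ KK N" by simp
      hence "real (card (upto_primes (N + 2 ^ KK N))) <= real (card (upto_primes N) + 2 ^ KK N)" by (simp only: of_nat_le_iff)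
      also have "... = p + 2 ^ KK N" by (simp add: p_def)
      also have "... <= (1 + e) * p" using pw by (simp add: algebra_simps)
      finally show ?thesis .
    qed
    define c where "c = (4 + e) * (1 + e) / (1 - e) / ln 2"
    have c0: "c > 0" using e by (simp add: c_def)
    have "Off <= (4 + e) * (K\<^sup>2 / l * real (card (upto_primes (N + 2 ^ KK N))))" using elim(7) by (simp add: Off_def K_def l_def)
    also have "... <= (4 + e) * (K\<^sup>2 / l * ((1 + e) * p))" using p1 e l by (intro mult_left_mono) auto
    also have "... = (4 + e) * (1 + e) * ((K / l) * (K * p))" by (simp add: power2_eq_square)
    also have "... <= (4 + e) * (1 + e) * ((1 / ln 2) * (S / (1 - e)))"
    proof (rule mult_left_mono, rule mult_mono)
      show "K / l <= 1 / ln 2" using elim(3) l by (simp add: K_def l_def field_simps)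
      show "K * p <= S / (1 - e)" using S e by (simp add: field_simps)
    qed (use e Kp in auto)
    also have "... = c * S" by (simp add: c_def)
    finally have Off: "Off <= c * S" .
    have "S * S <= X * (S + Off)" using RN_cauchy_schwarz[of "KK N" N] by (simp add: S_def X_def Off_def power2_eq_square)
    also have "... <= X * (S + c * S)" using Off by (intro mult_left_mono) (auto simp: X_def)
    also have "... = (X * (1 + c)) * S" by (simp add: algebra_simps)
    finally have SX: "S <= X * (1 + c)" using S0 by simp
    have "(1 - e) ^ 3 * real N / ln 2 = (1 - e) * (((1 - e) / ln 2 * l) * ((1 - e) * (real N / l)))" using l by (simp add: power3_eq_cube)
    also have "... <= (1 - e) * (K * p)"
      using elim(1) pl e l N0 K0 by (intro mult_left_mono mult_mono) (auto simp: K_def l_def)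
    also have "... <= X * (1 + c)" using S SX by linarith
    finally have "(1 - e) ^ 3 * real N / ln 2 <= X * (1 + c)" .
    moreover have "0 < 1 + c" using c0 by simp
    ultimately have "(1 - e) ^ 3 * real N / ln 2 / (1 + c) <= X" by (simp only: pos_divide_le_eq)
    also have "(1 - e) ^ 3 * real N / ln 2 / (1 + c) = (1 - e) ^ 3 / (ln 2 * (1 + c)) * real N" by simp
    also have "ln 2 * (1 + c) = ln 2 + (4 + e) * (1 + e) / (1 - e)"
    proof -
      have "ln 2 * (1 + Y / ln 2) = ln 2 + Y" for Y :: real by (simp add: distrib_left)
      thus ?thesis by (simp only: c_def)
    qed
    finally show ?case by (simp add: X_def)
  qed
qed

text \<open>The function \<open>f\<close> is continuous from the right at 0, so a fixed small
  \<open>e\<close> comes within \<open>eps\<close> of the limiting density.\<close>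

lemma RN_density:
  assumes "eps > 0" shows "\<forall>\<^sub>F N in sequentially. (1 / (ln 2 + 4) - eps) * real N <= real (card (RN N))"
proof -
  define f where "f = (\<lambda>e::real. (1 - e) ^ 3 / (ln 2 + (4 + e) * (1 + e) / (1 - e)))"
  have "ln 2 + (4 + 0) * (1 + 0) / (1 - 0) ~= (0::real)"
  proof -
    have "0 < ln (2::real)" by simp
    hence "0 < ln 2 + (4::real)" by (rule add_pos_pos) simp
    thus ?thesis by simp
  qed
  hence "(f \<longlongrightarrow> (1 - 0) ^ 3 / (ln 2 + (4 + 0) * (1 + 0) / (1 - 0))) (at_right 0)"
    unfolding f_def by (intro tendsto_intros) auto
  hence "\<forall>\<^sub>F e in at_right 0. f e > 1 / (ln 2 + 4) - eps" using assms by (intro order_tendstoD(1)) auto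
  moreover have "\<forall>\<^sub>F e in at_right 0. e \<in> {0<..<1::real}" by (rule eventually_at_right_real) simp
  ultimately have "\<forall>\<^sub>F e in at_right 0. f e > 1 / (ln 2 + 4) - eps & e \<in> {0<..<1}" by (rule eventually_conj)
  then obtain e where e: "f e > 1 / (ln 2 + 4) - eps" "0 < e" "e < 1"
    using eventually_happens'[OF trivial_limit_at_right_real] by fastforce
  from RN_density_aux[OF e(2,3)] show ?thesis
  proof eventually_elim
    case (elim N)
    have "(1 / (ln 2 + 4) - eps) * real N <= f e * real N" using e(1) by (intro mult_right_mono) auto
    thus ?case using elim by (simp add: f_def)
  qed
qed

theorem theorem2:
  shows "(\<exists>e :: nat \<Rightarrow> real. e \<longlonglongrightarrow> 0 \<and>
            (\<forall>\<^sub>F N in sequentially.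
               real (card (RN N)) \<ge> (1 / (ln 2 + 8 * Phi N) + e N) * real N)) \<and>
         (\<exists>\<delta> :: real. \<delta> \<ge> 0.0734 \<and>
            (\<forall>\<^sub>F N in sequentially. real (card (RN N)) \<ge> \<delta> * real N))"
proof (intro conjI)
  \<comment> \<open>With this choice the inequality holds by definition for \<open>N > 0\<close>.
    The substance is that \<open>e\<close> tends to 0, which combines \<open>RN_density\<close> with
    the lower bound for \<open>Phi\<close>.\<close>
  define e where "e = (\<lambda>N. min 0 (real (card (RN N)) / real N - 1 / (ln 2 + 8 * Phi N)))"
  have "e \<longlonglongrightarrow> 0"
  proof (rule LIMSEQ_I)
    fix r :: real assume r: "r > 0"
    \<comment> \<open>Ensures \<open>A - 8 * d >= 3\<close>, so the denominator stays away from 0,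
      and \<open>8 * d <= r\<close>, so the reciprocal moves by at most
      \<open>r / 4\<close>.\<close>
    define d where "d = min (1/8) (r / 8)"
    have d: "0 < d" "d <= 1/8" "8 * d <= r" using r by (auto simp: d_def)
    have r2: "r / 2 > 0" using r by simp
    have "\<forall>\<^sub>F N in sequentially. norm (e N - 0) < r"
      using RN_density[OF r2] Phi_lower[OF d(1)] eventually_gt_at_top[of 0]
    proof eventually_elim
      case (elim N)
      define A :: real where "A = ln 2 + 4"
      have A: "A >= 4" by (simp add: A_def)
      have "(1 / A - r / 2) * real N <= real (card (RN N))" using elim(1) by (simp add: A_def)
      hence "1 / A - r / 2 <= real (card (RN N)) / real N" using elim(3) by (simp add: pos_le_divide_eq)
      moreover have "1 / (ln 2 + 8 * Phi N) <= 1 / A + r / 4"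
      proof -
        have "A - 8 * d <= ln 2 + 8 * Phi N" using elim(2) by (simp add: A_def)
        moreover have A3: "A - 8 * d >= 3" using A d by linarith
        ultimately have "1 / (ln 2 + 8 * Phi N) <= 1 / (A - 8 * d)" by (intro divide_left_mono mult_pos_pos) auto
        also have "... = 1 / A + 8 * d / (A * (A - 8 * d))" using A A3 by (simp add: field_simps)
        also have "8 * d / (A * (A - 8 * d)) <= r / (4 * 1)" using d A A3 r by (intro frac_le mult_mono) auto
        finally show ?thesis by simp
      qed
      ultimately have "- r < real (card (RN N)) / real N - 1 / (ln 2 + 8 * Phi N)" using r by linarith
      thus ?case using r by (simp add: e_def min_def)
    qed
    thus "\<exists>no. \<forall>n\<ge>no. norm (e n - 0) < r" by (simp add: eventually_sequentially)
  qed
  moreover have "\<forall>\<^sub>F N in sequentially. real (card (RN N)) >= (1 / (ln 2 + 8 * Phi N) + e N) * real N"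
    using eventually_gt_at_top[of 0]
  proof eventually_elim
    case (elim N)
    have "1 / (ln 2 + 8 * Phi N) + e N <= real (card (RN N)) / real N" by (simp add: e_def)
    thus ?case using elim by (simp add: pos_le_divide_eq)
  qed
  ultimately show "\<exists>e :: nat => real. e \<longlonglongrightarrow> 0 & (\<forall>\<^sub>F N in sequentially.
      real (card (RN N)) >= (1 / (ln 2 + 8 * Phi N) + e N) * real N)" by blast
  \<comment> \<open>The density \<open>1 / (ln 2 + 4)\<close> is at least \<open>1 / 5\<close>, so
    half of that value already exceeds \<open>0.0734\<close>.\<close>
  have "ln 2 + 4 <= (5::real)" using ln_2_less_1 by linarith
  hence "1 / 5 <= 1 / (ln 2 + 4 :: real)" by (intro divide_left_mono mult_pos_pos) (auto intro: add_nonneg_pos)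
  hence c: "0.1 <= 1 / (ln 2 + 4) - (0.1::real)" by linarith
  have t: "(0.1::real) > 0" by simp
  have "\<forall>\<^sub>F N in sequentially. real (card (RN N)) >= 0.1 * real N"
    using RN_density[OF t]
  proof eventually_elim
    case (elim N)
    moreover have "0.1 * real N <= (1 / (ln 2 + 4) - 0.1) * real N" using c by (intro mult_right_mono) auto
    ultimately show ?case by linarith
  qed
  thus "\<exists>\<delta> :: real. \<delta> >= 0.0734 & (\<forall>\<^sub>F N in sequentially. real (card (RN N)) >= \<delta> * real N)"
    by (intro exI[of _ "0.1"]) auto
qed

end
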